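(* Let $\mathcal T_{q,t}$ be an equivalence class for $\sim_{q,t}$ on $\mathrm{Std}_{d,n}$ and let $\boldsymbol k=\mathrm{res}(\mathcal T_{q,t})$. Then in the Yokonuma–Hecke algebra $\mathcal Y_{d,n}(q)$ over $\Bbbk$, $$E_{\mathcal T_{q,t}}=e(\boldsymbol k).$$
   Context: **Yokonuma–Hecke algebra.** $n,d$ are positive integers, $\Bbbk$ is a field with $d$ coprime to $\mathrm{char}\,\Bbbk$ containing a primitive $d$-th root of unity $\xi$, and $q\in\Bbbk^\times$, $q\ne1$. For a commutative domain $R\ni d^{-1}$ and a unit $v\in R^\times$, $\mathcal Y^R_{d,n}(v)$ is the $R$-algebra generated by $g_1,\dots,g_{n-1},t_1,\dots,t_n$ with relations $t_a^d=1$; $t_at_b=t_bt_a$; $t_ag_b=g_bt_{\sigma_b(a)}$; $g_a^2=v+(v-1)e_ag_a$; $g_ag_bg_a=g_bg_ag_b$ if $|a-b|=1$; $g_ag_b=g_bg_a$ if $|a-b|>1$, where $\sigma_b=(b,b+1)$ and $e_a=\frac1d\sum_{r=0}^{d-1}t_a^rt_{a+1}^{-r}$. Put $X_1=1$, $X_{a+1}=v^{-1}g_aX_ag_a$; and $L_a=X_a$ for $1\le a\le n$, $L_a=t_{a-n}$ for $n+1\le a\le2n$. These elements commute. $\mathcal Y_{d,n}(q)=\mathcal Y^{\Bbbk}_{d,n}(q)$. **Idempotents $e(\boldsymbol k)$.** Let $e=\min\{m\ge1:1+q+\dots+q^{m-1}=0\}$ ($e=0$ if none), $I=\mathbb Z/e\mathbb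 Z$, $J=\mathbb Z/d\mathbb Z$, $\mathcal K_n=(I\times J)^n$. For $\boldsymbol k=((i_1,j_1),\dots,(i_n,j_n))\in\mathcal K_n$, $e(\boldsymbol k)$ denotes the (possibly zero) simultaneous generalized eigenspace projector: the $e(\boldsymbol k)\in\mathcal Y_{d,n}(q)$ are the orthogonal idempotents with sum $1$ such that $e(\boldsymbol k)\mathcal Y_{d,n}(q)=\{x:(X_a-q^{i_a})^Nx=(t_a-\xi^{j_a})x=0\ \text{for all }a,\ N\gg0\}$. **Tableaux.** A $d$-multipartition of $n$ is a $d$-tuple of partitions of total size $n$; nodes of its Young diagram are labelled $(r,c,p)$ (row, column, component). $\mathrm{Std}_{d,n}$ is the set of standard multitableaux of $d$-multipartitions of $n$ (bijective fillings by $1,\dots,n$, increasing along rows and down columns of each component). For $\mathbf t\in\mathrm{Std}_{d,n}$ the content is $c_{\mathbf t}(a)=q^{c-r}$ if $1\le a\le n$ and $a$ is in node $(r,c,p)$, and $c_{\mathbf t}(a)=\xi^p$ if $n+1\le a\le2n$ and $a-n$ is in component $p$. $\hat c_{\mathbf t}(a)$ is defined in the same way with $q$ replaced by an indeterminate $\hat q$. **Classes.** $\mathbf s\sim_{q,t}\mathbf t$ iff $c_{\mathbf s}(a)=c_{\mathbf t}(a)$ for all $1\le a\le2n$. For a class $\mathcal T_{q,t}$ and $\mathbf t\in\mathcal T_{q,t}$ there are unique $i_a\in I$, $j_a\in J$ with $c_{\mathbf t}(a)=q^{i_a}$, $c_{\mathbf t}(n+a)=\xi^{j_a}$ ($1\le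 a\le n$); $\mathrm{res}(\mathcal T_{q,t})=((i_1,j_1),\dots,(i_n,j_n))$. **Class idempotents.** In $\mathcal Y^{\Bbbk(\hat q)}_{d,n}(\hat q)$ put $$E_{\mathbf t}=\prod_{a=1}^{2n}\ \prod_{c\in\mathcal C(a),\,c\ne\hat c_{\mathbf t}(a)}\frac{L_a-c}{\hat c_{\mathbf t}(a)-c},\qquad \mathcal C(a)=\{\hat c_{\mathbf u}(a):\mathbf u\in\mathrm{Std}_{d,n}\},$$ and $\hat E_{\mathcal T_{q,t}}=\sum_{\mathbf t\in\mathcal T_{q,t}}E_{\mathbf t}$. Let $\mathcal O=\Bbbk[\hat q,\hat q^{-1}]_{(\hat q-q)}$ (localization at the prime ideal $(\hat q-q)$), a discrete valuation ring with residue field $\Bbbk$. It is known that $\hat E_{\mathcal T_{q,t}}\in\mathcal Y^{\mathcal O}_{d,n}(\hat q)$; $E_{\mathcal T_{q,t}}\in\mathcal Y_{d,n}(q)$ is its reduction modulo $(\hat q-q)\mathcal O$. *)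

theory Defs
  imports
    "HOL-Algebra.Algebra"
    "HOL-Algebra.Algebraic_Closure_Type"
    "HOL-Combinatorics.Transposition"
    "HOL-Computational_Algebra.Computational_Algebra"
begin

section \<open>Free associative algebras\<close>

text \<open>
  The free associative algebra over a commutative ring \<open>R\<close> on a set \<open>A\<close> of letters: finitely
  supported functions from words over \<open>A\<close> to \<open>R\<close>, multiplied by convolution along concatenation.
\<close>

definition free_algebra :: "('r, 'm) ring_scheme \<Rightarrow> 'g set \<Rightarrow> ('g list \<Rightarrow> 'r) ring" where
  "free_algebra R A =
    \<lparr>carrier = {f. (\<forall>w. f w \<in> carrier R) \<and> finite {w. f w \<noteq> \<zero>\<^bsub>R\<^esub>} \<and>
                   (\<forall>w. f w \<noteq> \<zero>\<^bsub>R\<^esub> \<longrightarrow> w \<in> lists A)},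
     monoid.mult = (\<lambda>f g w. \<Oplus>\<^bsub>R\<^esub>i\<in>{..length w}. f (take i w) \<otimes>\<^bsub>R\<^esub> g (drop i w)),
     one = (\<lambda>w. if w = [] then \<one>\<^bsub>R\<^esub> else \<zero>\<^bsub>R\<^esub>),
     ring.zero = (\<lambda>w. \<zero>\<^bsub>R\<^esub>),
     add = (\<lambda>f g w. f w \<oplus>\<^bsub>R\<^esub> g w)\<rparr>"

definition fa_const :: "('r, 'm) ring_scheme \<Rightarrow> 'r \<Rightarrow> 'g list \<Rightarrow> 'r" where
  "fa_const R c = (\<lambda>w. if w = [] then c else \<zero>\<^bsub>R\<^esub>)"

definition fa_gen :: "('r, 'm) ring_scheme \<Rightarrow> 'g \<Rightarrow> 'g list \<Rightarrow> 'r" where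
  "fa_gen R x = (\<lambda>w. if w = [x] then \<one>\<^bsub>R\<^esub> else \<zero>\<^bsub>R\<^esub>)"


section \<open>Yokonuma--Hecke algebras\<close>

datatype yh_gen = Gen_g nat | Gen_t nat

definition yh_gens :: "nat \<Rightarrow> yh_gen set" where
  "yh_gens n = Gen_g ` {1..<n} \<union> Gen_t ` {1..n}"

abbreviation yh_free :: "'r ring \<Rightarrow> nat \<Rightarrow> (yh_gen list \<Rightarrow> 'r) ring" where
  "yh_free R n \<equiv> free_algebra R (yh_gens n)"

text \<open>
  The element \<open>e\<^sub>a\<close>, lifted to the free algebra. Inverses are not available there;
  modulo the relation \<open>t\<^sub>a\<^sub>+\<^sub>1\<^sup>d = 1\<close>, the power \<open>t\<^sub>a\<^sub>+\<^sub>1\<^sup>d\<^sup>-\<^sup>r\<close> is the inverse of \<open>t\<^sub>a\<^sub>+\<^sub>1\<^sup>r\<close>.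
\<close>

definition yh_e :: "'r ring \<Rightarrow> nat \<Rightarrow> nat \<Rightarrow> nat \<Rightarrow> yh_gen list \<Rightarrow> 'r" where
  "yh_e R d n a =
    (let F = yh_free R n; t = (\<lambda>b. fa_gen R (Gen_t b)) in
      fa_const R (inv\<^bsub>R\<^esub> ([d] \<cdot>\<^bsub>R\<^esub> \<one>\<^bsub>R\<^esub>)) \<otimes>\<^bsub>F\<^esub>
        (\<Oplus>\<^bsub>F\<^esub>r\<in>{..<d}. (t a [^]\<^bsub>F\<^esub> r) \<otimes>\<^bsub>F\<^esub> (t (a + 1) [^]\<^bsub>F\<^esub> (d - r))))"

text \<open>Each relation \<open>x = y\<close> is given as the element \<open>x - y\<close> of the free algebra.\<close>

definition yh_rels :: "'r ring \<Rightarrow> nat \<Rightarrow> nat \<Rightarrow> 'r \<Rightarrow> (yh_gen list \<Rightarrow> 'r) set" where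
  "yh_rels R d n v =
    (let F = yh_free R n; g = (\<lambda>a. fa_gen R (Gen_g a)); t = (\<lambda>a. fa_gen R (Gen_t a)) in
      {(t a [^]\<^bsub>F\<^esub> d) \<ominus>\<^bsub>F\<^esub> \<one>\<^bsub>F\<^esub> | a. a \<in> {1..n}}
      \<union> {(t a \<otimes>\<^bsub>F\<^esub> t b) \<ominus>\<^bsub>F\<^esub> (t b \<otimes>\<^bsub>F\<^esub> t a) | a b. a \<in> {1..n} \<and> b \<in> {1..n}}
      \<union> {(t a \<otimes>\<^bsub>F\<^esub> g b) \<ominus>\<^bsub>F\<^esub> (g b \<otimes>\<^bsub>F\<^esub> t (Transposition.transpose b (b + 1) a)) | a b.
            a \<in> {1..n} \<and> b \<in> {1..<n}}
      \<union> {(g a [^]\<^bsub>F\<^esub> (2::nat)) \<ominus>\<^bsub>F\<^esub>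
            (fa_const R v \<oplus>\<^bsub>F\<^esub> (fa_const R (v \<ominus>\<^bsub>R\<^esub> \<one>\<^bsub>R\<^esub>) \<otimes>\<^bsub>F\<^esub> yh_e R d n a \<otimes>\<^bsub>F\<^esub> g a)) | a.
            a \<in> {1..<n}}
      \<union> {(g a \<otimes>\<^bsub>F\<^esub> g b \<otimes>\<^bsub>F\<^esub> g a) \<ominus>\<^bsub>F\<^esub> (g b \<otimes>\<^bsub>F\<^esub> g a \<otimes>\<^bsub>F\<^esub> g b) | a b.
            a \<in> {1..<n} \<and> b \<in> {1..<n} \<and> \<bar>int a - int b\<bar> = 1}
      \<union> {(g a \<otimes>\<^bsub>F\<^esub> g b) \<ominus>\<^bsub>F\<^esub> (g b \<otimes>\<^bsub>F\<^esub> g a) | a b.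
            a \<in> {1..<n} \<and> b \<in> {1..<n} \<and> \<bar>int a - int b\<bar> > 1})"

definition yh_ideal :: "'r ring \<Rightarrow> nat \<Rightarrow> nat \<Rightarrow> 'r \<Rightarrow> (yh_gen list \<Rightarrow> 'r) set" where
  "yh_ideal R d n v = Idl\<^bsub>yh_free R n\<^esub> (yh_rels R d n v)"

definition YH :: "'r ring \<Rightarrow> nat \<Rightarrow> nat \<Rightarrow> 'r \<Rightarrow> (yh_gen list \<Rightarrow> 'r) set ring" where
  "YH R d n v = yh_free R n Quot yh_ideal R d n v"

definition yh_class :: "'r ring \<Rightarrow> nat \<Rightarrow> nat \<Rightarrow> 'r \<Rightarrow> (yh_gen list \<Rightarrow> 'r) \<Rightarrow> (yh_gen list \<Rightarrow> 'r) set" where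
  "yh_class R d n v f = yh_ideal R d n v +>\<^bsub>yh_free R n\<^esub> f"

definition yh_g :: "'r ring \<Rightarrow> nat \<Rightarrow> nat \<Rightarrow> 'r \<Rightarrow> nat \<Rightarrow> (yh_gen list \<Rightarrow> 'r) set" where
  "yh_g R d n v a = yh_class R d n v (fa_gen R (Gen_g a))"

definition yh_t :: "'r ring \<Rightarrow> nat \<Rightarrow> nat \<Rightarrow> 'r \<Rightarrow> nat \<Rightarrow> (yh_gen list \<Rightarrow> 'r) set" where
  "yh_t R d n v a = yh_class R d n v (fa_gen R (Gen_t a))"

definition yh_scalar :: "'r ring \<Rightarrow> nat \<Rightarrow> nat \<Rightarrow> 'r \<Rightarrow> 'r \<Rightarrow> (yh_gen list \<Rightarrow> 'r) set" where
  "yh_scalar R d n v c = yh_class R d n v (fa_const R c)"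

text \<open>The indices of \<open>yh_X\<close> start at 1; the value at 0 is irrelevant.\<close>

primrec yh_X :: "'r ring \<Rightarrow> nat \<Rightarrow> nat \<Rightarrow> 'r \<Rightarrow> nat \<Rightarrow> (yh_gen list \<Rightarrow> 'r) set" where
  "yh_X R d n v 0 = \<one>\<^bsub>YH R d n v\<^esub>"
| "yh_X R d n v (Suc a) =
    (if a = 0 then \<one>\<^bsub>YH R d n v\<^esub>
     else yh_scalar R d n v (inv\<^bsub>R\<^esub> v) \<otimes>\<^bsub>YH R d n v\<^esub>
       (yh_g R d n v a \<otimes>\<^bsub>YH R d n v\<^esub> yh_X R d n v a \<otimes>\<^bsub>YH R d n v\<^esub> yh_g R d n v a))"

definition yh_L :: "'r ring \<Rightarrow> nat \<Rightarrow> nat \<Rightarrow> 'r \<Rightarrow> nat \<Rightarrow> (yh_gen list \<Rightarrow> 'r) set" where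
  "yh_L R d n v a = (if a \<le> n then yh_X R d n v a else yh_t R d n v (a - n))"

text \<open>
  The ring homomorphism \<open>YH R d n v \<rightarrow> YH S d n w\<close> induced by a ring homomorphism
  \<open>\<phi> : R \<rightarrow> S\<close> with \<open>\<phi> v = w\<close>, acting on coefficients and fixing the generators.
\<close>

definition yh_map ::
  "'r ring \<Rightarrow> 's ring \<Rightarrow> ('r \<Rightarrow> 's) \<Rightarrow> nat \<Rightarrow> nat \<Rightarrow> 's \<Rightarrow> (yh_gen list \<Rightarrow> 'r) set \<Rightarrow> (yh_gen list \<Rightarrow> 's) set"
where
  "yh_map R S \<phi> d n w x = the_elem ((\<lambda>f. yh_class S d n w (\<phi> \<circ> f)) ` x)"


section \<open>The residue index sets and the idempotents of generalized eigenspaces\<close>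

definition quantum_char :: "'k::field \<Rightarrow> nat" where
  "quantum_char q =
    (if \<exists>m\<ge>1. (\<Sum>i<m. q ^ i) = 0 then LEAST m. m \<ge> 1 \<and> (\<Sum>i<m. q ^ i) = 0 else 0)"

text \<open>
  Canonical representatives of \<open>\<int>/m\<int>\<close>: the integers \<open>0, \<dots>, m - 1\<close> if \<open>m > 0\<close>,
  and all integers if \<open>m = 0\<close> (as \<open>i mod 0 = i\<close>).
\<close>

definition zmod :: "nat \<Rightarrow> int set" where
  "zmod m = {i. i mod int m = i}"

definition K_index :: "nat \<Rightarrow> nat \<Rightarrow> 'k::field \<Rightarrow> (nat \<Rightarrow> int \<times> int) set" where
  "K_index d n q = {1..n} \<rightarrow>\<^sub>E zmod (quantum_char q) \<times> zmod d"

abbreviation fld :: "'k::field ring" where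
  "fld \<equiv> ring_of_type_algebra"

definition yh_eigenspace ::
  "nat \<Rightarrow> nat \<Rightarrow> 'k::field \<Rightarrow> 'k \<Rightarrow> (nat \<Rightarrow> int \<times> int) \<Rightarrow> (yh_gen list \<Rightarrow> 'k) set set"
where
  "yh_eigenspace d n q \<xi> k =
    (let Y = YH fld d n q; JM = yh_X fld d n q; t = yh_t fld d n q; s = yh_scalar fld d n q in
      {x \<in> carrier Y. \<exists>N\<^sub>0. \<forall>N\<ge>N\<^sub>0. \<forall>a\<in>{1..n}.
         ((JM a \<ominus>\<^bsub>Y\<^esub> s (q powi fst (k a))) [^]\<^bsub>Y\<^esub> (N::nat)) \<otimes>\<^bsub>Y\<^esub> x = \<zero>\<^bsub>Y\<^esub> \<and>
         (t a \<ominus>\<^bsub>Y\<^esub> s (\<xi> powi snd (k a))) \<otimes>\<^bsub>Y\<^esub> x = \<zero>\<^bsub>Y\<^esub>})"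

text \<open>\<open>K_index\<close> is infinite if \<open>quantum_char q = 0\<close> and \<open>n > 0\<close>, hence the finiteness condition.\<close>

definition eigen_idempotents ::
  "nat \<Rightarrow> nat \<Rightarrow> 'k::field \<Rightarrow> 'k \<Rightarrow> ((nat \<Rightarrow> int \<times> int) \<Rightarrow> (yh_gen list \<Rightarrow> 'k) set) \<Rightarrow> bool"
where
  "eigen_idempotents d n q \<xi> e \<longleftrightarrow>
    (let Y = YH fld d n q; K = K_index d n q in
      e \<in> K \<rightarrow>\<^sub>E carrier Y \<and>
      (\<forall>k\<in>K. e k \<otimes>\<^bsub>Y\<^esub> e k = e k) \<and>
      (\<forall>k\<in>K. \<forall>l\<in>K. k \<noteq> l \<longrightarrow> e k \<otimes>\<^bsub>Y\<^esub> e l = \<zero>\<^bsub>Y\<^esub>) \<and>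
      finite {k \<in> K. e k \<noteq> \<zero>\<^bsub>Y\<^esub>} \<and>
      (\<Oplus>\<^bsub>Y\<^esub>k\<in>{k \<in> K. e k \<noteq> \<zero>\<^bsub>Y\<^esub>}. e k) = \<one>\<^bsub>Y\<^esub> \<and>
      (\<forall>k\<in>K. {e k \<otimes>\<^bsub>Y\<^esub> x | x. x \<in> carrier Y} = yh_eigenspace d n q \<xi> k))"

definition eigen_idem ::
  "nat \<Rightarrow> nat \<Rightarrow> 'k::field \<Rightarrow> 'k \<Rightarrow> (nat \<Rightarrow> int \<times> int) \<Rightarrow> (yh_gen list \<Rightarrow> 'k) set"
where
  "eigen_idem d n q \<xi> k = (THE e. eigen_idempotents d n q \<xi> e) k"


section \<open>Standard multitableaux\<close>

definition is_partition :: "nat list \<Rightarrow> bool" where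
  "is_partition \<mu> \<longleftrightarrow> sorted_wrt (\<ge>) \<mu> \<and> 0 \<notin> set \<mu>"

definition multipartitions :: "nat \<Rightarrow> nat \<Rightarrow> nat list list set" where
  "multipartitions d n =
    {\<nu>. length \<nu> = d \<and> (\<forall>\<mu>\<in>set \<nu>. is_partition \<mu>) \<and> sum_list (map sum_list \<nu>) = n}"

text \<open>Rows, columns and components are numbered from 1.\<close>

definition diagram :: "nat list list \<Rightarrow> (nat \<times> nat \<times> nat) set" where
  "diagram \<nu> = {(r, c, p). p \<in> {1..length \<nu>} \<and> r \<in> {1..length (\<nu> ! (p - 1))} \<and>
                  c \<in> {1..\<nu> ! (p - 1) ! (r - 1)}}"

text \<open>A multitableau is a pair of its shape and its filling.\<close>

type_synonym multitableau = "nat list list \<times> (nat \<times> nat \<times> nat \<Rightarrow> nat)"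

definition Std :: "nat \<Rightarrow> nat \<Rightarrow> multitableau set" where
  "Std d n =
    {(\<nu>, \<tau>). \<nu> \<in> multipartitions d n \<and> \<tau> \<in> extensional (diagram \<nu>) \<and>
       bij_betw \<tau> (diagram \<nu>) {1..n} \<and>
       (\<forall>r c p. (r, c, p) \<in> diagram \<nu> \<and> (r, c + 1, p) \<in> diagram \<nu> \<longrightarrow> \<tau> (r, c, p) < \<tau> (r, c + 1, p)) \<and>
       (\<forall>r c p. (r, c, p) \<in> diagram \<nu> \<and> (r + 1, c, p) \<in> diagram \<nu> \<longrightarrow> \<tau> (r, c, p) < \<tau> (r + 1, c, p))}"

definition node_of :: "multitableau \<Rightarrow> nat \<Rightarrow> nat \<times> nat \<times> nat" where
  "node_of s a = inv_into (diagram (fst s)) (snd s) a"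

definition tab_content :: "nat \<Rightarrow> 'f::field \<Rightarrow> 'f \<Rightarrow> multitableau \<Rightarrow> nat \<Rightarrow> 'f" where
  "tab_content n q \<xi> s a =
    (if a \<le> n then case node_of s a of (r, c, p) \<Rightarrow> q powi (int c - int r)
     else case node_of s (a - n) of (r, c, p) \<Rightarrow> \<xi> ^ p)"

definition content_rel :: "nat \<Rightarrow> nat \<Rightarrow> 'k::field \<Rightarrow> 'k \<Rightarrow> (multitableau \<times> multitableau) set" where
  "content_rel d n q \<xi> =
    {(s, t). s \<in> Std d n \<and> t \<in> Std d n \<and>
       (\<forall>a\<in>{1..2 * n}. tab_content n q \<xi> s a = tab_content n q \<xi> t a)}"

definition class_res :: "nat \<Rightarrow> nat \<Rightarrow> 'k::field \<Rightarrow> 'k \<Rightarrow> multitableau set \<Rightarrow> nat \<Rightarrow> int \<times> int" where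
  "class_res d n q \<xi> C =
    (THE k. k \<in> K_index d n q \<and>
       (\<forall>t\<in>C. \<forall>a\<in>{1..n}. tab_content n q \<xi> t a = q powi fst (k a) \<and>
                         tab_content n q \<xi> t (n + a) = \<xi> powi snd (k a)))"


section \<open>The local ring at \<open>q\<close> in the field of rational functions\<close>

definition qhat :: "'k::field poly fract" where
  "qhat = to_fract [:0, 1:]"

definition rconst :: "'k::field \<Rightarrow> 'k poly fract" where
  "rconst c = to_fract [:c:]"

definition laurent_polys :: "'k::field poly fract set" where
  "laurent_polys = {to_fract p * qhat powi m | p m. True}"

definition local_carrier :: "'k::field \<Rightarrow> 'k poly fract set" where
  "local_carrier q =
    {x / y | x y. x \<in> laurent_polys \<and>
       y \<in> laurent_polys - {(qhat - rconst q) * z | z. z \<in> laurent_polys}}"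

definition local_ring :: "'k::field \<Rightarrow> 'k poly fract ring" where
  "local_ring q = fld\<lparr>carrier := local_carrier q\<rparr>"

text \<open>Reduction modulo the maximal ideal, with the residue field identified with the ground field.\<close>

definition reduce :: "'k::field \<Rightarrow> 'k poly fract \<Rightarrow> 'k" where
  "reduce q x = (THE c. \<exists>z\<in>local_carrier q. x = rconst c + (qhat - rconst q) * z)"


section \<open>Class idempotents\<close>

definition hat_content :: "nat \<Rightarrow> 'k::field \<Rightarrow> multitableau \<Rightarrow> nat \<Rightarrow> 'k poly fract" where
  "hat_content n \<xi> = tab_content n qhat (rconst \<xi>)"

text \<open>
  \<open>finprod\<close> is used here in a noncommutative ring; the factors commute pairwise, so that
  \<open>foldD\<close>, through which it is defined, does not depend on the order.
\<close>

definition tab_idem :: "nat \<Rightarrow> nat \<Rightarrow> 'k::field \<Rightarrow> multitableau \<Rightarrow> (yh_gen list \<Rightarrow> 'k poly fract) set" where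
  "tab_idem d n \<xi> t =
    (let Y = YH fld d n qhat; L = yh_L fld d n qhat; s = yh_scalar fld d n qhat;
         ct = hat_content n \<xi> t in
      (\<Otimes>\<^bsub>Y\<^esub>a\<in>{1..2 * n}. \<Otimes>\<^bsub>Y\<^esub>c\<in>{hat_content n \<xi> u a | u. u \<in> Std d n} - {ct a}.
         s (inverse (ct a - c)) \<otimes>\<^bsub>Y\<^esub> (L a \<ominus>\<^bsub>Y\<^esub> s c)))"

definition class_idem_generic ::
  "nat \<Rightarrow> nat \<Rightarrow> 'k::field \<Rightarrow> multitableau set \<Rightarrow> (yh_gen list \<Rightarrow> 'k poly fract) set"
where
  "class_idem_generic d n \<xi> C = (\<Oplus>\<^bsub>YH fld d n qhat\<^esub>t\<in>C. tab_idem d n \<xi> t)"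

text \<open>
  The generic class idempotent is the image of a unique element of the algebra over the local ring;
  the class idempotent is the reduction of that element.
\<close>

definition class_idem ::
  "nat \<Rightarrow> nat \<Rightarrow> 'k::field \<Rightarrow> 'k \<Rightarrow> multitableau set \<Rightarrow> (yh_gen list \<Rightarrow> 'k) set"
where
  "class_idem d n q \<xi> C =
    yh_map (local_ring q) fld (reduce q) d n q
      (THE x. x \<in> carrier (YH (local_ring q) d n qhat) \<and>
              yh_map (local_ring q) fld id d n qhat x = class_idem_generic d n \<xi> C)"

end

theory Submission
  imports Defs "HOL-Combinatorics.Transposition" "HOL-Library.FuncSet" "HOL-Library.Function_Algebras" Complex_Main
begin

text \<open>
  Everything is transported from the generic algebra, where \<open>v\<close> is the indeterminate and the
  \<open>L\<^sub>a\<close> are simultaneously diagonalizable, to the algebra at \<open>q\<close>.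

  For generic \<open>v\<close> the algebra acts faithfully on functions of words (\<open>act_faithful\<close>), with every
  \<open>t\<^sub>a\<close> diagonal. An argument in the style of Okounkov and Vershik determines the joint spectrum of
  the Jucys--Murphy elements in such a module: the module is spanned by joint eigenvectors whose
  eigenvalues are the contents of standard multitableaux (\<open>span_eigenvectors\<close> and
  \<open>tableau_of_valid_seq\<close>). Call an element of the algebra diagonal if it acts by a scalar on each of
  these tableau spaces. By faithfulness a diagonal element is determined by its function of scalars
  on the set of tableaux (\<open>diagonal_unique\<close>), so identities between diagonal elements can be checked
  tableau by tableau. Since contents separate tableaux, \<open>E\<^sub>t\<close> is the diagonal element with the
  indicator function of \<open>t\<close>, and the generic class idempotent is the one with the indicator
  function of the class.

  The faithful action also exists over the local ring \<open>O\<close>, and there the indicator function of a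
  class \<open>C\<close> is again the function of a diagonal element (\<open>class_indicator_exists\<close>): tableaux outside
  \<open>C\<close> differ from those in \<open>C\<close> in some content already after reduction, so a product of factors
  \<open>L\<^sub>a - c\<close> vanishes off \<open>C\<close> and takes unit values on \<open>C\<close>, and the different unit values are turned
  into \<open>1\<close> by an interpolation. This lift is the element whose reduction is the class idempotent
  (\<open>class_idem_eq\<close>).

  Reduction carries identities of diagonal elements to the algebra at \<open>q\<close>. The class idempotents are
  therefore orthogonal with sum \<open>1\<close>. The product over \<open>s \<in> C\<close> of \<open>L\<^sub>a\<close> minus the generic content of
  \<open>s\<close> kills the lift of \<open>C\<close>, and it reduces to a power of \<open>L\<^sub>a\<close> minus the common content of \<open>C\<close>
  (\<open>nilpotent_on_idem\<close>). So the reduced idempotent of \<open>C\<close> maps into the generalized eigenspace of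
  the residue sequence of \<open>C\<close>. Distinct classes have distinct residue sequences, and an element cannot
  be a generalized eigenvector for two eigenvalues, which leaves no other choice for the eigenspace
  projectors (\<open>eigen_idempotents_residue_idem\<close>, \<open>eigen_idempotents_unique\<close>).
\<close>

section \<open>Content sequences and their profiles\<close>

type_synonym content_seq = "nat \<Rightarrow> int \<times> nat"

text \<open>
  The upper boundary of the diagram of component \<open>p\<close> in the Russian convention: a box on the
  diagonal \<open>x\<close> is a square of height \<open>2\<close> on top of the graph of \<open>\<bar>x\<bar>\<close>.
\<close>

definition profile :: "content_seq \<Rightarrow> nat \<Rightarrow> nat \<Rightarrow> int \<Rightarrow> int" where
  "profile \<sigma> m p x = \<bar>x\<bar> + 2 * int (card {i \<in> {1..m}. \<sigma> i = (x, p)})"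

text \<open>
  A box fits on top of the boundary exactly at a local minimum.
\<close>

definition addable :: "content_seq \<Rightarrow> nat \<Rightarrow> nat \<Rightarrow> int set" where
  "addable \<sigma> m p =
    {x. profile \<sigma> m p (x + 1) = profile \<sigma> m p x + 1 \<and> profile \<sigma> m p (x - 1) = profile \<sigma> m p x + 1}"

definition valid_seq :: "content_seq \<Rightarrow> nat \<Rightarrow> bool" where
  "valid_seq \<sigma> m \<longleftrightarrow> (\<forall>i\<in>{1..m}. fst (\<sigma> i) \<in> addable \<sigma> (i - 1) (snd (\<sigma> i)))"

lemma profile_0 [simp]: "profile \<sigma> 0 p x = \<bar>x\<bar>"
  by (simp add: profile_def)

lemma profile_Suc:
  "profile \<sigma> (Suc m) p x = profile \<sigma> m p x + (if \<sigma> (Suc m) = (x, p) then 2 else 0)"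
proof -
  have "{i \<in> {1..Suc m}. \<sigma> i = (x, p)} =
      (if \<sigma> (Suc m) = (x, p) then insert (Suc m) {i \<in> {1..m}. \<sigma> i = (x, p)}
       else {i \<in> {1..m}. \<sigma> i = (x, p)})"
    by (auto simp: le_Suc_eq)
  then show ?thesis by (auto simp: profile_def)
qed

lemma profile_cong: "(\<And>i. i \<in> {1..m} \<Longrightarrow> \<sigma> i = \<tau> i) \<Longrightarrow> profile \<sigma> m p x = profile \<tau> m p x"
  unfolding profile_def by (metis (no_types, lifting) Collect_cong)

lemma addable_cong: "(\<And>i. i \<in> {1..m} \<Longrightarrow> \<sigma> i = \<tau> i) \<Longrightarrow> addable \<sigma> m p = addable \<tau> m p"
  unfolding addable_def using profile_cong[of m \<sigma> \<tau>] by simp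

lemma valid_seq_0 [simp]: "valid_seq \<sigma> 0"
  by (simp add: valid_seq_def)

lemma valid_seq_Suc:
  "valid_seq \<sigma> (Suc m) \<longleftrightarrow> valid_seq \<sigma> m \<and> fst (\<sigma> (Suc m)) \<in> addable \<sigma> m (snd (\<sigma> (Suc m)))"
proof -
  have "{1..Suc m} = insert (Suc m) {1..m}" by auto
  then show ?thesis unfolding valid_seq_def by auto
qed

lemma valid_seq_cong: "(\<And>i. i \<in> {1..m} \<Longrightarrow> \<sigma> i = \<tau> i) \<Longrightarrow> valid_seq \<sigma> m = valid_seq \<tau> m"
proof (induction m)
  case (Suc m)
  then show ?case using addable_cong[of m \<sigma> \<tau>] by (simp add: valid_seq_Suc)
qed simp

lemma finite_addable: "finite (addable \<sigma> m p)"
proof -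
  let ?c = "\<lambda>i. fst (\<sigma> i)"
  have "addable \<sigma> m p \<subseteq> {0} \<union> (\<Union>i\<in>{1..m}. {?c i - 1, ?c i, ?c i + 1})"
  proof
    fix x assume x: "x \<in> addable \<sigma> m p"
    show "x \<in> {0} \<union> (\<Union>i\<in>{1..m}. {?c i - 1, ?c i, ?c i + 1})"
    proof (rule ccontr)
      assume a: "\<not> ?thesis"
      have "{i \<in> {1..m}. \<sigma> i = (y, p)} = {}" if y: "y \<in> {x - 1, x, x + 1}" for y
      proof (rule ccontr)
        assume "\<not> ?thesis"
        then obtain i where i: "i \<in> {1..m}" "\<sigma> i = (y, p)" by blast
        then have "x \<noteq> ?c i - 1 \<and> x \<noteq> ?c i \<and> x \<noteq> ?c i + 1" using a by blast
        then show False using y i(2) by auto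
      qed
      then have "profile \<sigma> m p y = \<bar>y\<bar>" if "y \<in> {x - 1, x, x + 1}" for y
        using that by (simp only: profile_def) simp
      then show False using x a by (auto simp: addable_def)
    qed
  qed
  then show ?thesis by (rule finite_subset) auto
qed

lemma profile_step:
  assumes "valid_seq \<sigma> m"
  shows "\<bar>profile \<sigma> m p (x + 1) - profile \<sigma> m p x\<bar> = 1"
  using assms
proof (induction m)
  case (Suc m)
  then have IH: "\<bar>profile \<sigma> m p (x + 1) - profile \<sigma> m p x\<bar> = 1"
    and a: "fst (\<sigma> (Suc m)) \<in> addable \<sigma> m (snd (\<sigma> (Suc m)))" by (auto simp: valid_seq_Suc)
  show ?case
  proof (cases "\<sigma> (Suc m) = (x, p) \<or> \<sigma> (Suc m) = (x + 1, p)")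
    case True then show ?thesis using a IH by (auto simp: profile_Suc addable_def)
  next
    case False then show ?thesis using IH by (auto simp: profile_Suc)
  qed
qed auto

text \<open>
  Adding a box turns a local minimum into a local maximum, so a local maximum at \<open>y\<close> is as old as
  the last box on \<open>y\<close>: a later box on \<open>y + 1\<close> or \<open>y - 1\<close> would rise above \<open>y\<close>.
\<close>

lemma local_max_last_addition:
  assumes "valid_seq \<sigma> m"
    and "profile \<sigma> m p (y + 1) = profile \<sigma> m p y - 1" "profile \<sigma> m p (y - 1) = profile \<sigma> m p y - 1"
  shows "\<exists>b\<in>{1..m}. \<sigma> b = (y, p) \<and> (\<forall>i\<in>{b<..m}. \<sigma> i \<notin> {(y, p), (y + 1, p), (y - 1, p)})"
  using assms
proof (induction m)
  case 0 then show ?case by auto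
next
  case (Suc m)
  have a: "fst (\<sigma> (Suc m)) \<in> addable \<sigma> m (snd (\<sigma> (Suc m)))" and v: "valid_seq \<sigma> m"
    using Suc.prems by (auto simp: valid_seq_Suc)
  consider "\<sigma> (Suc m) = (y, p)" | "\<sigma> (Suc m) \<in> {(y + 1, p), (y - 1, p)}"
    | "\<sigma> (Suc m) \<notin> {(y, p), (y + 1, p), (y - 1, p)}" by auto
  then show ?case
  proof cases
    case 1 then show ?thesis by (intro bexI[of _ "Suc m"]) auto
  next
    case 2 then show ?thesis using a Suc.prems(2,3) by (auto simp: addable_def profile_Suc)
  next
    case 3
    then have "\<exists>b\<in>{1..m}. \<sigma> b = (y, p) \<and> (\<forall>i\<in>{b<..m}. \<sigma> i \<notin> {(y, p), (y + 1, p), (y - 1, p)})"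
      using Suc.IH[OF v] Suc.prems(2,3) by (auto simp: profile_Suc)
    then obtain b where "b\<in>{1..m}" "\<sigma> b = (y, p)" "\<forall>i\<in>{b<..m}. \<sigma> i \<notin> {(y, p), (y + 1, p), (y - 1, p)}"
      by blast
    then show ?thesis using 3 by (intro bexI[of _ b]) (auto simp: le_Suc_eq)
  qed
qed

text \<open>
  Before the addition, \<open>x\<close> is lower than its neighbours. A neighbour that does not become a local
  minimum by the addition slopes down on the other side as well, so it was a local maximum.
\<close>

lemma not_addable_after_addition:
  assumes v: "valid_seq \<sigma> (Suc m)" and s: "\<sigma> (Suc m) = (x, p)" and e: "e \<in> {1, -1}"
    and na: "x + e \<notin> addable \<sigma> (Suc m) p"
  shows "\<exists>b\<in>{1..m}. \<sigma> b = (x + e, p) \<and>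
    (\<forall>i\<in>{b<..m}. \<sigma> i \<notin> {(x + e, p), (x + e + 1, p), (x + e - 1, p)})"
proof (rule local_max_last_addition)
  show "valid_seq \<sigma> m" using v by (simp add: valid_seq_Suc)
  have a: "x \<in> addable \<sigma> m p" using v s by (simp add: valid_seq_Suc)
  have 1: "\<bar>profile \<sigma> m p (x + 2) - profile \<sigma> m p (x + 1)\<bar> = 1"
    using profile_step[OF v, of p "x + 1"] s by (simp add: profile_Suc add.commute)
  have 2: "\<bar>profile \<sigma> m p (x - 1) - profile \<sigma> m p (x - 2)\<bar> = 1"
    using profile_step[OF v, of p "x - 2"] s by (simp add: profile_Suc)
  have "e = 1 \<and> profile \<sigma> m p (x + 2) \<noteq> profile \<sigma> m p (x + 1) + 1 \<or>
        e = -1 \<and> profile \<sigma> m p (x - 2) \<noteq> profile \<sigma> m p (x - 1) + 1"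
    using a na e s by (auto simp: addable_def profile_Suc add.commute)
  then show "profile \<sigma> m p (x + e + 1) = profile \<sigma> m p (x + e) - 1"
    "profile \<sigma> m p (x + e - 1) = profile \<sigma> m p (x + e) - 1"
    using a 1 2 by (auto simp: addable_def add.commute)
qed

section \<open>Jucys--Murphy operators on a module\<close>

text \<open>
  Operators satisfying the relations of the algebra. The quadratic relation is imposed only on
  joint eigenvectors of \<open>t\<^sub>a\<close> and \<open>t\<^sub>a\<^sub>+\<^sub>1\<close>, where the idempotent \<open>e\<^sub>a\<close> acts as \<open>1\<close> or \<open>0\<close>
  according to whether the eigenvalues agree; such vectors span the module.
\<close>

locale yh_module = vector_space scale
  for scale :: "'f::field \<Rightarrow> 'v::ab_group_add \<Rightarrow> 'v" (infixr "*s" 75) +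
  fixes n :: nat and v :: 'f and \<chi> :: "nat \<Rightarrow> 'f" and P :: "nat set"
    and g t :: "nat \<Rightarrow> 'v \<Rightarrow> 'v"
  assumes v_nonzero: "v \<noteq> 0" and v_not_root_of_unity: "\<And>m. m > 0 \<Longrightarrow> v ^ m \<noteq> 1"
    and inj_char: "inj_on \<chi> P"
    and g_add: "g a (x + y) = g a x + g a y" and g_scale: "g a (c *s x) = c *s g a x"
    and t_add: "t a (x + y) = t a x + t a y" and t_scale: "t a (c *s x) = c *s t a x"
    and t_t: "\<lbrakk>a \<in> {1..n}; b \<in> {1..n}\<rbrakk> \<Longrightarrow> t a (t b x) = t b (t a x)"
    and t_g: "\<lbrakk>a \<in> {1..n}; b \<in> {1..<n}\<rbrakk> \<Longrightarrow> t a (g b x) = g b (t (transpose b (Suc b) a) x)"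
    and g_g_same: "\<lbrakk>a \<in> {1..<n}; t a x = z *s x; t (Suc a) x = z *s x\<rbrakk> \<Longrightarrow>
      g a (g a x) = v *s x + (v - 1) *s g a x"
    and g_g_different: "\<lbrakk>a \<in> {1..<n}; p \<in> P; p' \<in> P; p \<noteq> p'; t a x = \<chi> p *s x; t (Suc a) x = \<chi> p' *s x\<rbrakk> \<Longrightarrow>
      g a (g a x) = v *s x"
    and g_braid: "\<lbrakk>a \<in> {1..<n}; Suc a \<in> {1..<n}\<rbrakk> \<Longrightarrow> g a (g (Suc a) (g a x)) = g (Suc a) (g a (g (Suc a) x))"
    and g_comm: "\<lbrakk>a \<in> {1..<n}; b \<in> {1..<n}; Suc a < b\<rbrakk> \<Longrightarrow> g a (g b x) = g b (g a x)"
    and t_diagonalizable: "span {w. \<exists>\<pi>. \<forall>a\<in>{1..n}. \<pi> a \<in> P \<and> t a w = \<chi> (\<pi> a) *s w} = UNIV"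
begin

primrec jm :: "nat \<Rightarrow> 'v \<Rightarrow> 'v" where
  "jm 0 x = x"
| "jm (Suc a) x = (if a = 0 then x else inverse v *s g a (jm a (g a x)))"

lemma jm_1: "jm 1 x = x" "jm (Suc 0) x = x" by simp_all

lemma jm_Suc: "a \<ge> 1 \<Longrightarrow> jm (Suc a) x = inverse v *s g a (jm a (g a x))"
  by simp

declare jm.simps(2) [simp del]

lemma jm_add: "jm a (x + y) = jm a x + jm a y"
  by (induction a arbitrary: x y) (auto simp: jm.simps g_add scale_right_distrib)

lemma jm_scale: "jm a (c *s x) = c *s jm a x"
  by (induction a arbitrary: x) (auto simp: jm.simps g_scale mult.commute)

lemma g_zero: "g a 0 = 0" using g_scale[of a 0 0] by simp
lemma t_zero: "t a 0 = 0" using t_scale[of a 0 0] by simp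
lemma jm_zero: "jm a 0 = 0" using jm_scale[of a 0 0] by simp
lemma g_minus: "g a (- x) = - g a x" using g_add[of a x "- x"] g_zero by (simp add: eq_neg_iff_add_eq_0 add.commute)
lemma t_minus: "t a (- x) = - t a x" using t_add[of a x "- x"] t_zero by (simp add: eq_neg_iff_add_eq_0 add.commute)
lemma jm_minus: "jm a (- x) = - jm a x" using jm_add[of a x "- x"] jm_zero by (simp add: eq_neg_iff_add_eq_0 add.commute)
lemma g_diff: "g a (x - y) = g a x - g a y" using g_add[of a x "- y"] g_minus by simp
lemma t_diff: "t a (x - y) = t a x - t a y" using t_add[of a x "- y"] t_minus by simp
lemma jm_diff: "jm a (x - y) = jm a x - jm a y" using jm_add[of a x "- y"] jm_minus by simp

lemmas op_linear = g_add g_scale g_zero g_minus g_diff t_add t_scale t_zero t_minus t_diff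
  jm_add jm_scale jm_zero jm_minus jm_diff

lemma g_jm_later:
  assumes "a \<in> {1..<n}" "1 \<le> j" "j \<le> a - 1"
  shows "g a (jm j x) = jm j (g a x)"
  using assms(2,3)
proof (induction j arbitrary: x rule: dec_induct)
  case base then show ?case by (simp add: jm_1)
next
  case (step j)
  have c: "g a (g j y) = g j (g a y)" for y
    using g_comm[of j a y] step assms(1) by auto
  show ?case using step by (simp add: jm.simps g_scale c)
qed

text \<open>
  Moving \<open>g\<^sub>a\<close> past \<open>g\<^sub>a\<^sub>+\<^sub>1 g\<^sub>a\<close> turns it into \<open>g\<^sub>a\<^sub>+\<^sub>1\<close> by the braid relation, and \<open>g\<^sub>a\<^sub>+\<^sub>1\<close> commutes
  with the Jucys--Murphy operator \<open>a\<close>.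
\<close>

lemma g_jm_earlier:
  assumes "a \<in> {1..<n}" "Suc (Suc a) \<le> j" "j \<le> n"
  shows "g a (jm j x) = jm j (g a x)"
  using assms(2,3)
proof (induction j arbitrary: x rule: dec_induct)
  case base
  have X2: "jm (Suc (Suc a)) y = (inverse v * inverse v) *s g (Suc a) (g a (jm a (g a (g (Suc a) y))))" for y
    using assms(1) by (simp add: jm.simps op_linear)
  have b: "g a (g (Suc a) (g a y)) = g (Suc a) (g a (g (Suc a) y))" for y
    using g_braid[of a y] assms(1) base by auto
  have c: "g (Suc a) (jm a y) = jm a (g (Suc a) y)" for y
    using g_jm_later[of "Suc a" a y] assms(1) base by auto
  show ?case proof -
    have "g a (g (Suc a) (g a (jm a (g a (g (Suc a) x))))) = g (Suc a) (g a (jm a (g (Suc a) (g a (g (Suc a) x)))))"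
      by (simp only: b c)
    also have "\<dots> = g (Suc a) (g a (jm a (g a (g (Suc a) (g a x)))))"
      by (simp only: b)
    finally show ?thesis unfolding X2 by (simp add: op_linear)
  qed
next
  case (step j)
  have c: "g a (g j y) = g j (g a y)" for y
    using g_comm[of a j y] step assms(1) by auto
  show ?case using step by (simp add: jm.simps g_scale c)
qed

lemma jm_jm_less:
  assumes "1 \<le> i" "i < j" "j \<le> n"
  shows "jm i (jm j x) = jm j (jm i x)"
  using assms(1,2)
proof (induction i arbitrary: x rule: dec_induct)
  case base then show ?case by (simp add: jm_1)
next
  case (step i)
  have c: "g i (jm j y) = jm j (g i y)" for y
    using g_jm_earlier[of i j y] step assms(3) by auto
  show ?case using step by (simp add: jm.simps jm_scale c)
qed

lemma jm_jm:
  assumes "i \<in> {1..n}" "j \<in> {1..n}"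
  shows "jm i (jm j x) = jm j (jm i x)"
  using jm_jm_less[of i j x] jm_jm_less[of j i x] assms by (cases i j rule: linorder_cases) auto

lemma t_jm:
  assumes "a \<in> {1..n}" "1 \<le> j" "j \<le> n"
  shows "t a (jm j x) = jm j (t a x)"
  using assms(2,1,3)
proof (induction j arbitrary: a x rule: dec_induct)
  case base then show ?case by (simp add: jm_1)
next
  case (step j)
  let ?b = "transpose j (Suc j) a"
  have b: "?b \<in> {1..n}" using step by (auto simp: transpose_def)
  have "t a (g j (jm j (g j x))) = g j (jm j (t ?b (g j x)))"
    using t_g[of a j] step b by simp
  also have "\<dots> = g j (jm j (g j (t a x)))"
    using t_g[OF b, of j] step by simp
  finally show ?case using step by (simp add: jm.simps op_linear)
qed

subsection \<open>Decompositions into eigenvectors\<close>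

definition decomposes :: "('v \<Rightarrow> 'v) \<Rightarrow> ('i \<Rightarrow> 'f) \<Rightarrow> 'i set \<Rightarrow> 'v \<Rightarrow> bool" where
  "decomposes T \<mu> S x \<longleftrightarrow> (\<exists>u. x = (\<Sum>c\<in>S. u c) \<and> (\<forall>c\<in>S. T (u c) = \<mu> c *s u c))"

lemma op_sum:
  assumes "\<And>x y. T (x + y) = T x + T y" and "T 0 = 0"
  shows "T (\<Sum>c\<in>S. u c) = (\<Sum>c\<in>S. T (u c))"
  by (induction S rule: infinite_finite_induct) (auto simp: assms)

lemma eigenvectors_independent:
  assumes T: "\<And>x y. T (x + y) = T x + T y" "\<And>c x. T (c *s x) = c *s T x"
    and S: "finite S" "inj_on \<mu> S"
    and u: "\<And>c. c \<in> S \<Longrightarrow> T (u c) = \<mu> c *s u c" "(\<Sum>c\<in>S. u c) = 0"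
  shows "\<forall>c\<in>S. u c = 0"
  using S u
proof (induction S arbitrary: u rule: finite_induct)
  case (insert c0 S)
  have T0: "T 0 = 0" using T(2)[of 0 0] by simp
  have e: "u c0 = - (\<Sum>c\<in>S. u c)" using insert by (simp add: eq_neg_iff_add_eq_0)
  have "T (u c0 + (\<Sum>c\<in>S. u c)) = 0" using insert.prems insert.hyps T0 by simp
  then have "\<mu> c0 *s u c0 + (\<Sum>c\<in>S. \<mu> c *s u c) = 0"
    using insert by (simp add: T op_sum[of T, OF T(1) T0])
  then have "(\<Sum>c\<in>S. (\<mu> c - \<mu> c0) *s u c) = 0"
    unfolding e by (simp add: scale_left_diff_distrib sum_subtractf scale_sum_right)
  moreover have "T ((\<mu> c - \<mu> c0) *s u c) = \<mu> c *s ((\<mu> c - \<mu> c0) *s u c)" if "c \<in> S" for c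
    using insert that by (simp add: T mult.commute)
  ultimately have "\<forall>c\<in>S. (\<mu> c - \<mu> c0) *s u c = 0"
    using insert.IH[of "\<lambda>c. (\<mu> c - \<mu> c0) *s u c"] insert.prems by auto
  moreover have "\<mu> c \<noteq> \<mu> c0" if "c \<in> S" for c
    using insert.prems(1) insert.hyps that by (auto simp: inj_on_def)
  ultimately have z: "\<forall>c\<in>S. u c = 0" by auto
  then have "u c0 = 0" unfolding e by simp
  then show ?case using z by simp
qed auto

text \<open>
  An operator commuting with \<open>T\<close> preserves the eigenspaces of \<open>T\<close>, and these are independent.
\<close>

lemma eigenvector_component:
  assumes T: "\<And>x y. T (x + y) = T x + T y" "\<And>c x. T (c *s x) = c *s T x"
    and U: "\<And>x y. U (x + y) = U x + U y" "\<And>c x. U (c *s x) = c *s U x"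
    and TU: "\<And>x. T (U x) = U (T x)"
    and S: "finite S" "inj_on \<mu> S"
    and u: "\<And>c. c \<in> S \<Longrightarrow> T (u c) = \<mu> c *s u c"
    and x: "U (\<Sum>c\<in>S. u c) = \<gamma> *s (\<Sum>c\<in>S. u c)" and c: "c \<in> S"
  shows "U (u c) = \<gamma> *s u c"
proof -
  have U0: "U 0 = 0" using U(2)[of 0 0] by simp
  have m: "U (- y) = - U y" for y using U(1)[of y "- y"] U0 by (simp add: eq_neg_iff_add_eq_0 add.commute)
  have Tm: "T (- y) = - T y" for y using T(1)[of y "- y"] T(2)[of 0 0] by (simp add: eq_neg_iff_add_eq_0 add.commute)
  have Td: "T (x - y) = T x - T y" for x y using T(1)[of x "- y"] Tm by simp
  have "(\<Sum>c\<in>S. U (u c) - \<gamma> *s u c) = 0"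
    using x by (simp add: sum_subtractf op_sum[of U, OF U(1) U0] scale_sum_right)
  moreover have "T (U (u c) - \<gamma> *s u c) = \<mu> c *s (U (u c) - \<gamma> *s u c)" if "c \<in> S" for c
    using u[OF that] by (simp add: Td TU U T scale_right_diff_distrib mult.commute)
  ultimately have "\<forall>c\<in>S. U (u c) - \<gamma> *s u c = 0"
    by (intro eigenvectors_independent[OF T S])
  then show ?thesis using c by simp
qed

end

section \<open>Intertwiners\<close>

lemma addable_still_addable:
  assumes "x \<in> addable \<sigma> m p" "C \<in> addable \<sigma> m p" "\<sigma> (Suc m) = (C, p)" "x \<noteq> C"
  shows "x \<in> addable \<sigma> (Suc m) p"
  using assms by (auto simp: addable_def profile_Suc)

lemma addable_other_component:
  assumes "snd (\<sigma> (Suc m)) \<noteq> p"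
  shows "addable \<sigma> (Suc m) p = addable \<sigma> m p"
  using assms by (auto simp: addable_def profile_Suc)

context yh_module
begin

lemma inj_powi: "inj (\<lambda>x::int. v powi x)"
proof (rule injI)
  have *: "x = y" if "v powi x = v powi y" "x \<le> y" for x y
  proof (rule ccontr)
    assume "x \<noteq> y"
    then have "nat (y - x) > 0" using that by simp
    moreover have "v powi (y - x) = 1" using that v_nonzero by (simp add: power_int_diff)
    then have "v ^ nat (y - x) = 1" using that by (simp add: power_int_def)
    ultimately show False using v_not_root_of_unity by blast
  qed
  fix x y :: int assume "v powi x = v powi y"
  then show "x = y" using *[of x y] *[of y x] by (cases "x \<le> y") auto
qed

lemma v_powi_succ: "v powi (C + 1) = v * v powi C" "v * v powi (C - 1) = v powi C"
  using v_nonzero by (simp_all add: power_int_add power_int_diff)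

lemma char_eq_iff: "p \<in> P \<Longrightarrow> p' \<in> P \<Longrightarrow> \<chi> p = \<chi> p' \<longleftrightarrow> p = p'"
  using inj_char by (auto simp: inj_on_def)

definition same_char :: "nat \<Rightarrow> 'f \<Rightarrow> 'v \<Rightarrow> bool" where
  "same_char a z w \<longleftrightarrow> t a w = z *s w \<and> t (Suc a) w = z *s w"

text \<open>
  On vectors on which \<open>t\<^sub>a\<close> and \<open>t\<^sub>a\<^sub>+\<^sub>1\<close> have the same eigenvalue, \<open>g\<^sub>a\<close>, \<open>x = jm a\<close> and
  \<open>y = jm (a + 1)\<close> satisfy the relations of the affine Hecke algebra of rank two. The commutator
  \<open>g\<^sub>a x - x g\<^sub>a\<close> exchanges \<open>x\<close> and \<open>y\<close>, and its square is \<open>(v x - y) (v y - x)\<close>.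
\<close>

definition intertwiner :: "nat \<Rightarrow> 'v \<Rightarrow> 'v" where
  "intertwiner a w = g a (jm a w) - jm a (g a w)"

lemma intertwiner_linear:
  "intertwiner a (x + y) = intertwiner a x + intertwiner a y"
  "intertwiner a (c *s x) = c *s intertwiner a x"
  "intertwiner a 0 = 0"
  by (simp_all add: intertwiner_def op_linear scale_right_diff_distrib)

context
  fixes a :: nat
  assumes a: "a \<in> {1..<n}"
begin

lemma t_g_swap: "t a (g a w) = g a (t (Suc a) w)" "t (Suc a) (g a w) = g a (t a w)"
  using t_g[of a a w] t_g[of "Suc a" a w] a by (auto simp: transpose_def)

lemma same_char_g: "same_char a z w \<Longrightarrow> same_char a z (g a w)"
  unfolding same_char_def t_g_swap by (simp add: op_linear)

lemma same_char_jm: "same_char a z w \<Longrightarrow> 1 \<le> j \<Longrightarrow> j \<le> n \<Longrightarrow> same_char a z (jm j w)"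
  using t_jm[of a j w] t_jm[of "Suc a" j w] a unfolding same_char_def by (auto simp: op_linear)

lemma g_g: "same_char a z w \<Longrightarrow> g a (g a w) = v *s w + (v - 1) *s g a w"
  using g_g_same[OF a] by (auto simp: same_char_def)

lemma v_jm_Suc: "v *s jm (Suc a) w = g a (jm a (g a w))"
  using a v_nonzero by (simp add: jm_Suc)

lemma g_jm_Suc:
  assumes "same_char a z w"
  shows "g a (jm (Suc a) w) = jm a (g a w) + (v - 1) *s jm (Suc a) w"
proof -
  have "same_char a z (jm a (g a w))" using same_char_jm same_char_g assms a by auto
  from g_g[OF this] have "g a (v *s jm (Suc a) w) = v *s jm a (g a w) + (v - 1) *s v *s jm (Suc a) w"
    by (simp add: v_jm_Suc del: scale_scale)
  then have "v *s g a (jm (Suc a) w) = v *s (jm a (g a w) + (v - 1) *s jm (Suc a) w)"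
    by (simp add: g_scale scale_right_distrib mult.commute)
  then show ?thesis using v_nonzero by simp
qed

lemma jm_Suc_g:
  assumes "same_char a z w"
  shows "jm (Suc a) (g a w) = g a (jm a w) + (v - 1) *s jm (Suc a) w"
proof -
  have "v *s jm (Suc a) (g a w) = v *s g a (jm a w) + (v - 1) *s v *s jm (Suc a) w"
    unfolding v_jm_Suc g_g[OF assms] by (simp only: op_linear)
  also have "\<dots> = v *s (g a (jm a w) + (v - 1) *s jm (Suc a) w)"
    by (simp add: scale_right_distrib mult.commute)
  finally show ?thesis using v_nonzero by (simp only: scale_left_imp_eq scale_cancel_left) simp
qed

lemma jm_jm_Suc: "jm (Suc a) (jm a w) = jm a (jm (Suc a) w)"
  using jm_jm[of a "Suc a"] a by auto

lemma jm_Suc_intertwiner: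
  assumes "same_char a z w"
  shows "jm (Suc a) (intertwiner a w) = intertwiner a (jm a w)"
proof -
  have "same_char a z (jm a w)" using assms same_char_jm a by auto
  then show ?thesis using assms
    by (simp add: intertwiner_def op_linear jm_Suc_g jm_jm_Suc algebra_simps)
qed

lemma jm_intertwiner:
  assumes "same_char a z w"
  shows "jm a (intertwiner a w) = intertwiner a (jm (Suc a) w)"
proof -
  have "same_char a z (jm a w)" using assms same_char_jm a by auto
  then show ?thesis using assms
    by (simp add: intertwiner_def op_linear g_jm_Suc algebra_simps flip: jm_jm_Suc)
qed

lemma intertwiner_square:
  assumes s: "same_char a z w" and c: "jm a w = c *s w"
  shows "intertwiner a (intertwiner a w) =
    (v * c) *s (v *s jm (Suc a) w - c *s w) - jm (Suc a) (v *s jm (Suc a) w - c *s w)"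
proof -
  let ?y = "jm (Suc a)"
  have sy: "same_char a z (?y w)" "same_char a z (?y (?y w))"
    using s same_char_jm a by auto
  have cy1: "jm a (?y w) = c *s ?y w"
    using c jm_jm_Suc[of w] by (simp add: op_linear)
  then have "jm a (?y (?y w)) = c *s ?y (?y w)"
    using jm_jm_Suc[of "?y w"] by (simp add: op_linear)
  note cy = cy1 this
  have xg: "jm a (g a w) = g a (?y w) - (v - 1) *s ?y w"
      "jm a (g a (?y w)) = g a (?y (?y w)) - (v - 1) *s ?y (?y w)"
    using g_jm_Suc[OF s] g_jm_Suc[OF sy(1)] by simp_all
  have gg: "g a (g a w) = v *s w + (v - 1) *s g a w"
      "g a (g a (?y w)) = v *s ?y w + (v - 1) *s g a (?y w)"
      "g a (g a (?y (?y w))) = v *s ?y (?y w) + (v - 1) *s g a (?y (?y w))"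
    using g_g s sy by auto
  have xu: "jm a (intertwiner a w) = c *s g a (?y w) - g a (?y (?y w)) + (v - 1) *s ?y (?y w)"
    unfolding jm_intertwiner[OF s] by (simp add: intertwiner_def cy xg op_linear)
  have u: "intertwiner a w = c *s g a w - g a (?y w) + (v - 1) *s ?y w"
    unfolding intertwiner_def by (simp add: c xg op_linear)
  have gu: "g a (intertwiner a w) = (v * c) *s w + ((v - 1) * c) *s g a w - v *s ?y w"
    unfolding u by (simp add: op_linear gg algebra_simps)
  show ?thesis
    unfolding intertwiner_def[of a "intertwiner a w"] xu gu
    by (simp add: op_linear gg c cy xg algebra_simps)
qed

text \<open>
  If \<open>x\<close> and \<open>y\<close> had the same eigenvalue on \<open>w \<noteq> 0\<close>, then \<open>g\<^sub>a w\<close> would be a generalized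
  eigenvector of \<open>x\<close> that is not an eigenvector, against semisimplicity.
\<close>

lemma equal_eigenvalues:
  assumes ss: "\<And>c w. jm a (jm a w - c *s w) = c *s (jm a w - c *s w) \<Longrightarrow> jm a w = c *s w"
    and s: "same_char a z w" and x: "jm a w = c *s w" and y: "jm (Suc a) w = c *s w" and c: "c \<noteq> 0"
  shows "w = 0"
proof -
  let ?u = "g a w"
  have u: "jm a ?u - c *s ?u = - ((v - 1) * c) *s w"
    using g_jm_Suc[OF s] y by (simp add: op_linear algebra_simps)
  have "jm a (jm a ?u - c *s ?u) = c *s (jm a ?u - c *s ?u)"
    unfolding u by (simp add: op_linear x mult.commute)
  then have "jm a ?u = c *s ?u" by (rule ss)
  then have "- ((v - 1) * c) *s w = 0" using u by simp
  then show ?thesis using c v_not_root_of_unity[of 1] by simp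
qed

lemma same_char_intertwiner:
  assumes "same_char a z w"
  shows "same_char a z (intertwiner a w)"
proof -
  have "same_char a z (g a (jm a w))" "same_char a z (jm a (g a w))"
    using assms same_char_g same_char_jm a by auto
  then show ?thesis
    unfolding same_char_def intertwiner_def by (simp add: t_diff scale_right_diff_distrib)
qed

lemma g_t_other: "j \<in> {1..n} \<Longrightarrow> j \<notin> {a, Suc a} \<Longrightarrow> t j (g a w) = g a (t j w)"
  using t_g[of j a w] a by (simp add: transpose_def)

lemma g_jm_other: "j \<in> {1..n} \<Longrightarrow> j \<notin> {a, Suc a} \<Longrightarrow> jm j (g a w) = g a (jm j w)"
  using g_jm_later[of a j w] g_jm_earlier[of a j w] a by (cases "j < a") auto

lemma t_intertwiner_other:
  assumes "j \<in> {1..n}" "j \<notin> {a, Suc a}"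
  shows "t j (intertwiner a w) = intertwiner a (t j w)"
  using assms a t_jm[of j a] unfolding intertwiner_def by (simp add: t_diff g_t_other)

lemma jm_intertwiner_other:
  assumes "j \<in> {1..n}" "j \<notin> {a, Suc a}"
  shows "jm j (intertwiner a w) = intertwiner a (jm j w)"
  using assms a jm_jm[of j a] unfolding intertwiner_def by (simp add: jm_diff g_jm_other)

text \<open>
  For different characters \<open>g\<^sub>a\<close> itself is an intertwiner.
\<close>

lemma jm_g_different:
  assumes p: "p \<in> P" "p' \<in> P" "p \<noteq> p'" and t: "t a w = \<chi> p *s w" "t (Suc a) w = \<chi> p' *s w"
  shows "jm (Suc a) (g a w) = g a (jm a w)" "jm a (g a w) = g a (jm (Suc a) w)"
proof -
  have "v *s jm (Suc a) (g a w) = v *s g a (jm a w)"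
    unfolding v_jm_Suc g_g_different[OF a p t] by (simp add: op_linear)
  then show "jm (Suc a) (g a w) = g a (jm a w)" using v_nonzero by simp
  have 1: "t a (jm a (g a w)) = \<chi> p' *s jm a (g a w)" "t (Suc a) (jm a (g a w)) = \<chi> p *s jm a (g a w)"
    using t_jm[of a a] t_jm[of "Suc a" a] a t by (auto simp: t_g_swap op_linear)
  have "v *s g a (jm (Suc a) w) = v *s jm a (g a w)"
    using g_g_different[OF a p(2,1) p(3)[symmetric] 1] by (simp add: v_jm_Suc flip: g_scale)
  then show "jm a (g a w) = g a (jm (Suc a) w)" using v_nonzero by simp
qed

end

text \<open>
  Three consecutive eigenvalues \<open>\<alpha>, \<beta>, \<alpha>\<close> with \<open>\<beta> = v \<alpha>\<close> or \<open>\<alpha> = v \<beta>\<close> do not occur. Both intertwiners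
  vanish on \<open>w\<close>, so \<open>g\<^sub>a\<close> and \<open>g\<^sub>a\<^sub>+\<^sub>1\<close> act on \<open>w\<close> by the scalars \<open>v\<close> and \<open>-1\<close> in some order. The braid
  relation would force them to be equal.
\<close>

lemma braid_obstruction:
  assumes a: "a \<in> {1..<n}" "Suc a \<in> {1..<n}" and b: "{\<alpha>, \<beta>} = {c, v * c}" and c: "c \<noteq> 0"
    and ss: "\<And>i c w. i = a \<or> i = Suc a \<Longrightarrow> jm i (jm i w - c *s w) = c *s (jm i w - c *s w) \<Longrightarrow> jm i w = c *s w"
    and s: "same_char a z w" "same_char (Suc a) z w"
    and x: "jm a w = \<alpha> *s w" "jm (Suc a) w = \<beta> *s w" "jm (Suc (Suc a)) w = \<alpha> *s w"
  shows "w = 0"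
proof -
  have nz: "\<alpha> \<noteq> 0" using b c v_nonzero by (auto simp: doubleton_eq_iff)
  have v1: "v - 1 \<noteq> 0" using v_not_root_of_unity[of 1] by simp
  have v2: "v \<noteq> - 1"
  proof
    assume "v = - 1"
    then have "v ^ 2 = 1" by simp
    then show False using v_not_root_of_unity[of 2] by simp
  qed
  have z: "t a w = z *s w" "t (Suc a) w = z *s w" "t (Suc (Suc a)) w = z *s w"
    using s by (auto simp: same_char_def)
  \<comment> \<open>Moving either outer eigenvalue inwards would put two equal eigenvalues side by side.\<close>
  have "intertwiner a w = 0"
  proof (rule equal_eigenvalues[OF a(2) ss, where c = \<alpha> and z = z])
    show "same_char (Suc a) z (intertwiner a w)"
      using same_char_intertwiner[OF a(1) s(1)] t_intertwiner_other[OF a(1), of "Suc (Suc a)"] a z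
      by (simp add: same_char_def intertwiner_linear)
    show "jm (Suc a) (intertwiner a w) = \<alpha> *s intertwiner a w"
      unfolding jm_Suc_intertwiner[OF a(1) s(1)] by (simp add: x intertwiner_linear)
    show "jm (Suc (Suc a)) (intertwiner a w) = \<alpha> *s intertwiner a w"
      using jm_intertwiner_other[OF a(1), of "Suc (Suc a)"] a x by (simp add: intertwiner_linear)
  qed (use nz in simp_all)
  then have 1: "(\<alpha> - \<beta>) *s g a w = - ((v - 1) * \<beta>) *s w"
    using g_jm_Suc[OF a(1) s(1)] by (simp add: intertwiner_def x op_linear algebra_simps)
  have "intertwiner (Suc a) w = 0"
  proof (rule equal_eigenvalues[OF a(1) ss, where c = \<alpha> and z = z])
    show "same_char a z (intertwiner (Suc a) w)"
      using same_char_intertwiner[OF a(2) s(2)] t_intertwiner_other[OF a(2), of a] a z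
      by (simp add: same_char_def intertwiner_linear)
    show "jm (Suc a) (intertwiner (Suc a) w) = \<alpha> *s intertwiner (Suc a) w"
      unfolding jm_intertwiner[OF a(2) s(2)] by (simp add: x(3) x intertwiner_linear)
    show "jm a (intertwiner (Suc a) w) = \<alpha> *s intertwiner (Suc a) w"
      using jm_intertwiner_other[OF a(2), of a] a x by (simp add: intertwiner_linear)
  qed (use nz in simp_all)
  then have 2: "(\<beta> - \<alpha>) *s g (Suc a) w = - ((v - 1) * \<alpha>) *s w"
    using g_jm_Suc[OF a(2) s(2)] x(3) by (simp add: intertwiner_def x op_linear algebra_simps)
  have k: "\<exists>k l. g a w = k *s w \<and> g (Suc a) w = l *s w \<and> k \<noteq> l \<and> k \<noteq> 0 \<and> l \<noteq> 0"
  proof (cases "\<alpha> = c")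
    case True
    then have b: "\<beta> = v * c" using b by (auto simp: doubleton_eq_iff)
    have "((1 - v) * c) *s g a w = ((1 - v) * c) *s (v *s w)"
      using 1 True b by (simp add: algebra_simps)
    then have "g a w = v *s w" by (rule scale_left_imp_eq[rotated]) (use c v1 in auto)
    moreover have "((v - 1) * c) *s g (Suc a) w = ((v - 1) * c) *s ((- 1) *s w)"
      using 2 True b by (simp add: algebra_simps)
    then have "g (Suc a) w = (- 1) *s w" by (rule scale_left_imp_eq[rotated]) (use c v1 in auto)
    ultimately show ?thesis using v2 v_nonzero by (intro exI[of _ v] exI[of _ "- 1"]) simp
  next
    case False
    then have b: "\<alpha> = v * c" "\<beta> = c" using b by (auto simp: doubleton_eq_iff)
    have "((v - 1) * c) *s g a w = ((v - 1) * c) *s ((- 1) *s w)"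
      using 1 b by (simp add: algebra_simps)
    then have "g a w = (- 1) *s w" by (rule scale_left_imp_eq[rotated]) (use c v1 in auto)
    moreover have "((1 - v) * c) *s g (Suc a) w = ((1 - v) * c) *s (v *s w)"
      using 2 b by (simp add: algebra_simps)
    then have "g (Suc a) w = v *s w" by (rule scale_left_imp_eq[rotated]) (use c v1 in auto)
    ultimately show ?thesis using v2 v_nonzero
      by (intro exI[of _ "- 1"] exI[of _ v]) (simp add: eq_commute[of "- 1"])
  qed
  then obtain k l where kl: "g a w = k *s w" "g (Suc a) w = l *s w" "k \<noteq> l" "k \<noteq> 0" "l \<noteq> 0"
    by blast
  have "(k * l * (k - l)) *s w = 0"
    using g_braid[OF a, of w] kl by (simp add: op_linear algebra_simps)
  then show ?thesis using kl by auto
qed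

end

section \<open>The spectrum of the Jucys--Murphy operators\<close>

context yh_module
begin

definition colored :: "content_seq \<Rightarrow> bool" where
  "colored \<sigma> \<longleftrightarrow> (\<forall>i\<in>{1..n}. snd (\<sigma> i) \<in> P)"

definition joint_eigenvector :: "nat \<Rightarrow> content_seq \<Rightarrow> 'v \<Rightarrow> bool" where
  "joint_eigenvector m \<sigma> w \<longleftrightarrow>
    (\<forall>i\<in>{1..m}. jm i w = (v powi fst (\<sigma> i)) *s w) \<and> (\<forall>i\<in>{1..n}. t i w = \<chi> (snd (\<sigma> i)) *s w)"

definition semisimple :: "nat \<Rightarrow> bool" where
  "semisimple i \<longleftrightarrow> (\<forall>c w. jm i (jm i w - c *s w) = c *s (jm i w - c *s w) \<longrightarrow> jm i w = c *s w)"

lemma same_charI: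
  assumes "joint_eigenvector m \<sigma> w" "a \<in> {1..<n}" "snd (\<sigma> a) = p" "snd (\<sigma> (Suc a)) = p"
  shows "same_char a (\<chi> p) w"
  using assms by (auto simp: joint_eigenvector_def same_char_def)

text \<open>
  The square of the intertwiner is a scalar on \<open>w\<close>, and contents at distance at least two make this
  scalar nonzero.
\<close>

lemma swap_eigenvector:
  assumes w: "joint_eigenvector m \<sigma> w" "w \<noteq> 0" and col: "colored \<sigma>"
    and a: "1 \<le> a" "Suc a \<le> m" "m \<le> n"
    and far: "snd (\<sigma> a) = snd (\<sigma> (Suc a)) \<Longrightarrow> 2 \<le> \<bar>fst (\<sigma> a) - fst (\<sigma> (Suc a))\<bar>"
  shows "\<exists>w'. w' \<noteq> 0 \<and> joint_eigenvector m (\<sigma> \<circ> transpose a (Suc a)) w'"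
proof -
  have an: "a \<in> {1..<n}" using a by auto
  have Xw: "jm i w = (v powi fst (\<sigma> i)) *s w" if "i \<in> {1..m}" for i
    using w that by (auto simp: joint_eigenvector_def)
  have tw: "t i w = \<chi> (snd (\<sigma> i)) *s w" if "i \<in> {1..n}" for i
    using w that by (auto simp: joint_eigenvector_def)
  show ?thesis
  proof (cases "snd (\<sigma> a) = snd (\<sigma> (Suc a))")
    case False
    let ?w = "g a w"
    have p: "snd (\<sigma> a) \<in> P" "snd (\<sigma> (Suc a)) \<in> P" using col a by (auto simp: colored_def)
    have ta: "t a w = \<chi> (snd (\<sigma> a)) *s w" "t (Suc a) w = \<chi> (snd (\<sigma> (Suc a))) *s w"
      using tw a by auto
    have "?w \<noteq> 0"
      using g_g_different[OF an p False ta] w(2) v_nonzero g_zero[of a] by auto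
    moreover have "joint_eigenvector m (\<sigma> \<circ> transpose a (Suc a)) ?w"
      unfolding joint_eigenvector_def
    proof (intro conjI ballI)
      fix i assume i: "i \<in> {1..m}"
      show "jm i ?w = (v powi fst ((\<sigma> \<circ> transpose a (Suc a)) i)) *s ?w"
        using jm_g_different[OF an p False ta] Xw a i g_jm_other[OF an, of i w]
        by (cases "i = a"; cases "i = Suc a") (auto simp: op_linear)
    next
      fix i assume i: "i \<in> {1..n}"
      show "t i ?w = \<chi> (snd ((\<sigma> \<circ> transpose a (Suc a)) i)) *s ?w"
        using tw a i g_t_other[OF an, of i w] t_g_swap[OF an]
        by (cases "i = a"; cases "i = Suc a") (auto simp: op_linear)
    qed
    ultimately show ?thesis by blast
  next
    case True
    let ?w = "intertwiner a w"
    let ?A = "v powi fst (\<sigma> a)" and ?B = "v powi fst (\<sigma> (Suc a))"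
    have s: "same_char a (\<chi> (snd (\<sigma> a))) w" using same_charI[OF w(1) an refl] True by simp
    have x: "jm a w = ?A *s w" "jm (Suc a) w = ?B *s w" using Xw a by auto
    have "intertwiner a ?w = ((v * ?A - ?B) * (v * ?B - ?A)) *s w"
      using intertwiner_square[OF an s x(1)] x(2) by (simp add: op_linear algebra_simps)
    moreover have "v * ?A \<noteq> ?B" "v * ?B \<noteq> ?A"
      using far[OF True] injD[OF inj_powi, of "fst (\<sigma> a) + 1" "fst (\<sigma> (Suc a))"]
        injD[OF inj_powi, of "fst (\<sigma> (Suc a)) + 1" "fst (\<sigma> a)"] by (auto simp: v_powi_succ)
    ultimately have "intertwiner a ?w \<noteq> 0" using w(2) by auto
    then have "?w \<noteq> 0" by (auto simp: intertwiner_linear)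
    moreover have "joint_eigenvector m (\<sigma> \<circ> transpose a (Suc a)) ?w"
      unfolding joint_eigenvector_def
    proof (intro conjI ballI)
      fix i assume i: "i \<in> {1..m}"
      show "jm i ?w = (v powi fst ((\<sigma> \<circ> transpose a (Suc a)) i)) *s ?w"
        using jm_intertwiner[OF an s] jm_Suc_intertwiner[OF an s] x Xw a i jm_intertwiner_other[OF an, of i w]
        by (cases "i = a"; cases "i = Suc a") (auto simp: intertwiner_linear)
    next
      fix i assume i: "i \<in> {1..n}"
      show "t i ?w = \<chi> (snd ((\<sigma> \<circ> transpose a (Suc a)) i)) *s ?w"
        using same_char_intertwiner[OF an s] True tw a i t_intertwiner_other[OF an, of i w]
        by (cases "i = a"; cases "i = Suc a") (auto simp: intertwiner_linear same_char_def)
    qed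
    ultimately show ?thesis by blast
  qed
qed

text \<open>
  Between two boxes on the same diagonal there must be boxes on both neighbouring diagonals. If only
  one such box \<open>C\<close> occurs, swaps move the first of the two boxes to the position right before \<open>C\<close>, and
  the pattern \<open>y, C, y\<close> is excluded by the braid relation.
\<close>

lemma readdition_impossible:
  assumes "b < a" "1 \<le> b" "a < n" "\<And>i. i \<in> {1..a} \<Longrightarrow> semisimple i"
    and "joint_eigenvector (Suc a) \<sigma> w" "colored \<sigma>"
    and "\<sigma> b = (y, p)" "\<sigma> a = (C, p)" "\<sigma> (Suc a) = (y, p)" "\<bar>y - C\<bar> = 1"
    and "\<forall>i\<in>{b<..<a}. \<sigma> i \<notin> {(y, p), (y + 1, p), (y - 1, p)}"
  shows "w = 0"
  using assms
proof (induction "a - b" arbitrary: b \<sigma> w)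
  case 0 then show ?case by simp
next
  case (Suc l)
  show ?case
  proof (cases "Suc b = a")
    case True
    let ?c = "v powi min y C"
    have x: "jm i w = (v powi fst (\<sigma> i)) *s w" if "i \<in> {1..Suc a}" for i
      using Suc.prems(5) that by (auto simp: joint_eigenvector_def)
    show ?thesis
    proof (rule braid_obstruction[of b "v powi y" "v powi C" ?c "\<chi> p"])
      show "b \<in> {1..<n}" "Suc b \<in> {1..<n}" using True Suc.prems by auto
      then show "same_char b (\<chi> p) w" "same_char (Suc b) (\<chi> p) w"
        using same_charI[OF Suc.prems(5), of _ p] True Suc.prems by auto
      have "y = C + 1 \<or> C = y + 1" using Suc.prems(10) by linarith
      then show "{v powi y, v powi C} = {?c, v * ?c}" by (auto simp: v_powi_succ)
      show "jm b w = (v powi y) *s w" "jm (Suc b) w = (v powi C) *s w" "jm (Suc (Suc b)) w = (v powi y) *s w"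
        using x[of b] x[of "Suc b"] x[of "Suc (Suc b)"] True Suc.prems by auto
      show "?c \<noteq> 0" using v_nonzero by simp
      show "jm i w = c *s w" if "i = b \<or> i = Suc b" "jm i (jm i w - c *s w) = c *s (jm i w - c *s w)" for i c w
      proof -
        have "semisimple i" using that(1) True Suc.prems(2) by (intro Suc.prems(4)) auto
        then show ?thesis using that(2) unfolding semisimple_def by blast
      qed
    qed
  next
    case False
    then have lt: "Suc b < a" using Suc.prems by simp
    show ?thesis
    proof (rule ccontr)
      assume "w \<noteq> 0"
      have "2 \<le> \<bar>fst (\<sigma> b) - fst (\<sigma> (Suc b))\<bar>" if "snd (\<sigma> b) = snd (\<sigma> (Suc b))"
      proof -
        have "\<sigma> (Suc b) \<notin> {(y, p), (y + 1, p), (y - 1, p)}" using Suc.prems(11) lt by auto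
        then show ?thesis using that Suc.prems(7) by (cases "\<sigma> (Suc b)") auto
      qed
      then obtain w' where w': "w' \<noteq> 0" "joint_eigenvector (Suc a) (\<sigma> \<circ> transpose b (Suc b)) w'"
        using swap_eigenvector[OF Suc.prems(5) \<open>w \<noteq> 0\<close> Suc.prems(6), of b] lt Suc.prems by auto
      have o: "(\<sigma> \<circ> transpose b (Suc b)) i = \<sigma> i" if "i > Suc b" for i using that by simp
      let ?\<sigma> = "\<sigma> \<circ> transpose b (Suc b)"
      have "w' = 0"
      proof (rule Suc.hyps(1)[of "Suc b" ?\<sigma>])
        show "colored ?\<sigma>"
          using Suc.prems(2,3,6) lt by (auto simp: colored_def transpose_def)
        show "\<forall>i\<in>{Suc b<..<a}. ?\<sigma> i \<notin> {(y, p), (y + 1, p), (y - 1, p)}"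
          using Suc.prems(11) by (auto simp: transpose_def)
        show "?\<sigma> (Suc b) = (y, p)" using Suc.prems(7) by simp
        show "?\<sigma> a = (C, p)" "?\<sigma> (Suc a) = (y, p)" using o lt Suc.prems(8,9) by simp_all
        show "semisimple i" if "i \<in> {1..a}" for i using Suc.prems(4) that .
      qed (use Suc.hyps(2) lt w' Suc.prems(3,10) in simp_all)
      with w' show False by simp
    qed
  qed
qed

lemma not_addable_not_eigenvalue:
  assumes v: "valid_seq \<sigma> a" and a: "a \<in> {1..<n}" and s: "\<sigma> a = (C, p)" "\<sigma> (Suc a) = (y, p)" "\<bar>y - C\<bar> = 1"
    and na: "y \<notin> addable \<sigma> a p" and w: "joint_eigenvector (Suc a) \<sigma> w" and col: "colored \<sigma>"
    and ss: "\<And>i. i \<in> {1..a} \<Longrightarrow> semisimple i"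
  shows "w = 0"
proof -
  obtain k where k: "a = Suc k" using a by (cases a) auto
  have "\<exists>b\<in>{1..k}. \<sigma> b = (C + (y - C), p) \<and>
      (\<forall>i\<in>{b<..k}. \<sigma> i \<notin> {(C + (y - C), p), (C + (y - C) + 1, p), (C + (y - C) - 1, p)})"
    using v s na by (intro not_addable_after_addition) (auto simp: k)
  then obtain b where "b \<in> {1..k}" "\<sigma> b = (y, p)"
      "\<forall>i\<in>{b<..k}. \<sigma> i \<notin> {(y, p), (y + 1, p), (y - 1, p)}" by auto
  then show ?thesis
    using ss w col s a by (intro readdition_impossible[of b a \<sigma> w y p C]) (auto simp: k)
qed

subsection \<open>The branching rule\<close>

lemma decomposes_add:
  assumes "finite S" "finite S'" "decomposes T \<mu> S x" "decomposes T \<mu> S' x'"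
    and T: "\<And>x y. T (x + y) = T x + T y" "T 0 = 0"
  shows "decomposes T \<mu> (S \<union> S') (x + x')"
proof -
  obtain u u' where u: "x = (\<Sum>c\<in>S. u c)" "\<forall>c\<in>S. T (u c) = \<mu> c *s u c"
    "x' = (\<Sum>c\<in>S'. u' c)" "\<forall>c\<in>S'. T (u' c) = \<mu> c *s u' c"
    using assms(3,4) unfolding decomposes_def by blast
  define f where "f c = (if c \<in> S then u c else 0) + (if c \<in> S' then u' c else 0)" for c
  have "(\<Sum>c\<in>S\<union>S'. if c \<in> S then u c else 0) = x" "(\<Sum>c\<in>S\<union>S'. if c \<in> S' then u' c else 0) = x'"
    using assms(1,2) unfolding u(1,3) by (auto intro!: sum.mono_neutral_cong_right)
  then have "x + x' = (\<Sum>c\<in>S\<union>S'. f c)" by (simp add: f_def sum.distrib)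
  moreover have "\<forall>c\<in>S\<union>S'. T (f c) = \<mu> c *s f c"
    using u by (auto simp: f_def T scale_right_distrib)
  ultimately show ?thesis unfolding decomposes_def by blast
qed

lemma decomposes_scale:
  assumes "decomposes T \<mu> S x" "\<And>c x. T (c *s x) = c *s T x"
  shows "decomposes T \<mu> S (k *s x)"
proof -
  obtain u where u: "x = (\<Sum>c\<in>S. u c)" "\<forall>c\<in>S. T (u c) = \<mu> c *s u c"
    using assms unfolding decomposes_def by blast
  then show ?thesis unfolding decomposes_def
    by (intro exI[of _ "\<lambda>c. k *s u c"]) (auto simp: scale_sum_right assms(2) mult.commute)
qed

text \<open>
  With \<open>u\<close> the components of \<open>T x - \<mu> i x\<close>, the components of \<open>x\<close> are \<open>u c / (\<mu> c - \<mu> i)\<close>, and what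
  is left over is an eigenvector for \<open>\<mu> i\<close>.
\<close>

lemma decomposes_insert:
  assumes S: "finite S" "i \<notin> S" "inj_on \<mu> (insert i S)"
    and T: "\<And>x y. T (x + y) = T x + T y" "\<And>c x. T (c *s x) = c *s T x"
    and d: "decomposes T \<mu> S (T x - \<mu> i *s x)"
  shows "decomposes T \<mu> (insert i S) x"
proof -
  have T0: "T 0 = 0" using T(2)[of 0 0] by simp
  obtain u where u: "T x - \<mu> i *s x = (\<Sum>c\<in>S. u c)" "\<forall>c\<in>S. T (u c) = \<mu> c *s u c"
    using d unfolding decomposes_def by blast
  define f where "f c = inverse (\<mu> c - \<mu> i) *s u c" for c
  have ne: "\<mu> c - \<mu> i \<noteq> 0" if "c \<in> S" for c using S that by (auto simp: inj_on_def)
  have f: "T (f c) = \<mu> c *s f c" if "c \<in> S" for c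
    using u that by (simp add: f_def T mult.commute)
  have Tm: "T (x - y) = T x - T y" for x y
    using T(1)[of "x - y" y] by simp
  have "T (\<Sum>c\<in>S. f c) - \<mu> i *s (\<Sum>c\<in>S. f c) = (\<Sum>c\<in>S. (\<mu> c - \<mu> i) *s f c)"
    by (simp add: op_sum[of T, OF T(1) T0] f scale_left_diff_distrib sum_subtractf scale_sum_right)
  also have "\<dots> = (\<Sum>c\<in>S. u c)"
    using ne by (intro sum.cong) (auto simp: f_def)
  finally have r: "T (x - (\<Sum>c\<in>S. f c)) = \<mu> i *s (x - (\<Sum>c\<in>S. f c))"
    using u(1) by (simp add: Tm scale_right_diff_distrib algebra_simps)
  define h where "h c = (if c = i then x - (\<Sum>c\<in>S. f c) else f c)" for c
  have "(\<Sum>c\<in>S. h c) = (\<Sum>c\<in>S. f c)" using S by (intro sum.cong) (auto simp: h_def)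
  then have "x = (\<Sum>c\<in>insert i S. h c)" using S by (simp add: h_def)
  moreover have "\<forall>c\<in>insert i S. T (h c) = \<mu> c *s h c" using r f by (simp add: h_def)
  ultimately show ?thesis unfolding decomposes_def by blast
qed

definition eigenvectors :: "nat \<Rightarrow> 'v set" where
  "eigenvectors m = {w. \<exists>\<sigma>. valid_seq \<sigma> m \<and> colored \<sigma> \<and> joint_eigenvector m \<sigma> w}"

definition branching :: "nat \<Rightarrow> bool" where
  "branching m \<longleftrightarrow> (\<forall>\<sigma> w. valid_seq \<sigma> (m - 1) \<longrightarrow> colored \<sigma> \<longrightarrow> joint_eigenvector (m - 1) \<sigma> w \<longrightarrow>
     decomposes (jm m) (\<lambda>x. v powi x) (addable \<sigma> (m - 1) (snd (\<sigma> m))) w)"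

lemma semisimple_if_spanning:
  assumes sp: "span (eigenvectors m) = UNIV" and i: "i \<in> {1..m}"
  shows "semisimple i"
proof -
  have "\<exists>S. finite S \<and> decomposes (jm i) (\<lambda>c. c) S x" for x
  proof -
    have "x \<in> span (eigenvectors m)" using sp by simp
    then show ?thesis
    proof (induction rule: span_induct_alt)
      case base
      show ?case by (intro exI[of _ "{}"]) (simp add: decomposes_def)
    next
      case (step c x y)
      obtain \<sigma> where "joint_eigenvector m \<sigma> x" using step(1) by (auto simp: eigenvectors_def)
      then have "decomposes (jm i) (\<lambda>c. c) {v powi fst (\<sigma> i)} x"
        using i unfolding decomposes_def by (intro exI[of _ "\<lambda>_. x"]) (auto simp: joint_eigenvector_def)
      then have 1: "decomposes (jm i) (\<lambda>c. c) {v powi fst (\<sigma> i)} (c *s x)"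
        by (rule decomposes_scale) (rule jm_scale)
      obtain S where "finite S" "decomposes (jm i) (\<lambda>c. c) S y" using step(2) by blast
      with decomposes_add[OF _ _ 1 _ jm_add jm_zero] show ?case
        by (intro exI[of _ "{v powi fst (\<sigma> i)} \<union> S"]) simp
    qed
  qed
  then have *: "\<exists>S. finite S \<and> decomposes (jm i) (\<lambda>c. c) S x" for x by blast
  show ?thesis unfolding semisimple_def
  proof (intro allI impI)
    fix c w assume z: "jm i (jm i w - c *s w) = c *s (jm i w - c *s w)"
    obtain S u where S: "finite S" and u: "w = (\<Sum>c\<in>S. u c)" "\<forall>c\<in>S. jm i (u c) = c *s u c"
      using *[of w] unfolding decomposes_def by blast
    have "jm i w - c *s w = (\<Sum>b\<in>S. (b - c) *s u b)"
      using u by (simp add: op_sum[of "jm i", OF jm_add jm_zero] scale_left_diff_distrib sum_subtractf scale_sum_right)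
    then have "(\<Sum>b\<in>S. jm i ((b - c) *s u b) - c *s (b - c) *s u b) = 0"
      using z by (simp only: op_sum[of "jm i", OF jm_add jm_zero] scale_sum_right sum_subtractf) simp
    moreover have "jm i ((b - c) *s u b) - c *s (b - c) *s u b = (b - c) *s (b - c) *s u b" if "b \<in> S" for b
    proof -
      have "jm i ((b - c) *s u b) = ((b - c) * b) *s u b"
        using u(2) that unfolding jm_scale by simp
      then have "jm i ((b - c) *s u b) - c *s (b - c) *s u b = ((b - c) * b - c * (b - c)) *s u b"
        by (metis scale_scale scale_left_diff_distrib)
      also have "(b - c) * b - c * (b - c) = (b - c) * (b - c)" by (simp add: algebra_simps)
      finally show ?thesis by simp
    qed
    ultimately have "(\<Sum>b\<in>S. (b - c) *s (b - c) *s u b) = 0" by simp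
    then have "\<forall>b\<in>S. (b - c) *s (b - c) *s u b = 0"
      using u(2) S by (intro eigenvectors_independent[where T = "jm i" and \<mu> = "\<lambda>c. c"])
        (auto simp: jm_add jm_scale mult.commute mult.left_commute)
    then have "(b - c) *s u b = 0" if "b \<in> S" for b using that by auto
    then show "jm i w = c *s w"
      using \<open>jm i w - c *s w = (\<Sum>b\<in>S. (b - c) *s u b)\<close> by (simp del: scale_eq_0_iff)
  qed
qed

lemma branching_1: "branching 1"
  unfolding branching_def
proof (intro allI impI)
  fix \<sigma> w
  have "addable \<sigma> 0 p = {0}" for p by (auto simp: addable_def)
  then show "decomposes (jm 1) (\<lambda>x. v powi x) (addable \<sigma> (1 - 1) (snd (\<sigma> 1))) w"
    unfolding decomposes_def by (intro exI[of _ "\<lambda>_. w"]) (simp add: jm_1)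
qed

lemma spanning_Suc:
  assumes m: "m < n" and sp: "span (eigenvectors m) = UNIV" and br: "branching (Suc m)"
  shows "span (eigenvectors (Suc m)) = UNIV"
proof -
  have "w \<in> span (eigenvectors (Suc m))" if w: "w \<in> eigenvectors m" for w
  proof -
    obtain \<sigma> where \<sigma>: "valid_seq \<sigma> m" "colored \<sigma>" "joint_eigenvector m \<sigma> w"
      using w by (auto simp: eigenvectors_def)
    let ?p = "snd (\<sigma> (Suc m))"
    let ?A = "addable \<sigma> m ?p"
    obtain u where u: "w = (\<Sum>x\<in>?A. u x)" "\<forall>x\<in>?A. jm (Suc m) (u x) = (v powi x) *s u x"
      using br \<sigma> unfolding branching_def decomposes_def by auto
    have comp: "U (u x) = \<gamma> *s u x" if "x \<in> ?A" "U w = \<gamma> *s w"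
      and U: "\<And>x y. U (x + y) = U x + U y" "\<And>c x. U (c *s x) = c *s U x"
        "\<And>x. jm (Suc m) (U x) = U (jm (Suc m) x)" for U \<gamma> x
      using u that inj_powi
      by (intro eigenvector_component[OF jm_add jm_scale U finite_addable, where \<mu> = "\<lambda>x. v powi x"])
        (auto intro: inj_on_subset)
    have "u x \<in> eigenvectors (Suc m)" if x: "x \<in> ?A" for x
    proof -
      let ?\<sigma> = "\<sigma>(Suc m := (x, ?p))"
      have "joint_eigenvector (Suc m) ?\<sigma> (u x)"
        unfolding joint_eigenvector_def
      proof (intro conjI ballI)
        fix i assume i: "i \<in> {1..Suc m}"
        show "jm i (u x) = (v powi fst (?\<sigma> i)) *s u x"
        proof (cases "i = Suc m")
          case False
          then have "jm i w = (v powi fst (\<sigma> i)) *s w" using \<sigma>(3) i by (auto simp: joint_eigenvector_def)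
          then have "jm i (u x) = (v powi fst (\<sigma> i)) *s u x"
            using x m i jm_jm[of "Suc m" i] by (intro comp) (auto simp: jm_add jm_scale)
          then show ?thesis using False by simp
        qed (use u x in auto)
      next
        fix i assume i: "i \<in> {1..n}"
        have "t i w = \<chi> (snd (\<sigma> i)) *s w" using \<sigma>(3) i by (auto simp: joint_eigenvector_def)
        then have "t i (u x) = \<chi> (snd (\<sigma> i)) *s u x"
          using x m i t_jm[of i "Suc m"] by (intro comp) (auto simp: t_add t_scale)
        then show "t i (u x) = \<chi> (snd (?\<sigma> i)) *s u x" by (cases "i = Suc m") auto
      qed
      moreover have "valid_seq ?\<sigma> (Suc m)"
        using \<sigma>(1) x valid_seq_cong[of m ?\<sigma> \<sigma>] addable_cong[of m ?\<sigma> \<sigma>] by (auto simp: valid_seq_Suc)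
      moreover have "colored ?\<sigma>" using \<sigma>(2) by (auto simp: colored_def)
      ultimately show ?thesis by (auto simp: eigenvectors_def)
    qed
    then show ?thesis unfolding u(1) by (intro span_sum) (auto intro: span_base)
  qed
  then have "span (eigenvectors m) \<subseteq> span (eigenvectors (Suc m))"
    by (intro span_minimal) auto
  then show ?thesis using sp by auto
qed

text \<open>
  Let \<open>C\<close> be the content of the last box of \<open>w\<close>. If the next box lies in the same component, apply the
  intertwiner to \<open>w\<close>: the branching rule for \<open>m\<close> decomposes the result, a second application carries
  the eigenvalues of \<open>jm m\<close> to \<open>jm (m + 1)\<close>, and the formula for the square shows that \<open>w\<close> itself
  decomposes for \<open>jm (m + 1)\<close> with eigenvalues among the positions addable before the last box and
  \<open>C + 1\<close>, \<open>C - 1\<close>. Of these, \<open>C\<close> is excluded by \<open>equal_eigenvalues\<close>, and \<open>C + 1\<close> and \<open>C - 1\<close> are excluded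
  by \<open>not_addable_not_eigenvalue\<close> unless they are addable. If the next box lies in another component,
  \<open>g\<^sub>m\<close> plays the part of the intertwiner.
\<close>

lemma branching_Suc:
  assumes m: "1 \<le> m" "m < n" and sp: "span (eigenvectors m) = UNIV" and br: "branching m"
  shows "branching (Suc m)"
  unfolding branching_def diff_Suc_1
proof (intro allI impI)
  fix \<sigma> w assume \<sigma>: "valid_seq \<sigma> m" "colored \<sigma>" and w: "joint_eigenvector m \<sigma> w"
  obtain k where k: "m = Suc k" using m by (cases m) auto
  have mn: "m \<in> {1..<n}" using m by auto
  obtain C p where Cp: "\<sigma> m = (C, p)" by (cases "\<sigma> m")
  define p' where "p' = snd (\<sigma> (Suc m))"
  have "snd (\<sigma> m) \<in> P" "snd (\<sigma> (Suc m)) \<in> P" using \<sigma>(2) m by (auto simp: colored_def)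
  then have pP: "p \<in> P" "p' \<in> P" using Cp by (auto simp: p'_def)
  have vk: "valid_seq \<sigma> k" and Ca: "C \<in> addable \<sigma> k p"
    using \<sigma>(1) Cp by (auto simp: k valid_seq_Suc)
  have Xw: "jm i w = (v powi fst (\<sigma> i)) *s w" if "i \<in> {1..m}" for i
    using w that by (auto simp: joint_eigenvector_def)
  have tw: "t i w = \<chi> (snd (\<sigma> i)) *s w" if "i \<in> {1..n}" for i
    using w that by (auto simp: joint_eigenvector_def)
  have inj: "inj_on (\<lambda>x::int. v powi x) S" for S using inj_powi by (rule inj_on_subset) simp
  have cmp: "U (u x) = \<gamma> *s u x" if x: "x \<in> S" and S: "finite S" and i: "i \<in> {m, Suc m}"
      and u: "\<forall>x\<in>S. jm i (u x) = (v powi x) *s u x" and Uw: "U (\<Sum>x\<in>S. u x) = \<gamma> *s (\<Sum>x\<in>S. u x)"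
      and U: "U \<in> jm ` {1..n} \<union> t ` {1..n}" for U \<gamma> x u S i
  proof -
    have i: "i \<in> {1..n}" using i m by auto
    have XU: "jm i (U y) = U (jm i y)" for y
    proof (cases "U \<in> jm ` {1..n}")
      case True then show ?thesis using jm_jm[OF i] by blast
    next
      case False
      then obtain j where "j \<in> {1..n}" "U = t j" using U by auto
      then show ?thesis using t_jm[of j i y] i by simp
    qed
    have Ul: "U (x + y) = U x + U y" "U (c *s x) = c *s U x" for x y c
      using U by (auto simp: jm_add jm_scale t_add t_scale)
    show ?thesis
      by (rule eigenvector_component[OF jm_add jm_scale Ul XU S inj _ Uw x]) (use u in blast)
  qed
  show "decomposes (jm (Suc m)) (\<lambda>x. v powi x) (addable \<sigma> m (snd (\<sigma> (Suc m)))) w"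
  proof (cases "p = p'")
    case False
    \<comment> \<open>Only the components of \<open>\<sigma>'\<close> at \<open>m\<close> and \<open>m + 1\<close> matter, hence the arbitrary contents \<open>0\<close>.\<close>
    define \<sigma>' where "\<sigma>' = \<sigma>(m := (0, p'), Suc m := (0, p))"
    have tm: "t m w = \<chi> p *s w" "t (Suc m) w = \<chi> p' *s w" using tw m Cp by (auto simp: p'_def)
    have "joint_eigenvector k \<sigma>' (g m w)"
      unfolding joint_eigenvector_def
    proof (intro conjI ballI)
      fix i assume "i \<in> {1..k}"
      then show "jm i (g m w) = (v powi fst (\<sigma>' i)) *s g m w"
        using g_jm_other[OF mn, of i w] Xw[of i] m by (auto simp: \<sigma>'_def k op_linear)
    next
      fix i assume i: "i \<in> {1..n}"
      show "t i (g m w) = \<chi> (snd (\<sigma>' i)) *s g m w"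
        using g_t_other[OF mn i, of w] tw[OF i] t_g_swap[OF mn] tm
        by (cases "i = m"; cases "i = Suc m") (auto simp: \<sigma>'_def op_linear)
    qed
    moreover have "colored \<sigma>'" using \<sigma>(2) pP by (auto simp: colored_def \<sigma>'_def)
    moreover have "valid_seq \<sigma>' k" using vk valid_seq_cong[of k \<sigma>' \<sigma>] by (auto simp: \<sigma>'_def k)
    moreover have "snd (\<sigma>' m) = p'" by (simp add: \<sigma>'_def)
    ultimately have "decomposes (jm m) (\<lambda>x. v powi x) (addable \<sigma>' k p') (g m w)"
      using br unfolding branching_def by (auto simp: k)
    moreover have A: "addable \<sigma>' k p' = addable \<sigma> m p'"
      using addable_cong[of k \<sigma>' \<sigma>] addable_other_component[of \<sigma> k p'] False Cp by (auto simp: \<sigma>'_def k)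
    ultimately obtain u where u: "g m w = (\<Sum>x\<in>addable \<sigma> m p'. u x)"
      "\<forall>x\<in>addable \<sigma> m p'. jm m (u x) = (v powi x) *s u x" unfolding decomposes_def by auto
    have "jm (Suc m) (g m (u x)) = (v powi x) *s g m (u x)" if x: "x \<in> addable \<sigma> m p'" for x
    proof -
      have c: "t i (u x) = \<gamma> *s u x" if "i \<in> {1..n}" "t i (g m w) = \<gamma> *s g m w" for i \<gamma>
        using that by (intro cmp[OF x finite_addable _ u(2)]) (auto simp flip: u(1))
      have "t m (g m w) = \<chi> p' *s g m w" "t (Suc m) (g m w) = \<chi> p *s g m w"
        unfolding t_g_swap[OF mn] tm by (simp_all only: g_scale)
      then have "t m (u x) = \<chi> p' *s u x" "t (Suc m) (u x) = \<chi> p *s u x"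
        using c[of m] c[of "Suc m"] m by simp_all
      from jm_g_different(1)[OF mn pP(2,1) _ this] False show ?thesis
        using u(2) x by (simp add: g_scale)
    qed
    then have "decomposes (jm (Suc m)) (\<lambda>x. v powi x) (addable \<sigma> m p') (g m (g m w))"
      unfolding decomposes_def u(1)
      by (intro exI[of _ "\<lambda>x. g m (u x)"]) (auto simp: op_sum[of "g m", OF g_add g_zero])
    from decomposes_scale[OF this jm_scale, of "inverse v"] show ?thesis
      using g_g_different[OF mn pP False tm] v_nonzero by (simp add: p'_def)
  next
    case True
    have s: "same_char m (\<chi> p) w" using same_charI[OF w mn] Cp True by (auto simp: p'_def)
    let ?A = "addable \<sigma> k p" and ?\<mu> = "\<lambda>x::int. v powi x" and ?y = "jm (Suc m)"
    let ?B = "insert (C - 1) (insert (C + 1) ?A)"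
    have x: "jm m w = ?\<mu> C *s w" using Xw[of m] m Cp by simp
    have "joint_eigenvector k \<sigma> (intertwiner m w)"
      unfolding joint_eigenvector_def
    proof (intro conjI ballI)
      fix i assume "i \<in> {1..k}"
      then show "jm i (intertwiner m w) = (v powi fst (\<sigma> i)) *s intertwiner m w"
        using jm_intertwiner_other[OF mn, of i w] Xw[of i] m by (auto simp: k intertwiner_linear)
    next
      fix i assume i: "i \<in> {1..n}"
      show "t i (intertwiner m w) = \<chi> (snd (\<sigma> i)) *s intertwiner m w"
        using t_intertwiner_other[OF mn i, of w] tw[OF i] same_char_intertwiner[OF mn s] Cp True
        by (cases "i = m"; cases "i = Suc m") (auto simp: p'_def same_char_def intertwiner_linear)
    qed
    then have "decomposes (jm m) ?\<mu> ?A (intertwiner m w)"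
      using br \<sigma>(2) vk Cp unfolding branching_def by (auto simp: k)
    then obtain u where u: "intertwiner m w = (\<Sum>x\<in>?A. u x)" "\<forall>x\<in>?A. jm m (u x) = ?\<mu> x *s u x"
      unfolding decomposes_def by blast
    have "?y (intertwiner m (u x)) = ?\<mu> x *s intertwiner m (u x)" if x': "x \<in> ?A" for x
    proof -
      have "t i (u x) = \<chi> p *s u x" if "i \<in> {m, Suc m}" for i
        using that m same_char_intertwiner[OF mn s]
        by (intro cmp[OF x' finite_addable _ u(2)]) (auto simp: same_char_def simp flip: u(1))
      then have "same_char m (\<chi> p) (u x)" by (simp add: same_char_def)
      from jm_Suc_intertwiner[OF mn this] show ?thesis
        using u(2) x' by (simp add: intertwiner_linear)
    qed
    then have "decomposes ?y ?\<mu> ?A (intertwiner m (intertwiner m w))"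
      unfolding decomposes_def u(1) by (intro exI[of _ "\<lambda>x. intertwiner m (u x)"])
        (auto simp: op_sum[of "intertwiner m", OF intertwiner_linear(1,3)])
    from decomposes_scale[OF this jm_scale, of "- 1"]
    have "decomposes ?y ?\<mu> ?A (?y (v *s ?y w - ?\<mu> C *s w) - ?\<mu> (C + 1) *s (v *s ?y w - ?\<mu> C *s w))"
      unfolding intertwiner_square[OF mn s x] by (simp add: v_powi_succ)
    then have d1: "decomposes ?y ?\<mu> (insert (C + 1) ?A) (v *s ?y w - ?\<mu> C *s w)"
      by (rule decomposes_insert[OF finite_addable _ inj jm_add jm_scale, rotated])
        (use Ca in \<open>auto simp: addable_def\<close>)
    have "inverse v *s (v *s ?y w - ?\<mu> C *s w) = ?y w - ?\<mu> (C - 1) *s w"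
      using v_nonzero by (simp add: scale_right_diff_distrib flip: v_powi_succ(2)[of C] mult.assoc)
    with decomposes_scale[OF d1 jm_scale, of "inverse v"]
    have d2: "decomposes ?y ?\<mu> (insert (C + 1) ?A) (?y w - ?\<mu> (C - 1) *s w)" by simp
    have "finite (insert (C + 1) ?A)" "C - 1 \<notin> insert (C + 1) ?A"
      using Ca finite_addable by (auto simp: addable_def)
    then have "decomposes ?y ?\<mu> ?B w"
      by (rule decomposes_insert[OF _ _ inj jm_add jm_scale d2])
    then obtain z where z: "w = (\<Sum>x\<in>?B. z x)" "\<forall>x\<in>?B. ?y (z x) = ?\<mu> x *s z x"
      unfolding decomposes_def by blast
    have zj: "joint_eigenvector (Suc m) (\<sigma>(Suc m := (x, p))) (z x)" if xB: "x \<in> ?B" for x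
    proof -
      have c: "U (z x) = \<gamma> *s z x" if "U \<in> jm ` {1..n} \<union> t ` {1..n}" "U w = \<gamma> *s w" for U \<gamma>
        using that finite_addable by (intro cmp[OF xB _ _ z(2)]) (auto simp flip: z(1))
      show ?thesis unfolding joint_eigenvector_def
      proof (intro conjI ballI)
        fix i assume "i \<in> {1..Suc m}"
        then show "jm i (z x) = (v powi fst ((\<sigma>(Suc m := (x, p))) i)) *s z x"
          using c[of "jm i"] Xw[of i] z(2) xB m by (cases "i = Suc m") auto
      next
        fix i assume "i \<in> {1..n}"
        then show "t i (z x) = \<chi> (snd ((\<sigma>(Suc m := (x, p))) i)) *s z x"
          using c[of "t i"] tw[of i] True by (cases "i = Suc m") (auto simp: p'_def)
      qed
    qed
    have ss: "semisimple i" if "i \<in> {1..m}" for i using semisimple_if_spanning[OF sp that] .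
    have z0: "z x = 0" if xB: "x \<in> ?B" and na: "x \<notin> addable \<sigma> m p" for x
    proof (cases "x = C")
      case True
      have "jm m (z x) = ?\<mu> C *s z x" "?y (z x) = ?\<mu> C *s z x"
        using zj[OF xB] True m Cp by (simp_all add: joint_eigenvector_def)
      moreover have "same_char m (\<chi> p) (z x)"
        using same_charI[OF zj[OF xB] mn] Cp by simp
      moreover have "jm m w' = c *s w'" if "jm m (jm m w' - c *s w') = c *s (jm m w' - c *s w')" for c w'
      proof -
        have "semisimple m" using ss m by simp
        then show ?thesis using that unfolding semisimple_def by blast
      qed
      moreover have "?\<mu> C \<noteq> 0" using v_nonzero by simp
      ultimately show ?thesis by (intro equal_eigenvalues[OF mn])
    next
      case False
      with na have "x \<notin> ?A" using addable_still_addable[of x \<sigma> k p C] Ca Cp by (auto simp: k)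
      then have "\<bar>x - C\<bar> = 1" using xB by auto
      then show ?thesis
      proof (intro not_addable_not_eigenvalue[OF _ mn _ _ _ _ zj[OF xB] _ ss])
        let ?\<sigma> = "\<sigma>(Suc m := (x, p))"
        show "valid_seq ?\<sigma> m" using \<sigma>(1) valid_seq_cong[of m ?\<sigma> \<sigma>] by auto
        show "x \<notin> addable ?\<sigma> m p" using na addable_cong[of m ?\<sigma> \<sigma>] by auto
        show "colored ?\<sigma>" using \<sigma>(2) pP by (auto simp: colored_def)
      qed (use Cp in auto)
    qed
    let ?z = "\<lambda>x. if x \<in> ?B then z x else 0"
    have "w = (\<Sum>x\<in>addable \<sigma> m p. ?z x)"
    proof -
      have "w = (\<Sum>x\<in>?B \<union> addable \<sigma> m p. ?z x)"
        unfolding z(1) using finite_addable by (intro sum.mono_neutral_cong_left) auto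
      also have "\<dots> = (\<Sum>x\<in>addable \<sigma> m p. ?z x)"
        using finite_addable z0 by (intro sum.mono_neutral_right) auto
      finally show ?thesis .
    qed
    then show ?thesis
      unfolding decomposes_def using z(2) True
      by (intro exI[of _ ?z]) (auto simp: p'_def jm_zero)
  qed
qed

theorem span_eigenvectors: "span (eigenvectors n) = UNIV"
proof -
  have "span (eigenvectors m) = UNIV \<and> (1 \<le> m \<longrightarrow> branching m)" if "m \<le> n" for m
    using that
  proof (induction m)
    case 0
    have "{w. \<exists>\<pi>. \<forall>a\<in>{1..n}. \<pi> a \<in> P \<and> t a w = \<chi> (\<pi> a) *s w} \<subseteq> eigenvectors 0"
    proof
      fix w assume "w \<in> {w. \<exists>\<pi>. \<forall>a\<in>{1..n}. \<pi> a \<in> P \<and> t a w = \<chi> (\<pi> a) *s w}"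
      then obtain \<pi> where "\<forall>a\<in>{1..n}. \<pi> a \<in> P \<and> t a w = \<chi> (\<pi> a) *s w" by blast
      then show "w \<in> eigenvectors 0" unfolding eigenvectors_def
        by (auto simp: colored_def joint_eigenvector_def intro!: exI[of _ "\<lambda>a. (0, \<pi> a)"])
    qed
    from span_mono[OF this] t_diagonalizable show ?case by auto
  next
    case (Suc m)
    have "branching (Suc m)"
    proof (cases "m = 0")
      case True then show ?thesis using branching_1 by simp
    next
      case False then show ?thesis using branching_Suc[of m] Suc by simp
    qed
    then show ?case using spanning_Suc[of m] Suc by simp
  qed
  then show ?thesis by simp
qed

end

section \<open>Standard multitableaux and content sequences\<close>

text \<open>
  The diagrams of multipartitions are the finite order ideals.
\<close>

definition order_ideal :: "(nat \<times> nat \<times> nat) set \<Rightarrow> bool" where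
  "order_ideal D \<longleftrightarrow> (\<forall>r c p. (r, c, p) \<in> D \<longrightarrow>
     1 \<le> r \<and> 1 \<le> c \<and> (1 < r \<longrightarrow> (r - 1, c, p) \<in> D) \<and> (1 < c \<longrightarrow> (r, c - 1, p) \<in> D))"

definition tab_seq :: "multitableau \<Rightarrow> content_seq" where
  "tab_seq s i = (case node_of s i of (r, c, p) \<Rightarrow> (int c - int r, p))"

lemma order_idealD:
  assumes "order_ideal D" "(r, c, p) \<in> D"
  shows "1 \<le> r" "1 \<le> c" "1 < r \<Longrightarrow> (r - 1, c, p) \<in> D" "1 < c \<Longrightarrow> (r, c - 1, p) \<in> D"
  using assms unfolding order_ideal_def by blast+

lemma order_ideal_diagonal:
  assumes "order_ideal D" "1 \<le> r" "1 \<le> c" "(r + k, c + k, p) \<in> D"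
  shows "(r, c, p) \<in> D"
  using assms(4)
proof (induction k)
  case (Suc k)
  have "(r + Suc k - 1, c + Suc k, p) \<in> D" using order_idealD(3)[OF assms(1) Suc.prems] assms(2) by auto
  then have "(r + k, c + Suc k - 1, p) \<in> D" using order_idealD(4)[OF assms(1)] assms(3) by fastforce
  then show ?case using Suc.IH by simp
qed simp

lemma tab_content_seq:
  "tab_content n q \<xi> s a = (if a \<le> n then q powi fst (tab_seq s a) else \<xi> ^ snd (tab_seq s (a - n)))"
  by (simp add: tab_content_def tab_seq_def split: prod.split)

lemma order_ideal_diagram:
  assumes "\<forall>\<mu>\<in>set \<nu>. is_partition \<mu>"
  shows "order_ideal (diagram \<nu>)"
  unfolding order_ideal_def
proof (intro allI impI)
  fix r c p assume D: "(r, c, p) \<in> diagram \<nu>"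
  let ?\<mu> = "\<nu> ! (p - 1)"
  have b: "1 \<le> p" "p \<le> length \<nu>" "1 \<le> r" "r \<le> length ?\<mu>" "1 \<le> c" "c \<le> ?\<mu> ! (r - 1)"
    using D by (auto simp: diagram_def)
  have "is_partition ?\<mu>" using assms b by auto
  then have "?\<mu> ! (r - 1) \<le> ?\<mu> ! (r - 2)" if "1 < r"
    using b that unfolding is_partition_def by (intro sorted_wrt_nth_less[of "(\<ge>)", simplified]) auto
  then show "1 \<le> r \<and> 1 \<le> c \<and> (1 < r \<longrightarrow> (r - 1, c, p) \<in> diagram \<nu>) \<and> (1 < c \<longrightarrow> (r, c - 1, p) \<in> diagram \<nu>)"
    using b by (auto simp: diagram_def numeral_2_eq_2)
qed

context
  fixes d n :: nat and s :: multitableau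
  assumes s: "s \<in> Std d n"
begin

lemma Std_facts:
  "fst s \<in> multipartitions d n" "snd s \<in> extensional (diagram (fst s))"
  "bij_betw (snd s) (diagram (fst s)) {1..n}"
  "(r, c, p) \<in> diagram (fst s) \<Longrightarrow> (r, c + 1, p) \<in> diagram (fst s) \<Longrightarrow> snd s (r, c, p) < snd s (r, c + 1, p)"
  "(r, c, p) \<in> diagram (fst s) \<Longrightarrow> (r + 1, c, p) \<in> diagram (fst s) \<Longrightarrow> snd s (r, c, p) < snd s (r + 1, c, p)"
  using s unfolding Std_def by auto

lemma node_of_bij: "bij_betw (node_of s) {1..n} (diagram (fst s))"
  unfolding node_of_def using bij_betw_inv_into[OF Std_facts(3)] by (simp add: eta_contract_eq)

lemma node_of_mem: "i \<in> {1..n} \<Longrightarrow> node_of s i \<in> diagram (fst s)"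
  using node_of_bij by (rule bij_betwE[THEN bspec])

lemma entry_mem: "x \<in> diagram (fst s) \<Longrightarrow> snd s x \<in> {1..n}"
  using Std_facts(3) by (rule bij_betwE[THEN bspec])

lemma entry_node_of: "i \<in> {1..n} \<Longrightarrow> snd s (node_of s i) = i"
  unfolding node_of_def using Std_facts(3) by (simp add: bij_betw_def f_inv_into_f)

lemma node_of_entry: "x \<in> diagram (fst s) \<Longrightarrow> node_of s (snd s x) = x"
  unfolding node_of_def using Std_facts(3) by (simp add: bij_betw_def)

lemma node_of_new: "i \<in> {1..n} \<Longrightarrow> node_of s i \<notin> node_of s ` {1..<i}"
proof
  assume i: "i \<in> {1..n}" and "node_of s i \<in> node_of s ` {1..<i}"
  then obtain j where j: "j \<in> {1..<i}" "node_of s i = node_of s j" by blast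
  then have "j \<in> {1..n}" using i by auto
  then have "i = j" using entry_node_of[OF i] entry_node_of[of j] j(2) by metis
  then show False using j by simp
qed

lemma order_ideal_shape: "order_ideal (diagram (fst s))"
  using Std_facts(1) by (intro order_ideal_diagram) (auto simp: multipartitions_def)

lemma order_ideal_entries:
  assumes "m \<le> n"
  shows "order_ideal (node_of s ` {1..m})"
  unfolding order_ideal_def
proof (intro allI impI)
  fix r c p assume "(r, c, p) \<in> node_of s ` {1..m}"
  then obtain i where i: "i \<in> {1..m}" "node_of s i = (r, c, p)" by auto
  have D: "(r, c, p) \<in> diagram (fst s)" "snd s (r, c, p) = i"
    using i assms node_of_mem[of i] entry_node_of[of i] by auto
  have mem: "x \<in> node_of s ` {1..m}" if "x \<in> diagram (fst s)" "snd s x < i" for x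
    using that node_of_entry[OF that(1)] i Std_facts(3) by (intro image_eqI[of _ _ "snd s x"]) (auto simp: bij_betw_def)
  note o = order_idealD[OF order_ideal_shape D(1)]
  have "(r - 1, c, p) \<in> node_of s ` {1..m}" if "1 < r"
    using o(3)[OF that] Std_facts(5)[of "r - 1" c p] D that by (intro mem) auto
  moreover have "(r, c - 1, p) \<in> node_of s ` {1..m}" if "1 < c"
    using o(4)[OF that] Std_facts(4)[of r "c - 1" p] D that by (intro mem) auto
  ultimately show "1 \<le> r \<and> 1 \<le> c \<and> (1 < r \<longrightarrow> (r - 1, c, p) \<in> node_of s ` {1..m}) \<and>
      (1 < c \<longrightarrow> (r, c - 1, p) \<in> node_of s ` {1..m})" using o(1,2) by blast
qed

lemma component_range: "i \<in> {1..n} \<Longrightarrow> snd (tab_seq s i) \<in> {1..d}"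
proof -
  assume "i \<in> {1..n}"
  then have "node_of s i \<in> diagram (fst s)" using node_of_bij by (auto simp: bij_betw_def)
  then show ?thesis using Std_facts(1) by (auto simp: tab_seq_def diagram_def multipartitions_def)
qed

lemma node_of_range: "i \<in> {1..n} \<Longrightarrow> node_of s i \<in> {1..n} \<times> {1..n} \<times> {1..d}"
proof -
  assume i: "i \<in> {1..n}"
  obtain r c p where x: "node_of s i = (r, c, p)" by (cases "node_of s i")
  let ?D = "diagram (fst s)"
  have D: "(r, c, p) \<in> ?D" using node_of_mem[OF i] x by simp
  have fin: "finite ?D" "card ?D = n"
    using bij_betw_finite[OF node_of_bij] bij_betw_same_card[OF node_of_bij] by auto
  have "(r - k, c, p) \<in> ?D" if "k < r" for k using that
  proof (induction k)
    case (Suc k) then show ?case using order_idealD(3)[OF order_ideal_shape, of "r - k" c p] by auto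
  qed (use D in simp)
  then have "(\<lambda>k. (r - k, c, p)) ` {..<r} \<subseteq> ?D" by auto
  moreover have "inj_on (\<lambda>k. (r - k, c, p)) {..<r}" by (auto simp: inj_on_def)
  ultimately have "r \<le> n" using card_mono[OF fin(1)] fin(2) by (metis card_image card_lessThan)
  moreover have "(r, c - k, p) \<in> ?D" if "k < c" for k using that
  proof (induction k)
    case (Suc k) then show ?case using order_idealD(4)[OF order_ideal_shape, of r "c - k" p] by auto
  qed (use D in simp)
  then have "(\<lambda>k. (r, c - k, p)) ` {..<c} \<subseteq> ?D" by auto
  moreover have "inj_on (\<lambda>k. (r, c - k, p)) {..<c}" by (auto simp: inj_on_def)
  ultimately have "c \<le> n" using card_mono[OF fin(1)] fin(2) by (metis card_image card_lessThan)
  with \<open>r \<le> n\<close> show ?thesis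
    using x order_idealD(1,2)[OF order_ideal_shape D] component_range[OF i] by (simp add: tab_seq_def)
qed

end

lemma diagram_eq_imp_eq:
  assumes "\<nu> \<in> multipartitions d n" "\<nu>' \<in> multipartitions d n" "diagram \<nu> = diagram \<nu>'"
  shows "\<nu> = \<nu>'"
proof (rule nth_equalityI)
  have len: "length \<nu> = d" "length \<nu>' = d" using assms by (auto simp: multipartitions_def)
  then show "length \<nu> = length \<nu>'" by simp
  fix i assume i: "i < length \<nu>"
  have P: "is_partition (\<nu> ! i)" "is_partition (\<nu>' ! i)"
    using assms i len by (auto simp: multipartitions_def)
  have mem: "c \<in> {1..\<nu> ! i ! j} \<and> j < length (\<nu> ! i) \<longleftrightarrow> c \<in> {1..\<nu>' ! i ! j} \<and> j < length (\<nu>' ! i)" for j c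
  proof -
    have "(Suc j, c, Suc i) \<in> diagram \<nu> \<longleftrightarrow> (Suc j, c, Suc i) \<in> diagram \<nu>'" using assms(3) by simp
    then show ?thesis using i len by (auto simp: diagram_def)
  qed
  have pos: "1 \<le> \<mu> ! j" if "is_partition \<mu>" "j < length \<mu>" for \<mu> j
    using that unfolding is_partition_def by (metis less_one not_less nth_mem)
  have l: "j < length (\<nu> ! i) \<longleftrightarrow> j < length (\<nu>' ! i)" for j
    using mem[of 1 j] pos[OF P(1), of j] pos[OF P(2), of j] by auto
  show "\<nu> ! i = \<nu>' ! i"
  proof (rule nth_equalityI)
    show "length (\<nu> ! i) = length (\<nu>' ! i)" using l by (metis linorder_neqE_nat less_irrefl)
    fix j assume j: "j < length (\<nu> ! i)"
    have "\<nu> ! i ! j \<le> \<nu>' ! i ! j" using mem[of "\<nu> ! i ! j" j] pos[OF P(1) j] j by auto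
    moreover have "\<nu>' ! i ! j \<le> \<nu> ! i ! j" using mem[of "\<nu>' ! i ! j" j] pos[OF P(2)] j l by auto
    ultimately show "\<nu> ! i ! j = \<nu>' ! i ! j" by simp
  qed
qed

lemma Std_eqI:
  assumes s: "s \<in> Std d n" and t: "t \<in> Std d n" and eq: "\<And>i. i \<in> {1..n} \<Longrightarrow> node_of s i = node_of t i"
  shows "s = t"
proof -
  have "node_of s ` {1..n} = node_of t ` {1..n}" using eq by (intro image_cong) auto
  then have D: "diagram (fst s) = diagram (fst t)"
    using node_of_bij[OF s] node_of_bij[OF t] by (simp add: bij_betw_def)
  have "snd s x = snd t x" for x
  proof (cases "x \<in> diagram (fst s)")
    case True
    then obtain i where i: "i \<in> {1..n}" "x = node_of s i"
      using entry_mem[OF s] node_of_entry[OF s] by metis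
    then show ?thesis using entry_node_of[OF s i(1)] entry_node_of[OF t i(1)] eq by simp
  next
    case False
    then have "x \<notin> diagram (fst t)" using D by simp
    with False show ?thesis
      using extensional_arb[OF Std_facts(2)[OF s]] extensional_arb[OF Std_facts(2)[OF t]] by simp
  qed
  then show ?thesis
    using diagram_eq_imp_eq[OF Std_facts(1)[OF s] Std_facts(1)[OF t] D] by (simp add: prod_eq_iff fun_eq_iff)
qed

lemma finite_Std: "finite (Std d n)"
proof (rule inj_on_finite)
  let ?f = "\<lambda>s. restrict (node_of s) {1..n}"
  show "inj_on ?f (Std d n)"
  proof (rule inj_onI)
    fix s t assume st: "s \<in> Std d n" "t \<in> Std d n" "?f s = ?f t"
    then show "s = t" by (intro Std_eqI[OF st(1,2)]) (metis restrict_apply')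
  qed
  show "?f ` Std d n \<subseteq> {1..n} \<rightarrow>\<^sub>E {1..n} \<times> {1..n} \<times> {1..d}"
    using node_of_range by (auto simp: PiE_def Pi_def extensional_def)
  show "finite ({1..n} \<rightarrow>\<^sub>E {1..n} \<times> {1..n} \<times> {1..d})" by (intro finite_PiE) auto
qed

text \<open>
  The boxes on a diagonal are filled from the corner outwards, so the content and the component of
  an entry determine its node once the smaller entries are placed.
\<close>

lemma tab_seq_inj:
  assumes s: "s \<in> Std d n" and t: "t \<in> Std d n" and eq: "\<And>i. i \<in> {1..n} \<Longrightarrow> tab_seq s i = tab_seq t i"
  shows "s = t"
proof (rule Std_eqI[OF s t])
  fix i assume "i \<in> {1..n}"
  then show "node_of s i = node_of t i"
  proof (induction i rule: less_induct)
    case (less i)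
    let ?D = "node_of s ` {1..<i}"
    have "node_of s ` {1..<i} = node_of t ` {1..<i}" using less by (intro image_cong) auto
    have i: "{1..i} = insert i {1..<i}" using less.prems by auto
    have os: "order_ideal (insert (node_of s i) ?D)"
      using order_ideal_entries[OF s, of i] less.prems unfolding i image_insert by simp
    have ot: "order_ideal (insert (node_of t i) ?D)"
      using order_ideal_entries[OF t, of i] less.prems unfolding i image_insert \<open>node_of s ` {1..<i} = _\<close> by simp
    have ns: "node_of s i \<notin> ?D" by (rule node_of_new[OF s less.prems])
    have nt: "node_of t i \<notin> ?D"
      unfolding \<open>node_of s ` {1..<i} = _\<close>
      by (rule node_of_new[OF t less.prems])
    obtain r c p r' c' where x: "node_of s i = (r, c, p)" "node_of t i = (r', c', p)"
      "int c - int r = int c' - int r'"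
      using eq[OF less.prems] by (cases "node_of s i"; cases "node_of t i") (auto simp: tab_seq_def)
    have b: "1 \<le> r" "1 \<le> c" "1 \<le> r'" "1 \<le> c'"
      using order_idealD(1,2)[OF os, of r c p] order_idealD(1,2)[OF ot, of r' c' p] x by simp_all
    show ?case
    proof (cases "r \<le> r'")
      case True
      then have "(r', c', p) = (r + (r' - r), c + (r' - r), p)" using x(3) by auto
      then have "(r, c, p) \<in> insert (node_of t i) ?D"
        using order_ideal_diagonal[OF ot b(1,2), of "r' - r" p] x by simp
      then show ?thesis using ns x by auto
    next
      case False
      then have "(r, c, p) = (r' + (r - r'), c' + (r - r'), p)" using x(3) by auto
      then have "(r', c', p) \<in> insert (node_of s i) ?D"
        using order_ideal_diagonal[OF os b(3,4), of "r - r'" p] x by simp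
      then show ?thesis using nt x by auto
    qed
  qed
qed

subsection \<open>The tableau of a content sequence\<close>

lemma initial_segment:
  assumes "finite A" "\<And>k. k \<in> A \<Longrightarrow> 1 \<le> k" "\<And>k. k \<in> A \<Longrightarrow> 1 < k \<Longrightarrow> k - 1 \<in> A"
  shows "A = {1..card A}"
proof (cases "A = {}")
  case False
  have "Max A - k \<in> A" if "k < Max A" for k using that
  proof (induction k)
    case (Suc k) then show ?case using assms(3)[of "Max A - k"] by auto
  qed (use False assms(1) in simp)
  then have "k \<in> A" if "1 \<le> k" "k \<le> Max A" for k
    using that \<open>\<And>k. k < Max A \<Longrightarrow> Max A - k \<in> A\<close>[of "Max A - k"] by simp
  note in_A = this
  define M where "M = Max A"
  have "A = {1..M}"
  proof (intro equalityI subsetI)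
    fix k assume "k \<in> A"
    then show "k \<in> {1..M}" unfolding M_def atLeastAtMost_iff by (intro conjI assms(2) Max_ge[OF assms(1)])
  next
    fix k assume "k \<in> {1..M}"
    then have "1 \<le> k" "k \<le> Max A" by (simp_all add: M_def)
    then show "k \<in> A" by (rule in_A)
  qed
  then show ?thesis by simp
qed simp

lemma card_diagram: "card (diagram \<nu>) = sum_list (map sum_list \<nu>)"
proof -
  let ?S = "SIGMA p:{1..length \<nu>}. SIGMA r:{1..length (\<nu> ! (p - 1))}. {1..\<nu> ! (p - 1) ! (r - 1)}"
  have "diagram \<nu> = (\<lambda>(p, r, c). (r, c, p)) ` ?S" by (force simp: diagram_def)
  moreover have "inj_on (\<lambda>(p, r, c). (r, c, p)) ?S" by (auto simp: inj_on_def)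
  ultimately have "card (diagram \<nu>) = card ?S" by (simp add: card_image)
  also have "\<dots> = (\<Sum>p\<in>{1..length \<nu>}. \<Sum>r\<in>{1..length (\<nu> ! (p - 1))}. \<nu> ! (p - 1) ! (r - 1))"
    by simp
  also have "\<dots> = sum_list (map sum_list \<nu>)"
  proof -
    have s: "(\<Sum>r\<in>{1..length \<mu>}. f (\<mu> ! (r - 1))) = sum_list (map f \<mu>)" for \<mu> :: "'b list" and f :: "'b \<Rightarrow> nat"
    proof -
      have "(\<Sum>r\<in>{1..length \<mu>}. f (\<mu> ! (r - 1))) = (\<Sum>r\<in>{0..<length \<mu>}. f (\<mu> ! r))"
        by (rule sum.reindex_bij_witness[of _ Suc "\<lambda>r. r - 1"]) auto
      then show ?thesis by (simp add: sum_list_sum_nth)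
    qed
    have "(\<Sum>r\<in>{1..length \<mu>}. \<mu> ! (r - 1)) = sum_list \<mu>" for \<mu> :: "nat list"
      using s[of "\<lambda>x. x" \<mu>] by simp
    then show ?thesis using s[of sum_list \<nu>] by simp
  qed
  finally show ?thesis .
qed

lemma order_ideal_is_diagram:
  assumes o: "order_ideal D" and fin: "finite D" and comp: "\<And>r c p. (r, c, p) \<in> D \<Longrightarrow> p \<in> {1..d}"
  shows "\<exists>\<nu>\<in>multipartitions d (card D). diagram \<nu> = D"
proof -
  define row where "row p r = card {c. (r, c, p) \<in> D}" for p r
  define len where "len p = card {r. (r, 1, p) \<in> D}" for p
  have finr: "finite {c. (r, c, p) \<in> D}" for r p
    by (rule finite_subset[of _ "(\<lambda>(r, c, p). c) ` D"]) (use fin in force)+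
  have finc: "finite {r. (r, c, p) \<in> D}" for c p
    by (rule finite_subset[of _ "(\<lambda>(r, c, p). r) ` D"]) (use fin in force)+
  have row: "{c. (r, c, p) \<in> D} = {1..row p r}" for r p
    unfolding row_def using finr order_idealD[OF o] by (intro initial_segment) auto
  have len: "{r. (r, 1, p) \<in> D} = {1..len p}" for p
    unfolding len_def using finc order_idealD[OF o] by (intro initial_segment) auto
  have mem: "(r, c, p) \<in> D \<longleftrightarrow> c \<in> {1..row p r}" for r c p using row by blast
  have pos: "r \<in> {1..len p} \<longleftrightarrow> 1 \<le> row p r" for r p
  proof -
    have "r \<in> {1..len p} \<longleftrightarrow> (r, 1, p) \<in> D" using len[of p] by blast
    then show ?thesis using mem[of r 1 p] by simp
  qed
  have dec: "row p (Suc r) \<le> row p r" if "1 \<le> r" for p r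
  proof (cases "row p (Suc r) = 0")
    case False
    then have "(Suc r, row p (Suc r), p) \<in> D" using mem by simp
    then have "(r, row p (Suc r), p) \<in> D" using order_idealD(3)[OF o] that by fastforce
    then show ?thesis using mem by simp
  qed simp
  define \<nu> where "\<nu> = map (\<lambda>p. map (\<lambda>r. row (Suc p) (Suc r)) [0..<len (Suc p)]) [0..<d]"
  have part: "is_partition \<mu>" if "\<mu> \<in> set \<nu>" for \<mu>
  proof -
    obtain p where p: "\<mu> = map (\<lambda>r. row (Suc p) (Suc r)) [0..<len (Suc p)]" using \<open>\<mu> \<in> set \<nu>\<close> by (auto simp: \<nu>_def)
    have "row (Suc p) (Suc j) \<le> row (Suc p) (Suc i)" if "i \<le> j" for i j
      using that
    proof (induction j rule: dec_induct)
      case (step j)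
      have "row (Suc p) (Suc (Suc j)) \<le> row (Suc p) (Suc j)" by (rule dec) simp
      then show ?case using step by simp
    qed simp
    then have "sorted_wrt (\<ge>) \<mu>" by (auto simp: p sorted_wrt_iff_nth_less)
    moreover have "0 \<notin> set \<mu>"
    proof
      assume "0 \<in> set \<mu>"
      then obtain r where "r < len (Suc p)" "row (Suc p) (Suc r) = 0" by (auto simp: p)
      then show False using pos[of "Suc r" "Suc p"] by simp
    qed
    ultimately show ?thesis by (simp add: is_partition_def)
  qed
  have dia: "diagram \<nu> = D"
  proof -
    have "(r, c, p) \<in> diagram \<nu> \<longleftrightarrow> (r, c, p) \<in> D" for r c p
    proof (cases "p \<in> {1..d}")
      case True
      then have "\<nu> ! (p - 1) = map (\<lambda>r. row p (Suc r)) [0..<len p]" "length \<nu> = d" by (auto simp: \<nu>_def)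
      then have "(r, c, p) \<in> diagram \<nu> \<longleftrightarrow> r \<in> {1..len p} \<and> c \<in> {1..row p r}"
        using True by (auto simp: diagram_def)
      then have "(r, c, p) \<in> diagram \<nu> \<longleftrightarrow> 1 \<le> row p r \<and> c \<in> {1..row p r}" by (simp only: pos)
      then show ?thesis unfolding mem by auto
    next
      case False
      then show ?thesis using comp by (auto simp: diagram_def \<nu>_def)
    qed
    then show ?thesis by auto
  qed
  then have "sum_list (map sum_list \<nu>) = card D" using card_diagram[of \<nu>] by simp
  then have "\<nu> \<in> multipartitions d (card D)" using part by (simp add: multipartitions_def \<nu>_def)
  then show ?thesis using dia by blast
qed

definition occurrences :: "content_seq \<Rightarrow> nat \<Rightarrow> int \<Rightarrow> nat \<Rightarrow> nat" where
  "occurrences \<sigma> m x p = card {i \<in> {1..m}. \<sigma> i = (x, p)}"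

lemma profile_occurrences: "profile \<sigma> m p x = \<bar>x\<bar> + 2 * int (occurrences \<sigma> m x p)"
  by (simp add: profile_def occurrences_def)

lemma occurrences_Suc: "occurrences \<sigma> (Suc m) x p = occurrences \<sigma> m x p + (if \<sigma> (Suc m) = (x, p) then 1 else 0)"
  using profile_Suc[of \<sigma> m p x] by (auto simp: profile_occurrences split: if_splits)

text \<open>
  A box \<open>(r, c)\<close> is the one with number \<open>min r c\<close> on its diagonal. \<open>seq_diagram\<close> has as many boxes on
  each diagonal as the sequence demands, and \<open>seq_node \<sigma> i\<close> is the outermost box on the diagonal of
  \<open>\<sigma> i\<close> at time \<open>i\<close>.
\<close>

definition seq_diagram :: "content_seq \<Rightarrow> nat \<Rightarrow> (nat \<times> nat \<times> nat) set" where
  "seq_diagram \<sigma> m = {(r, c, p). 1 \<le> r \<and> 1 \<le> c \<and> min r c \<le> occurrences \<sigma> m (int c - int r) p}"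

definition seq_node :: "content_seq \<Rightarrow> nat \<Rightarrow> nat \<times> nat \<times> nat" where
  "seq_node \<sigma> i = (let (x, p) = \<sigma> i; k = occurrences \<sigma> i x p in (k + nat (- x), k + nat x, p))"

lemma seq_diagram_0: "seq_diagram \<sigma> 0 = {}"
  by (auto simp: seq_diagram_def occurrences_def)

lemma seq_diagram_Suc:
  "seq_diagram \<sigma> (Suc m) = insert (seq_node \<sigma> (Suc m)) (seq_diagram \<sigma> m)"
  "seq_node \<sigma> (Suc m) \<notin> seq_diagram \<sigma> m"
proof -
  obtain x p where s: "\<sigma> (Suc m) = (x, p)" by (cases "\<sigma> (Suc m)")
  show "seq_diagram \<sigma> (Suc m) = insert (seq_node \<sigma> (Suc m)) (seq_diagram \<sigma> m)"
    unfolding seq_diagram_def seq_node_def occurrences_Suc s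
    by (auto simp: Let_def min_def split: if_splits)
  show "seq_node \<sigma> (Suc m) \<notin> seq_diagram \<sigma> m"
    unfolding seq_diagram_def seq_node_def s by (auto simp: Let_def occurrences_Suc s min_def)
qed

text \<open>
  The slopes of the profile are \<open>1\<close> and \<open>-1\<close>, so the numbers of boxes on adjacent diagonals differ as
  little as a diagram requires.
\<close>

lemma order_ideal_seq_diagram:
  assumes "valid_seq \<sigma> m"
  shows "order_ideal (seq_diagram \<sigma> m)"
  unfolding order_ideal_def
proof (intro allI impI)
  fix r c p assume D: "(r, c, p) \<in> seq_diagram \<sigma> m"
  let ?x = "int c - int r" and ?o = "\<lambda>x. int (occurrences \<sigma> m x p)"
  have b: "1 \<le> r" "1 \<le> c" "min (int r) (int c) \<le> ?o ?x" using D by (auto simp: seq_diagram_def min_def split: if_splits)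
  have up: "\<bar>\<bar>?x + 1\<bar> + 2 * ?o (?x + 1) - (\<bar>?x\<bar> + 2 * ?o ?x)\<bar> = 1"
    using profile_step[OF assms, of p ?x] by (simp add: profile_occurrences)
  have left: "\<bar>\<bar>?x\<bar> + 2 * ?o ?x - (\<bar>?x - 1\<bar> + 2 * ?o (?x - 1))\<bar> = 1"
    using profile_step[OF assms, of p "?x - 1"] by (simp add: profile_occurrences)
  have "(r - 1, c, p) \<in> seq_diagram \<sigma> m" if r: "1 < r"
  proof -
    have e: "int c - int (r - 1) = ?x + 1" using r by simp
    have "int (min (r - 1) c) \<le> ?o (?x + 1)"
      using b up r by (auto simp: min_def abs_if split: if_splits)
    then show ?thesis using b r by (simp only: seq_diagram_def mem_Collect_eq prod.case e) auto
  qed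
  moreover have "(r, c - 1, p) \<in> seq_diagram \<sigma> m" if r: "1 < c"
  proof -
    have e: "int (c - 1) - int r = ?x - 1" using r by simp
    have "int (min r (c - 1)) \<le> ?o (?x - 1)"
      using b left r by (auto simp: min_def abs_if split: if_splits)
    then show ?thesis using b r by (simp only: seq_diagram_def mem_Collect_eq prod.case e) auto
  qed
  ultimately show "1 \<le> r \<and> 1 \<le> c \<and> (1 < r \<longrightarrow> (r - 1, c, p) \<in> seq_diagram \<sigma> m) \<and>
      (1 < c \<longrightarrow> (r, c - 1, p) \<in> seq_diagram \<sigma> m)" using b by blast
qed

lemma tableau_of_valid_seq:
  assumes v: "valid_seq \<sigma> n" and col: "\<And>i. i \<in> {1..n} \<Longrightarrow> snd (\<sigma> i) \<in> {1..d}"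
  shows "\<exists>t\<in>Std d n. \<forall>i\<in>{1..n}. tab_seq t i = \<sigma> i"
proof -
  let ?N = "seq_node \<sigma>" and ?D = "seq_diagram \<sigma>"
  have D: "?D m = ?N ` {1..m}" for m
  proof (induction m)
    case (Suc m)
    have "{1..Suc m} = insert (Suc m) {1..m}" by auto
    then show ?case using Suc seq_diagram_Suc(1) by simp
  qed (simp add: seq_diagram_0)
  have new: "?N i \<notin> ?N ` {1..<i}" if "1 \<le> i" for i
    using seq_diagram_Suc(2)[of \<sigma> "i - 1"] D[of "i - 1"] that by (simp add: atLeastLessThanSuc_atLeastAtMost[symmetric])
  have inj: "inj_on ?N {1..n}"
  proof (rule linorder_inj_onI)
    fix i j :: nat assume *: "i < j" "i \<in> {1..n}" "j \<in> {1..n}"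
    then have "?N i \<in> ?N ` {1..<j}" by simp
    moreover have "1 \<le> j" using * by simp
    ultimately show "?N i \<noteq> ?N j" using new[of j] by metis
  qed auto
  have cont: "(case ?N i of (r, c, p) \<Rightarrow> (int c - int r, p)) = \<sigma> i" for i
    by (cases "\<sigma> i") (auto simp: seq_node_def Let_def)
  have comp: "p \<in> {1..d}" if "(r, c, p) \<in> ?D n" for r c p
  proof -
    obtain i where "i \<in> {1..n}" "?N i = (r, c, p)" using \<open>(r, c, p) \<in> ?D n\<close> D by auto
    then show ?thesis using col[of i] cont[of i] by (metis prod.case snd_conv)
  qed
  have fin: "finite (?D n)" and card: "card (?D n) = n" using D card_image[OF inj] by auto
  have "\<exists>\<nu>\<in>multipartitions d (card (?D n)). diagram \<nu> = ?D n"
    by (rule order_ideal_is_diagram[OF order_ideal_seq_diagram[OF v] fin]) (rule comp)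
  then obtain \<nu> where \<nu>: "\<nu> \<in> multipartitions d n" "diagram \<nu> = ?D n"
    unfolding card by blast
  define \<tau> where "\<tau> = restrict (inv_into {1..n} ?N) (?D n)"
  have bij: "bij_betw ?N {1..n} (?D n)" using inj D by (simp add: bij_betw_def)
  have \<tau>N: "\<tau> (?N i) = i" if "i \<in> {1..n}" for i
    using that inj D by (simp add: \<tau>_def)
  have N\<tau>: "x \<in> ?D n \<Longrightarrow> ?N (\<tau> x) = x \<and> \<tau> x \<in> {1..n}" for x
    using D[of n] f_inv_into_f[of x ?N "{1..n}"] inv_into_into[of x ?N "{1..n}"] by (simp add: \<tau>_def)
  \<comment> \<open>At the time a box is added, the boxes to its left and above it are already there.\<close>
  have smaller: "\<tau> y < \<tau> x" if x: "x \<in> ?D n" and y: "y \<in> ?D (\<tau> x)" "y \<noteq> x" for x y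
  proof -
    obtain j where j: "j \<in> {1..\<tau> x}" "y = ?N j" using y D by auto
    have "j \<in> {1..n}" using j N\<tau>[OF x] by auto
    then have "\<tau> y = j" using \<tau>N j by simp
    moreover have "j \<noteq> \<tau> x" using y(2) j N\<tau>[OF x] by auto
    ultimately show ?thesis using j by simp
  qed
  have oi: "order_ideal (?D m)" if "m \<le> n" for m
    using v that by (intro order_ideal_seq_diagram) (auto simp: valid_seq_def)
  have at: "x \<in> ?D (\<tau> x)" if "x \<in> ?D n" for x
    using N\<tau>[OF that] D[of "\<tau> x"] by (metis atLeastAtMost_iff image_eqI order_refl)
  have "(\<nu>, \<tau>) \<in> Std d n"
    unfolding Std_def mem_Collect_eq prod.case
  proof (intro conjI allI impI)
    show "\<nu> \<in> multipartitions d n" "\<tau> \<in> extensional (diagram \<nu>)" using \<nu> by (auto simp: \<tau>_def)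
    have "bij_betw (inv_into {1..n} ?N) (?D n) {1..n}" by (rule bij_betw_inv_into[OF bij])
    then show "bij_betw \<tau> (diagram \<nu>) {1..n}" unfolding \<nu>(2) \<tau>_def by (rule bij_betw_restrict_eq[THEN iffD2])
  next
    fix r c p assume *: "(r, c, p) \<in> diagram \<nu> \<and> (r, c + 1, p) \<in> diagram \<nu>"
    then have x: "(r, c + 1, p) \<in> ?D n" and c: "1 \<le> c" using \<nu> by (auto simp: seq_diagram_def)
    have "(r, c + 1 - 1, p) \<in> ?D (\<tau> (r, c + 1, p))"
      using N\<tau>[OF x] c by (intro order_idealD(4)[OF oi at[OF x]]) auto
    then show "\<tau> (r, c, p) < \<tau> (r, c + 1, p)" by (intro smaller[OF x]) auto
  next
    fix r c p assume *: "(r, c, p) \<in> diagram \<nu> \<and> (r + 1, c, p) \<in> diagram \<nu>"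
    then have x: "(r + 1, c, p) \<in> ?D n" and c: "1 \<le> r" using \<nu> by (auto simp: seq_diagram_def)
    have "(r + 1 - 1, c, p) \<in> ?D (\<tau> (r + 1, c, p))"
      using N\<tau>[OF x] c by (intro order_idealD(3)[OF oi at[OF x]]) auto
    then show "\<tau> (r, c, p) < \<tau> (r + 1, c, p)" by (intro smaller[OF x]) auto
  qed
  moreover have "tab_seq (\<nu>, \<tau>) i = \<sigma> i" if i: "i \<in> {1..n}" for i
  proof -
    have "?N i \<in> ?D n" using D i by auto
    then have "node_of (\<nu>, \<tau>) (\<tau> (?N i)) = ?N i"
      by (intro node_of_entry[OF \<open>(\<nu>, \<tau>) \<in> Std d n\<close>, simplified]) (simp add: \<nu>)
    then show ?thesis using \<tau>N[OF i] cont[of i] by (simp add: tab_seq_def)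
  qed
  ultimately show ?thesis by blast
qed

section \<open>Free algebras over subrings of a field\<close>

text \<open>
  Coefficient rings are subrings of a field: the local ring and its field of fractions share one
  carrier type, and the representation below can be written with field operations.
\<close>

abbreviation sub_ring :: "'f::field set \<Rightarrow> 'f ring" where
  "sub_ring S \<equiv> fld\<lparr>carrier := S\<rparr>"

lemma sub_ring_UNIV: "sub_ring UNIV = fld"
  by (simp add: ring_of_type_algebra_def)

lemma fld_simps [simp]:
  "carrier (fld :: 'f::field ring) = UNIV" "\<zero>\<^bsub>fld :: 'f ring\<^esub> = 0" "\<one>\<^bsub>fld :: 'f ring\<^esub> = 1"
  "x \<oplus>\<^bsub>fld :: 'f ring\<^esub> y = x + y" "x \<otimes>\<^bsub>fld :: 'f ring\<^esub> y = x * y"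
  by (simp_all add: ring_of_type_algebra_def)

definition convolution :: "('g list \<Rightarrow> 'f::field) \<Rightarrow> ('g list \<Rightarrow> 'f) \<Rightarrow> 'g list \<Rightarrow> 'f" where
  "convolution f h w = (\<Sum>i\<le>length w. f (take i w) * h (drop i w))"

definition word_monom :: "'f::field \<Rightarrow> 'g list \<Rightarrow> 'g list \<Rightarrow> 'f" where
  "word_monom c w = (\<lambda>w'. if w' = w then c else 0)"

lemma convolution_add_left: "convolution (\<lambda>w. f w + f' w) h = (\<lambda>w. convolution f h w + convolution f' h w)"
  by (auto simp: convolution_def distrib_right sum.distrib)

lemma convolution_add_right: "convolution h (\<lambda>w. f w + f' w) = (\<lambda>w. convolution h f w + convolution h f' w)"
  by (auto simp: convolution_def distrib_left sum.distrib)

lemma convolution_const_left: "convolution (word_monom c []) f = (\<lambda>w. c * f w)"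
proof
  fix w
  have "convolution (word_monom c []) f w = (\<Sum>i\<in>{0}. word_monom c [] (take i w) * f (drop i w))"
    unfolding convolution_def by (rule sum.mono_neutral_right) (auto simp: word_monom_def)
  then show "convolution (word_monom c []) f w = c * f w" by (simp add: word_monom_def)
qed

lemma convolution_const_right: "convolution f (word_monom c []) = (\<lambda>w. f w * c)"
proof
  fix w
  have "convolution f (word_monom c []) w = (\<Sum>i\<in>{length w}. f (take i w) * word_monom c [] (drop i w))"
    unfolding convolution_def by (rule sum.mono_neutral_right) (auto simp: word_monom_def)
  then show "convolution f (word_monom c []) w = f w * c" by (simp add: word_monom_def)
qed

lemma convolution_gen:
  "convolution (word_monom 1 [x]) f w = (case w of [] \<Rightarrow> 0 | y # w' \<Rightarrow> if y = x then f w' else 0)"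
proof (cases w)
  case Nil then show ?thesis by (simp add: convolution_def word_monom_def)
next
  case (Cons y w')
  have "convolution (word_monom 1 [x]) f w = (\<Sum>i\<in>{1}. word_monom 1 [x] (take i w) * f (drop i w))"
    unfolding convolution_def
  proof (rule sum.mono_neutral_right)
    show "\<forall>i\<in>{..length w} - {1}. word_monom 1 [x] (take i w) * f (drop i w) = 0"
    proof
      fix i assume "i \<in> {..length w} - {1}"
      then have "length (take i w) \<noteq> length [x]" by (auto simp: min_def)
      then have "take i w \<noteq> [x]" by metis
      then show "word_monom 1 [x] (take i w) * f (drop i w) = 0" by (simp add: word_monom_def)
    qed
  qed (auto simp: Cons)
  then show ?thesis by (simp add: Cons word_monom_def)
qed

lemma word_monom_Cons: "word_monom c (x # w) = convolution (word_monom 1 [x]) (word_monom c w)"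
  by (rule ext) (simp add: convolution_gen word_monom_def[of c] split: list.split)

lemma convolution_assoc: "convolution (convolution f h) k = convolution f (convolution h k)"
proof
  fix w :: "'a list"
  let ?F = "\<lambda>i j _. f (take i w) * h (take j (drop i w)) * k (drop (i + j) w)"
  let ?n = "length w"
  have "convolution (convolution f h) k w =
      (\<Sum>i\<le>?n. \<Sum>j\<le>i. f (take j w) * h (drop j (take i w)) * k (drop i w))"
    unfolding convolution_def by (intro sum.cong refl) (auto simp: sum_distrib_right min_def intro!: sum.cong)
  also have "\<dots> = (\<Sum>i=0..?n. \<Sum>j=0..i. ?F j (i - j) (?n - i))"
    by (intro sum.cong) (auto simp: drop_take)
  also have "\<dots> = (\<Sum>j=0..?n. \<Sum>i=0..?n - j. ?F j i (?n - j - i))"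
    by (rule fps_mult_assoc_lemma)
  also have "\<dots> = convolution f (convolution h k) w"
    unfolding convolution_def
    by (intro sum.cong) (auto simp: sum_distrib_left mult.assoc add.commute atLeast0AtMost intro!: sum.cong)
  finally show "convolution (convolution f h) k w = convolution f (convolution h k) w" .
qed

locale subring_of_field =
  fixes S :: "'f::field set"
  assumes zero_mem: "0 \<in> S" and one_mem: "1 \<in> S"
    and add_mem: "\<lbrakk>x \<in> S; y \<in> S\<rbrakk> \<Longrightarrow> x + y \<in> S" and uminus_mem: "x \<in> S \<Longrightarrow> - x \<in> S"
    and mult_mem: "\<lbrakk>x \<in> S; y \<in> S\<rbrakk> \<Longrightarrow> x * y \<in> S"
begin

abbreviation "R \<equiv> sub_ring S"

lemma R_simps [simp]:
  "carrier R = S" "\<zero>\<^bsub>R\<^esub> = 0" "\<one>\<^bsub>R\<^esub> = 1" "x \<oplus>\<^bsub>R\<^esub> y = x + y" "x \<otimes>\<^bsub>R\<^esub> y = x * y"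
  by simp_all

lemma sum_mem: "(\<And>i. i \<in> A \<Longrightarrow> f i \<in> S) \<Longrightarrow> sum f A \<in> S"
  by (induction A rule: infinite_finite_induct) (auto simp: zero_mem add_mem)

lemma power_mem: "x \<in> S \<Longrightarrow> x ^ k \<in> S"
  by (induction k) (auto simp: one_mem mult_mem)

lemma diff_mem: "x \<in> S \<Longrightarrow> y \<in> S \<Longrightarrow> x - y \<in> S"
  using add_mem[of x "- y"] uminus_mem by simp

sublocale R: cring R
proof (rule cringI)
  show "abelian_group R"
    by (rule abelian_groupI) (auto simp: add_mem zero_mem algebra_simps intro!: bexI[OF _ uminus_mem])
  show "Group.comm_monoid R"
    by (rule Group.comm_monoidI) (auto simp: mult_mem one_mem algebra_simps)
qed (auto simp: algebra_simps)

lemma R_finsum: "finite A \<Longrightarrow> (\<And>i. i \<in> A \<Longrightarrow> f i \<in> S) \<Longrightarrow> finsum R f A = sum f A"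
  by (induction A rule: finite_induct) auto

lemma R_minus [simp]: "x \<in> S \<Longrightarrow> y \<in> S \<Longrightarrow> x \<ominus>\<^bsub>R\<^esub> y = x - y"
proof -
  assume "x \<in> S" "y \<in> S"
  then have "\<ominus>\<^bsub>R\<^esub> y = - y" by (intro R.minus_equality) (auto simp: uminus_mem)
  then show ?thesis by (simp add: a_minus_def)
qed

lemma R_inv: "x \<in> S \<Longrightarrow> inverse x \<in> S \<Longrightarrow> x \<noteq> 0 \<Longrightarrow> inv\<^bsub>R\<^esub> x = inverse x"
  by (rule R.comm_inv_char) auto

lemma R_of_nat: "[k] \<cdot>\<^bsub>R\<^esub> \<one>\<^bsub>R\<^esub> = of_nat k"
  by (induction k) (auto simp: R.add.nat_pow_Suc add.commute)

lemma of_nat_mem: "of_nat k \<in> S"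
  by (induction k) (auto simp: zero_mem one_mem add_mem)

abbreviation "FA A \<equiv> free_algebra R A"

lemma FA_carrier: "f \<in> carrier (FA A) \<longleftrightarrow> (\<forall>w. f w \<in> S) \<and> finite {w. f w \<noteq> 0} \<and> (\<forall>w. f w \<noteq> 0 \<longrightarrow> w \<in> lists A)"
  by (auto simp: free_algebra_def)

lemma FA_zero: "\<zero>\<^bsub>FA A\<^esub> = (\<lambda>w. 0)" by (simp add: free_algebra_def)
lemma FA_one: "\<one>\<^bsub>FA A\<^esub> = word_monom 1 []" by (auto simp: free_algebra_def word_monom_def)
lemma FA_add: "f \<oplus>\<^bsub>FA A\<^esub> h = (\<lambda>w. f w + h w)" by (simp add: free_algebra_def)
lemma FA_mult: "(\<And>w. f w \<in> S) \<Longrightarrow> (\<And>w. h w \<in> S) \<Longrightarrow> f \<otimes>\<^bsub>FA A\<^esub> h = convolution f h"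
proof -
  assume "\<And>w. f w \<in> S" "\<And>w. h w \<in> S"
  then have "finsum R (\<lambda>i. f (take i w) * h (drop i w)) {..length w} = convolution f h w" for w
    unfolding convolution_def by (intro R_finsum) (simp_all add: mult_mem)
  then show ?thesis by (simp add: free_algebra_def)
qed

lemma FA_mult': "f \<in> carrier (FA A) \<Longrightarrow> h \<in> carrier (FA A) \<Longrightarrow> f \<otimes>\<^bsub>FA A\<^esub> h = convolution f h"
  by (intro FA_mult) (auto simp: FA_carrier)

lemma const_word_monom: "fa_const R c = word_monom c []"
  by (auto simp: fa_const_def word_monom_def)

lemma gen_word_monom: "fa_gen R x = word_monom 1 [x]"
  by (auto simp: fa_gen_def word_monom_def)

lemma word_monom_carrier: "c \<in> S \<Longrightarrow> w \<in> lists A \<Longrightarrow> word_monom c w \<in> carrier (FA A)"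
proof -
  assume c: "c \<in> S" "w \<in> lists A"
  have "finite {w'. word_monom c w w' \<noteq> 0}"
    by (rule finite_subset[of _ "{w}"]) (auto simp: word_monom_def)
  then show ?thesis using c zero_mem by (auto simp: FA_carrier word_monom_def split: if_splits)
qed

lemma const_carrier: "c \<in> S \<Longrightarrow> fa_const R c \<in> carrier (FA A)"
  by (simp add: const_word_monom word_monom_carrier)

lemma gen_carrier: "x \<in> A \<Longrightarrow> fa_gen R x \<in> carrier (FA A)"
  by (simp add: gen_word_monom word_monom_carrier one_mem)

lemma convolution_carrier:
  assumes "f \<in> carrier (FA A)" "h \<in> carrier (FA A)"
  shows "convolution f h \<in> carrier (FA A)"
proof -
  let ?s = "\<lambda>f. {w. f w \<noteq> 0}"
  have nz: "\<exists>a b. w = a @ b \<and> f a \<noteq> 0 \<and> h b \<noteq> 0" if nz: "convolution f h w \<noteq> 0" for w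
  proof -
    obtain i where "f (take i w) * h (drop i w) \<noteq> 0"
      using nz unfolding convolution_def by (meson sum.neutral)
    then show ?thesis by (intro exI[of _ "take i w"] exI[of _ "drop i w"]) auto
  qed
  have "?s (convolution f h) \<subseteq> (\<lambda>(a, b). a @ b) ` (?s f \<times> ?s h)" using nz by force
  then have "finite (?s (convolution f h))" using assms by (auto simp: FA_carrier intro: finite_subset)
  moreover have "w \<in> lists A" if "convolution f h w \<noteq> 0" for w
    using nz[OF that] assms unfolding FA_carrier by (metis append_in_lists_conv)
  moreover have "convolution f h w \<in> S" for w
    using assms unfolding convolution_def by (intro sum_mem mult_mem) (auto simp: FA_carrier)
  ultimately show ?thesis by (auto simp: FA_carrier)
qed

lemma FA_add_carrier:
  assumes "f \<in> carrier (FA A)" "h \<in> carrier (FA A)"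
  shows "(\<lambda>w. f w + h w) \<in> carrier (FA A)"
proof -
  have "{w. f w + h w \<noteq> 0} \<subseteq> {w. f w \<noteq> 0} \<union> {w. h w \<noteq> 0}" by auto
  then have "finite {w. f w + h w \<noteq> 0}" using assms by (auto simp: FA_carrier intro: finite_subset)
  moreover have "w \<in> lists A" if "f w + h w \<noteq> 0" for w
    using assms that unfolding FA_carrier by (cases "f w = 0") auto
  ultimately show ?thesis using assms by (simp add: FA_carrier add_mem)
qed

lemma free_algebra_is_ring: "ring (FA A)"
proof (rule ringI)
  show "abelian_group (FA A)"
  proof (rule abelian_groupI)
    fix f assume f: "f \<in> carrier (FA A)"
    have "{w. - f w \<noteq> 0} = {w. f w \<noteq> 0}" by auto
    then have "(\<lambda>w. - f w) \<in> carrier (FA A)" using f by (auto simp: FA_carrier uminus_mem)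
    then show "\<exists>h\<in>carrier (FA A). h \<oplus>\<^bsub>FA A\<^esub> f = \<zero>\<^bsub>FA A\<^esub>"
      by (intro bexI[of _ "\<lambda>w. - f w"]) (auto simp: FA_add FA_zero)
  next
    show "\<zero>\<^bsub>FA A\<^esub> \<in> carrier (FA A)" by (simp add: FA_carrier FA_zero zero_mem)
  qed (simp_all add: FA_add FA_zero FA_add_carrier algebra_simps)
  show "Group.monoid (FA A)"
  proof (rule Group.monoidI)
    fix f h k assume *: "f \<in> carrier (FA A)" "h \<in> carrier (FA A)" "k \<in> carrier (FA A)"
    then show "f \<otimes>\<^bsub>FA A\<^esub> h \<otimes>\<^bsub>FA A\<^esub> k = f \<otimes>\<^bsub>FA A\<^esub> (h \<otimes>\<^bsub>FA A\<^esub> k)"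
      by (simp add: FA_mult' convolution_carrier convolution_assoc)
  qed (auto simp: FA_mult' convolution_carrier FA_one word_monom_carrier one_mem
      convolution_const_left convolution_const_right)
qed (auto simp: FA_add FA_mult' FA_add_carrier convolution_carrier convolution_add_left convolution_add_right)

lemma free_algebra_induct [consumes 1, case_names zero add monom]:
  assumes f: "f \<in> carrier (FA A)"
    and z: "Q (\<lambda>w. 0)"
    and a: "\<And>f h. \<lbrakk>f \<in> carrier (FA A); h \<in> carrier (FA A); Q f; Q h\<rbrakk> \<Longrightarrow> Q (\<lambda>w. f w + h w)"
    and m: "\<And>c w. \<lbrakk>c \<in> S; w \<in> lists A\<rbrakk> \<Longrightarrow> Q (word_monom c w)"
  shows "Q f"
  using f
proof (induction "card {w. f w \<noteq> 0}" arbitrary: f)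
  case 0
  then have "f = (\<lambda>w. 0)" by (auto simp: FA_carrier)
  then show ?case using z by simp
next
  case (Suc k)
  then have fin: "finite {w. f w \<noteq> 0}" by (auto simp: FA_carrier)
  obtain w where w: "f w \<noteq> 0" using Suc.hyps(2) by (metis (mono_tags, lifting) Collect_empty_eq card.empty nat.distinct(1))
  let ?h = "f(w := 0)"
  have s: "{x. ?h x \<noteq> 0} = {x. f x \<noteq> 0} - {w}" by auto
  have h: "?h \<in> carrier (FA A)" using Suc.prems unfolding FA_carrier s by (auto simp: zero_mem)
  have "card {x. ?h x \<noteq> 0} = k" unfolding s using fin w Suc.hyps(2) by simp
  then have "Q ?h" using Suc.hyps(1)[of ?h] h by simp
  moreover have c: "f w \<in> S" "w \<in> lists A" using Suc.prems w by (auto simp: FA_carrier)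
  ultimately have "Q (\<lambda>x. word_monom (f w) w x + ?h x)"
    by (intro a m word_monom_carrier h)
  moreover have "(\<lambda>x. word_monom (f w) w x + ?h x) = f" by (auto simp: word_monom_def)
  ultimately show ?case by simp
qed

lemma word_monom_mult_gen:
  assumes "c \<in> S" "x \<in> A" "w \<in> lists A"
  shows "word_monom c (x # w) = fa_gen R x \<otimes>\<^bsub>FA A\<^esub> word_monom c w"
  using FA_mult'[OF gen_carrier[OF assms(2)] word_monom_carrier[OF assms(1,3)]]
  by (simp only: gen_word_monom word_monom_Cons[symmetric])

lemma const_mult: "c \<in> S \<Longrightarrow> f \<in> carrier (FA A) \<Longrightarrow> fa_const R c \<otimes>\<^bsub>FA A\<^esub> f = (\<lambda>w. c * f w)"
  by (simp add: FA_mult' const_carrier) (simp add: const_word_monom convolution_const_left)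

lemma const_central:
  "c \<in> S \<Longrightarrow> f \<in> carrier (FA A) \<Longrightarrow> fa_const R c \<otimes>\<^bsub>FA A\<^esub> f = f \<otimes>\<^bsub>FA A\<^esub> fa_const R c"
  by (simp add: FA_mult' const_carrier)
    (auto simp: const_word_monom convolution_const_left convolution_const_right mult.commute)

end

section \<open>The algebra over a subring and change of coefficients\<close>

locale yokonuma_hecke = subring_of_field S for S :: "'f::field set" +
  fixes d n :: nat and v :: 'f
  assumes d_nonzero: "of_nat d \<noteq> (0 :: 'f)" and d_inv_mem: "inverse (of_nat d) \<in> S"
    and v_mem: "v \<in> S" and v_inv_mem: "inverse v \<in> S" and v_nonzero: "v \<noteq> 0"
begin

abbreviation "F \<equiv> yh_free R n"
abbreviation "Y \<equiv> YH R d n v"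
abbreviation "cls \<equiv> yh_class R d n v"
abbreviation "G a \<equiv> fa_gen R (Gen_g a)"
abbreviation "T a \<equiv> fa_gen R (Gen_t a)"
abbreviation "sc \<equiv> yh_scalar R d n v"

sublocale F: ring F by (rule free_algebra_is_ring)

lemma d_pos: "d > 0" using d_nonzero by (cases d) auto

lemma G_carrier: "a \<in> {1..<n} \<Longrightarrow> G a \<in> carrier F"
  by (rule gen_carrier) (auto simp: yh_gens_def)

lemma T_carrier: "a \<in> {1..n} \<Longrightarrow> T a \<in> carrier F"
  by (rule gen_carrier) (auto simp: yh_gens_def)

lemma yh_e_eq:
  "yh_e R d n a = fa_const R (inverse (of_nat d)) \<otimes>\<^bsub>F\<^esub>
     (\<Oplus>\<^bsub>F\<^esub>r\<in>{..<d}. (T a [^]\<^bsub>F\<^esub> r) \<otimes>\<^bsub>F\<^esub> (T (Suc a) [^]\<^bsub>F\<^esub> (d - r)))"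
  unfolding yh_e_def Let_def R_of_nat using R_inv[OF of_nat_mem d_inv_mem d_nonzero] by simp

lemma yh_e_carrier: "a \<in> {1..<n} \<Longrightarrow> yh_e R d n a \<in> carrier F"
  unfolding yh_e_eq using T_carrier[of a] T_carrier[of "Suc a"]
  by (intro F.m_closed const_carrier d_inv_mem F.finsum_closed) auto

lemma transpose_in: "a \<in> {1..n} \<Longrightarrow> b \<in> {1..<n} \<Longrightarrow> transpose b (b + 1) a \<in> {1..n}"
  by (auto simp: transpose_def)

lemma rels_carrier: "yh_rels R d n v \<subseteq> carrier F"
  unfolding yh_rels_def Let_def
  by (auto intro!: F.minus_closed F.m_closed F.a_closed const_carrier yh_e_carrier G_carrier T_carrier
      v_mem diff_mem one_mem F.nat_pow_closed F.one_closed simp: v_mem one_mem transpose_def)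

sublocale I: ideal "yh_ideal R d n v" F
  unfolding yh_ideal_def using rels_carrier by (rule F.genideal_ideal)

sublocale Y: ring Y
  unfolding YH_def by (rule I.quotient_is_ring)

sublocale cls: ring_hom_ring F Y cls
proof -
  have "cls = (+>\<^bsub>F\<^esub>) (yh_ideal R d n v)" by (rule ext) (simp add: yh_class_def)
  then show "ring_hom_ring F Y cls" using I.rcos_ring_hom_ring by (simp add: YH_def)
qed

lemma cls_surj: "y \<in> carrier Y \<Longrightarrow> \<exists>f\<in>carrier F. y = cls f"
  by (auto simp: YH_def FactRing_def A_RCOSETS_def' yh_class_def)

lemma cls_self: "f \<in> carrier F \<Longrightarrow> f \<in> cls f"
  unfolding yh_class_def by (rule I.a_rcos_self)

lemma cls_eqI_member:
  assumes "f \<in> carrier F" "h \<in> cls f"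
  shows "h \<in> carrier F" "cls h = cls f"
proof -
  show "h \<in> carrier F"
    using assms F.a_r_coset_subset_G[OF I.a_subset, of f] unfolding yh_class_def by blast
  show "cls h = cls f"
    using F.a_repr_independence[OF _ assms(1) I.a_subgroup] assms(2) unfolding yh_class_def by simp
qed

lemma cls_eq_iff:
  assumes "f \<in> carrier F" "h \<in> carrier F"
  shows "cls f = cls h \<longleftrightarrow> f \<ominus>\<^bsub>F\<^esub> h \<in> yh_ideal R d n v"
proof -
  have "cls f = cls h \<longleftrightarrow> f \<in> cls h"
    using cls_self assms cls_eqI_member by blast
  then show ?thesis
    using I.a_rcos_module_minus[OF F.ring_axioms assms(2,1)] by (simp add: yh_class_def)
qed

lemma rel_cls:
  assumes "f \<ominus>\<^bsub>F\<^esub> h \<in> yh_rels R d n v" "f \<in> carrier F" "h \<in> carrier F"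
  shows "cls f = cls h"
  using assms F.genideal_self[OF rels_carrier] by (auto simp: cls_eq_iff yh_ideal_def)

end

context yokonuma_hecke
begin

abbreviation "g \<equiv> yh_g R d n v"
abbreviation "t \<equiv> yh_t R d n v"
abbreviation "JM \<equiv> yh_X R d n v"

lemma g_closed: "a \<in> {1..<n} \<Longrightarrow> g a \<in> carrier Y"
  unfolding yh_g_def by (intro cls.hom_closed G_carrier)

lemma t_closed: "a \<in> {1..n} \<Longrightarrow> t a \<in> carrier Y"
  unfolding yh_t_def by (intro cls.hom_closed T_carrier)

lemma sc_closed: "c \<in> S \<Longrightarrow> sc c \<in> carrier Y"
  unfolding yh_scalar_def by (intro cls.hom_closed const_carrier)

lemma sc_central:
  assumes "c \<in> S" "y \<in> carrier Y"
  shows "sc c \<otimes>\<^bsub>Y\<^esub> y = y \<otimes>\<^bsub>Y\<^esub> sc c"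
proof -
  obtain f where f: "f \<in> carrier F" "y = cls f" using cls_surj assms by blast
  then show ?thesis
    using const_central[OF assms(1) f(1)] const_carrier[OF assms(1)]
    unfolding yh_scalar_def by (metis cls.hom_mult)
qed

lemma sc_add: "c \<in> S \<Longrightarrow> c' \<in> S \<Longrightarrow> sc (c + c') = sc c \<oplus>\<^bsub>Y\<^esub> sc c'"
proof -
  assume "c \<in> S" "c' \<in> S"
  moreover have "fa_const R (c + c') = fa_const R c \<oplus>\<^bsub>F\<^esub> (fa_const R c' :: yh_gen list \<Rightarrow> 'f)"
    by (auto simp: fa_const_def FA_add)
  ultimately show ?thesis unfolding yh_scalar_def by (metis cls.hom_add const_carrier)
qed

lemma sc_mult: "c \<in> S \<Longrightarrow> c' \<in> S \<Longrightarrow> sc (c * c') = sc c \<otimes>\<^bsub>Y\<^esub> sc c'"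
proof -
  assume c: "c \<in> S" "c' \<in> S"
  have "fa_const R (c * c') = fa_const R c \<otimes>\<^bsub>F\<^esub> (fa_const R c' :: yh_gen list \<Rightarrow> 'f)"
    unfolding const_mult[OF c(1) const_carrier[OF c(2)]] by (auto simp: fa_const_def)
  with c show ?thesis unfolding yh_scalar_def by (metis cls.hom_mult const_carrier)
qed

lemma sc_1: "sc 1 = \<one>\<^bsub>Y\<^esub>"
  using cls.hom_one unfolding yh_scalar_def FA_one const_word_monom by simp

lemma sc_0: "sc 0 = \<zero>\<^bsub>Y\<^esub>"
proof -
  have "fa_const R 0 = \<zero>\<^bsub>F\<^esub>" by (auto simp: fa_const_def FA_zero)
  then show ?thesis unfolding yh_scalar_def using cls.hom_zero by metis
qed

lemma t_pow_d: "a \<in> {1..n} \<Longrightarrow> t a [^]\<^bsub>Y\<^esub> d = \<one>\<^bsub>Y\<^esub>"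
proof -
  assume a: "a \<in> {1..n}"
  have "cls (T a [^]\<^bsub>F\<^esub> d) = cls \<one>\<^bsub>F\<^esub>"
    by (rule rel_cls) (use a T_carrier[OF a] in \<open>auto simp: yh_rels_def Let_def\<close>)
  then show ?thesis using T_carrier[OF a] by (simp add: yh_t_def cls.hom_nat_pow)
qed

lemma t_t: "a \<in> {1..n} \<Longrightarrow> b \<in> {1..n} \<Longrightarrow> t a \<otimes>\<^bsub>Y\<^esub> t b = t b \<otimes>\<^bsub>Y\<^esub> t a"
proof -
  assume a: "a \<in> {1..n}" "b \<in> {1..n}"
  note c = T_carrier[OF a(1)] T_carrier[OF a(2)]
  have "cls (T a \<otimes>\<^bsub>F\<^esub> T b) = cls (T b \<otimes>\<^bsub>F\<^esub> T a)"
    by (rule rel_cls) (use a c in \<open>simp_all add: yh_rels_def Let_def\<close>, blast)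
  then show ?thesis using c by (simp add: yh_t_def)
qed

lemma t_g:
  assumes a: "a \<in> {1..n}" "b \<in> {1..<n}"
  shows "t a \<otimes>\<^bsub>Y\<^esub> g b = g b \<otimes>\<^bsub>Y\<^esub> t (transpose b (Suc b) a)"
proof -
  have b: "transpose b (b + 1) a \<in> {1..n}" by (rule transpose_in[OF a])
  note c = T_carrier[OF a(1)] T_carrier[OF b] G_carrier[OF a(2)]
  have "(T a \<otimes>\<^bsub>F\<^esub> G b) \<ominus>\<^bsub>F\<^esub> (G b \<otimes>\<^bsub>F\<^esub> T (transpose b (b + 1) a)) \<in> yh_rels R d n v"
    using a unfolding yh_rels_def Let_def by blast
  then have "cls (T a \<otimes>\<^bsub>F\<^esub> G b) = cls (G b \<otimes>\<^bsub>F\<^esub> T (transpose b (b + 1) a))"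
    by (rule rel_cls) (use c in simp_all)
  then show ?thesis using c by (simp add: yh_t_def yh_g_def)
qed

lemma g_braid:
  assumes a: "a \<in> {1..<n}" "Suc a \<in> {1..<n}"
  shows "g a \<otimes>\<^bsub>Y\<^esub> g (Suc a) \<otimes>\<^bsub>Y\<^esub> g a = g (Suc a) \<otimes>\<^bsub>Y\<^esub> g a \<otimes>\<^bsub>Y\<^esub> g (Suc a)"
proof -
  note c = G_carrier[OF a(1)] G_carrier[OF a(2)]
  have "\<bar>int a - int (Suc a)\<bar> = 1" by simp
  then have "(G a \<otimes>\<^bsub>F\<^esub> G (Suc a) \<otimes>\<^bsub>F\<^esub> G a) \<ominus>\<^bsub>F\<^esub> (G (Suc a) \<otimes>\<^bsub>F\<^esub> G a \<otimes>\<^bsub>F\<^esub> G (Suc a)) \<in> yh_rels R d n v"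
    using a unfolding yh_rels_def Let_def by blast
  then have "cls (G a \<otimes>\<^bsub>F\<^esub> G (Suc a) \<otimes>\<^bsub>F\<^esub> G a) = cls (G (Suc a) \<otimes>\<^bsub>F\<^esub> G a \<otimes>\<^bsub>F\<^esub> G (Suc a))"
    by (rule rel_cls) (use c in simp_all)
  then show ?thesis using c by (simp add: yh_g_def)
qed

lemma g_comm:
  assumes a: "a \<in> {1..<n}" "b \<in> {1..<n}" "Suc a < b"
  shows "g a \<otimes>\<^bsub>Y\<^esub> g b = g b \<otimes>\<^bsub>Y\<^esub> g a"
proof -
  note c = G_carrier[OF a(1)] G_carrier[OF a(2)]
  have "\<bar>int a - int b\<bar> > 1" using a by simp
  then have "(G a \<otimes>\<^bsub>F\<^esub> G b) \<ominus>\<^bsub>F\<^esub> (G b \<otimes>\<^bsub>F\<^esub> G a) \<in> yh_rels R d n v"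
    using a unfolding yh_rels_def Let_def by blast
  then have "cls (G a \<otimes>\<^bsub>F\<^esub> G b) = cls (G b \<otimes>\<^bsub>F\<^esub> G a)"
    by (rule rel_cls) (use c in simp_all)
  then show ?thesis using c by (simp add: yh_g_def)
qed

definition eY :: "nat \<Rightarrow> (yh_gen list \<Rightarrow> 'f) set" where
  "eY a = sc (inverse (of_nat d)) \<otimes>\<^bsub>Y\<^esub>
     (\<Oplus>\<^bsub>Y\<^esub>r\<in>{..<d}. (t a [^]\<^bsub>Y\<^esub> r) \<otimes>\<^bsub>Y\<^esub> (t (Suc a) [^]\<^bsub>Y\<^esub> (d - r)))"

lemma cls_e: "a \<in> {1..<n} \<Longrightarrow> cls (yh_e R d n a) = eY a"
proof -
  assume a: "a \<in> {1..<n}"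
  have c: "T a \<in> carrier F" "T (Suc a) \<in> carrier F" using T_carrier a by auto
  let ?f = "\<lambda>r. (T a [^]\<^bsub>F\<^esub> (r::nat)) \<otimes>\<^bsub>F\<^esub> (T (Suc a) [^]\<^bsub>F\<^esub> (d - r))"
  have s: "?f \<in> {..<d} \<rightarrow> carrier F" using c by auto
  have "cls (?f r) = (t a [^]\<^bsub>Y\<^esub> r) \<otimes>\<^bsub>Y\<^esub> (t (Suc a) [^]\<^bsub>Y\<^esub> (d - r))" for r
    using c by (simp add: cls.hom_nat_pow yh_t_def)
  then have "cls (finsum F ?f {..<d}) = (\<Oplus>\<^bsub>Y\<^esub>r\<in>{..<d}. (t a [^]\<^bsub>Y\<^esub> r) \<otimes>\<^bsub>Y\<^esub> (t (Suc a) [^]\<^bsub>Y\<^esub> (d - r)))"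
    using cls.hom_finsum[OF s] by (simp add: comp_def)
  then show ?thesis
    using cls.hom_mult[OF const_carrier[OF d_inv_mem] F.finsum_closed[OF s]]
    unfolding yh_e_eq eY_def yh_scalar_def by simp
qed

lemma eY_closed: "a \<in> {1..<n} \<Longrightarrow> eY a \<in> carrier Y"
  using cls_e yh_e_carrier cls.hom_closed by metis

lemma g_square:
  assumes a: "a \<in> {1..<n}"
  shows "g a \<otimes>\<^bsub>Y\<^esub> g a = sc v \<oplus>\<^bsub>Y\<^esub> (sc (v - 1) \<otimes>\<^bsub>Y\<^esub> eY a \<otimes>\<^bsub>Y\<^esub> g a)"
proof -
  note c = G_carrier[OF a] yh_e_carrier[OF a] const_carrier[where A = "yh_gens n", OF v_mem]
    const_carrier[where A = "yh_gens n", OF diff_mem[OF v_mem one_mem]]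
  have m: "v \<ominus>\<^bsub>R\<^esub> \<one>\<^bsub>R\<^esub> = v - 1" using v_mem one_mem by simp
  let ?r = "fa_const R v \<oplus>\<^bsub>F\<^esub> (fa_const R (v - 1) \<otimes>\<^bsub>F\<^esub> yh_e R d n a \<otimes>\<^bsub>F\<^esub> G a)"
  have "(G a [^]\<^bsub>F\<^esub> (2::nat)) \<ominus>\<^bsub>F\<^esub> ?r \<in> yh_rels R d n v"
    using a unfolding yh_rels_def Let_def m by blast
  then have "cls (G a [^]\<^bsub>F\<^esub> (2::nat)) = cls ?r"
    by (rule rel_cls) (use c in simp_all)
  moreover have "G a [^]\<^bsub>F\<^esub> (2::nat) = G a \<otimes>\<^bsub>F\<^esub> G a" using c by (simp add: numeral_2_eq_2)
  ultimately show ?thesis using c by (simp add: yh_g_def yh_scalar_def cls_e[OF a])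
qed

lemma JM_Suc: "a \<ge> 1 \<Longrightarrow> JM (Suc a) = sc (inverse v) \<otimes>\<^bsub>Y\<^esub> (g a \<otimes>\<^bsub>Y\<^esub> JM a \<otimes>\<^bsub>Y\<^esub> g a)"
  using R_inv[OF v_mem v_inv_mem v_nonzero] by simp

lemma JM_1: "JM (Suc 0) = \<one>\<^bsub>Y\<^esub>" by simp

lemma JM_closed: "1 \<le> a \<Longrightarrow> a \<le> n \<Longrightarrow> JM a \<in> carrier Y"
proof (induction a rule: dec_induct)
  case (step a)
  then show ?case using g_closed[of a] sc_closed[OF v_inv_mem] by (simp only: JM_Suc) simp
qed (simp add: JM_1)

lemma L_closed: "a \<in> {1..2 * n} \<Longrightarrow> yh_L R d n v a \<in> carrier Y"
proof (cases "a \<le> n")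
  case False
  moreover assume "a \<in> {1..2 * n}"
  ultimately have "a - n \<in> {1..n}" by auto
  then show ?thesis using False t_closed by (simp add: yh_L_def)
qed (use JM_closed in \<open>simp add: yh_L_def\<close>)

end

locale yokonuma_hecke_map =
  A: yokonuma_hecke S d n v + B: yokonuma_hecke S' d n v'
  for S :: "'a::field set" and S' :: "'b::field set" and d n v v' +
  fixes \<phi> :: "'a \<Rightarrow> 'b"
  assumes \<phi>_mem: "x \<in> S \<Longrightarrow> \<phi> x \<in> S'"
    and \<phi>_add: "\<lbrakk>x \<in> S; y \<in> S\<rbrakk> \<Longrightarrow> \<phi> (x + y) = \<phi> x + \<phi> y"
    and \<phi>_mult: "\<lbrakk>x \<in> S; y \<in> S\<rbrakk> \<Longrightarrow> \<phi> (x * y) = \<phi> x * \<phi> y"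
    and \<phi>_1: "\<phi> 1 = 1" and \<phi>_v: "\<phi> v = v'"
begin

lemma \<phi>_0: "\<phi> 0 = 0"
  using \<phi>_add[OF A.zero_mem A.zero_mem] by (metis add_0 add_cancel_right_right)

lemma \<phi>_uminus: "x \<in> S \<Longrightarrow> \<phi> (- x) = - \<phi> x"
  using \<phi>_add[of "- x" x] A.uminus_mem \<phi>_0 by (simp add: eq_neg_iff_add_eq_0)

lemma \<phi>_diff: "x \<in> S \<Longrightarrow> y \<in> S \<Longrightarrow> \<phi> (x - y) = \<phi> x - \<phi> y"
  using \<phi>_add[of x "- y"] \<phi>_uminus A.uminus_mem by simp

lemma \<phi>_sum: "(\<And>i. i \<in> A \<Longrightarrow> f i \<in> S) \<Longrightarrow> \<phi> (sum f A) = (\<Sum>i\<in>A. \<phi> (f i))"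
  by (induction A rule: infinite_finite_induct) (auto simp: \<phi>_0 \<phi>_add A.sum_mem)

lemma \<phi>_of_nat: "\<phi> (of_nat k) = of_nat k"
  by (induction k) (auto simp: \<phi>_0 \<phi>_add \<phi>_1 A.one_mem A.of_nat_mem)

lemma \<phi>_inverse: "x \<in> S \<Longrightarrow> inverse x \<in> S \<Longrightarrow> x \<noteq> 0 \<Longrightarrow> \<phi> (inverse x) = inverse (\<phi> x)"
  using \<phi>_mult[of x "inverse x"] \<phi>_1 by (simp add: inverse_unique)

lemma map_const: "\<phi> \<circ> fa_const A.R c = fa_const B.R (\<phi> c)"
  by (auto simp: fa_const_def \<phi>_0)

lemma map_gen: "\<phi> \<circ> fa_gen A.R x = fa_gen B.R x"
  by (auto simp: fa_gen_def \<phi>_0 \<phi>_1)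

lemma map_carrier: "f \<in> carrier A.F \<Longrightarrow> \<phi> \<circ> f \<in> carrier B.F"
proof -
  assume f: "f \<in> carrier A.F"
  have s: "{w. (\<phi> \<circ> f) w \<noteq> 0} \<subseteq> {w. f w \<noteq> 0}" using \<phi>_0 by auto
  then show ?thesis using f finite_subset[OF s] unfolding A.FA_carrier B.FA_carrier
    by (auto simp: \<phi>_mem)
qed

sublocale h: ring_hom_ring A.F B.F "\<lambda>f. \<phi> \<circ> f"
proof (rule ring_hom_ringI[OF A.F.ring_axioms B.F.ring_axioms])
  fix f k assume *: "f \<in> carrier A.F" "k \<in> carrier A.F"
  then show "\<phi> \<circ> (f \<otimes>\<^bsub>A.F\<^esub> k) = (\<phi> \<circ> f) \<otimes>\<^bsub>B.F\<^esub> (\<phi> \<circ> k)"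
    by (auto simp: A.FA_mult' B.FA_mult' map_carrier convolution_def \<phi>_sum \<phi>_mult A.mult_mem A.FA_carrier)
  show "\<phi> \<circ> (f \<oplus>\<^bsub>A.F\<^esub> k) = (\<phi> \<circ> f) \<oplus>\<^bsub>B.F\<^esub> (\<phi> \<circ> k)"
    using * by (auto simp: A.FA_add B.FA_add \<phi>_add A.FA_carrier)
qed (auto simp: map_carrier A.FA_one B.FA_one word_monom_def \<phi>_0 \<phi>_1)

lemma map_minus: "f \<in> carrier A.F \<Longrightarrow> k \<in> carrier A.F \<Longrightarrow> \<phi> \<circ> (f \<ominus>\<^bsub>A.F\<^esub> k) = (\<phi> \<circ> f) \<ominus>\<^bsub>B.F\<^esub> (\<phi> \<circ> k)"
  by (simp add: a_minus_def)

lemma map_e: "a \<in> {1..<n} \<Longrightarrow> \<phi> \<circ> yh_e A.R d n a = yh_e B.R d n a"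
proof -
  assume a: "a \<in> {1..<n}"
  have c: "A.T a \<in> carrier A.F" "A.T (Suc a) \<in> carrier A.F" using A.T_carrier a by auto
  let ?f = "\<lambda>r. (A.T a [^]\<^bsub>A.F\<^esub> (r::nat)) \<otimes>\<^bsub>A.F\<^esub> (A.T (Suc a) [^]\<^bsub>A.F\<^esub> (d - r))"
  let ?f' = "\<lambda>r. (B.T a [^]\<^bsub>B.F\<^esub> (r::nat)) \<otimes>\<^bsub>B.F\<^esub> (B.T (Suc a) [^]\<^bsub>B.F\<^esub> (d - r))"
  have s: "?f \<in> {..<d} \<rightarrow> carrier A.F" using c by auto
  have "\<phi> \<circ> ?f r = ?f' r" for r
    using c by (simp add: h.hom_nat_pow map_gen)
  then have "\<phi> \<circ> finsum A.F ?f {..<d} = finsum B.F ?f' {..<d}"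
    using h.hom_finsum[OF s] by (simp add: comp_def[of "(\<circ>) \<phi>"])
  moreover have "\<phi> (inverse (of_nat d)) = inverse (of_nat d)"
    using \<phi>_inverse[OF A.of_nat_mem A.d_inv_mem A.d_nonzero] \<phi>_of_nat by simp
  ultimately show ?thesis
    using h.hom_mult[OF A.const_carrier[OF A.d_inv_mem] A.F.finsum_closed[OF s]]
    unfolding A.yh_e_eq B.yh_e_eq by (simp add: map_const)
qed

lemma map_rels: "(\<lambda>f. \<phi> \<circ> f) ` yh_rels A.R d n v \<subseteq> yh_rels B.R d n v'"
proof -
  have v1: "v \<ominus>\<^bsub>A.R\<^esub> \<one>\<^bsub>A.R\<^esub> = v - 1" "v' \<ominus>\<^bsub>B.R\<^esub> \<one>\<^bsub>B.R\<^esub> = v' - 1"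
    using A.v_mem A.one_mem B.v_mem B.one_mem by simp_all
  have \<phi>v1: "\<phi> (v - 1) = v' - 1" using \<phi>_diff[OF A.v_mem A.one_mem] \<phi>_v \<phi>_1 by simp
  note c = A.T_carrier A.G_carrier A.transpose_in A.yh_e_carrier A.const_carrier[OF A.v_mem]
    A.const_carrier[OF A.diff_mem[OF A.v_mem A.one_mem]]
  note hs = map_minus h.hom_mult h.hom_add h.hom_nat_pow h.hom_one map_gen map_const map_e \<phi>v1 \<phi>_v c
  have r: "a \<in> {1..n} \<Longrightarrow> \<phi> \<circ> ((A.T a [^]\<^bsub>A.F\<^esub> d) \<ominus>\<^bsub>A.F\<^esub> \<one>\<^bsub>A.F\<^esub>) = (B.T a [^]\<^bsub>B.F\<^esub> d) \<ominus>\<^bsub>B.F\<^esub> \<one>\<^bsub>B.F\<^esub>"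
    "\<lbrakk>a \<in> {1..n}; b \<in> {1..n}\<rbrakk> \<Longrightarrow> \<phi> \<circ> ((A.T a \<otimes>\<^bsub>A.F\<^esub> A.T b) \<ominus>\<^bsub>A.F\<^esub> (A.T b \<otimes>\<^bsub>A.F\<^esub> A.T a)) =
      (B.T a \<otimes>\<^bsub>B.F\<^esub> B.T b) \<ominus>\<^bsub>B.F\<^esub> (B.T b \<otimes>\<^bsub>B.F\<^esub> B.T a)"
    "\<lbrakk>a \<in> {1..n}; b \<in> {1..<n}\<rbrakk> \<Longrightarrow>
      \<phi> \<circ> ((A.T a \<otimes>\<^bsub>A.F\<^esub> A.G b) \<ominus>\<^bsub>A.F\<^esub> (A.G b \<otimes>\<^bsub>A.F\<^esub> A.T (transpose b (b + 1) a))) =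
      (B.T a \<otimes>\<^bsub>B.F\<^esub> B.G b) \<ominus>\<^bsub>B.F\<^esub> (B.G b \<otimes>\<^bsub>B.F\<^esub> B.T (transpose b (b + 1) a))"
    "a \<in> {1..<n} \<Longrightarrow> \<phi> \<circ> ((A.G a [^]\<^bsub>A.F\<^esub> (2::nat)) \<ominus>\<^bsub>A.F\<^esub>
        (fa_const A.R v \<oplus>\<^bsub>A.F\<^esub> (fa_const A.R (v - 1) \<otimes>\<^bsub>A.F\<^esub> yh_e A.R d n a \<otimes>\<^bsub>A.F\<^esub> A.G a))) =
      (B.G a [^]\<^bsub>B.F\<^esub> (2::nat)) \<ominus>\<^bsub>B.F\<^esub>
        (fa_const B.R v' \<oplus>\<^bsub>B.F\<^esub> (fa_const B.R (v' - 1) \<otimes>\<^bsub>B.F\<^esub> yh_e B.R d n a \<otimes>\<^bsub>B.F\<^esub> B.G a))"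
    "\<lbrakk>a \<in> {1..<n}; b \<in> {1..<n}\<rbrakk> \<Longrightarrow>
      \<phi> \<circ> ((A.G a \<otimes>\<^bsub>A.F\<^esub> A.G b \<otimes>\<^bsub>A.F\<^esub> A.G a) \<ominus>\<^bsub>A.F\<^esub> (A.G b \<otimes>\<^bsub>A.F\<^esub> A.G a \<otimes>\<^bsub>A.F\<^esub> A.G b)) =
      (B.G a \<otimes>\<^bsub>B.F\<^esub> B.G b \<otimes>\<^bsub>B.F\<^esub> B.G a) \<ominus>\<^bsub>B.F\<^esub> (B.G b \<otimes>\<^bsub>B.F\<^esub> B.G a \<otimes>\<^bsub>B.F\<^esub> B.G b)"
    "\<lbrakk>a \<in> {1..<n}; b \<in> {1..<n}\<rbrakk> \<Longrightarrow>
      \<phi> \<circ> ((A.G a \<otimes>\<^bsub>A.F\<^esub> A.G b) \<ominus>\<^bsub>A.F\<^esub> (A.G b \<otimes>\<^bsub>A.F\<^esub> A.G a)) =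
      (B.G a \<otimes>\<^bsub>B.F\<^esub> B.G b) \<ominus>\<^bsub>B.F\<^esub> (B.G b \<otimes>\<^bsub>B.F\<^esub> B.G a)" for a b
    using A.transpose_in[of a b] by (simp_all add: hs del: Suc_eq_plus1 add_Suc_right One_nat_def)
  show ?thesis
    unfolding yh_rels_def Let_def image_Un v1
  proof (intro Un_mono)
  qed (clarify, subst r, (assumption | simp only:)+, blast)+
qed

lemma map_ideal:
  assumes "f \<in> yh_ideal A.R d n v"
  shows "\<phi> \<circ> f \<in> yh_ideal B.R d n v'"
proof -
  have "ideal {f \<in> carrier A.F. \<phi> \<circ> f \<in> yh_ideal B.R d n v'} A.F"
    by (rule h.ideal_vimage) (rule B.I.is_ideal)
  moreover have "yh_rels A.R d n v \<subseteq> {f \<in> carrier A.F. \<phi> \<circ> f \<in> yh_ideal B.R d n v'}"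
    using A.rels_carrier map_rels B.F.genideal_self[OF B.rels_carrier] by (auto simp: yh_ideal_def)
  ultimately have "yh_ideal A.R d n v \<subseteq> {f \<in> carrier A.F. \<phi> \<circ> f \<in> yh_ideal B.R d n v'}"
    unfolding yh_ideal_def[of A.R] by (rule A.F.genideal_minimal)
  then show ?thesis using assms by blast
qed

abbreviation "mapY \<equiv> yh_map A.R B.R \<phi> d n v'"

lemma map_cls:
  assumes f: "f \<in> carrier A.F"
  shows "mapY (A.cls f) = B.cls (\<phi> \<circ> f)"
proof -
  have "B.cls (\<phi> \<circ> k) = B.cls (\<phi> \<circ> f)" if "k \<in> A.cls f" for k
  proof -
    have k: "k \<in> carrier A.F" "A.cls k = A.cls f" using A.cls_eqI_member[OF f that] by auto
    then have "\<phi> \<circ> (k \<ominus>\<^bsub>A.F\<^esub> f) \<in> yh_ideal B.R d n v'"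
      using A.cls_eq_iff f map_ideal by blast
    then show ?thesis using k f by (simp add: B.cls_eq_iff map_carrier map_minus)
  qed
  then have "(\<lambda>k. B.cls (\<phi> \<circ> k)) ` A.cls f = {B.cls (\<phi> \<circ> f)}"
    using A.cls_self[OF f] by blast
  then show ?thesis by (simp add: yh_map_def)
qed

sublocale m: ring_hom_ring A.Y B.Y mapY
proof (rule ring_hom_ringI[OF A.Y.ring_axioms B.Y.ring_axioms])
  fix x y assume "x \<in> carrier A.Y" "y \<in> carrier A.Y"
  then obtain f k where *: "f \<in> carrier A.F" "x = A.cls f" "k \<in> carrier A.F" "y = A.cls k"
    using A.cls_surj by metis
  then show "mapY (x \<otimes>\<^bsub>A.Y\<^esub> y) = mapY x \<otimes>\<^bsub>B.Y\<^esub> mapY y" "mapY (x \<oplus>\<^bsub>A.Y\<^esub> y) = mapY x \<oplus>\<^bsub>B.Y\<^esub> mapY y"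
    by (simp_all add: map_cls map_carrier flip: A.cls.hom_mult A.cls.hom_add)
next
  fix x assume "x \<in> carrier A.Y"
  then obtain f where *: "f \<in> carrier A.F" "x = A.cls f" using A.cls_surj by metis
  then show "mapY x \<in> carrier B.Y" by (simp add: map_cls map_carrier)
next
  show "mapY \<one>\<^bsub>A.Y\<^esub> = \<one>\<^bsub>B.Y\<^esub>"
    by (simp add: map_cls flip: A.cls.hom_one)
qed

lemma map_g: "a \<in> {1..<n} \<Longrightarrow> mapY (A.g a) = B.g a"
  unfolding yh_g_def by (simp add: map_cls A.G_carrier map_gen)

lemma map_t: "a \<in> {1..n} \<Longrightarrow> mapY (A.t a) = B.t a"
  unfolding yh_t_def by (simp add: map_cls A.T_carrier map_gen)

lemma map_sc: "c \<in> S \<Longrightarrow> mapY (A.sc c) = B.sc (\<phi> c)"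
  unfolding yh_scalar_def by (simp add: map_cls A.const_carrier map_const)

lemma map_JM: "1 \<le> a \<Longrightarrow> a \<le> n \<Longrightarrow> mapY (A.JM a) = B.JM a"
proof (induction a rule: dec_induct)
  case base
  show ?case using m.hom_one by simp
next
  case (step a)
  have "\<phi> (inverse v) = inverse v'"
    using \<phi>_inverse[OF A.v_mem A.v_inv_mem A.v_nonzero] \<phi>_v by simp
  then show ?case
    using step A.JM_closed[of a] A.g_closed[of a] A.sc_closed[OF A.v_inv_mem]
    by (simp only: A.JM_Suc B.JM_Suc) (simp add: map_g map_sc A.v_inv_mem)
qed

lemma map_L: "a \<in> {1..2 * n} \<Longrightarrow> mapY (yh_L A.R d n v a) = yh_L B.R d n v' a"
proof (cases "a \<le> n")
  case False
  moreover assume "a \<in> {1..2 * n}"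
  ultimately have "a - n \<in> {1..n}" by auto
  then show ?thesis using False map_t by (simp add: yh_L_def)
qed (use map_JM in \<open>simp add: yh_L_def\<close>)

end

section \<open>A representation on functions of words\<close>

lemma transpose_comp_self [simp]: "(u \<circ> transpose a b) \<circ> transpose a b = u"
  by (auto simp: fun_eq_iff)

lemma root_of_unity_sum:
  fixes \<zeta> \<zeta>' :: "'f::field"
  assumes "\<zeta> ^ d = 1" "\<zeta>' ^ d = 1"
  shows "(\<Sum>r<d. \<zeta> ^ r * \<zeta>' ^ (d - r)) = (if \<zeta> = \<zeta>' then of_nat d else 0)"
proof (cases "\<zeta> = \<zeta>'")
  case True
  then show ?thesis using assms by (simp flip: power_add)
next
  case False
  have "(\<Sum>r<d. \<zeta> ^ r * \<zeta>' ^ (d - r)) = \<zeta>' * (\<Sum>r<d. \<zeta>' ^ (d - Suc r) * \<zeta> ^ r)"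
    unfolding sum_distrib_left
    by (intro sum.cong) (auto simp: Suc_diff_Suc mult_ac simp flip: power_Suc mult.assoc)
  also have "(\<zeta> - \<zeta>') * (\<Sum>r<d. \<zeta>' ^ (d - Suc r) * \<zeta> ^ r) = \<zeta> ^ d - \<zeta>' ^ d"
    by (rule power_diff_sumr2[symmetric])
  then have "(\<Sum>r<d. \<zeta>' ^ (d - Suc r) * \<zeta> ^ r) = 0" using assms False by auto
  finally show ?thesis using False by simp
qed

text \<open>
  The module of functions on words \<open>u\<close>, where the letter \<open>u a\<close> has the colour \<open>\<xi> ^ u a\<close>. Letters of
  the same colour are exchanged as in the permutation module of the Hecke algebra, and letters of
  different colours as in the twisted group algebra with \<open>g\<^sub>a\<^sup>2 = v\<close>. The alphabet is infinite so that
  every sequence of colours is realized by words with distinct letters, which makes the module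
  faithful.
\<close>

definition word_g :: "'f::field \<Rightarrow> 'f \<Rightarrow> nat \<Rightarrow> ((nat \<Rightarrow> nat) \<Rightarrow> 'f) \<Rightarrow> (nat \<Rightarrow> nat) \<Rightarrow> 'f" where
  "word_g \<xi> v a m u =
    (if u a = u (Suc a) then v * m u
     else if u a < u (Suc a) then v * m (u \<circ> transpose a (Suc a))
     else m (u \<circ> transpose a (Suc a)) + (if \<xi> ^ u a = \<xi> ^ u (Suc a) then (v - 1) * m u else 0))"

definition word_t :: "'f::field \<Rightarrow> nat \<Rightarrow> ((nat \<Rightarrow> nat) \<Rightarrow> 'f) \<Rightarrow> (nat \<Rightarrow> nat) \<Rightarrow> 'f" where
  "word_t \<xi> a m u = \<xi> ^ u a * m u"

lemma word_g_square:
  "word_g \<xi> v a (word_g \<xi> v a m) u = v * m u + (if \<xi> ^ u a = \<xi> ^ u (Suc a) then (v - 1) * word_g \<xi> v a m u else 0)"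
  by (simp add: word_g_def algebra_simps)

lemma word_g_comm:
  assumes "Suc a < b"
  shows "word_g \<xi> v a (word_g \<xi> v b m) u = word_g \<xi> v b (word_g \<xi> v a m) u"
proof -
  have c: "u \<circ> transpose a (Suc a) \<circ> transpose b (Suc b) = u \<circ> transpose b (Suc b) \<circ> transpose a (Suc a)"
    using assms by (auto simp: fun_eq_iff transpose_def)
  have e: "(u \<circ> transpose a (Suc a)) b = u b" "(u \<circ> transpose a (Suc a)) (Suc b) = u (Suc b)"
    "(u \<circ> transpose b (Suc b)) a = u a" "(u \<circ> transpose b (Suc b)) (Suc a) = u (Suc a)"
    using assms by (auto simp: transpose_def)
  show ?thesis unfolding word_g_def e c by (simp add: algebra_simps)
qed

lemma word_g_braid:
  "word_g \<xi> v a (word_g \<xi> v (Suc a) (word_g \<xi> v a m)) u =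
   word_g \<xi> v (Suc a) (word_g \<xi> v a (word_g \<xi> v (Suc a) m)) u"
proof -
  define w where "w x y z = u(a := x, Suc a := y, Suc (Suc a) := z)" for x y z
  have s: "w x y z \<circ> transpose a (Suc a) = w y x z"
      "w x y z \<circ> transpose (Suc a) (Suc (Suc a)) = w x z y" for x y z
    by (auto simp: w_def fun_eq_iff transpose_def)
  have e: "w x y z a = x" "w x y z (Suc a) = y" "w x y z (Suc (Suc a)) = z" for x y z
    by (auto simp: w_def)
  have g: "word_g \<xi> v a m (w x y z) = (if x = y then v * m (w x y z) else if x < y then v * m (w y x z)
        else m (w y x z) + (if \<xi> ^ x = \<xi> ^ y then (v - 1) * m (w x y z) else 0))"
      "word_g \<xi> v (Suc a) m (w x y z) = (if y = z then v * m (w x y z) else if y < z then v * m (w x z y)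
        else m (w x z y) + (if \<xi> ^ y = \<xi> ^ z then (v - 1) * m (w x y z) else 0))" for m x y z
    unfolding word_g_def by (simp_all add: s e)
  have "word_g \<xi> v a (word_g \<xi> v (Suc a) (word_g \<xi> v a m)) (w x y z) =
    word_g \<xi> v (Suc a) (word_g \<xi> v a (word_g \<xi> v (Suc a) m)) (w x y z)" for x y z
  proof (cases "x > y \<and> y > z")
      case True
      \<comment> \<open>The terms with a factor \<open>K\<close> agree because equality of colours is transitive.\<close>
      define K where "K i j = (if \<xi> ^ i = \<xi> ^ j then v - 1 else 0)" for i j
      have e: "(if \<xi> ^ i = \<xi> ^ j then (v - 1) * c else 0) = K i j * c" for i j c by (simp add: K_def)
      have "K x y * K x z = K x y * K y z" "K x y * K y z = K x z * K y z"
        "K x y * K x y * K y z = K x y * K y z * K y z" by (auto simp: K_def)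
      then show ?thesis using True unfolding g e by simp (auto simp: algebra_simps)
  next
    case False
    then show ?thesis
      by (cases x y rule: linorder_cases; cases y z rule: linorder_cases; cases x z rule: linorder_cases;
          simp add: g algebra_simps)
  qed
  moreover have "u = w (u a) (u (Suc a)) (u (Suc (Suc a)))" by (simp add: w_def)
  ultimately show ?thesis by metis
qed

lemma word_t_g: "word_t \<xi> a (word_g \<xi> v b m) u = word_g \<xi> v b (word_t \<xi> (transpose b (Suc b) a) m) u"
  by (auto simp: word_t_def word_g_def algebra_simps transpose_def)

lemma word_t_t: "word_t \<xi> a (word_t \<xi> b m) u = word_t \<xi> b (word_t \<xi> a m) u"
  by (simp add: word_t_def)

fun word_op :: "'f::field \<Rightarrow> 'f \<Rightarrow> yh_gen \<Rightarrow> ((nat \<Rightarrow> nat) \<Rightarrow> 'f) \<Rightarrow> (nat \<Rightarrow> nat) \<Rightarrow> 'f" where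
  "word_op \<xi> v (Gen_g a) = word_g \<xi> v a"
| "word_op \<xi> v (Gen_t a) = word_t \<xi> a"

lemma word_op_linear:
  "word_op \<xi> v x (\<lambda>u. m u + m' u) = (\<lambda>u. word_op \<xi> v x m u + word_op \<xi> v x m' u)"
  "word_op \<xi> v x (\<lambda>u. c * m u) = (\<lambda>u. c * word_op \<xi> v x m u)"
  "word_op \<xi> v x (\<lambda>u. 0) = (\<lambda>u. 0)"
  by (cases x; auto simp: word_g_def word_t_def fun_eq_iff algebra_simps)+

primrec word_ops :: "'f::field \<Rightarrow> 'f \<Rightarrow> yh_gen list \<Rightarrow> ((nat \<Rightarrow> nat) \<Rightarrow> 'f) \<Rightarrow> (nat \<Rightarrow> nat) \<Rightarrow> 'f" where
  "word_ops \<xi> v [] m = m"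
| "word_ops \<xi> v (x # w) m = word_op \<xi> v x (word_ops \<xi> v w m)"

locale yh_representation = yokonuma_hecke S d n v for S :: "'f::field set" and d n v +
  fixes \<xi> :: 'f
  assumes \<xi>_mem: "\<xi> \<in> S" and \<xi>_pow_d: "\<xi> ^ d = 1"
    and \<xi>_primitive: "\<And>k. 0 < k \<Longrightarrow> k < d \<Longrightarrow> \<xi> ^ k \<noteq> 1"
begin

lemma \<xi>_nonzero: "\<xi> \<noteq> 0" using \<xi>_pow_d d_pos by (cases "\<xi> = 0") (auto simp: power_0_left)

lemma \<xi>_pow_pow_d: "(\<xi> ^ k) ^ d = 1"
  by (metis \<xi>_pow_d power_mult mult.commute power_one)

definition eval :: "(yh_gen list \<Rightarrow> 'f) \<Rightarrow> ((nat \<Rightarrow> nat) \<Rightarrow> 'f) \<Rightarrow> (nat \<Rightarrow> nat) \<Rightarrow> 'f" where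
  "eval f m u = (\<Sum>w | f w \<noteq> 0. f w * word_ops \<xi> v w m u)"

lemma eval_eq: "finite W \<Longrightarrow> {w. f w \<noteq> 0} \<subseteq> W \<Longrightarrow> eval f m u = (\<Sum>w\<in>W. f w * word_ops \<xi> v w m u)"
  unfolding eval_def by (rule sum.mono_neutral_left) auto

lemma eval_zero: "eval (\<lambda>w. 0) m = (\<lambda>u. 0)"
  by (simp add: eval_def fun_eq_iff)

lemma eval_add:
  assumes "f \<in> carrier F" "h \<in> carrier F"
  shows "eval (\<lambda>w. f w + h w) m = (\<lambda>u. eval f m u + eval h m u)"
proof
  fix u
  let ?W = "{w. f w \<noteq> 0} \<union> {w. h w \<noteq> 0}"
  have "finite ?W" using assms by (auto simp: FA_carrier)
  moreover have "{w. f w + h w \<noteq> 0} \<subseteq> ?W" by auto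
  ultimately show "eval (\<lambda>w. f w + h w) m u = eval f m u + eval h m u"
    by (simp add: eval_eq[of ?W] distrib_right sum.distrib)
qed

lemma eval_monom: "eval (word_monom c w) m = (\<lambda>u. c * word_ops \<xi> v w m u)"
proof
  fix u show "eval (word_monom c w) m u = c * word_ops \<xi> v w m u"
    by (subst eval_eq[of "{w}"]) (auto simp: word_monom_def)
qed

lemma eval_scale: "eval (\<lambda>w. c * f w) m = (\<lambda>u. c * eval f m u)"
proof
  fix u show "eval (\<lambda>w. c * f w) m u = c * eval f m u"
    by (cases "c = 0") (simp_all add: eval_def sum_distrib_left mult.assoc)
qed

lemma eval_gen_mult:
  assumes f: "f \<in> carrier F" and x: "x \<in> yh_gens n"
  shows "eval (fa_gen R x \<otimes>\<^bsub>F\<^esub> f) m = word_op \<xi> v x (eval f m)"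
  using f
proof (induction rule: free_algebra_induct)
  case zero
  show ?case using F.r_null[OF gen_carrier[OF x]] by (simp add: FA_zero eval_zero word_op_linear)
next
  case (add f h)
  have "fa_gen R x \<otimes>\<^bsub>F\<^esub> (\<lambda>w. f w + h w) = (\<lambda>w. (fa_gen R x \<otimes>\<^bsub>F\<^esub> f) w + (fa_gen R x \<otimes>\<^bsub>F\<^esub> h) w)"
    using F.r_distr[OF add(1,2) gen_carrier[OF x]] by (simp add: FA_add)
  then show ?case
    using add gen_carrier[OF x] by (simp add: eval_add word_op_linear)
next
  case (monom c w)
  then have "eval (fa_gen R x \<otimes>\<^bsub>F\<^esub> word_monom c w) m = eval (word_monom c (x # w)) m"
    using word_monom_mult_gen[OF monom(1) x monom(2)] by simp
  then show ?case by (simp add: eval_monom word_op_linear)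
qed

lemma eval_mult:
  assumes f: "f \<in> carrier F" and h: "h \<in> carrier F"
  shows "eval (f \<otimes>\<^bsub>F\<^esub> h) m = eval f (eval h m)"
  using f
proof (induction rule: free_algebra_induct)
  case zero
  show ?case using F.l_null[OF h] by (simp add: FA_zero eval_zero)
next
  case (add f f')
  have "(\<lambda>w. f w + f' w) \<otimes>\<^bsub>F\<^esub> h = (\<lambda>w. (f \<otimes>\<^bsub>F\<^esub> h) w + (f' \<otimes>\<^bsub>F\<^esub> h) w)"
    using F.l_distr[OF add(1,2) h] by (simp add: FA_add)
  then show ?case using add h by (simp add: eval_add)
next
  case (monom c w)
  then show ?case
  proof (induction w)
    case Nil
    then show ?case using const_mult[OF Nil(1) h]
      by (simp add: const_word_monom eval_scale eval_monom)
  next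
    case (Cons x w)
    have x: "x \<in> yh_gens n" "w \<in> lists (yh_gens n)" using Cons.prems by auto
    have w: "word_monom c w \<in> carrier F" using word_monom_carrier[OF Cons.prems(1) x(2)] .
    have "word_monom c (x # w) \<otimes>\<^bsub>F\<^esub> h = fa_gen R x \<otimes>\<^bsub>F\<^esub> (word_monom c w \<otimes>\<^bsub>F\<^esub> h)"
      using word_monom_mult_gen[OF Cons.prems(1) x] F.m_assoc[OF gen_carrier[OF x(1)] w h] by simp
    then have "eval (word_monom c (x # w) \<otimes>\<^bsub>F\<^esub> h) m = word_op \<xi> v x (eval (word_monom c w) (eval h m))"
      using eval_gen_mult[OF _ x(1)] w h Cons.IH[OF Cons.prems(1) x(2)] by simp
    then show ?case by (simp add: eval_monom word_op_linear)
  qed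
qed

lemma eval_one: "eval \<one>\<^bsub>F\<^esub> m = m"
  by (simp add: FA_one eval_monom)

lemma eval_const: "eval (fa_const R c) m = (\<lambda>u. c * m u)"
  by (simp add: const_word_monom eval_monom)

lemma eval_G: "eval (G a) m = word_g \<xi> v a m" and eval_T: "eval (T a) m = word_t \<xi> a m"
  by (simp_all add: gen_word_monom eval_monom)

lemma eval_plus: "f \<in> carrier F \<Longrightarrow> h \<in> carrier F \<Longrightarrow> eval (f \<oplus>\<^bsub>F\<^esub> h) m = (\<lambda>u. eval f m u + eval h m u)"
  by (simp add: FA_add eval_add)

lemma eval_minus:
  assumes "f \<in> carrier F" "h \<in> carrier F"
  shows "eval (f \<ominus>\<^bsub>F\<^esub> h) m = (\<lambda>u. eval f m u - eval h m u)"
proof -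
  have "f = (f \<ominus>\<^bsub>F\<^esub> h) \<oplus>\<^bsub>F\<^esub> h"
    using assms by (simp add: a_minus_def F.a_assoc F.l_neg)
  then have "eval f m = eval ((f \<ominus>\<^bsub>F\<^esub> h) \<oplus>\<^bsub>F\<^esub> h) m" by simp
  also have "\<dots> = (\<lambda>u. eval (f \<ominus>\<^bsub>F\<^esub> h) m u + eval h m u)" using assms by (intro eval_plus) auto
  finally show ?thesis by simp
qed

lemma eval_T_pow: "a \<in> {1..n} \<Longrightarrow> eval (T a [^]\<^bsub>F\<^esub> (k::nat)) m = (\<lambda>u. (\<xi> ^ u a) ^ k * m u)"
proof (induction k arbitrary: m)
  case 0 then show ?case by (simp add: eval_one)
next
  case (Suc k)
  then show ?case using T_carrier[OF Suc.prems] by (simp add: eval_mult eval_T) (simp add: word_t_def fun_eq_iff)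
qed

lemma eval_finsum:
  "finite A \<Longrightarrow> (\<And>i. i \<in> A \<Longrightarrow> f i \<in> carrier F) \<Longrightarrow> eval (finsum F f A) m u = (\<Sum>i\<in>A. eval (f i) m u)"
proof (induction A rule: finite_induct)
  case empty then show ?case by (simp add: FA_zero eval_zero)
next
  case (insert i A)
  then have "finsum F f (insert i A) = f i \<oplus>\<^bsub>F\<^esub> finsum F f A" "finsum F f A \<in> carrier F"
    by (auto intro!: F.finsum_insert F.finsum_closed)
  then show ?case using insert by (simp add: eval_plus)
qed

lemma eval_e:
  assumes a: "a \<in> {1..<n}"
  shows "eval (yh_e R d n a) m = (\<lambda>u. if \<xi> ^ u a = \<xi> ^ u (Suc a) then m u else 0)"
proof
  fix u
  have c: "a \<in> {1..n}" "Suc a \<in> {1..n}" using a by auto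
  let ?f = "\<lambda>r. (T a [^]\<^bsub>F\<^esub> (r::nat)) \<otimes>\<^bsub>F\<^esub> (T (Suc a) [^]\<^bsub>F\<^esub> (d - r))"
  have f: "?f r \<in> carrier F" for r using T_carrier[OF c(1)] T_carrier[OF c(2)] by auto
  have "eval (?f r) m u = ((\<xi> ^ u a) ^ r * (\<xi> ^ u (Suc a)) ^ (d - r)) * m u" for r
    using T_carrier[OF c(1)] T_carrier[OF c(2)] by (simp add: eval_mult eval_T_pow[OF c(1)] eval_T_pow[OF c(2)])
  then have "eval (finsum F ?f {..<d}) m u = (\<Sum>r<d. (\<xi> ^ u a) ^ r * (\<xi> ^ u (Suc a)) ^ (d - r)) * m u"
    using f by (simp add: eval_finsum sum_distrib_right)
  then show "eval (yh_e R d n a) m u = (if \<xi> ^ u a = \<xi> ^ u (Suc a) then m u else 0)"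
    unfolding yh_e_eq root_of_unity_sum[OF \<xi>_pow_pow_d \<xi>_pow_pow_d]
    using eval_mult[OF const_carrier[OF d_inv_mem] F.finsum_closed, of ?f "{..<d}"] f d_nonzero
    by (auto simp: eval_const)
qed

lemma eval_kernel_ideal: "ideal {f \<in> carrier F. \<forall>m. eval f m = (\<lambda>u. 0)} F"
proof (rule idealI[OF F.ring_axioms])
  have z: "eval (f \<ominus>\<^bsub>F\<^esub> h) m = (\<lambda>u. 0)"
    if "f \<in> carrier F" "h \<in> carrier F" "eval f m = (\<lambda>u. 0)" "eval h m = (\<lambda>u. 0)" for f h m
    using that by (simp add: eval_minus)
  show "subgroup {f \<in> carrier F. \<forall>m. eval f m = (\<lambda>u. 0)} (add_monoid F)"
  proof (rule F.add.subgroupI)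
    fix f assume f: "f \<in> {f \<in> carrier F. \<forall>m. eval f m = (\<lambda>u. 0)}"
    have "\<ominus>\<^bsub>F\<^esub> f = \<zero>\<^bsub>F\<^esub> \<ominus>\<^bsub>F\<^esub> f" using f by (simp add: a_minus_def)
    moreover have "eval \<zero>\<^bsub>F\<^esub> m = (\<lambda>u. 0)" for m by (simp add: FA_zero eval_zero)
    ultimately show "\<ominus>\<^bsub>F\<^esub> f \<in> {f \<in> carrier F. \<forall>m. eval f m = (\<lambda>u. 0)}"
      using f z[OF F.zero_closed, of f] by auto
  next
    have "\<zero>\<^bsub>F\<^esub> \<in> {f \<in> carrier F. \<forall>m. eval f m = (\<lambda>u. 0)}"
      using F.zero_closed by (simp add: FA_zero eval_zero)
    then show "{f \<in> carrier F. \<forall>m. eval f m = (\<lambda>u. 0)} \<noteq> {}" by blast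
  qed (auto simp: eval_plus)
next
  have z: "eval f (\<lambda>u. 0) = (\<lambda>u. 0)" for f
  proof -
    have "word_ops \<xi> v w (\<lambda>u. 0) = (\<lambda>u. 0)" for w by (induction w) (simp_all add: word_op_linear)
    then show ?thesis by (simp add: eval_def fun_eq_iff)
  qed
  fix f h assume "f \<in> {f \<in> carrier F. \<forall>m. eval f m = (\<lambda>u. 0)}" "h \<in> carrier F"
  then show "h \<otimes>\<^bsub>F\<^esub> f \<in> {f \<in> carrier F. \<forall>m. eval f m = (\<lambda>u. 0)}"
    "f \<otimes>\<^bsub>F\<^esub> h \<in> {f \<in> carrier F. \<forall>m. eval f m = (\<lambda>u. 0)}"
    by (auto simp: eval_mult z)
qed

lemma eval_rels: "yh_rels R d n v \<subseteq> {f \<in> carrier F. \<forall>m. eval f m = (\<lambda>u. 0)}"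
proof -
  have v1: "v \<ominus>\<^bsub>R\<^esub> \<one>\<^bsub>R\<^esub> = v - 1" using v_mem one_mem by simp
  note c = const_carrier[where A = "yh_gens n", OF v_mem]
    const_carrier[where A = "yh_gens n", OF diff_mem[OF v_mem one_mem]]
  have cm: "word_g \<xi> v a (word_g \<xi> v b m) u = word_g \<xi> v b (word_g \<xi> v a m) u" if "1 < \<bar>int a - int b\<bar>" for a b m u
  proof (cases "a < b")
    case True
    then have "Suc a < b" using that by linarith
    then show ?thesis by (rule word_g_comm)
  next
    case False
    then have "Suc b < a" using that by linarith
    then show ?thesis by (rule word_g_comm[symmetric])
  qed
  have br: "word_g \<xi> v a (word_g \<xi> v b (word_g \<xi> v a m)) u = word_g \<xi> v b (word_g \<xi> v a (word_g \<xi> v b m)) u"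
    if "\<bar>int a - int b\<bar> = 1" for a b m u
  proof -
    have "b = Suc a \<or> a = Suc b" using that by linarith
    then show ?thesis using word_g_braid by metis
  qed
  have r: "a \<in> {1..n} \<Longrightarrow> eval ((T a [^]\<^bsub>F\<^esub> d) \<ominus>\<^bsub>F\<^esub> \<one>\<^bsub>F\<^esub>) m = (\<lambda>u. 0)"
    "\<lbrakk>a \<in> {1..n}; b \<in> {1..n}\<rbrakk> \<Longrightarrow> eval ((T a \<otimes>\<^bsub>F\<^esub> T b) \<ominus>\<^bsub>F\<^esub> (T b \<otimes>\<^bsub>F\<^esub> T a)) m = (\<lambda>u. 0)"
    "\<lbrakk>a \<in> {1..n}; b \<in> {1..<n}\<rbrakk> \<Longrightarrow>
      eval ((T a \<otimes>\<^bsub>F\<^esub> G b) \<ominus>\<^bsub>F\<^esub> (G b \<otimes>\<^bsub>F\<^esub> T (transpose b (b + 1) a))) m = (\<lambda>u. 0)"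
    "a \<in> {1..<n} \<Longrightarrow> eval ((G a [^]\<^bsub>F\<^esub> (2::nat)) \<ominus>\<^bsub>F\<^esub>
        (fa_const R v \<oplus>\<^bsub>F\<^esub> (fa_const R (v - 1) \<otimes>\<^bsub>F\<^esub> yh_e R d n a \<otimes>\<^bsub>F\<^esub> G a))) m = (\<lambda>u. 0)"
    "\<lbrakk>a \<in> {1..<n}; b \<in> {1..<n}; \<bar>int a - int b\<bar> = 1\<rbrakk> \<Longrightarrow>
      eval ((G a \<otimes>\<^bsub>F\<^esub> G b \<otimes>\<^bsub>F\<^esub> G a) \<ominus>\<^bsub>F\<^esub> (G b \<otimes>\<^bsub>F\<^esub> G a \<otimes>\<^bsub>F\<^esub> G b)) m = (\<lambda>u. 0)"
    "\<lbrakk>a \<in> {1..<n}; b \<in> {1..<n}; \<bar>int a - int b\<bar> > 1\<rbrakk> \<Longrightarrow>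
      eval ((G a \<otimes>\<^bsub>F\<^esub> G b) \<ominus>\<^bsub>F\<^esub> (G b \<otimes>\<^bsub>F\<^esub> G a)) m = (\<lambda>u. 0)" for a b m
  proof -
    assume a: "a \<in> {1..n}"
    show "eval ((T a [^]\<^bsub>F\<^esub> d) \<ominus>\<^bsub>F\<^esub> \<one>\<^bsub>F\<^esub>) m = (\<lambda>u. 0)"
      using T_carrier[OF a] by (simp add: eval_minus eval_one eval_T_pow[OF a] \<xi>_pow_pow_d)
  next
    assume a: "a \<in> {1..n}" "b \<in> {1..n}"
    show "eval ((T a \<otimes>\<^bsub>F\<^esub> T b) \<ominus>\<^bsub>F\<^esub> (T b \<otimes>\<^bsub>F\<^esub> T a)) m = (\<lambda>u. 0)"
      using T_carrier[OF a(1)] T_carrier[OF a(2)] by (simp add: eval_minus eval_mult eval_T word_t_t[of \<xi> a b])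
  next
    assume a: "a \<in> {1..n}" "b \<in> {1..<n}"
    show "eval ((T a \<otimes>\<^bsub>F\<^esub> G b) \<ominus>\<^bsub>F\<^esub> (G b \<otimes>\<^bsub>F\<^esub> T (transpose b (b + 1) a))) m = (\<lambda>u. 0)"
      using T_carrier[OF a(1)] G_carrier[OF a(2)] T_carrier[OF transpose_in[OF a]]
      by (simp add: eval_minus eval_mult eval_T eval_G word_t_g)
  next
    assume a: "a \<in> {1..<n}"
    show "eval ((G a [^]\<^bsub>F\<^esub> (2::nat)) \<ominus>\<^bsub>F\<^esub>
        (fa_const R v \<oplus>\<^bsub>F\<^esub> (fa_const R (v - 1) \<otimes>\<^bsub>F\<^esub> yh_e R d n a \<otimes>\<^bsub>F\<^esub> G a))) m = (\<lambda>u. 0)"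
      using G_carrier[OF a] yh_e_carrier[OF a] c
      by (simp add: eval_minus eval_plus eval_mult eval_G eval_const eval_e[OF a] numeral_2_eq_2 eval_one)
        (auto simp: word_g_square)
  next
    assume a: "a \<in> {1..<n}" "b \<in> {1..<n}" "\<bar>int a - int b\<bar> = 1"
    show "eval ((G a \<otimes>\<^bsub>F\<^esub> G b \<otimes>\<^bsub>F\<^esub> G a) \<ominus>\<^bsub>F\<^esub> (G b \<otimes>\<^bsub>F\<^esub> G a \<otimes>\<^bsub>F\<^esub> G b)) m = (\<lambda>u. 0)"
      using G_carrier[OF a(1)] G_carrier[OF a(2)] by (simp add: eval_minus eval_mult eval_G br[OF a(3)])
  next
    assume a: "a \<in> {1..<n}" "b \<in> {1..<n}" "\<bar>int a - int b\<bar> > 1"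
    show "eval ((G a \<otimes>\<^bsub>F\<^esub> G b) \<ominus>\<^bsub>F\<^esub> (G b \<otimes>\<^bsub>F\<^esub> G a)) m = (\<lambda>u. 0)"
      using G_carrier[OF a(1)] G_carrier[OF a(2)] by (simp add: eval_minus eval_mult eval_G cm[OF a(3)])
  qed
  have "eval f m = (\<lambda>u. 0)" if "f \<in> yh_rels R d n v" for f m
    using that unfolding yh_rels_def Let_def v1 Un_iff
    by (elim disjE) (clarify, (rule r; assumption))+
  then show ?thesis using rels_carrier by blast
qed

lemma eval_ideal: "f \<in> yh_ideal R d n v \<Longrightarrow> eval f m = (\<lambda>u. 0)"
  using F.genideal_minimal[OF eval_kernel_ideal eval_rels] unfolding yh_ideal_def by blast

lemma eval_cong_cls:
  assumes "f \<in> carrier F" "h \<in> carrier F" "cls f = cls h"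
  shows "eval f m = eval h m"
proof -
  have "f \<ominus>\<^bsub>F\<^esub> h \<in> yh_ideal R d n v" using assms by (simp add: cls_eq_iff)
  from eval_ideal[OF this, of m] eval_minus[OF assms(1,2), of m] show ?thesis
    by (simp add: fun_eq_iff)
qed

definition act :: "(yh_gen list \<Rightarrow> 'f) set \<Rightarrow> ((nat \<Rightarrow> nat) \<Rightarrow> 'f) \<Rightarrow> (nat \<Rightarrow> nat) \<Rightarrow> 'f" where
  "act y = eval (SOME f. f \<in> carrier F \<and> cls f = y)"

lemma act_cls: "f \<in> carrier F \<Longrightarrow> act (cls f) m = eval f m"
  unfolding act_def using someI_ex[of "\<lambda>h. h \<in> carrier F \<and> cls h = cls f"] eval_cong_cls by blast

lemma act_mult: "x \<in> carrier Y \<Longrightarrow> y \<in> carrier Y \<Longrightarrow> act (x \<otimes>\<^bsub>Y\<^esub> y) m = act x (act y m)"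
proof -
  assume "x \<in> carrier Y" "y \<in> carrier Y"
  then obtain f h where "f \<in> carrier F" "x = cls f" "h \<in> carrier F" "y = cls h" using cls_surj by metis
  then show ?thesis by (simp add: act_cls eval_mult flip: cls.hom_mult)
qed

lemma act_add: "x \<in> carrier Y \<Longrightarrow> y \<in> carrier Y \<Longrightarrow> act (x \<oplus>\<^bsub>Y\<^esub> y) m = (\<lambda>u. act x m u + act y m u)"
proof -
  assume "x \<in> carrier Y" "y \<in> carrier Y"
  then obtain f h where "f \<in> carrier F" "x = cls f" "h \<in> carrier F" "y = cls h" using cls_surj by metis
  then show ?thesis by (simp add: act_cls eval_plus flip: cls.hom_add)
qed

lemma act_minus: "x \<in> carrier Y \<Longrightarrow> y \<in> carrier Y \<Longrightarrow> act (x \<ominus>\<^bsub>Y\<^esub> y) m = (\<lambda>u. act x m u - act y m u)"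
proof -
  assume "x \<in> carrier Y" "y \<in> carrier Y"
  then obtain f h where *: "f \<in> carrier F" "x = cls f" "h \<in> carrier F" "y = cls h" using cls_surj by metis
  have "cls (f \<ominus>\<^bsub>F\<^esub> h) = cls f \<ominus>\<^bsub>Y\<^esub> cls h" using * by (simp add: a_minus_def)
  then show ?thesis using act_cls[of "f \<ominus>\<^bsub>F\<^esub> h"] * by (simp add: act_cls eval_minus)
qed

lemma act_one: "act \<one>\<^bsub>Y\<^esub> m = m"
  using act_cls[OF F.one_closed] eval_one by simp

lemma act_zero: "act \<zero>\<^bsub>Y\<^esub> m = (\<lambda>u. 0)"
  using act_cls[OF F.zero_closed, of m, unfolded cls.hom_zero] by (simp add: FA_zero eval_zero)

lemma act_sc: "c \<in> S \<Longrightarrow> act (sc c) m = (\<lambda>u. c * m u)"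
  unfolding yh_scalar_def by (simp add: act_cls const_carrier eval_const)

lemma act_g: "a \<in> {1..<n} \<Longrightarrow> act (g a) m = word_g \<xi> v a m"
  unfolding yh_g_def by (simp add: act_cls G_carrier eval_G)

lemma act_t: "a \<in> {1..n} \<Longrightarrow> act (t a) m = word_t \<xi> a m"
  unfolding yh_t_def by (simp add: act_cls T_carrier eval_T)

lemma act_linear:
  assumes "y \<in> carrier Y"
  shows "act y (\<lambda>u. m u + m' u) = (\<lambda>u. act y m u + act y m' u)"
    "act y (\<lambda>u. c * m u) = (\<lambda>u. c * act y m u)"
proof -
  obtain f where f: "f \<in> carrier F" "y = cls f" using cls_surj assms by metis
  have "word_ops \<xi> v w (\<lambda>u. m u + m' u) = (\<lambda>u. word_ops \<xi> v w m u + word_ops \<xi> v w m' u)"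
    "word_ops \<xi> v w (\<lambda>u. c * m u) = (\<lambda>u. c * word_ops \<xi> v w m u)" for w
    by (induction w) (simp_all add: word_op_linear)
  then show "act y (\<lambda>u. m u + m' u) = (\<lambda>u. act y m u + act y m' u)"
    "act y (\<lambda>u. c * m u) = (\<lambda>u. c * act y m u)"
    using f by (simp_all add: act_cls eval_def fun_eq_iff algebra_simps sum.distrib sum_distrib_left)
qed

end

section \<open>Sorting words by braid operators\<close>

text \<open>
  The weights \<open>n - i\<close> decrease, so moving the larger letter of a descent to the right lowers the sum.
\<close>

definition sort_measure :: "nat \<Rightarrow> (nat \<Rightarrow> nat) \<Rightarrow> nat" where
  "sort_measure n u = (\<Sum>i\<in>{1..n}. (n - i) * u i)"

lemma sort_measure_swap:
  assumes a: "a \<in> {1..<n}" and d: "u a > u (Suc a)"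
  shows "sort_measure n (u \<circ> transpose a (Suc a)) < sort_measure n u"
proof -
  let ?u = "u \<circ> transpose a (Suc a)" and ?B = "{1..n} - {a} - {Suc a}"
  have s: "sort_measure n w = (n - a) * w a + ((n - Suc a) * w (Suc a) + (\<Sum>i\<in>?B. (n - i) * w i))" for w
    unfolding sort_measure_def using a
    by (subst sum.remove[of _ a]; (subst sum.remove[of _ "Suc a"])?) auto
  have r: "(\<Sum>i\<in>?B. (n - i) * ?u i) = (\<Sum>i\<in>?B. (n - i) * u i)"
    by (intro sum.cong) (auto simp: transpose_def)
  obtain k where k: "n = Suc a + k" using a by (metis atLeastLessThan_iff less_iff_Suc_add add_Suc)
  have "(n - a) * u (Suc a) + (n - Suc a) * u a < (n - a) * u a + (n - Suc a) * u (Suc a)"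
    using d by (simp add: k)
  then show ?thesis unfolding s r by simp
qed

context
  fixes h :: "nat \<Rightarrow> 'y \<Rightarrow> 'y" and n :: nat and y :: 'y
begin

text \<open>
  \<open>sorted_action u\<close> applies the operators \<open>h\<close> along a sequence of descents that sorts \<open>u\<close>. For braid
  operators the choice of the descents does not matter (\<open>sorted_action_descent\<close>), as in Matsumoto's
  theorem; for \<open>h a = g\<^sub>a\<close> this is the standard basis element of a permutation applied to \<open>y\<close>.
\<close>

function sorted_action :: "(nat \<Rightarrow> nat) \<Rightarrow> 'y" where
  "sorted_action u = (if \<exists>a\<in>{1..<n}. u a > u (Suc a)
     then let a = (LEAST a. a \<in> {1..<n} \<and> u a > u (Suc a)) in h a (sorted_action (u \<circ> transpose a (Suc a)))
     else y)"
  by pat_completeness auto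
termination
proof (relation "measure (sort_measure n)")
  fix u :: "nat \<Rightarrow> nat" and a assume "\<exists>a\<in>{1..<n}. u (Suc a) < u a" and a: "a = (LEAST a. a \<in> {1..<n} \<and> u (Suc a) < u a)"
  then have "\<exists>a. a \<in> {1..<n} \<and> u (Suc a) < u a" by blast
  from LeastI_ex[OF this] show "(u \<circ> transpose a (Suc a), u) \<in> measure (sort_measure n)"
    using sort_measure_swap[of a n u] a by simp
qed simp

declare sorted_action.simps [simp del]

lemma sorted_action_closed:
  assumes "y \<in> C" "\<And>a z. \<lbrakk>a \<in> {1..<n}; z \<in> C\<rbrakk> \<Longrightarrow> h a z \<in> C"
  shows "sorted_action u \<in> C"
proof (induction u rule: sorted_action.induct)
  case (1 u)
  show ?case
  proof (cases "\<exists>a\<in>{1..<n}. u a > u (Suc a)")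
    case True
    then have "\<exists>a. a \<in> {1..<n} \<and> u a > u (Suc a)" by blast
    from LeastI_ex[OF this] 1[OF True refl] show ?thesis
      using True assms(2) by (subst sorted_action.simps) (simp add: Let_def del: o_apply)
  next
    case False
    then show ?thesis using assms(1) by (subst sorted_action.simps) simp
  qed
qed

lemma sorted_action_descent:
  assumes y: "y \<in> C" and closed: "\<And>a z. \<lbrakk>a \<in> {1..<n}; z \<in> C\<rbrakk> \<Longrightarrow> h a z \<in> C"
    and braid: "\<And>a z. \<lbrakk>a \<in> {1..<n}; Suc a \<in> {1..<n}; z \<in> C\<rbrakk> \<Longrightarrow>
      h a (h (Suc a) (h a z)) = h (Suc a) (h a (h (Suc a) z))"
    and comm: "\<And>a b z. \<lbrakk>a \<in> {1..<n}; b \<in> {1..<n}; Suc a < b; z \<in> C\<rbrakk> \<Longrightarrow> h a (h b z) = h b (h a z)"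
    and a: "a \<in> {1..<n}" "u a > u (Suc a)"
  shows "sorted_action u = h a (sorted_action (u \<circ> transpose a (Suc a)))"
  using a
proof (induction "sort_measure n u" arbitrary: u a rule: less_induct)
  case less
  let ?s = "\<lambda>u a. u \<circ> transpose a (Suc a)"
  have C: "sorted_action u \<in> C" for u using sorted_action_closed[OF y closed] .
  have IH: "sorted_action w = h b (sorted_action (?s w b))"
    if "sort_measure n w < sort_measure n u" "b \<in> {1..<n}" "w b > w (Suc b)" for w b
    using less.hyps that by blast
  note m = sort_measure_swap
  \<comment> \<open>Any two descents lead to a common word: the local confluence behind Matsumoto's theorem.\<close>
  have conf: "h a (sorted_action (?s u a)) = h b (sorted_action (?s u b))"
    if ab: "a \<in> {1..<n}" "u a > u (Suc a)" "b \<in> {1..<n}" "u b > u (Suc b)" "a < b" for a b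
  proof (cases "Suc a < b")
    case True
    have c: "?s (?s u a) b = ?s (?s u b) a" using True by (auto simp: fun_eq_iff transpose_def)
    have "sorted_action (?s u a) = h b (sorted_action (?s (?s u a) b))"
      using ab True by (intro IH m) (auto simp: transpose_def)
    moreover have "sorted_action (?s u b) = h a (sorted_action (?s (?s u b) a))"
      using ab True by (intro IH m) (auto simp: transpose_def)
    ultimately show ?thesis using comm[OF ab(1,3) True C] c by simp
  next
    case False
    then have b: "b = Suc a" using ab by simp
    let ?u1 = "?s u a" and ?u2 = "?s u (Suc a)"
    have c: "?s (?s ?u1 (Suc a)) a = ?s (?s ?u2 a) (Suc a)" by (auto simp: fun_eq_iff transpose_def)
    have m1: "sort_measure n ?u1 < sort_measure n u" "sort_measure n ?u2 < sort_measure n u"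
      using ab b by (auto intro!: m)
    have v1: "?u1 (Suc a) > ?u1 (Suc (Suc a))" "?u2 a > ?u2 (Suc a)"
      "(?s ?u1 (Suc a)) a > (?s ?u1 (Suc a)) (Suc a)" "(?s ?u2 a) (Suc a) > (?s ?u2 a) (Suc (Suc a))"
      using ab b by (auto simp: transpose_def)
    have m2: "sort_measure n (?s ?u1 (Suc a)) < sort_measure n u" "sort_measure n (?s ?u2 a) < sort_measure n u"
      using m1 m[of "Suc a" n ?u1] m[of a n ?u2] v1 ab b by (auto simp del: o_apply intro: less_trans)
    have "sorted_action ?u1 = h (Suc a) (h a (sorted_action (?s (?s ?u1 (Suc a)) a)))"
      using IH[OF m1(1) _ v1(1)] IH[OF m2(1) _ v1(3)] ab b by (simp del: o_apply)
    moreover have "sorted_action ?u2 = h a (h (Suc a) (sorted_action (?s (?s ?u2 a) (Suc a))))"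
      using IH[OF m1(2) _ v1(2)] IH[OF m2(2) _ v1(4)] ab b by (simp del: o_apply)
    ultimately show ?thesis using braid[of a, OF _ _ C] ab b c by (simp del: o_apply)
  qed
  have ex: "\<exists>a. a \<in> {1..<n} \<and> u a > u (Suc a)" using less.prems by blast
  define b where "b = (LEAST a. a \<in> {1..<n} \<and> u a > u (Suc a))"
  have b: "b \<in> {1..<n}" "u b > u (Suc b)" using LeastI_ex[OF ex] unfolding b_def by auto
  have "sorted_action u = h b (sorted_action (?s u b))"
    using ex by (subst sorted_action.simps) (auto simp: Let_def b_def)
  also have "\<dots> = h a (sorted_action (?s u a))"
  proof (cases a b rule: linorder_cases)
    case less
    from conf[OF \<open>a \<in> {1..<n}\<close> \<open>u a > u (Suc a)\<close> b less] show ?thesis by (rule sym)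
  next
    case equal then show ?thesis by (simp only:)
  next
    case greater
    from conf[OF b \<open>a \<in> {1..<n}\<close> \<open>u a > u (Suc a)\<close> greater] show ?thesis .
  qed
  finally show ?case .
qed

lemma sorted_action_sorted:
  "(\<And>a. a \<in> {1..<n} \<Longrightarrow> u a \<le> u (Suc a)) \<Longrightarrow> sorted_action u = y"
  by (subst sorted_action.simps) (auto simp: not_less[symmetric])

end

lemma increasing_permutation_id:
  fixes u :: "nat \<Rightarrow> nat"
  assumes p: "p permutes {1..n}" and inc: "\<And>i j. \<lbrakk>i \<in> {1..n}; j \<in> {1..n}; i < j\<rbrakk> \<Longrightarrow> u i < u j"
    and s: "\<And>a. a \<in> {1..<n} \<Longrightarrow> u (p a) \<le> u (p (Suc a))"
  shows "p = id"
proof -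
  have step: "p a < p (Suc a)" if a: "a \<in> {1..<n}" for a
  proof -
    have m: "p a \<in> {1..n}" "p (Suc a) \<in> {1..n}" using a permutes_in_image[OF p] by auto
    have "p a \<noteq> p (Suc a)" using permutes_inj[OF p] by (metis injD n_not_Suc_n)
    then show ?thesis using s[OF a] inc[OF m(2,1)] by (cases "p a" "p (Suc a)" rule: linorder_cases) auto
  qed
  have ge: "i \<le> p i" if "1 \<le> i" "i \<le> n" for i
    using that
  proof (induction i rule: dec_induct)
    case base then show ?case using permutes_in_image[OF p, of 1] by auto
  next
    case (step i) then show ?case using \<open>\<And>a. a \<in> {1..<n} \<Longrightarrow> p a < p (Suc a)\<close>[of i] by auto
  qed
  have "(\<Sum>i\<in>{1..n}. p i) = (\<Sum>i\<in>{1..n}. i)"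
    using sum.permute[OF p, of "\<lambda>i. i"] by (simp add: comp_def)
  then have "\<forall>i\<in>{1..n}. p i = i"
    using ge sum_strict_mono_ex1[of "{1..n}" "\<lambda>i. i" p] by (metis atLeastAtMost_iff finite_atLeastAtMost le_neq_implies_less nat_neq_iff)
  then show ?thesis using permutes_not_in[OF p] by (auto simp: fun_eq_iff)
qed

section \<open>Faithfulness\<close>

context yh_representation
begin

lemma eY_eigen:
  assumes a: "a \<in> {1..<n}" and z: "z \<in> carrier Y"
    and e: "t a \<otimes>\<^bsub>Y\<^esub> z = sc \<zeta> \<otimes>\<^bsub>Y\<^esub> z" "t (Suc a) \<otimes>\<^bsub>Y\<^esub> z = sc \<zeta>' \<otimes>\<^bsub>Y\<^esub> z"
    and \<zeta>: "\<zeta> \<in> S" "\<zeta>' \<in> S" "\<zeta> ^ d = 1" "\<zeta>' ^ d = 1"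
  shows "eY a \<otimes>\<^bsub>Y\<^esub> z = (if \<zeta> = \<zeta>' then z else \<zero>\<^bsub>Y\<^esub>)"
proof -
  have tc: "t a \<in> carrier Y" "t (Suc a) \<in> carrier Y" using t_closed a by auto
  have pw: "x [^]\<^bsub>Y\<^esub> (k::nat) \<otimes>\<^bsub>Y\<^esub> z = sc (\<eta> ^ k) \<otimes>\<^bsub>Y\<^esub> z"
    if "x \<in> carrier Y" "\<eta> \<in> S" "x \<otimes>\<^bsub>Y\<^esub> z = sc \<eta> \<otimes>\<^bsub>Y\<^esub> z" for x \<eta> k
  proof (induction k)
    case 0 then show ?case by (simp add: sc_1)
  next
    case (Suc k)
    have s: "sc \<eta> \<in> carrier Y" "sc (\<eta> ^ k) \<in> carrier Y" using that sc_closed power_mem by auto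
    have "x [^]\<^bsub>Y\<^esub> Suc k \<otimes>\<^bsub>Y\<^esub> z = x [^]\<^bsub>Y\<^esub> k \<otimes>\<^bsub>Y\<^esub> (x \<otimes>\<^bsub>Y\<^esub> z)"
      using that z by (simp add: Y.m_assoc)
    also have "\<dots> = (x [^]\<^bsub>Y\<^esub> k \<otimes>\<^bsub>Y\<^esub> sc \<eta>) \<otimes>\<^bsub>Y\<^esub> z" using that s z by (simp add: Y.m_assoc)
    also have "x [^]\<^bsub>Y\<^esub> k \<otimes>\<^bsub>Y\<^esub> sc \<eta> = sc \<eta> \<otimes>\<^bsub>Y\<^esub> x [^]\<^bsub>Y\<^esub> k"
      using sc_central[OF that(2), of "x [^]\<^bsub>Y\<^esub> k"] that(1) by simp
    also have "(sc \<eta> \<otimes>\<^bsub>Y\<^esub> x [^]\<^bsub>Y\<^esub> k) \<otimes>\<^bsub>Y\<^esub> z = sc \<eta> \<otimes>\<^bsub>Y\<^esub> (sc (\<eta> ^ k) \<otimes>\<^bsub>Y\<^esub> z)"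
      using that s z Suc by (simp add: Y.m_assoc)
    also have "\<dots> = sc (\<eta> ^ Suc k) \<otimes>\<^bsub>Y\<^esub> z"
      using that s z by (simp add: sc_mult power_mem Y.m_assoc)
    finally show ?case .
  qed
  let ?f = "\<lambda>r. (t a [^]\<^bsub>Y\<^esub> (r::nat)) \<otimes>\<^bsub>Y\<^esub> (t (Suc a) [^]\<^bsub>Y\<^esub> (d - r))"
  let ?\<mu> = "\<lambda>r. \<zeta> ^ r * \<zeta>' ^ (d - r)"
  have \<mu>: "?\<mu> r \<in> S" for r using \<zeta> power_mem mult_mem by auto
  have f: "?f r \<otimes>\<^bsub>Y\<^esub> z = sc (?\<mu> r) \<otimes>\<^bsub>Y\<^esub> z" for r
  proof -
    have s: "sc (\<zeta> ^ r) \<in> carrier Y" "sc (\<zeta>' ^ (d - r)) \<in> carrier Y" using \<zeta> sc_closed power_mem by auto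
    have "?f r \<otimes>\<^bsub>Y\<^esub> z = t a [^]\<^bsub>Y\<^esub> r \<otimes>\<^bsub>Y\<^esub> (sc (\<zeta>' ^ (d - r)) \<otimes>\<^bsub>Y\<^esub> z)"
      using tc z pw[OF tc(2) \<zeta>(2) e(2)] by (simp add: Y.m_assoc)
    also have "\<dots> = (sc (\<zeta>' ^ (d - r)) \<otimes>\<^bsub>Y\<^esub> t a [^]\<^bsub>Y\<^esub> r) \<otimes>\<^bsub>Y\<^esub> z"
      using sc_central[of "\<zeta>' ^ (d - r)" "t a [^]\<^bsub>Y\<^esub> r"] \<zeta> power_mem tc s z by (simp add: Y.m_assoc)
    also have "\<dots> = sc (\<zeta>' ^ (d - r)) \<otimes>\<^bsub>Y\<^esub> (sc (\<zeta> ^ r) \<otimes>\<^bsub>Y\<^esub> z)"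
      using tc s z pw[OF tc(1) \<zeta>(1) e(1)] by (simp add: Y.m_assoc)
    also have "\<dots> = sc (?\<mu> r) \<otimes>\<^bsub>Y\<^esub> z"
      using \<zeta> s z by (simp add: sc_mult power_mem Y.m_assoc mult.commute[of "\<zeta> ^ r"])
    finally show ?thesis .
  qed
  have sum: "finsum Y (\<lambda>r. sc (?\<mu> r) \<otimes>\<^bsub>Y\<^esub> z) A = sc (\<Sum>r\<in>A. ?\<mu> r) \<otimes>\<^bsub>Y\<^esub> z" if "finite A" for A :: "nat set"
    using that
  proof (induction A rule: finite_induct)
    case empty then show ?case using z by (simp add: sc_0)
  next
    case (insert r A)
    then show ?case using z \<mu> by (simp add: sc_closed sc_add sum_mem Y.l_distr Pi_def)
  qed
  have fc: "?f \<in> {..<d} \<rightarrow> carrier Y" using tc by auto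
  have "finsum Y ?f {..<d} \<otimes>\<^bsub>Y\<^esub> z = finsum Y (\<lambda>r. ?f r \<otimes>\<^bsub>Y\<^esub> z) {..<d}"
    by (rule Y.finsum_ldistr[OF _ z fc]) simp
  also have "\<dots> = sc (if \<zeta> = \<zeta>' then of_nat d else 0) \<otimes>\<^bsub>Y\<^esub> z"
    unfolding f using sum[of "{..<d}"] root_of_unity_sum[OF \<zeta>(3,4)] by simp
  finally have "eY a \<otimes>\<^bsub>Y\<^esub> z = sc (inverse (of_nat d)) \<otimes>\<^bsub>Y\<^esub> (sc (if \<zeta> = \<zeta>' then of_nat d else 0) \<otimes>\<^bsub>Y\<^esub> z)"
    unfolding eY_def using Y.finsum_closed[OF fc] sc_closed[OF d_inv_mem] z by (simp add: Y.m_assoc)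
  also have "\<dots> = sc (inverse (of_nat d) * (if \<zeta> = \<zeta>' then of_nat d else 0)) \<otimes>\<^bsub>Y\<^esub> z"
    using z sc_closed d_inv_mem of_nat_mem zero_mem by (simp add: sc_mult Y.m_assoc)
  also have "\<dots> = (if \<zeta> = \<zeta>' then z else \<zero>\<^bsub>Y\<^esub>)"
    using d_nonzero z by (simp add: sc_1 sc_0)
  finally show ?thesis .
qed

lemma sc_sc: "c \<in> S \<Longrightarrow> c' \<in> S \<Longrightarrow> z \<in> carrier Y \<Longrightarrow> sc c \<otimes>\<^bsub>Y\<^esub> (sc c' \<otimes>\<^bsub>Y\<^esub> z) = sc (c * c') \<otimes>\<^bsub>Y\<^esub> z"
  by (simp add: sc_mult sc_closed Y.m_assoc)

lemma sc_out: "c \<in> S \<Longrightarrow> x \<in> carrier Y \<Longrightarrow> z \<in> carrier Y \<Longrightarrow> x \<otimes>\<^bsub>Y\<^esub> (sc c \<otimes>\<^bsub>Y\<^esub> z) = sc c \<otimes>\<^bsub>Y\<^esub> (x \<otimes>\<^bsub>Y\<^esub> z)"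
  using sc_central[of c x] by (simp add: sc_closed flip: Y.m_assoc)

lemma sc_distrib: "c \<in> S \<Longrightarrow> c' \<in> S \<Longrightarrow> z \<in> carrier Y \<Longrightarrow> (sc c \<otimes>\<^bsub>Y\<^esub> z) \<oplus>\<^bsub>Y\<^esub> (sc c' \<otimes>\<^bsub>Y\<^esub> z) = sc (c + c') \<otimes>\<^bsub>Y\<^esub> z"
  by (simp add: sc_add sc_closed Y.l_distr)

lemma word_ops_mem: "(\<And>u. m u \<in> S) \<Longrightarrow> word_ops \<xi> v w m u \<in> S"
proof (induction w arbitrary: u)
  case (Cons x w)
  then show ?case
    by (cases x) (auto simp: word_g_def word_t_def intro!: add_mem mult_mem diff_mem v_mem one_mem zero_mem power_mem \<xi>_mem)
qed simp

lemma eval_mem: "f \<in> carrier F \<Longrightarrow> (\<And>u. m u \<in> S) \<Longrightarrow> eval f m u \<in> S"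
  unfolding eval_def by (intro sum_mem mult_mem word_ops_mem) (auto simp: FA_carrier)

text \<open>
  The left ideal generated by a joint eigenvector \<open>y\<close> of the \<open>t\<^sub>a\<close> is spanned by the products of \<open>y\<close>
  with the standard elements of the permutations, indexed here by the rearrangements of a word \<open>u0\<close>
  with distinct letters. Multiplication by a generator changes the coefficients exactly as the
  generator acts on functions of words, so the coefficients of \<open>cls f y\<close> are read off from the action
  of \<open>f\<close> on the indicator function of \<open>u0\<close>.
\<close>

lemma cls_eq_orbit_sum:
  assumes y: "y \<in> carrier Y" and ty: "\<And>a. a \<in> {1..n} \<Longrightarrow> t a \<otimes>\<^bsub>Y\<^esub> y = sc (\<xi> ^ u0 a) \<otimes>\<^bsub>Y\<^esub> y"
    and inc: "\<And>i j. \<lbrakk>i \<in> {1..n}; j \<in> {1..n}; i < j\<rbrakk> \<Longrightarrow> u0 i < u0 j"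
    and f: "f \<in> carrier F"
  shows "cls f \<otimes>\<^bsub>Y\<^esub> y = (\<Oplus>\<^bsub>Y\<^esub>u\<in>{u0 \<circ> p | p. p permutes {1..n}}.
    sc (eval f (\<lambda>u. if u = u0 then 1 else 0) u) \<otimes>\<^bsub>Y\<^esub> sorted_action (\<lambda>a z. g a \<otimes>\<^bsub>Y\<^esub> z) n y u)"
proof -
  define W where "W = {u0 \<circ> p | p. p permutes {1..n}}"
  define \<Gamma> where "\<Gamma> = sorted_action (\<lambda>a z. g a \<otimes>\<^bsub>Y\<^esub> z) n y"
  let ?s = "\<lambda>u a. u \<circ> transpose a (Suc a)"
  have fin: "finite W" unfolding W_def by (simp add: finite_permutations setcompr_eq_image)
  have Ws: "?s u a \<in> W" if u: "u \<in> W" and a: "a \<in> {1..<n}" for u a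
  proof -
    obtain p where p: "u = u0 \<circ> p" "p permutes {1..n}" using u by (auto simp: W_def)
    have "p \<circ> transpose a (Suc a) permutes {1..n}"
      using a p by (intro permutes_compose permutes_swap_id) auto
    then show ?thesis unfolding W_def p o_assoc[symmetric] by blast
  qed
  have \<Gamma>c: "\<Gamma> u \<in> carrier Y" for u
    unfolding \<Gamma>_def using y g_closed by (intro sorted_action_closed) auto
  have desc: "\<Gamma> u = g a \<otimes>\<^bsub>Y\<^esub> \<Gamma> (?s u a)" if "a \<in> {1..<n}" "u a > u (Suc a)" for u a
    unfolding \<Gamma>_def
  proof (rule sorted_action_descent[OF y _ _ _ that])
    fix b z assume *: "b \<in> {1..<n}" "Suc b \<in> {1..<n}" "z \<in> carrier Y"
    show "g b \<otimes>\<^bsub>Y\<^esub> (g (Suc b) \<otimes>\<^bsub>Y\<^esub> (g b \<otimes>\<^bsub>Y\<^esub> z)) = g (Suc b) \<otimes>\<^bsub>Y\<^esub> (g b \<otimes>\<^bsub>Y\<^esub> (g (Suc b) \<otimes>\<^bsub>Y\<^esub> z))"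
      using g_braid[OF *(1,2)] g_closed[OF *(1)] g_closed[OF *(2)] *(3) by (simp flip: Y.m_assoc)
  next
    fix b c z assume *: "b \<in> {1..<n}" "c \<in> {1..<n}" "Suc b < c" "z \<in> carrier Y"
    show "g b \<otimes>\<^bsub>Y\<^esub> (g c \<otimes>\<^bsub>Y\<^esub> z) = g c \<otimes>\<^bsub>Y\<^esub> (g b \<otimes>\<^bsub>Y\<^esub> z)"
      using g_comm[OF *(1,2,3)] g_closed[OF *(1)] g_closed[OF *(2)] *(4) by (simp flip: Y.m_assoc)
  qed (use g_closed in auto)
  have sorted: "u = u0" if u: "u \<in> W" and s: "\<And>a. a \<in> {1..<n} \<Longrightarrow> u a \<le> u (Suc a)" for u
  proof -
    obtain p where p: "u = u0 \<circ> p" "p permutes {1..n}" using u by (auto simp: W_def)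
    have "p = id" by (rule increasing_permutation_id[OF p(2) inc]) (use s p in auto)
    then show ?thesis using p by simp
  qed
  have u0: "u0 \<in> W" unfolding W_def using permutes_id by (force intro: exI[of _ id])
  have \<Gamma>0: "\<Gamma> u0 = y" unfolding \<Gamma>_def
  proof (rule sorted_action_sorted)
    fix a assume "a \<in> {1..<n}"
    then show "u0 a \<le> u0 (Suc a)" using inc[of a "Suc a"] by auto
  qed
  have ne: "u a \<noteq> u (Suc a)" if u: "u \<in> W" and a: "a \<in> {1..<n}" for u a
  proof -
    obtain p where p: "u = u0 \<circ> p" "p permutes {1..n}" using u by (auto simp: W_def)
    have m: "p a \<in> {1..n}" "p (Suc a) \<in> {1..n}" using a permutes_in_image[OF p(2)] by auto
    have "p a \<noteq> p (Suc a)" using permutes_inj[OF p(2)] by (metis injD n_not_Suc_n)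
    then show ?thesis using inc[OF m] inc[OF m(2,1)] p by (cases "p a" "p (Suc a)" rule: linorder_cases) auto
  qed
  have \<xi>S: "\<xi> ^ k \<in> S" for k by (intro power_mem \<xi>_mem)
  have t\<Gamma>: "t a \<otimes>\<^bsub>Y\<^esub> \<Gamma> u = sc (\<xi> ^ u a) \<otimes>\<^bsub>Y\<^esub> \<Gamma> u" if "u \<in> W" "a \<in> {1..n}" for u a
    using that
  proof (induction "sort_measure n u" arbitrary: u a rule: less_induct)
    case less
    show ?case
    proof (cases "\<exists>b\<in>{1..<n}. u b > u (Suc b)")
      case False
      then have "u = u0" using sorted[OF less.prems(1)] by (meson not_le)
      then show ?thesis using ty less.prems \<Gamma>0 by simp
    next
      case True
      then obtain b where b: "b \<in> {1..<n}" "u b > u (Suc b)" by blast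
      let ?a = "transpose b (Suc b) a"
      have a': "?a \<in> {1..n}" using transpose_in[OF less.prems(2) b(1)] by simp
      have IH: "t ?a \<otimes>\<^bsub>Y\<^esub> \<Gamma> (?s u b) = sc (\<xi> ^ u a) \<otimes>\<^bsub>Y\<^esub> \<Gamma> (?s u b)"
        using less.hyps[OF sort_measure_swap[of b n u, OF b] Ws[OF less.prems(1) b(1)] a'] by simp
      have "t a \<otimes>\<^bsub>Y\<^esub> \<Gamma> u = g b \<otimes>\<^bsub>Y\<^esub> (t ?a \<otimes>\<^bsub>Y\<^esub> \<Gamma> (?s u b))"
        using desc[of b u, OF b] t_g[OF less.prems(2) b(1)] t_closed[OF less.prems(2)] t_closed[OF a'] g_closed[OF b(1)] \<Gamma>c
        by (simp flip: Y.m_assoc)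
      also have "\<dots> = sc (\<xi> ^ u a) \<otimes>\<^bsub>Y\<^esub> \<Gamma> u"
        unfolding IH using sc_out[OF \<xi>S g_closed[OF b(1)] \<Gamma>c] desc[of b u, OF b] by simp
      finally show ?thesis .
    qed
  qed
  define \<kappa> where "\<kappa> u a = (if u a < u (Suc a) then 1 else v)" for u :: "nat \<Rightarrow> nat" and a
  define \<delta> where "\<delta> u a = (if u a > u (Suc a) \<and> \<xi> ^ u a = \<xi> ^ u (Suc a) then v - 1 else 0)" for u :: "nat \<Rightarrow> nat" and a
  have \<kappa>\<delta>: "\<kappa> u a \<in> S" "\<delta> u a \<in> S" for u a
    by (auto simp: \<kappa>_def \<delta>_def v_mem one_mem zero_mem diff_mem)
  have g\<Gamma>: "g a \<otimes>\<^bsub>Y\<^esub> \<Gamma> u = (sc (\<kappa> u a) \<otimes>\<^bsub>Y\<^esub> \<Gamma> (?s u a)) \<oplus>\<^bsub>Y\<^esub> (sc (\<delta> u a) \<otimes>\<^bsub>Y\<^esub> \<Gamma> u)"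
    if u: "u \<in> W" and a: "a \<in> {1..<n}" for u a
  proof (cases "u a < u (Suc a)")
    case True
    have "\<Gamma> (?s u a) = g a \<otimes>\<^bsub>Y\<^esub> \<Gamma> u" using desc[OF a, of "?s u a"] True by simp
    then show ?thesis using True \<Gamma>c[of u] g_closed[OF a] by (simp add: \<kappa>_def \<delta>_def sc_0 sc_1)
  next
    case False
    then have lt: "u a > u (Suc a)" using ne[OF u a] by simp
    have d: "\<Gamma> u = g a \<otimes>\<^bsub>Y\<^esub> \<Gamma> (?s u a)" using desc[of a u, OF a lt] .
    have aa: "a \<in> {1..n}" "Suc a \<in> {1..n}" using a by auto
    have e: "eY a \<otimes>\<^bsub>Y\<^esub> \<Gamma> u = (if \<xi> ^ u a = \<xi> ^ u (Suc a) then \<Gamma> u else \<zero>\<^bsub>Y\<^esub>)"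
      by (rule eY_eigen[OF a \<Gamma>c t\<Gamma>[OF u aa(1)] t\<Gamma>[OF u aa(2)] \<xi>S \<xi>S \<xi>_pow_pow_d \<xi>_pow_pow_d])
    have c: "sc v \<in> carrier Y" "sc (v - 1) \<in> carrier Y" using sc_closed v_mem one_mem diff_mem by auto
    have "g a \<otimes>\<^bsub>Y\<^esub> \<Gamma> u = (g a \<otimes>\<^bsub>Y\<^esub> g a) \<otimes>\<^bsub>Y\<^esub> \<Gamma> (?s u a)"
      unfolding d using g_closed[OF a] \<Gamma>c by (simp add: Y.m_assoc)
    also have "\<dots> = (sc v \<otimes>\<^bsub>Y\<^esub> \<Gamma> (?s u a)) \<oplus>\<^bsub>Y\<^esub> (sc (v - 1) \<otimes>\<^bsub>Y\<^esub> (eY a \<otimes>\<^bsub>Y\<^esub> \<Gamma> u))"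
      unfolding g_square[OF a] using g_closed[OF a] \<Gamma>c c eY_closed[OF a] d
      by (simp add: Y.l_distr Y.m_assoc)
    finally show ?thesis using False lt c \<Gamma>c[of u] by (simp add: e \<kappa>_def \<delta>_def sc_0)
  qed
  have step: "cls (fa_gen R x) \<otimes>\<^bsub>Y\<^esub> (\<Oplus>\<^bsub>Y\<^esub>u\<in>W. sc (m u) \<otimes>\<^bsub>Y\<^esub> \<Gamma> u) = (\<Oplus>\<^bsub>Y\<^esub>u\<in>W. sc (word_op \<xi> v x m u) \<otimes>\<^bsub>Y\<^esub> \<Gamma> u)"
    if x: "x \<in> yh_gens n" and m: "\<And>u. m u \<in> S" for x m
  proof -
    have xc: "cls (fa_gen R x) \<in> carrier Y" using gen_carrier[OF x] by simp
    have c: "(\<lambda>u. sc (m' u) \<otimes>\<^bsub>Y\<^esub> \<Gamma> (k u)) \<in> W \<rightarrow> carrier Y" if "\<And>u. m' u \<in> S" for m' k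
      using that sc_closed \<Gamma>c by auto
    have 1: "cls (fa_gen R x) \<otimes>\<^bsub>Y\<^esub> (\<Oplus>\<^bsub>Y\<^esub>u\<in>W. sc (m u) \<otimes>\<^bsub>Y\<^esub> \<Gamma> u) =
        (\<Oplus>\<^bsub>Y\<^esub>u\<in>W. sc (m u) \<otimes>\<^bsub>Y\<^esub> (cls (fa_gen R x) \<otimes>\<^bsub>Y\<^esub> \<Gamma> u))"
      using Y.finsum_rdistr[OF fin xc c[OF m, of "\<lambda>u. u"]] m xc \<Gamma>c by (simp add: sc_out)
    show ?thesis
    proof (cases x)
      case (Gen_t a)
      then have a: "a \<in> {1..n}" using x by (auto simp: yh_gens_def)
      show ?thesis unfolding 1
      proof (rule Y.finsum_cong')
        fix u assume "u \<in> W"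
        then show "sc (m u) \<otimes>\<^bsub>Y\<^esub> (cls (fa_gen R x) \<otimes>\<^bsub>Y\<^esub> \<Gamma> u) = sc (word_op \<xi> v x m u) \<otimes>\<^bsub>Y\<^esub> \<Gamma> u"
          using t\<Gamma>[OF _ a, of u] Gen_t m \<Gamma>c by (simp add: yh_t_def sc_sc \<xi>S word_t_def mult.commute)
      qed (use c[of "word_op \<xi> v x m" "\<lambda>u. u"] Gen_t m in \<open>auto simp: word_t_def mult_mem \<xi>S\<close>)
    next
      case (Gen_g a)
      then have a: "a \<in> {1..<n}" using x by (auto simp: yh_gens_def)
      have i: "inj_on (\<lambda>u. ?s u a) W" by (rule inj_onI) (metis transpose_comp_self)
      have im: "(\<lambda>u. ?s u a) ` W = W"
      proof
        show "W \<subseteq> (\<lambda>u. ?s u a) ` W" using Ws[OF _ a] by (metis image_eqI subsetI transpose_comp_self)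
      qed (use Ws a in blast)
      have k: "m u * \<kappa> u a \<in> S" "m u * \<delta> u a \<in> S" for u using m \<kappa>\<delta> mult_mem by auto
      have w: "word_g \<xi> v a m u = m (?s u a) * \<kappa> (?s u a) a + m u * \<delta> u a" if "u \<in> W" for u
        using ne[OF that a] by (auto simp: word_g_def \<kappa>_def \<delta>_def)
      have "(\<Oplus>\<^bsub>Y\<^esub>u\<in>W. sc (m u) \<otimes>\<^bsub>Y\<^esub> (cls (fa_gen R x) \<otimes>\<^bsub>Y\<^esub> \<Gamma> u)) =
          (\<Oplus>\<^bsub>Y\<^esub>u\<in>W. (sc (m u * \<kappa> u a) \<otimes>\<^bsub>Y\<^esub> \<Gamma> (?s u a)) \<oplus>\<^bsub>Y\<^esub> (sc (m u * \<delta> u a) \<otimes>\<^bsub>Y\<^esub> \<Gamma> u))"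
      proof (rule Y.finsum_cong')
        fix u assume u: "u \<in> W"
        have "sc (m u) \<otimes>\<^bsub>Y\<^esub> (cls (fa_gen R x) \<otimes>\<^bsub>Y\<^esub> \<Gamma> u) =
            sc (m u) \<otimes>\<^bsub>Y\<^esub> ((sc (\<kappa> u a) \<otimes>\<^bsub>Y\<^esub> \<Gamma> (?s u a)) \<oplus>\<^bsub>Y\<^esub> (sc (\<delta> u a) \<otimes>\<^bsub>Y\<^esub> \<Gamma> u))"
          using g\<Gamma>[OF u a] Gen_g by (simp add: yh_g_def)
        then show "sc (m u) \<otimes>\<^bsub>Y\<^esub> (cls (fa_gen R x) \<otimes>\<^bsub>Y\<^esub> \<Gamma> u) =
            (sc (m u * \<kappa> u a) \<otimes>\<^bsub>Y\<^esub> \<Gamma> (?s u a)) \<oplus>\<^bsub>Y\<^esub> (sc (m u * \<delta> u a) \<otimes>\<^bsub>Y\<^esub> \<Gamma> u)"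
          using m \<kappa>\<delta> \<Gamma>c by (simp add: Y.r_distr sc_closed sc_sc)
      qed (use k \<Gamma>c sc_closed in auto)
      also have "\<dots> = (\<Oplus>\<^bsub>Y\<^esub>u\<in>W. sc (m u * \<kappa> u a) \<otimes>\<^bsub>Y\<^esub> \<Gamma> (?s u a)) \<oplus>\<^bsub>Y\<^esub> (\<Oplus>\<^bsub>Y\<^esub>u\<in>W. sc (m u * \<delta> u a) \<otimes>\<^bsub>Y\<^esub> \<Gamma> u)"
        by (rule Y.finsum_addf[OF c[OF k(1)] c[OF k(2), of "\<lambda>u. u"]])
      also have "(\<Oplus>\<^bsub>Y\<^esub>u\<in>W. sc (m u * \<kappa> u a) \<otimes>\<^bsub>Y\<^esub> \<Gamma> (?s u a)) =
          (\<Oplus>\<^bsub>Y\<^esub>u\<in>(\<lambda>u. ?s u a) ` W. sc (m (?s u a) * \<kappa> (?s u a) a) \<otimes>\<^bsub>Y\<^esub> \<Gamma> u)"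
        by (subst Y.finsum_reindex[OF _ i]) (use k \<Gamma>c sc_closed in \<open>auto simp del: o_apply\<close>)
      also have "\<dots> \<oplus>\<^bsub>Y\<^esub> (\<Oplus>\<^bsub>Y\<^esub>u\<in>W. sc (m u * \<delta> u a) \<otimes>\<^bsub>Y\<^esub> \<Gamma> u) =
          (\<Oplus>\<^bsub>Y\<^esub>u\<in>W. (sc (m (?s u a) * \<kappa> (?s u a) a) \<otimes>\<^bsub>Y\<^esub> \<Gamma> u) \<oplus>\<^bsub>Y\<^esub> (sc (m u * \<delta> u a) \<otimes>\<^bsub>Y\<^esub> \<Gamma> u))"
        unfolding im by (rule Y.finsum_addf[symmetric]) (use k \<Gamma>c sc_closed in \<open>auto simp del: o_apply\<close>)
      also have "\<dots> = (\<Oplus>\<^bsub>Y\<^esub>u\<in>W. sc (word_op \<xi> v x m u) \<otimes>\<^bsub>Y\<^esub> \<Gamma> u)"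
      proof (rule Y.finsum_cong')
        fix u assume "u \<in> W"
        then show "(sc (m (?s u a) * \<kappa> (?s u a) a) \<otimes>\<^bsub>Y\<^esub> \<Gamma> u) \<oplus>\<^bsub>Y\<^esub> (sc (m u * \<delta> u a) \<otimes>\<^bsub>Y\<^esub> \<Gamma> u) =
            sc (word_op \<xi> v x m u) \<otimes>\<^bsub>Y\<^esub> \<Gamma> u"
          unfolding sc_distrib[OF k(1) k(2) \<Gamma>c] using w Gen_g by simp
      next
        show "(\<lambda>u. sc (word_op \<xi> v x m u) \<otimes>\<^bsub>Y\<^esub> \<Gamma> u) \<in> W \<rightarrow> carrier Y"
          using w Gen_g k add_mem sc_closed \<Gamma>c by (auto simp del: o_apply)
      qed simp
      finally show ?thesis unfolding 1 .
    qed
  qed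
  let ?e = "\<lambda>u. if u = u0 then 1 else 0 :: 'f"
  have e: "?e u \<in> S" for u by (simp add: zero_mem one_mem)
  have "cls f \<otimes>\<^bsub>Y\<^esub> y = (\<Oplus>\<^bsub>Y\<^esub>u\<in>W. sc (eval f ?e u) \<otimes>\<^bsub>Y\<^esub> \<Gamma> u)"
    using f
  proof (induction rule: free_algebra_induct)
    case zero
    have "cls (\<lambda>w. 0) = \<zero>\<^bsub>Y\<^esub>" using cls.hom_zero by (simp add: FA_zero)
    then show ?case using y \<Gamma>c by (simp add: eval_zero sc_0)
  next
    case (add f f')
    have s: "eval f ?e u \<in> S" "eval f' ?e u \<in> S" for u using eval_mem e add by auto
    have "cls (\<lambda>w. f w + f' w) = cls f \<oplus>\<^bsub>Y\<^esub> cls f'" using cls.hom_add[OF add(1,2)] by (simp add: FA_add)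
    then have "cls (\<lambda>w. f w + f' w) \<otimes>\<^bsub>Y\<^esub> y = (\<Oplus>\<^bsub>Y\<^esub>u\<in>W. sc (eval f ?e u) \<otimes>\<^bsub>Y\<^esub> \<Gamma> u) \<oplus>\<^bsub>Y\<^esub> (\<Oplus>\<^bsub>Y\<^esub>u\<in>W. sc (eval f' ?e u) \<otimes>\<^bsub>Y\<^esub> \<Gamma> u)"
      using add y by (simp add: Y.l_distr)
    also have "\<dots> = (\<Oplus>\<^bsub>Y\<^esub>u\<in>W. (sc (eval f ?e u) \<otimes>\<^bsub>Y\<^esub> \<Gamma> u) \<oplus>\<^bsub>Y\<^esub> (sc (eval f' ?e u) \<otimes>\<^bsub>Y\<^esub> \<Gamma> u))"
      using s sc_closed \<Gamma>c by (intro Y.finsum_addf[symmetric]) auto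
    finally show ?case using sc_distrib[OF s \<Gamma>c] by (simp add: eval_add[OF add(1,2)])
  next
    case (monom c w)
    then show ?case
    proof (induction w)
      case Nil
      have "(\<Oplus>\<^bsub>Y\<^esub>u\<in>W. sc (c * ?e u) \<otimes>\<^bsub>Y\<^esub> \<Gamma> u) = (\<Oplus>\<^bsub>Y\<^esub>u\<in>W. if u0 = u then sc c \<otimes>\<^bsub>Y\<^esub> \<Gamma> u else \<zero>\<^bsub>Y\<^esub>)"
        by (rule Y.finsum_cong') (use \<Gamma>c sc_closed Nil in \<open>auto simp: sc_0\<close>)
      also have "\<dots> = sc c \<otimes>\<^bsub>Y\<^esub> y"
        using Y.finsum_singleton[OF u0 fin, of "\<lambda>u. sc c \<otimes>\<^bsub>Y\<^esub> \<Gamma> u"] \<Gamma>c sc_closed Nil \<Gamma>0 by simp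
      finally show ?case by (simp add: eval_monom yh_scalar_def const_word_monom)
    next
      case (Cons x w)
      have x: "x \<in> yh_gens n" "w \<in> lists (yh_gens n)" using Cons.prems by auto
      have w: "word_monom c w \<in> carrier F" using word_monom_carrier[OF Cons.prems(1) x(2)] .
      have "cls (word_monom c (x # w)) \<otimes>\<^bsub>Y\<^esub> y = cls (fa_gen R x) \<otimes>\<^bsub>Y\<^esub> (cls (word_monom c w) \<otimes>\<^bsub>Y\<^esub> y)"
        using word_monom_mult_gen[OF Cons.prems(1) x] gen_carrier[OF x(1)] w y by (simp add: Y.m_assoc)
      also have "\<dots> = (\<Oplus>\<^bsub>Y\<^esub>u\<in>W. sc (word_op \<xi> v x (eval (word_monom c w) ?e) u) \<otimes>\<^bsub>Y\<^esub> \<Gamma> u)"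
        unfolding Cons.IH[OF Cons.prems(1) x(2)] by (rule step[OF x(1) eval_mem[OF w e]])
      finally show ?case by (simp add: eval_monom word_op_linear)
    qed
  qed
  then show ?thesis by (simp add: W_def \<Gamma>_def)
qed

lemma finsum_swap:
  assumes "finite A" "finite B" "\<And>i j. f i j \<in> carrier Y"
  shows "(\<Oplus>\<^bsub>Y\<^esub>i\<in>A. \<Oplus>\<^bsub>Y\<^esub>j\<in>B. f i j) = (\<Oplus>\<^bsub>Y\<^esub>j\<in>B. \<Oplus>\<^bsub>Y\<^esub>i\<in>A. f i j)"
  using assms(1)
proof (induction A rule: finite_induct)
  case (insert i A)
  have "(\<Oplus>\<^bsub>Y\<^esub>j\<in>B. \<Oplus>\<^bsub>Y\<^esub>i\<in>insert i A. f i j) = (\<Oplus>\<^bsub>Y\<^esub>j\<in>B. f i j \<oplus>\<^bsub>Y\<^esub> (\<Oplus>\<^bsub>Y\<^esub>i\<in>A. f i j))"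
    using insert assms by (intro Y.finsum_cong') (auto intro!: Y.finsum_closed Y.finsum_insert)
  also have "\<dots> = (\<Oplus>\<^bsub>Y\<^esub>j\<in>B. f i j) \<oplus>\<^bsub>Y\<^esub> (\<Oplus>\<^bsub>Y\<^esub>j\<in>B. \<Oplus>\<^bsub>Y\<^esub>i\<in>A. f i j)"
    using assms by (intro Y.finsum_addf) (auto intro!: Y.finsum_closed)
  finally show ?case using insert assms by (simp add: Y.finsum_closed Pi_def)
qed simp

text \<open>
  The components are \<open>d\<^sup>-\<^sup>1 \<Sum>\<^sub>r \<xi>\<^sup>-\<^sup>j\<^sup>r t\<^sub>a\<^sup>r y\<close>, the discrete Fourier transform of the powers of \<open>t\<^sub>a\<close>.
\<close>

lemma t_eigen_split:
  assumes a: "a \<in> {1..n}" and y: "y \<in> carrier Y"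
  shows "\<exists>z. (\<forall>j. z j \<in> carrier Y) \<and> y = (\<Oplus>\<^bsub>Y\<^esub>j\<in>{..<d}. z j) \<and>
    (\<forall>j. t a \<otimes>\<^bsub>Y\<^esub> z j = sc (\<xi> ^ j) \<otimes>\<^bsub>Y\<^esub> z j) \<and>
    (\<forall>j. \<forall>b\<in>{1..n}. \<forall>c\<in>S. t b \<otimes>\<^bsub>Y\<^esub> y = sc c \<otimes>\<^bsub>Y\<^esub> y \<longrightarrow> t b \<otimes>\<^bsub>Y\<^esub> z j = sc c \<otimes>\<^bsub>Y\<^esub> z j)"
proof -
  have inv: "inverse \<xi> = \<xi> ^ (d - 1)"
    using \<xi>_pow_d d_pos \<xi>_nonzero by (cases d) (auto simp: inverse_unique)
  let ?c = "\<lambda>j r. inverse (of_nat d) * inverse \<xi> ^ (j * r)"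
  have iS: "inverse \<xi> \<in> S" unfolding inv by (intro power_mem \<xi>_mem)
  have cS: "?c j r \<in> S" for j r by (intro mult_mem power_mem iS d_inv_mem)
  have tc: "t a \<in> carrier Y" using t_closed[OF a] .
  define A where "A j r = sc (?c j r) \<otimes>\<^bsub>Y\<^esub> (t a [^]\<^bsub>Y\<^esub> (r::nat) \<otimes>\<^bsub>Y\<^esub> y)" for j r
  have Ac: "A j r \<in> carrier Y" for j r unfolding A_def using cS sc_closed tc y by auto
  define z where "z j = (\<Oplus>\<^bsub>Y\<^esub>r\<in>{..<d}. A j r)" for j
  have zc: "z j \<in> carrier Y" for j unfolding z_def using Ac by (intro Y.finsum_closed) auto
  have "(\<Oplus>\<^bsub>Y\<^esub>j\<in>{..<d}. z j) = (\<Oplus>\<^bsub>Y\<^esub>r\<in>{..<d}. \<Oplus>\<^bsub>Y\<^esub>j\<in>{..<d}. A j r)"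
    unfolding z_def using Ac by (intro finsum_swap) auto
  also have "\<dots> = (\<Oplus>\<^bsub>Y\<^esub>r\<in>{..<d}. if 0 = r then y else \<zero>\<^bsub>Y\<^esub>)"
  proof (rule Y.finsum_cong')
    fix r assume r: "r \<in> {..<d}"
    have py: "t a [^]\<^bsub>Y\<^esub> r \<otimes>\<^bsub>Y\<^esub> y \<in> carrier Y" using tc y by auto
    have "(\<Oplus>\<^bsub>Y\<^esub>j\<in>B. A j r) = sc (\<Sum>j\<in>B. ?c j r) \<otimes>\<^bsub>Y\<^esub> (t a [^]\<^bsub>Y\<^esub> r \<otimes>\<^bsub>Y\<^esub> y)" if "finite B" for B
      using that
    proof (induction B rule: finite_induct)
      case empty then show ?case using py by (simp add: sc_0)
    next
      case (insert j B)
      have s: "(\<Sum>j\<in>B. ?c j r) \<in> S" using cS by (rule sum_mem)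
      have "(\<Oplus>\<^bsub>Y\<^esub>j\<in>insert j B. A j r) = A j r \<oplus>\<^bsub>Y\<^esub> (\<Oplus>\<^bsub>Y\<^esub>j\<in>B. A j r)"
        using insert Ac by (intro Y.finsum_insert) auto
      also have "\<dots> = sc (?c j r + (\<Sum>j\<in>B. ?c j r)) \<otimes>\<^bsub>Y\<^esub> (t a [^]\<^bsub>Y\<^esub> r \<otimes>\<^bsub>Y\<^esub> y)"
        unfolding insert.IH A_def[of j r] by (rule sc_distrib[OF cS s py])
      finally show ?case using insert by simp
    qed
    then have "(\<Oplus>\<^bsub>Y\<^esub>j\<in>{..<d}. A j r) = sc (\<Sum>j<d. ?c j r) \<otimes>\<^bsub>Y\<^esub> (t a [^]\<^bsub>Y\<^esub> r \<otimes>\<^bsub>Y\<^esub> y)" by simp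
    also have "(\<Sum>j<d. ?c j r) = inverse (of_nat d) * (\<Sum>j<d. (inverse \<xi> ^ r) ^ j * 1 ^ (d - j))"
      by (simp add: sum_distrib_left mult.commute flip: power_mult)
    also have "\<dots> = (if r = 0 then 1 else 0)"
    proof -
      have "(inverse \<xi> ^ r) ^ d = 1"
        by (metis \<xi>_pow_pow_d inverse_1 power_inverse)
      moreover have "inverse \<xi> ^ r = 1 \<longleftrightarrow> r = 0"
        using \<xi>_primitive[of r] r by (auto simp: power_inverse)
      ultimately show ?thesis using root_of_unity_sum[of "inverse \<xi> ^ r" d 1] d_nonzero by auto
    qed
    finally show "(\<Oplus>\<^bsub>Y\<^esub>j\<in>{..<d}. A j r) = (if 0 = r then y else \<zero>\<^bsub>Y\<^esub>)" using y py by (auto simp: sc_1 sc_0)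
  qed (use y in auto)
  also have "\<dots> = y" using Y.finsum_singleton[of 0 "{..<d}" "\<lambda>_. y"] d_pos y by simp
  finally have sum: "y = (\<Oplus>\<^bsub>Y\<^esub>j\<in>{..<d}. z j)" by simp
  have "t a \<otimes>\<^bsub>Y\<^esub> z j = sc (\<xi> ^ j) \<otimes>\<^bsub>Y\<^esub> z j" for j
  proof -
    have \<xi>S: "\<xi> ^ j \<in> S" by (intro power_mem \<xi>_mem)
    have st: "t a \<otimes>\<^bsub>Y\<^esub> A j r = sc (\<xi> ^ j) \<otimes>\<^bsub>Y\<^esub> A j (Suc r)" for r
    proof -
      have "t a \<otimes>\<^bsub>Y\<^esub> A j r = sc (?c j r) \<otimes>\<^bsub>Y\<^esub> (t a \<otimes>\<^bsub>Y\<^esub> (t a [^]\<^bsub>Y\<^esub> r \<otimes>\<^bsub>Y\<^esub> y))"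
        unfolding A_def using sc_out[OF cS tc] tc y by simp
      also have "t a \<otimes>\<^bsub>Y\<^esub> (t a [^]\<^bsub>Y\<^esub> r \<otimes>\<^bsub>Y\<^esub> y) = t a [^]\<^bsub>Y\<^esub> Suc r \<otimes>\<^bsub>Y\<^esub> y"
        unfolding Y.nat_pow_Suc2[OF tc] using tc y by (simp add: Y.m_assoc)
      also have "?c j r = \<xi> ^ j * ?c j (Suc r)"
        using \<xi>_nonzero by (simp add: power_add field_simps)
      also have "sc (\<xi> ^ j * ?c j (Suc r)) \<otimes>\<^bsub>Y\<^esub> (t a [^]\<^bsub>Y\<^esub> Suc r \<otimes>\<^bsub>Y\<^esub> y) = sc (\<xi> ^ j) \<otimes>\<^bsub>Y\<^esub> A j (Suc r)"
        unfolding A_def by (rule sc_sc[OF \<xi>S cS, symmetric]) (use tc y in simp)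
      finally show ?thesis .
    qed
    have "(\<Oplus>\<^bsub>Y\<^esub>r\<in>{..<k}. A j (Suc r)) \<oplus>\<^bsub>Y\<^esub> A j 0 = (\<Oplus>\<^bsub>Y\<^esub>r\<in>{..<k}. A j r) \<oplus>\<^bsub>Y\<^esub> A j k" for k
    proof (induction k)
      case (Suc k)
      have c: "(\<Oplus>\<^bsub>Y\<^esub>r\<in>{..<k}. A j (Suc r)) \<in> carrier Y" "(\<Oplus>\<^bsub>Y\<^esub>r\<in>{..<k}. A j r) \<in> carrier Y"
        using Ac by (auto intro!: Y.finsum_closed)
      let ?P = "\<Oplus>\<^bsub>Y\<^esub>r\<in>{..<k}. A j (Suc r)" and ?Q = "\<Oplus>\<^bsub>Y\<^esub>r\<in>{..<k}. A j r"
      have "(A j (Suc k) \<oplus>\<^bsub>Y\<^esub> ?P) \<oplus>\<^bsub>Y\<^esub> A j 0 = A j (Suc k) \<oplus>\<^bsub>Y\<^esub> (?P \<oplus>\<^bsub>Y\<^esub> A j 0)"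
        by (rule Y.a_assoc) (use Ac c in auto)
      also have "\<dots> = (A j k \<oplus>\<^bsub>Y\<^esub> ?Q) \<oplus>\<^bsub>Y\<^esub> A j (Suc k)"
        unfolding Suc using Ac c by (simp add: Y.a_ac)
      finally show ?case using Ac by (simp add: lessThan_Suc Pi_def)
    qed (use Ac in simp)
    from this[of d] have "(\<Oplus>\<^bsub>Y\<^esub>r\<in>{..<d}. A j (Suc r)) \<oplus>\<^bsub>Y\<^esub> A j 0 = z j \<oplus>\<^bsub>Y\<^esub> A j d" by (simp add: z_def)
    moreover have "A j d = A j 0"
    proof -
      have "inverse \<xi> ^ (j * d) = 1"
        by (metis \<xi>_pow_pow_d inverse_1 power_inverse power_mult)
      then show ?thesis unfolding A_def using t_pow_d[OF a] by simp
    qed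
    ultimately have "(\<Oplus>\<^bsub>Y\<^esub>r\<in>{..<d}. A j (Suc r)) = z j"
      using Ac zc by (simp add: Y.finsum_closed Pi_def)
    moreover have "t a \<otimes>\<^bsub>Y\<^esub> z j = (\<Oplus>\<^bsub>Y\<^esub>r\<in>{..<d}. sc (\<xi> ^ j) \<otimes>\<^bsub>Y\<^esub> A j (Suc r))"
      unfolding z_def using Y.finsum_rdistr[OF _ tc, of "{..<d}" "A j"] Ac by (simp add: st)
    ultimately show ?thesis
      using Y.finsum_rdistr[OF _ sc_closed[OF \<xi>S], of "{..<d}" "\<lambda>r. A j (Suc r)"] Ac by simp
  qed
  moreover have "t b \<otimes>\<^bsub>Y\<^esub> z j = sc c \<otimes>\<^bsub>Y\<^esub> z j"
    if b: "b \<in> {1..n}" "c \<in> S" "t b \<otimes>\<^bsub>Y\<^esub> y = sc c \<otimes>\<^bsub>Y\<^esub> y" for b c j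
  proof -
    have bc: "t b \<in> carrier Y" using t_closed[OF b(1)] .
    have p: "t b \<otimes>\<^bsub>Y\<^esub> t a [^]\<^bsub>Y\<^esub> (r::nat) = t a [^]\<^bsub>Y\<^esub> r \<otimes>\<^bsub>Y\<^esub> t b" for r
      by (rule Y.group_commutes_pow[symmetric]) (use t_t[OF b(1) a] bc tc in auto)
    have "t b \<otimes>\<^bsub>Y\<^esub> A j r = sc c \<otimes>\<^bsub>Y\<^esub> A j r" for r
    proof -
      have pc: "t a [^]\<^bsub>Y\<^esub> r \<in> carrier Y" using tc by simp
      have "t b \<otimes>\<^bsub>Y\<^esub> (t a [^]\<^bsub>Y\<^esub> r \<otimes>\<^bsub>Y\<^esub> y) = sc c \<otimes>\<^bsub>Y\<^esub> (t a [^]\<^bsub>Y\<^esub> r \<otimes>\<^bsub>Y\<^esub> y)"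
        using p[of r] pc bc y b(3) sc_out[OF b(2) pc y] by (metis Y.m_assoc)
      then show ?thesis unfolding A_def
        using sc_out[OF cS bc] sc_out[OF cS sc_closed[OF b(2)]] pc y by simp
    qed
    then show ?thesis unfolding z_def
      using Y.finsum_rdistr[OF _ bc, of "{..<d}" "A j"] Y.finsum_rdistr[OF _ sc_closed[OF b(2)], of "{..<d}" "A j"] Ac
      by simp
  qed
  ultimately show ?thesis using zc sum by (intro exI[of _ z]) blast
qed

text \<open>
  The unit is a sum of joint eigenvectors \<open>y\<close> of the \<open>t\<^sub>a\<close>, and \<open>x y\<close> vanishes for each of them by
  \<open>cls_eq_orbit_sum\<close>, applied to an increasing word whose colours are the eigenvalues of \<open>y\<close>.
\<close>

theorem act_faithful:
  assumes x: "x \<in> carrier Y" and 0: "\<And>m. act x m = (\<lambda>u. 0)"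
  shows "x = \<zero>\<^bsub>Y\<^esub>"
proof -
  obtain f where f: "f \<in> carrier F" "x = cls f" using cls_surj[OF x] by blast
  have ev: "eval f m = (\<lambda>u. 0)" for m using 0 f act_cls by simp
  have "x \<otimes>\<^bsub>Y\<^esub> y = \<zero>\<^bsub>Y\<^esub>"
    if "k \<le> n" "y \<in> carrier Y" "\<And>a. a \<in> {k<..n} \<Longrightarrow> \<exists>j<d. t a \<otimes>\<^bsub>Y\<^esub> y = sc (\<xi> ^ j) \<otimes>\<^bsub>Y\<^esub> y" for k y
    using that
  proof (induction k arbitrary: y)
    case 0
    then have "\<forall>a. \<exists>j. a \<in> {1..n} \<longrightarrow> j < d \<and> t a \<otimes>\<^bsub>Y\<^esub> y = sc (\<xi> ^ j) \<otimes>\<^bsub>Y\<^esub> y" by force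
    then obtain b where b: "\<And>a. a \<in> {1..n} \<Longrightarrow> b a < d \<and> t a \<otimes>\<^bsub>Y\<^esub> y = sc (\<xi> ^ b a) \<otimes>\<^bsub>Y\<^esub> y"
      by metis
    \<comment> \<open>Letters remember a position in the quotient modulo \<open>d\<close> and a colour in the remainder.\<close>
    define u0 where "u0 i = d * i + b i" for i
    have c: "\<xi> ^ u0 a = \<xi> ^ b a" for a by (simp add: u0_def power_add power_mult \<xi>_pow_d)
    have inc: "u0 i < u0 j" if "i \<in> {1..n}" "j \<in> {1..n}" "i < j" for i j
    proof -
      have "u0 i < d * Suc i" using b[OF that(1)] by (simp add: u0_def)
      also have "\<dots> \<le> d * j" using that by (intro mult_le_mono2) simp
      finally show ?thesis by (simp add: u0_def)
    qed
    have gc: "sorted_action (\<lambda>a z. g a \<otimes>\<^bsub>Y\<^esub> z) n y u \<in> carrier Y" for u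
      using 0(2) g_closed by (intro sorted_action_closed) auto
    have "cls f \<otimes>\<^bsub>Y\<^esub> y = (\<Oplus>\<^bsub>Y\<^esub>u\<in>{u0 \<circ> p | p. p permutes {1..n}}. \<zero>\<^bsub>Y\<^esub>)"
      using cls_eq_orbit_sum[OF 0(2) _ inc f(1), unfolded ev] b c gc by (simp add: sc_0)
    then show ?case using f by simp
  next
    case (Suc k)
    then have k: "Suc k \<in> {1..n}" by simp
    obtain z where z: "\<And>j. z j \<in> carrier Y" "y = (\<Oplus>\<^bsub>Y\<^esub>j\<in>{..<d}. z j)"
      "\<And>j. t (Suc k) \<otimes>\<^bsub>Y\<^esub> z j = sc (\<xi> ^ j) \<otimes>\<^bsub>Y\<^esub> z j"
      "\<And>j b c. \<lbrakk>b \<in> {1..n}; c \<in> S; t b \<otimes>\<^bsub>Y\<^esub> y = sc c \<otimes>\<^bsub>Y\<^esub> y\<rbrakk> \<Longrightarrow> t b \<otimes>\<^bsub>Y\<^esub> z j = sc c \<otimes>\<^bsub>Y\<^esub> z j"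
      using t_eigen_split[OF k Suc.prems(2)] by metis
    have "x \<otimes>\<^bsub>Y\<^esub> z j = \<zero>\<^bsub>Y\<^esub>" if j: "j < d" for j
    proof (rule Suc.IH)
      fix a assume a: "a \<in> {k<..n}"
      show "\<exists>i<d. t a \<otimes>\<^bsub>Y\<^esub> z j = sc (\<xi> ^ i) \<otimes>\<^bsub>Y\<^esub> z j"
      proof (cases "a = Suc k")
        case True then show ?thesis using z(3) j by blast
      next
        case False
        then have "a \<in> {Suc k<..n}" using a by auto
        then obtain i where "i < d" "t a \<otimes>\<^bsub>Y\<^esub> y = sc (\<xi> ^ i) \<otimes>\<^bsub>Y\<^esub> y" using Suc.prems(3) by blast
        then show ?thesis using z(4)[of a "\<xi> ^ i" j] a power_mem[OF \<xi>_mem] by auto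
      qed
    qed (use Suc.prems z in auto)
    moreover have "x \<otimes>\<^bsub>Y\<^esub> y = (\<Oplus>\<^bsub>Y\<^esub>j\<in>{..<d}. x \<otimes>\<^bsub>Y\<^esub> z j)"
      unfolding z(2) using z(1) x by (intro Y.finsum_rdistr) auto
    ultimately show ?case by (simp cong: Y.finsum_cong)
  qed
  from this[of n "\<one>\<^bsub>Y\<^esub>"] x show ?thesis by simp
qed

corollary act_inj:
  assumes "x \<in> carrier Y" "y \<in> carrier Y" "\<And>m. act x m = act y m"
  shows "x = y"
proof -
  have "x \<ominus>\<^bsub>Y\<^esub> y = \<zero>\<^bsub>Y\<^esub>" using assms by (intro act_faithful) (auto simp: act_minus)
  then show ?thesis using assms by simp
qed

end

section \<open>The local ring\<close>

lemma rconst_simps: "rconst 0 = 0" "rconst 1 = 1" "rconst (a + b) = rconst a + rconst b"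
  "rconst (a * b) = rconst a * rconst b" "rconst (a - b) = rconst a - rconst b"
  by (simp_all add: rconst_def flip: to_fract_add to_fract_mult to_fract_diff one_pCons)

lemma rconst_power: "rconst (a ^ k) = rconst a ^ k"
  by (induction k) (simp_all add: rconst_simps)

lemma rconst_eq_iff: "rconst a = rconst b \<longleftrightarrow> a = b"
  by (simp add: rconst_def to_fract_eq_iff)

lemma rconst_of_nat: "rconst (of_nat k) = of_nat k"
  by (induction k) (simp_all add: rconst_simps)

lemma to_fract_power: "to_fract (p ^ k) = to_fract p ^ k"
  by (induction k) simp_all

lemma qhat_power: "(qhat :: 'k::field poly fract) ^ k = to_fract (monom 1 k)"
  by (simp add: qhat_def monom_altdef flip: to_fract_power)

lemma qhat_nonzero: "(qhat :: 'k::field poly fract) \<noteq> 0"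
  by (simp add: qhat_def to_fract_eq_0_iff)

lemma qhat_not_root_of_unity: "m > 0 \<Longrightarrow> (qhat :: 'k::field poly fract) ^ m \<noteq> 1"
proof
  assume m: "m > 0" and "(qhat :: 'k poly fract) ^ m = 1"
  then have "to_fract (monom (1 :: 'k) m) = to_fract 1" by (simp add: qhat_power)
  then have "monom (1 :: 'k) m = 1" by (simp only: to_fract_eq_iff)
  then have "degree (monom (1 :: 'k) m) = degree (1 :: 'k poly)" by simp
  then show False using m by (simp add: degree_monom_eq)
qed

lemma qhat_powi_cases:
  obtains k where "(qhat :: 'k::field poly fract) powi i = to_fract (monom 1 k)"
  | k where "(qhat :: 'k::field poly fract) powi i = inverse (to_fract (monom 1 k))"
  by (cases "i \<ge> 0") (auto simp: power_int_def qhat_power power_inverse)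

lemma qhat_minus: "qhat - rconst q = to_fract [:- q, 1:]"
  by (simp add: qhat_def rconst_def flip: to_fract_diff)

context
  fixes q :: "'k::field"
  assumes q: "q \<noteq> 0"
begin

lemma poly_nz: "poly b q \<noteq> 0 \<Longrightarrow> to_fract b \<noteq> 0"
  by (auto simp: to_fract_eq_0_iff)

text \<open>
  As \<open>q \<noteq> 0\<close>, powers of the indeterminate are units in the local ring, so that polynomials suffice
  as numerators and denominators, and reduction is evaluation at \<open>q\<close>.
\<close>

lemma in_local_carrier_iff: "x \<in> local_carrier q \<longleftrightarrow> (\<exists>a b. poly b q \<noteq> 0 \<and> x = to_fract a / to_fract b)"
proof
  assume "x \<in> local_carrier q"
  then obtain p m p' m' where x: "x = (to_fract p * qhat powi m) / (to_fract p' * qhat powi m')"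
    and n: "to_fract p' * qhat powi m' \<notin> {(qhat - rconst q) * z | z. z \<in> laurent_polys}"
    unfolding local_carrier_def laurent_polys_def by blast
  have p': "poly p' q \<noteq> 0"
  proof
    assume "poly p' q = 0"
    then obtain r where "p' = [:- q, 1:] * r" unfolding poly_eq_0_iff_dvd by (elim dvdE)
    then have "to_fract p' * qhat powi m' = (qhat - rconst q) * (to_fract r * qhat powi m')"
      by (simp only: to_fract_mult qhat_minus mult.assoc)
    then show False using n unfolding laurent_polys_def by blast
  qed
  have e: "x = to_fract p / to_fract p' * qhat powi (m - m')"
    using qhat_nonzero[where ?'k = 'k] by (simp add: x power_int_diff)
  show "\<exists>a b. poly b q \<noteq> 0 \<and> x = to_fract a / to_fract b"
  proof (cases "m - m'" rule: qhat_powi_cases[where ?'k = 'k])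
    case (1 k)
    then have "x = to_fract (p * monom 1 k) / to_fract p'" unfolding e by simp
    then show ?thesis using p' by blast
  next
    case (2 k)
    then have "x = to_fract p / to_fract (p' * monom 1 k)" unfolding e by (simp add: divide_inverse)
    moreover have "poly (p' * monom 1 k) q \<noteq> 0" using p' q by (simp add: poly_monom)
    ultimately show ?thesis by blast
  qed
next
  assume "\<exists>a b. poly b q \<noteq> 0 \<and> x = to_fract a / to_fract b"
  then obtain a b where b: "poly b q \<noteq> 0" and x: "x = to_fract a / to_fract b" by blast
  have l: "to_fract c \<in> laurent_polys" for c :: "'k poly"
    unfolding laurent_polys_def by (rule CollectI, intro exI[of _ c] exI[of _ 0]) simp
  have "to_fract b \<noteq> (qhat - rconst q) * z" if z: "z \<in> laurent_polys" for z
  proof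
    assume eq: "to_fract b = (qhat - rconst q) * z"
    obtain p m where zp: "z = to_fract p * qhat powi m" using z by (auto simp: laurent_polys_def)
    show False
    proof (cases m rule: qhat_powi_cases[where ?'k = 'k])
      case (1 k)
      then have "to_fract b = to_fract ([:- q, 1:] * (p * monom 1 k))"
        using eq by (simp only: zp qhat_minus to_fract_mult)
      then have "b = [:- q, 1:] * (p * monom 1 k)" by (simp only: to_fract_eq_iff)
      then show False using b by simp
    next
      case (2 k)
      have nz: "to_fract (monom (1 :: 'k) k) \<noteq> 0" by simp
      have "to_fract b * to_fract (monom 1 k) =
          to_fract [:- q, 1:] * (to_fract p * inverse (to_fract (monom 1 k))) * to_fract (monom 1 k)"
        using eq 2 by (simp only: zp qhat_minus)
      also have "\<dots> = to_fract [:- q, 1:] * to_fract p"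
        by (simp only: mult.assoc left_inverse[OF nz] mult_1_right)
      finally have "b * monom 1 k = [:- q, 1:] * p" by (simp only: to_fract_mult[symmetric] to_fract_eq_iff)
      then have "poly (b * monom 1 k) q = 0" by simp
      then show False using b q by (simp add: poly_monom)
    qed
  qed
  then show "x \<in> local_carrier q" unfolding local_carrier_def x using l by blast
qed

lemma local_carrierI: "poly b q \<noteq> 0 \<Longrightarrow> to_fract a / to_fract b \<in> local_carrier q"
  using in_local_carrier_iff by blast

lemma local_carrierE:
  assumes "x \<in> local_carrier q"
  obtains a b where "poly b q \<noteq> 0" "x = to_fract a / to_fract b"
  using assms in_local_carrier_iff by blast

lemma reduce_fraction:
  assumes b: "poly b q \<noteq> 0"
  shows "reduce q (to_fract a / to_fract b) = poly a q / poly b q"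
  unfolding reduce_def
proof (rule the_equality)
  let ?c = "poly a q / poly b q"
  have "poly (a - smult ?c b) q = 0" using b by simp
  then obtain r where r: "a - smult ?c b = [:- q, 1:] * r" unfolding poly_eq_0_iff_dvd by (elim dvdE)
  have "to_fract a = rconst ?c * to_fract b + (qhat - rconst q) * to_fract r"
  proof -
    have "a = [:?c:] * b + [:- q, 1:] * r" using r by (simp add: algebra_simps)
    then have "to_fract a = to_fract ([:?c:] * b + [:- q, 1:] * r)" by (rule arg_cong)
    then show ?thesis unfolding qhat_minus unfolding rconst_def by (simp only: to_fract_add to_fract_mult)
  qed
  then have "to_fract a / to_fract b = rconst ?c + (qhat - rconst q) * (to_fract r / to_fract b)"
    using poly_nz[OF b] by (simp add: field_simps)
  then show "\<exists>z\<in>local_carrier q. to_fract a / to_fract b = rconst ?c + (qhat - rconst q) * z"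
    using local_carrierI[OF b] by blast
next
  fix c assume "\<exists>z\<in>local_carrier q. to_fract a / to_fract b = rconst c + (qhat - rconst q) * z"
  then obtain z where z: "z \<in> local_carrier q" "to_fract a / to_fract b = rconst c + (qhat - rconst q) * z"
    by blast
  obtain r w where w: "poly w q \<noteq> 0" "z = to_fract r / to_fract w" using z(1) by (rule local_carrierE)
  then have eq: "to_fract a / to_fract b = rconst c + (qhat - rconst q) * (to_fract r / to_fract w)"
    using z(2) by simp
  have "to_fract a * to_fract w = to_fract b * (to_fract [:c:] * to_fract w + to_fract [:- q, 1:] * to_fract r)"
    using eq[unfolded qhat_minus] poly_nz[OF b] poly_nz[OF w(1)] by (simp add: rconst_def field_simps)
  then have "a * w = b * ([:c:] * w + [:- q, 1:] * r)"
    by (simp only: to_fract_eq_iff flip: to_fract_mult to_fract_add)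
  then have "poly (a * w) q = poly (b * ([:c:] * w + [:- q, 1:] * r)) q" by (rule arg_cong)
  then have "poly a q * poly w q = poly b q * (c * poly w q)" by simp
  then show "c = poly a q / poly b q" using b w by (simp add: field_simps)
qed

lemma local_ring_facts:
  shows reduce_rconst: "rconst c \<in> local_carrier q \<and> reduce q (rconst c) = c"
    and reduce_qhat: "qhat \<in> local_carrier q \<and> reduce q qhat = q"
  using local_carrierI[of 1 "[:c:]"] reduce_fraction[of 1 "[:c:]"]
    local_carrierI[of 1 "[:0, 1:]"] reduce_fraction[of 1 "[:0, 1:]"]
  by (simp_all add: rconst_def qhat_def)

lemma reduce_add:
  assumes "x \<in> local_carrier q" "y \<in> local_carrier q"
  shows "x + y \<in> local_carrier q \<and> reduce q (x + y) = reduce q x + reduce q y"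
proof -
  obtain a b a' b' where *: "poly b q \<noteq> 0" "x = to_fract a / to_fract b" "poly b' q \<noteq> 0" "y = to_fract a' / to_fract b'"
    using assms by (auto elim!: local_carrierE)
  have nz: "poly (b * b') q \<noteq> 0" using * by simp
  have "x + y = to_fract (a * b' + a' * b) / to_fract (b * b')"
    using * poly_nz by (simp add: field_simps)
  then show ?thesis
    using local_carrierI[OF nz, of "a * b' + a' * b"] reduce_fraction[OF nz, of "a * b' + a' * b"] *
    by (simp add: reduce_fraction field_simps)
qed

lemma reduce_mult:
  assumes "x \<in> local_carrier q" "y \<in> local_carrier q"
  shows "x * y \<in> local_carrier q \<and> reduce q (x * y) = reduce q x * reduce q y"
proof -
  obtain a b a' b' where *: "poly b q \<noteq> 0" "x = to_fract a / to_fract b" "poly b' q \<noteq> 0" "y = to_fract a' / to_fract b'"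
    using assms by (auto elim!: local_carrierE)
  have nz: "poly (b * b') q \<noteq> 0" using * by simp
  have "x * y = to_fract (a * a') / to_fract (b * b')" using * by simp
  then show ?thesis
    using local_carrierI[OF nz, of "a * a'"] reduce_fraction[OF nz, of "a * a'"] * by (simp add: reduce_fraction)
qed

lemma inverse_mem_local:
  assumes "x \<in> local_carrier q" "reduce q x \<noteq> 0"
  shows "inverse x \<in> local_carrier q" "x \<noteq> 0"
proof -
  obtain a b where *: "poly b q \<noteq> 0" "x = to_fract a / to_fract b" using assms by (auto elim!: local_carrierE)
  then have a: "poly a q \<noteq> 0" using assms by (auto simp: reduce_fraction)
  then show "inverse x \<in> local_carrier q" using local_carrierI[OF a, of b] * by simp
  show "x \<noteq> 0" using * poly_nz[OF a] poly_nz[OF *(1)] by simp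
qed

lemma subring_local: "subring_of_field (local_carrier q)"
proof
  show "0 \<in> local_carrier q" "1 \<in> local_carrier q" using local_ring_facts(1)[of 0] local_ring_facts(1)[of 1]
    by (simp_all add: rconst_simps)
  fix x y assume *: "x \<in> local_carrier q" "y \<in> local_carrier q"
  then show "x + y \<in> local_carrier q" "x * y \<in> local_carrier q" using reduce_add reduce_mult by blast+
  have "rconst (- 1) = (- 1 :: 'k poly fract)" using rconst_simps(5)[of 0 "1 :: 'k"] by (simp add: rconst_simps)
  then have "- x = rconst (- 1) * x" by simp
  then show "- x \<in> local_carrier q" using reduce_mult[OF _ *(1)] local_ring_facts(1)[of "- 1"] by simp
qed

end

section \<open>Diagonal elements of the generic algebra\<close>

abbreviation fun_scale :: "'f::field \<Rightarrow> ('u \<Rightarrow> 'f) \<Rightarrow> 'u \<Rightarrow> 'f" where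
  "fun_scale c m \<equiv> (\<lambda>u. c * m u)"

lemma vector_space_fun: "vector_space (fun_scale :: 'f::field \<Rightarrow> ('u \<Rightarrow> 'f) \<Rightarrow> 'u \<Rightarrow> 'f)"
  by unfold_locales (auto simp: fun_eq_iff algebra_simps)

lemma inj_on_roots:
  fixes \<xi> :: "'f::field"
  assumes "\<xi> ^ d = 1" "\<And>k. 0 < k \<Longrightarrow> k < d \<Longrightarrow> \<xi> ^ k \<noteq> 1"
  shows "inj_on (\<lambda>p. \<xi> ^ p) {1..d}"
proof (rule linorder_inj_onI)
  fix i j :: nat assume *: "i < j" "i \<in> {1..d}" "j \<in> {1..d}"
  have nz: "\<xi> \<noteq> 0" using assms(1) * by (cases "\<xi> = 0") (auto simp: power_0_left)
  show "\<xi> ^ i \<noteq> \<xi> ^ j"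
  proof
    assume "\<xi> ^ i = \<xi> ^ j"
    moreover have "\<xi> ^ j = \<xi> ^ i * \<xi> ^ (j - i)" using * by (simp flip: power_add)
    ultimately have "\<xi> ^ i * 1 = \<xi> ^ i * \<xi> ^ (j - i)" by simp
    then have "\<xi> ^ (j - i) = 1" using nz by simp
    moreover have "0 < j - i" "j - i < d" using * unfolding atLeastAtMost_iff by linarith+
    ultimately show False using assms(2) by blast
  qed
qed auto

locale generic_yh = yh_representation S d n v \<xi> for S :: "'f::field set" and d n v \<xi> +
  assumes v_generic: "\<And>m. m > 0 \<Longrightarrow> v ^ m \<noteq> 1"
begin

lemma colour_exists:
  shows "\<exists>p\<in>{1..d}. \<xi> ^ k = \<xi> ^ p"
proof -
  have "\<xi> ^ k = \<xi> ^ (k mod d)"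
  proof -
    have "\<xi> ^ k = \<xi> ^ (d * (k div d) + k mod d)" by simp
    then show ?thesis by (simp only: power_add power_mult \<xi>_pow_d power_one mult_1_left)
  qed
  show ?thesis
  proof (cases "k mod d = 0")
    case True
    then have "\<xi> ^ k = \<xi> ^ d" using \<open>\<xi> ^ k = _\<close> \<xi>_pow_d by simp
    then show ?thesis using d_pos by (intro bexI[of _ d]) auto
  next
    case False
    then show ?thesis using \<open>\<xi> ^ k = _\<close> d_pos by (intro bexI[of _ "k mod d"]) (auto simp: less_imp_le)
  qed
qed

text \<open>
  The joint eigenvectors of the \<open>t\<^sub>a\<close> are the functions supported on words of one sequence of colours;
  the restrictions of a function to these finitely many sets of words add up to it.
\<close>

sublocale M: yh_module fun_scale n v "\<lambda>p. \<xi> ^ p" "{1..d}" "word_g \<xi> v" "word_t \<xi>"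
proof -
  interpret V: vector_space "fun_scale :: 'f \<Rightarrow> ((nat \<Rightarrow> nat) \<Rightarrow> 'f) \<Rightarrow> (nat \<Rightarrow> nat) \<Rightarrow> 'f" by (rule vector_space_fun)
  have same: "word_g \<xi> v a (word_g \<xi> v a x) = (\<lambda>u. v * x u) + (\<lambda>u. (v - 1) * word_g \<xi> v a x u)"
    if t: "word_t \<xi> a x = (\<lambda>u. z * x u)" "word_t \<xi> (Suc a) x = (\<lambda>u. z * x u)" for a x z
  proof
    fix u
    have z: "x w = 0" if "\<xi> ^ w a \<noteq> \<xi> ^ w (Suc a)" for w
      using fun_cong[OF t(1), of w] fun_cong[OF t(2), of w] that by (auto simp: word_t_def)
    have "word_g \<xi> v a x u = 0" if "\<xi> ^ u a \<noteq> \<xi> ^ u (Suc a)"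
      using z[of u] z[of "u \<circ> transpose a (Suc a)"] that by (auto simp: word_g_def)
    then show "word_g \<xi> v a (word_g \<xi> v a x) u = ((\<lambda>u. v * x u) + (\<lambda>u. (v - 1) * word_g \<xi> v a x u)) u"
      by (auto simp: word_g_square)
  qed
  have different: "word_g \<xi> v a (word_g \<xi> v a x) = (\<lambda>u. v * x u)"
    if t: "word_t \<xi> a x = (\<lambda>u. z * x u)" "word_t \<xi> (Suc a) x = (\<lambda>u. z' * x u)" "z \<noteq> z'" for a x z z'
  proof
    fix u
    have z: "x w = 0" if "\<xi> ^ w a = \<xi> ^ w (Suc a)" for w
      using fun_cong[OF t(1), of w] fun_cong[OF t(2), of w] that t(3) by (auto simp: word_t_def)
    have "word_g \<xi> v a x u = 0" if "\<xi> ^ u a = \<xi> ^ u (Suc a)"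
      using z[of u] z[of "u \<circ> transpose a (Suc a)"] that by (auto simp: word_g_def)
    then show "word_g \<xi> v a (word_g \<xi> v a x) u = v * x u"
      by (auto simp: word_g_square)
  qed
  have span: "V.span {w. \<exists>\<pi>. \<forall>a\<in>{1..n}. \<pi> a \<in> {1..d} \<and> word_t \<xi> a w = (\<lambda>u. \<xi> ^ \<pi> a * w u)} = UNIV"
  proof -
    have "m \<in> V.span {w. \<exists>\<pi>. \<forall>a\<in>{1..n}. \<pi> a \<in> {1..d} \<and> word_t \<xi> a w = (\<lambda>u. \<xi> ^ \<pi> a * w u)}" for m
    proof -
      let ?B = "{1..n} \<rightarrow>\<^sub>E {1..d}"
      have fin: "finite ?B" by (intro finite_PiE) auto
      define m' where "m' \<pi> u = (if \<forall>a\<in>{1..n}. \<xi> ^ u a = \<xi> ^ \<pi> a then m u else 0)" for \<pi> u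
      have "m' \<pi> \<in> {w. \<exists>\<pi>. \<forall>a\<in>{1..n}. \<pi> a \<in> {1..d} \<and> word_t \<xi> a w = (\<lambda>u. \<xi> ^ \<pi> a * w u)}" if "\<pi> \<in> ?B" for \<pi>
        using that by (intro CollectI exI[of _ \<pi>]) (auto simp: m'_def word_t_def fun_eq_iff PiE_def Pi_def)
      then have "(\<Sum>\<pi>\<in>?B. m' \<pi>) \<in> V.span {w. \<exists>\<pi>. \<forall>a\<in>{1..n}. \<pi> a \<in> {1..d} \<and> word_t \<xi> a w = (\<lambda>u. \<xi> ^ \<pi> a * w u)}"
        by (intro V.span_sum V.span_base)
      moreover have "(\<Sum>\<pi>\<in>?B. m' \<pi>) = m"
      proof
        fix u :: "nat \<Rightarrow> nat"
        obtain p where p: "\<And>a. p a \<in> {1..d}" "\<And>a. \<xi> ^ u a = \<xi> ^ p a" using choice[of "\<lambda>a p. p \<in> {1..d} \<and> \<xi> ^ u a = \<xi> ^ p"] colour_exists by blast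
        let ?p = "restrict p {1..n}"
        have "m' \<pi> u = (if \<pi> = ?p then m u else 0)" if \<pi>: "\<pi> \<in> ?B" for \<pi>
        proof (cases "\<pi> = ?p")
          case True then show ?thesis using p(2) by (auto simp: m'_def)
        next
          case False
          have "\<exists>a\<in>{1..n}. \<pi> a \<noteq> p a"
          proof (rule ccontr)
            assume "\<not> ?thesis"
            then have "\<pi> = ?p" using p(1) by (intro PiE_ext[OF \<pi>, of ?p]) auto
            with False show False ..
          qed
          then obtain a where a: "a \<in> {1..n}" "\<pi> a \<noteq> p a" by blast
          then have "\<xi> ^ \<pi> a \<noteq> \<xi> ^ p a"
            using inj_onD[OF inj_on_roots[OF \<xi>_pow_d \<xi>_primitive], of "\<pi> a" "p a"] \<pi> p(1)
            by (auto simp: PiE_def Pi_def)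
          then show ?thesis using False a p(2)[of a] by (auto simp: m'_def)
        qed
        then have "(\<Sum>\<pi>\<in>?B. m' \<pi> u) = (\<Sum>\<pi>\<in>?B. if \<pi> = ?p then m u else 0)" by (intro sum.cong) auto
        also have "\<dots> = m u" using fin p(1) by (simp add: sum.delta)
        finally have "(\<Sum>\<pi>\<in>?B. m' \<pi> u) = m u" .
        moreover have "(\<Sum>\<pi>\<in>A. m' \<pi>) u = (\<Sum>\<pi>\<in>A. m' \<pi> u)" if "finite A" for A
          using that by (induction A rule: finite_induct) auto
        ultimately show "(\<Sum>\<pi>\<in>?B. m' \<pi>) u = m u" using fin by simp
      qed
      ultimately show ?thesis by simp
    qed
    then show ?thesis by auto
  qed
  show "yh_module fun_scale n v (\<lambda>p. \<xi> ^ p) {1..d} (word_g \<xi> v) (word_t \<xi>)"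
  proof
    show "inj_on (\<lambda>p. \<xi> ^ p) {1..d}" by (rule inj_on_roots[OF \<xi>_pow_d \<xi>_primitive])
    fix a p p' :: nat and x :: "(nat \<Rightarrow> nat) \<Rightarrow> 'f"
    assume "p \<in> {1..d}" "p' \<in> {1..d}" "p \<noteq> p'" "word_t \<xi> a x = (\<lambda>u. \<xi> ^ p * x u)" "word_t \<xi> (Suc a) x = (\<lambda>u. \<xi> ^ p' * x u)"
    then show "word_g \<xi> v a (word_g \<xi> v a x) = (\<lambda>u. v * x u)"
      using inj_onD[OF inj_on_roots[OF \<xi>_pow_d \<xi>_primitive], of p p'] by (intro different) auto
  next
    fix a :: nat and z :: 'f and x :: "(nat \<Rightarrow> nat) \<Rightarrow> 'f"
    assume "word_t \<xi> a x = (\<lambda>u. z * x u)" "word_t \<xi> (Suc a) x = (\<lambda>u. z * x u)"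
    then show "word_g \<xi> v a (word_g \<xi> v a x) = (\<lambda>u. v * x u) + (\<lambda>u. (v - 1) * word_g \<xi> v a x u)"
      by (rule same)
  next
    fix a :: nat and c :: 'f and x y :: "(nat \<Rightarrow> nat) \<Rightarrow> 'f"
    show "word_g \<xi> v a (x + y) = word_g \<xi> v a x + word_g \<xi> v a y"
      "word_g \<xi> v a (\<lambda>u. c * x u) = (\<lambda>u. c * word_g \<xi> v a x u)"
      "word_t \<xi> a (x + y) = word_t \<xi> a x + word_t \<xi> a y"
      "word_t \<xi> a (\<lambda>u. c * x u) = (\<lambda>u. c * word_t \<xi> a x u)"
      by (auto simp: fun_eq_iff word_g_def word_t_def algebra_simps)
  next
    fix a b :: nat and x :: "(nat \<Rightarrow> nat) \<Rightarrow> 'f"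
    show "word_t \<xi> a (word_t \<xi> b x) = word_t \<xi> b (word_t \<xi> a x)" by (rule ext) (rule word_t_t)
    show "word_t \<xi> a (word_g \<xi> v b x) = word_g \<xi> v b (word_t \<xi> (transpose b (Suc b) a) x)"
      by (rule ext) (rule word_t_g)
    show "word_g \<xi> v a (word_g \<xi> v (Suc a) (word_g \<xi> v a x)) = word_g \<xi> v (Suc a) (word_g \<xi> v a (word_g \<xi> v (Suc a) x))"
      by (rule ext) (rule word_g_braid)
  next
    fix a b :: nat and x :: "(nat \<Rightarrow> nat) \<Rightarrow> 'f"
    assume "Suc a < b"
    then show "word_g \<xi> v a (word_g \<xi> v b x) = word_g \<xi> v b (word_g \<xi> v a x)"
      by (intro ext word_g_comm)
  next
    show "V.span {w. \<exists>\<pi>. \<forall>a\<in>{1..n}. \<pi> a \<in> {1..d} \<and> word_t \<xi> a w = (\<lambda>u. \<xi> ^ \<pi> a * w u)} = UNIV"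
      by (rule span)
  qed (fact v_nonzero, rule v_generic)
qed

abbreviation "in_tab_space s m \<equiv> M.joint_eigenvector n (tab_seq s) m"

lemma span_tab_spaces: "M.span {m. \<exists>t\<in>Std d n. in_tab_space t m} = UNIV"
proof -
  have "M.eigenvectors n \<subseteq> {m. \<exists>t\<in>Std d n. in_tab_space t m}"
  proof
    fix m assume "m \<in> M.eigenvectors n"
    then obtain \<sigma> where \<sigma>: "valid_seq \<sigma> n" "M.colored \<sigma>" "M.joint_eigenvector n \<sigma> m"
      unfolding M.eigenvectors_def by blast
    obtain t where t: "t \<in> Std d n" "\<forall>i\<in>{1..n}. tab_seq t i = \<sigma> i"
      using tableau_of_valid_seq[OF \<sigma>(1), of d] \<sigma>(2) unfolding M.colored_def by blast
    have "in_tab_space t m" using \<sigma>(3) t(2) by (simp add: M.joint_eigenvector_def)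
    then show "m \<in> {m. \<exists>t\<in>Std d n. in_tab_space t m}" using t(1) by blast
  qed
  from M.span_mono[OF this] M.span_eigenvectors show ?thesis by auto
qed

lemma act_JM: "1 \<le> a \<Longrightarrow> a \<le> n \<Longrightarrow> act (JM a) m = M.jm a m"
proof (induction a arbitrary: m rule: dec_induct)
  case base then show ?case by (simp add: act_one M.jm.simps)
next
  case (step a)
  then show ?case using g_closed[of a] JM_closed[of a] sc_closed[OF v_inv_mem]
    by (simp only: JM_Suc) (simp add: act_mult act_sc v_inv_mem act_g M.jm.simps)
qed

text \<open>
  \<open>in_tab_space t\<close> is the simultaneous eigenspace of the \<open>L\<^sub>a\<close> for the contents of \<open>t\<close>. These spaces span the
  module, so by faithfulness the scalars \<open>\<kappa>\<close> determine a diagonal element.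
\<close>

definition diagonal :: "(yh_gen list \<Rightarrow> 'f) set \<Rightarrow> (multitableau \<Rightarrow> 'f) \<Rightarrow> bool" where
  "diagonal x \<kappa> \<longleftrightarrow> x \<in> carrier Y \<and>
     (\<forall>t\<in>Std d n. \<forall>m. in_tab_space t m \<longrightarrow> act x m = (\<lambda>u. \<kappa> t * m u))"

lemma diagonal_closed: "diagonal x \<kappa> \<Longrightarrow> x \<in> carrier Y"
  by (simp add: diagonal_def)

lemma diagonal_cong: "(\<And>t. t \<in> Std d n \<Longrightarrow> \<kappa> t = \<mu> t) \<Longrightarrow> diagonal x \<kappa> \<longleftrightarrow> diagonal x \<mu>"
  by (auto simp: diagonal_def)

lemma diagonal_act_eq:
  assumes x: "diagonal x \<kappa>" and y: "diagonal y \<kappa>"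
  shows "act x m = act y m"
proof -
  have c: "x \<in> carrier Y" "y \<in> carrier Y" using x y by (auto simp: diagonal_def)
  have "m \<in> M.span {m. \<exists>t\<in>Std d n. in_tab_space t m}" using span_tab_spaces by simp
  then show ?thesis
  proof (induction rule: M.span_induct_alt)
    case base
    have "act z (\<lambda>u. 0 * m u) = (\<lambda>u. 0)" if "z \<in> carrier Y" for z m
      using act_linear(2)[OF that, of 0 m] by simp
    then show ?case using c by (simp add: zero_fun_def)
  next
    case (step k m m')
    then have "act x m = act y m" using x y by (auto simp: diagonal_def)
    moreover have e: "act z ((\<lambda>u. k * m u) + m') = (\<lambda>u. k * act z m u + act z m' u)" if "z \<in> carrier Y" for z
      unfolding plus_fun_def act_linear(1)[OF that] act_linear(2)[OF that] ..
    ultimately show ?case using step(2) by (simp only: e[OF c(1)] e[OF c(2)])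
  qed
qed

lemma diagonal_unique: "diagonal x \<kappa> \<Longrightarrow> diagonal y \<kappa> \<Longrightarrow> x = y"
  using diagonal_act_eq by (intro act_inj) (auto simp: diagonal_def)

lemma diagonal_mult: "diagonal x \<kappa> \<Longrightarrow> diagonal y \<mu> \<Longrightarrow> diagonal (x \<otimes>\<^bsub>Y\<^esub> y) (\<lambda>t. \<kappa> t * \<mu> t)"
  unfolding diagonal_def
proof (elim conjE, intro conjI ballI allI impI)
  assume c: "x \<in> carrier Y" "y \<in> carrier Y"
    and x: "\<forall>s\<in>Std d n. \<forall>m. in_tab_space s m \<longrightarrow> act x m = (\<lambda>u. \<kappa> s * m u)"
    and y: "\<forall>s\<in>Std d n. \<forall>m. in_tab_space s m \<longrightarrow> act y m = (\<lambda>u. \<mu> s * m u)"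
  show "x \<otimes>\<^bsub>Y\<^esub> y \<in> carrier Y" using c by simp
  fix s m assume s: "s \<in> Std d n" "in_tab_space s m"
  have "act (x \<otimes>\<^bsub>Y\<^esub> y) m = (\<lambda>u. \<mu> s * act x m u)"
    unfolding act_mult[OF c] y[rule_format, OF s] by (rule act_linear(2)[OF c(1)])
  also have "\<dots> = (\<lambda>u. \<kappa> s * \<mu> s * m u)"
    unfolding x[rule_format, OF s] by (rule ext) (simp only: mult.assoc mult.left_commute)
  finally show "act (x \<otimes>\<^bsub>Y\<^esub> y) m = (\<lambda>u. \<kappa> s * \<mu> s * m u)" .
qed

lemma diagonal_add: "diagonal x \<kappa> \<Longrightarrow> diagonal y \<mu> \<Longrightarrow> diagonal (x \<oplus>\<^bsub>Y\<^esub> y) (\<lambda>t. \<kappa> t + \<mu> t)"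
  unfolding diagonal_def
proof (elim conjE, intro conjI ballI allI impI)
  assume c: "x \<in> carrier Y" "y \<in> carrier Y"
    and x: "\<forall>s\<in>Std d n. \<forall>m. in_tab_space s m \<longrightarrow> act x m = (\<lambda>u. \<kappa> s * m u)"
    and y: "\<forall>s\<in>Std d n. \<forall>m. in_tab_space s m \<longrightarrow> act y m = (\<lambda>u. \<mu> s * m u)"
  show "x \<oplus>\<^bsub>Y\<^esub> y \<in> carrier Y" using c by simp
  fix s m assume s: "s \<in> Std d n" "in_tab_space s m"
  show "act (x \<oplus>\<^bsub>Y\<^esub> y) m = (\<lambda>u. (\<kappa> s + \<mu> s) * m u)"
    unfolding act_add[OF c] x[rule_format, OF s] y[rule_format, OF s] by (simp add: distrib_right)
qed

lemma diagonal_minus: "diagonal x \<kappa> \<Longrightarrow> diagonal y \<mu> \<Longrightarrow> diagonal (x \<ominus>\<^bsub>Y\<^esub> y) (\<lambda>t. \<kappa> t - \<mu> t)"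
  unfolding diagonal_def
proof (elim conjE, intro conjI ballI allI impI)
  assume c: "x \<in> carrier Y" "y \<in> carrier Y"
    and x: "\<forall>s\<in>Std d n. \<forall>m. in_tab_space s m \<longrightarrow> act x m = (\<lambda>u. \<kappa> s * m u)"
    and y: "\<forall>s\<in>Std d n. \<forall>m. in_tab_space s m \<longrightarrow> act y m = (\<lambda>u. \<mu> s * m u)"
  show "x \<ominus>\<^bsub>Y\<^esub> y \<in> carrier Y" using c by simp
  fix s m assume s: "s \<in> Std d n" "in_tab_space s m"
  show "act (x \<ominus>\<^bsub>Y\<^esub> y) m = (\<lambda>u. (\<kappa> s - \<mu> s) * m u)"
    unfolding act_minus[OF c] x[rule_format, OF s] y[rule_format, OF s] by (simp add: left_diff_distrib)
qed

lemma diagonal_sc: "c \<in> S \<Longrightarrow> diagonal (sc c) (\<lambda>t. c)"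
  unfolding diagonal_def by (auto simp: act_sc sc_closed)

lemma diagonal_one: "diagonal \<one>\<^bsub>Y\<^esub> (\<lambda>t. 1)"
  unfolding diagonal_def by (auto simp: act_one)

lemma diagonal_zero: "diagonal \<zero>\<^bsub>Y\<^esub> (\<lambda>t. 0)"
  unfolding diagonal_def by (auto simp: act_zero)

lemma diagonal_L:
  assumes a: "a \<in> {1..2 * n}"
  shows "diagonal (yh_L R d n v a) (\<lambda>t. tab_content n v \<xi> t a)"
  unfolding diagonal_def
proof (intro conjI ballI allI impI)
  show "yh_L R d n v a \<in> carrier Y" by (rule L_closed[OF a])
  fix s m assume "in_tab_space s m"
  then have e: "\<And>i. i \<in> {1..n} \<Longrightarrow> M.jm i m = (\<lambda>u. v powi fst (tab_seq s i) * m u)"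
    "\<And>i. i \<in> {1..n} \<Longrightarrow> word_t \<xi> i m = (\<lambda>u. \<xi> ^ snd (tab_seq s i) * m u)"
    unfolding M.joint_eigenvector_def by blast+
  show "act (yh_L R d n v a) m = (\<lambda>u. tab_content n v \<xi> s a * m u)"
  proof (cases "a \<le> n")
    case True
    then show ?thesis using a e(1)[of a] unfolding yh_L_def tab_content_seq by (simp add: act_JM)
  next
    case False
    then have i: "a - n \<in> {1..n}" using a by auto
    show ?thesis using False e(2)[OF i] act_t[OF i] unfolding yh_L_def tab_content_seq by simp
  qed
qed

lemma diagonal_commute: "diagonal x \<kappa> \<Longrightarrow> diagonal y \<mu> \<Longrightarrow> x \<otimes>\<^bsub>Y\<^esub> y = y \<otimes>\<^bsub>Y\<^esub> x"
  using diagonal_unique[OF diagonal_mult diagonal_mult, of x \<kappa> y \<mu>] diagonal_mult[of y \<mu> x \<kappa>]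
  by (metis (no_types, lifting) diagonal_cong diagonal_mult diagonal_unique mult.commute)

lemma diagonal_finsum:
  assumes "finite A" "\<And>i. i \<in> A \<Longrightarrow> diagonal (f i) (\<lambda>t. \<mu> i t)"
  shows "diagonal (\<Oplus>\<^bsub>Y\<^esub>i\<in>A. f i) (\<lambda>t. \<Sum>i\<in>A. \<mu> i t)"
  using assms
proof (induction A rule: finite_induct)
  case empty then show ?case using diagonal_zero by simp
next
  case (insert i A)
  have "(\<Oplus>\<^bsub>Y\<^esub>i\<in>insert i A. f i) = f i \<oplus>\<^bsub>Y\<^esub> (\<Oplus>\<^bsub>Y\<^esub>i\<in>A. f i)"
    using insert diagonal_closed by (intro Y.finsum_insert) auto
  then show ?case using insert diagonal_add[of "f i" "\<mu> i"] by simp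
qed

text \<open>
  \<open>finprod\<close> is a fold, and the factors commute by \<open>diagonal_commute\<close>.
\<close>

lemma diagonal_finprod:
  assumes "finite A" "\<And>i. i \<in> A \<Longrightarrow> diagonal (f i) (\<lambda>t. \<mu> i t)"
  shows "diagonal (\<Otimes>\<^bsub>Y\<^esub>i\<in>A. f i) (\<lambda>t. \<Prod>i\<in>A. \<mu> i t)"
proof -
  interpret LCD A "carrier Y" "(\<otimes>\<^bsub>Y\<^esub>) \<circ> f"
  proof
    fix i j z assume *: "i \<in> A" "j \<in> A" "z \<in> carrier Y"
    have "f i \<otimes>\<^bsub>Y\<^esub> f j = f j \<otimes>\<^bsub>Y\<^esub> f i" using * assms(2) diagonal_commute by blast
    moreover have "f i \<in> carrier Y" "f j \<in> carrier Y" using * assms(2) diagonal_closed by blast+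
    ultimately show "((\<otimes>\<^bsub>Y\<^esub>) \<circ> f) i (((\<otimes>\<^bsub>Y\<^esub>) \<circ> f) j z) = ((\<otimes>\<^bsub>Y\<^esub>) \<circ> f) j (((\<otimes>\<^bsub>Y\<^esub>) \<circ> f) i z)"
      using *(3) by (simp flip: Y.m_assoc)
  qed (use assms(2) diagonal_closed in auto)
  have "diagonal (foldD (carrier Y) ((\<otimes>\<^bsub>Y\<^esub>) \<circ> f) \<one>\<^bsub>Y\<^esub> B) (\<lambda>t. \<Prod>i\<in>B. \<mu> i t)" if "finite B" "B \<subseteq> A" for B
    using that
  proof (induction B rule: finite_induct)
    case empty then show ?case using diagonal_one by simp
  next
    case (insert i B)
    have e: "foldD (carrier Y) ((\<otimes>\<^bsub>Y\<^esub>) \<circ> f) \<one>\<^bsub>Y\<^esub> (insert i B) =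
        f i \<otimes>\<^bsub>Y\<^esub> foldD (carrier Y) ((\<otimes>\<^bsub>Y\<^esub>) \<circ> f) \<one>\<^bsub>Y\<^esub> B"
      using insert by (subst foldD_insert) auto
    have "diagonal (f i \<otimes>\<^bsub>Y\<^esub> foldD (carrier Y) ((\<otimes>\<^bsub>Y\<^esub>) \<circ> f) \<one>\<^bsub>Y\<^esub> B) (\<lambda>s. \<mu> i s * (\<Prod>i\<in>B. \<mu> i s))"
      by (rule diagonal_mult[OF assms(2) insert.IH]) (use insert.prems in blast)+
    then show ?case unfolding e prod.insert[OF insert.hyps] .
  qed
  then show ?thesis using assms(1) by (simp add: finprod_def)
qed

end

section \<open>Exponents modulo the order\<close>

lemma powi_mod_order:
  fixes x :: "'f::field"
  assumes x: "x \<noteq> 0" and e: "e > 0 \<Longrightarrow> x ^ e = 1"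
  shows "x powi (i mod int e) = x powi i"
proof (cases "e = 0")
  case False
  have "x powi i = x powi (int e * (i div int e) + i mod int e)" by simp
  also have "\<dots> = (x ^ e) powi (i div int e) * x powi (i mod int e)"
    using x by (subst power_int_add) (simp_all add: power_int_mult)
  finally show ?thesis using False e by simp
qed simp

lemma inj_on_powi_zmod:
  fixes x :: "'f::field"
  assumes x: "x \<noteq> 0" and min: "\<And>m. 0 < m \<Longrightarrow> x ^ m = 1 \<Longrightarrow> e > 0 \<and> e \<le> m"
  shows "inj_on (\<lambda>i. x powi i) (zmod e)"
proof (rule linorder_inj_onI)
  fix i j :: int assume *: "i < j" "i \<in> zmod e" "j \<in> zmod e"
  show "x powi i \<noteq> x powi j"
  proof
    assume "x powi i = x powi j"
    then have "x powi (j - i) = 1" using x by (simp add: power_int_diff)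
    then have "x ^ nat (j - i) = 1" using * by (simp add: power_int_def)
    then have e: "e > 0" "e \<le> nat (j - i)" using min[of "nat (j - i)"] * by auto
    have "i mod int e = i" "j mod int e = j" using *(2,3) by (auto simp: zmod_def)
    moreover have "0 \<le> i mod int e" "j mod int e < int e" using e by simp_all
    ultimately show False using e(2) *(1) by linarith
  qed
qed auto

text \<open>
  As \<open>q \<noteq> 1\<close>, the geometric sum \<open>1 + q + \<dots> + q\<^sup>m\<^sup>-\<^sup>1\<close> vanishes iff \<open>q\<^sup>m = 1\<close>: the quantum characteristic is
  the multiplicative order of \<open>q\<close>.
\<close>

lemma quantum_char_order:
  fixes q :: "'k::field"
  assumes q: "q \<noteq> 1"
  shows "quantum_char q > 0 \<Longrightarrow> q ^ quantum_char q = 1"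
    and "0 < m \<Longrightarrow> q ^ m = 1 \<Longrightarrow> quantum_char q > 0 \<and> quantum_char q \<le> m"
proof -
  have s: "(\<Sum>i<m. q ^ i) = 0 \<longleftrightarrow> q ^ m = 1" for m
    using q by (simp add: geometric_sum)
  let ?P = "\<lambda>m. m \<ge> 1 \<and> q ^ m = 1"
  have qc: "quantum_char q = (if \<exists>m\<ge>1. q ^ m = 1 then LEAST m. ?P m else 0)"
    unfolding quantum_char_def s ..
  { assume "quantum_char q > 0"
    then have "\<exists>m. ?P m" unfolding qc by (auto split: if_splits)
    from LeastI_ex[OF this] this show "q ^ quantum_char q = 1" unfolding qc by auto }
  { assume m: "0 < m" "q ^ m = 1"
    then have P: "?P m" by simp
    from LeastI[of ?P, OF P] Least_le[of ?P, OF P] P show "quantum_char q > 0 \<and> quantum_char q \<le> m"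
      unfolding qc by auto }
qed

text \<open>
  By induction on \<open>N\<close>, \<open>u\<close> acts on \<open>z\<close> as \<open>c\<close>; then \<open>u - c'\<close> acts as the unit \<open>c - c'\<close>, and no power of it
  kills \<open>z \<noteq> 0\<close>.
\<close>

lemma (in yokonuma_hecke) two_eigenvalues:
  assumes u: "u \<in> carrier Y" and c: "c \<in> S" "c' \<in> S" "c \<noteq> c'" "inverse (c - c') \<in> S"
    and z: "z \<in> carrier Y"
    and N: "(u \<ominus>\<^bsub>Y\<^esub> sc c) [^]\<^bsub>Y\<^esub> (N::nat) \<otimes>\<^bsub>Y\<^esub> z = \<zero>\<^bsub>Y\<^esub>"
    and M: "(u \<ominus>\<^bsub>Y\<^esub> sc c') [^]\<^bsub>Y\<^esub> (M::nat) \<otimes>\<^bsub>Y\<^esub> z = \<zero>\<^bsub>Y\<^esub>"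
  shows "z = \<zero>\<^bsub>Y\<^esub>"
proof -
  define w w' where "w = u \<ominus>\<^bsub>Y\<^esub> sc c" and "w' = u \<ominus>\<^bsub>Y\<^esub> sc c'"
  define \<gamma> where "\<gamma> = c - c'"
  have \<gamma>: "\<gamma> \<in> S" "inverse \<gamma> \<in> S" "\<gamma> \<noteq> 0" using c by (auto simp: \<gamma>_def diff_mem)
  have s: "sc c \<in> carrier Y" "sc c' \<in> carrier Y" "sc \<gamma> \<in> carrier Y" using c \<gamma> sc_closed by auto
  have wc: "w \<in> carrier Y" "w' \<in> carrier Y" using u s by (auto simp: w_def w'_def)
  have w': "w' = w \<oplus>\<^bsub>Y\<^esub> sc \<gamma>"
  proof -
    have "sc \<gamma> \<oplus>\<^bsub>Y\<^esub> sc c' = sc c" using sc_add[OF \<gamma>(1) c(2)] by (simp add: \<gamma>_def)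
    then have "w \<oplus>\<^bsub>Y\<^esub> sc \<gamma> \<oplus>\<^bsub>Y\<^esub> sc c' = u"
      using u s by (simp add: w_def a_minus_def Y.a_assoc Y.l_neg)
    moreover have "w \<oplus>\<^bsub>Y\<^esub> sc \<gamma> = w \<oplus>\<^bsub>Y\<^esub> sc \<gamma> \<oplus>\<^bsub>Y\<^esub> sc c' \<ominus>\<^bsub>Y\<^esub> sc c'"
      using s wc by (simp add: a_minus_def Y.a_assoc Y.r_neg)
    ultimately show ?thesis by (simp add: w'_def)
  qed
  have com: "w' \<otimes>\<^bsub>Y\<^esub> w = w \<otimes>\<^bsub>Y\<^esub> w'"
    unfolding w' using wc s sc_central[OF \<gamma>(1) wc(1)] by (simp add: Y.l_distr Y.r_distr)
  have "z = \<zero>\<^bsub>Y\<^esub>" if "z \<in> carrier Y" "w [^]\<^bsub>Y\<^esub> N \<otimes>\<^bsub>Y\<^esub> z = \<zero>\<^bsub>Y\<^esub>" "w' [^]\<^bsub>Y\<^esub> M \<otimes>\<^bsub>Y\<^esub> z = \<zero>\<^bsub>Y\<^esub>" for z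
    using that
  proof (induction N arbitrary: z)
    case 0 then show ?case by simp
  next
    case (Suc N)
    have comM: "w' [^]\<^bsub>Y\<^esub> k \<otimes>\<^bsub>Y\<^esub> w = w \<otimes>\<^bsub>Y\<^esub> w' [^]\<^bsub>Y\<^esub> k" for k :: nat
      using Y.group_commutes_pow[OF com wc(2,1)] .
    have "w [^]\<^bsub>Y\<^esub> N \<otimes>\<^bsub>Y\<^esub> (w \<otimes>\<^bsub>Y\<^esub> z) = \<zero>\<^bsub>Y\<^esub>" using Suc.prems wc by (simp add: Y.m_assoc)
    moreover have "w' [^]\<^bsub>Y\<^esub> M \<otimes>\<^bsub>Y\<^esub> (w \<otimes>\<^bsub>Y\<^esub> z) = w \<otimes>\<^bsub>Y\<^esub> (w' [^]\<^bsub>Y\<^esub> M \<otimes>\<^bsub>Y\<^esub> z)"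
      using comM[of M] wc Suc.prems(1) by (simp flip: Y.m_assoc)
    ultimately have wz: "w \<otimes>\<^bsub>Y\<^esub> z = \<zero>\<^bsub>Y\<^esub>"
      using Suc.IH[of "w \<otimes>\<^bsub>Y\<^esub> z"] Suc.prems wc by simp
    have "w' [^]\<^bsub>Y\<^esub> k \<otimes>\<^bsub>Y\<^esub> z = sc (\<gamma> ^ k) \<otimes>\<^bsub>Y\<^esub> z" for k :: nat
    proof (induction k)
      case 0 then show ?case by (simp add: sc_1)
    next
      case (Suc k)
      have k: "sc (\<gamma> ^ k) \<in> carrier Y" using \<gamma> power_mem sc_closed by auto
      have "w' [^]\<^bsub>Y\<^esub> Suc k \<otimes>\<^bsub>Y\<^esub> z = w' [^]\<^bsub>Y\<^esub> k \<otimes>\<^bsub>Y\<^esub> (w' \<otimes>\<^bsub>Y\<^esub> z)"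
        using wc \<open>z \<in> carrier Y\<close> by (simp add: Y.m_assoc)
      also have "w' \<otimes>\<^bsub>Y\<^esub> z = sc \<gamma> \<otimes>\<^bsub>Y\<^esub> z"
        unfolding w' using wc s wz \<open>z \<in> carrier Y\<close> by (simp add: Y.l_distr)
      also have "w' [^]\<^bsub>Y\<^esub> k \<otimes>\<^bsub>Y\<^esub> (sc \<gamma> \<otimes>\<^bsub>Y\<^esub> z) = sc \<gamma> \<otimes>\<^bsub>Y\<^esub> (w' [^]\<^bsub>Y\<^esub> k \<otimes>\<^bsub>Y\<^esub> z)"
        using sc_central[OF \<gamma>(1), of "w' [^]\<^bsub>Y\<^esub> k"] wc s \<open>z \<in> carrier Y\<close> by (simp flip: Y.m_assoc)
      also have "\<dots> = sc (\<gamma> ^ Suc k) \<otimes>\<^bsub>Y\<^esub> z"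
        unfolding Suc using \<gamma> power_mem k s \<open>z \<in> carrier Y\<close> by (simp add: sc_mult Y.m_assoc)
      finally show ?case .
    qed
    then have "sc (\<gamma> ^ M) \<otimes>\<^bsub>Y\<^esub> z = \<zero>\<^bsub>Y\<^esub>" using Suc.prems by simp
    then have "sc (inverse \<gamma> ^ M) \<otimes>\<^bsub>Y\<^esub> (sc (\<gamma> ^ M) \<otimes>\<^bsub>Y\<^esub> z) = \<zero>\<^bsub>Y\<^esub>"
      using sc_closed \<gamma> power_mem by simp
    moreover have "sc (inverse \<gamma> ^ M) \<otimes>\<^bsub>Y\<^esub> sc (\<gamma> ^ M) = \<one>\<^bsub>Y\<^esub>"
    proof -
      have "inverse \<gamma> ^ M * \<gamma> ^ M = 1" using \<gamma>(3) by (simp flip: power_mult_distrib)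
      then show ?thesis using sc_mult[of "inverse \<gamma> ^ M" "\<gamma> ^ M"] \<gamma> power_mem sc_1 by simp
    qed
    ultimately show ?case
      using sc_closed \<gamma> power_mem \<open>z \<in> carrier Y\<close> by (simp flip: Y.m_assoc)
  qed
  then show ?thesis using z N M by (simp add: w_def w'_def)
qed

section \<open>Lifting and reducing class idempotents\<close>

text \<open>
  Three algebras are compared: over the local ring (\<open>O\<close>), over its field of fractions (\<open>F\<close>) and over
  the residue field (\<open>K\<close>), with the inclusion \<open>\<iota>\<close> and the reduction \<open>\<rho>\<close> between them.
\<close>

locale specialization =
  fixes n d :: nat and q \<xi> :: "'k::field"
  assumes d_nonzero: "of_nat d \<noteq> (0 :: 'k)" and \<xi>_pow_d: "\<xi> ^ d = 1"
    and \<xi>_primitive: "\<And>m. 0 < m \<Longrightarrow> m < d \<Longrightarrow> \<xi> ^ m \<noteq> 1"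
    and q_nonzero: "q \<noteq> 0" and q_neq_1: "q \<noteq> 1"
begin

lemma d_nonzero_fract: "of_nat d \<noteq> (0 :: 'k poly fract)"
  using d_nonzero rconst_eq_iff[of "of_nat d :: 'k" 0] by (simp add: rconst_of_nat rconst_simps)

lemma rconst_\<xi>: "rconst \<xi> ^ d = 1" "0 < m \<Longrightarrow> m < d \<Longrightarrow> rconst \<xi> ^ m \<noteq> 1"
  using \<xi>_pow_d \<xi>_primitive[of m] rconst_eq_iff[of "\<xi> ^ m" 1] rconst_power[of \<xi> d] rconst_power[of \<xi> m]
  by (simp_all add: rconst_simps)

lemmas reduce_facts = reduce_rconst[OF q_nonzero] reduce_qhat[OF q_nonzero] reduce_add[OF q_nonzero]
  reduce_mult[OF q_nonzero]

lemma reduce_1: "reduce q 1 = 1" "1 \<in> local_carrier q"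
  using reduce_facts(1)[of 1] by (simp_all add: rconst_simps)

sublocale O: generic_yh "local_carrier q" d n qhat "rconst \<xi>"
proof -
  interpret subring_of_field "local_carrier q" by (rule subring_local[OF q_nonzero])
  have "of_nat d = rconst (of_nat d :: 'k)" by (simp add: rconst_of_nat)
  then have "inverse (of_nat d) \<in> local_carrier q"
    using inverse_mem_local(1)[OF q_nonzero, of "rconst (of_nat d)"] reduce_facts(1) d_nonzero by simp
  then show "generic_yh (local_carrier q) d qhat (rconst \<xi>)"
    using d_nonzero_fract inverse_mem_local(1)[OF q_nonzero, of qhat] reduce_facts(1)[of \<xi>] reduce_facts(2) q_nonzero
      qhat_nonzero qhat_not_root_of_unity rconst_\<xi>
    by unfold_locales auto
qed

sublocale F: generic_yh UNIV d n qhat "rconst \<xi>"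
  using d_nonzero_fract qhat_nonzero qhat_not_root_of_unity rconst_\<xi> by unfold_locales auto

sublocale K: yokonuma_hecke UNIV d n q
  using d_nonzero q_nonzero by unfold_locales auto

sublocale \<iota>: yokonuma_hecke_map "local_carrier q" UNIV d n qhat qhat id
  by unfold_locales auto

sublocale \<rho>: yokonuma_hecke_map "local_carrier q" UNIV d n qhat q "reduce q"
  using reduce_facts reduce_1 by unfold_locales auto

lemma rename_fld:
  "YH fld d n q = K.Y" "yh_X fld d n q = K.JM" "yh_t fld d n q = K.t" "yh_scalar fld d n q = K.sc"
  "YH fld d n qhat = F.Y" "yh_L fld d n qhat = yh_L F.R d n qhat" "yh_scalar fld d n qhat = F.sc"
  "yh_map (local_ring q) fld id d n qhat = \<iota>.mapY" "yh_map (local_ring q) fld (reduce q) d n q = \<rho>.mapY"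
  "YH (local_ring q) d n qhat = O.Y"
  by (simp_all only: sub_ring_UNIV local_ring_def)

lemma act_map: "x \<in> carrier O.Y \<Longrightarrow> F.act (\<iota>.mapY x) m = O.act x m"
proof -
  assume "x \<in> carrier O.Y"
  then obtain f where f: "f \<in> carrier O.F" "x = O.cls f" using O.cls_surj by blast
  then have "\<iota>.mapY x = F.cls f" "f \<in> carrier F.F"
    using \<iota>.map_cls[OF f(1)] \<iota>.map_carrier[OF f(1)] by simp_all
  then show ?thesis using O.act_cls[OF f(1)] F.act_cls[of f] f by (simp add: O.eval_def F.eval_def fun_eq_iff)
qed

lemma diagonal_map: "O.diagonal x \<kappa> \<Longrightarrow> F.diagonal (\<iota>.mapY x) \<kappa>"
  unfolding O.diagonal_def F.diagonal_def using act_map \<iota>.m.hom_closed by simp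

lemma reduce_power: "x \<in> local_carrier q \<Longrightarrow> x ^ k \<in> local_carrier q \<and> reduce q (x ^ k) = reduce q x ^ k"
  by (induction k) (auto simp: reduce_1 reduce_facts)

lemma reduce_content:
  "hat_content n \<xi> s a \<in> local_carrier q" "reduce q (hat_content n \<xi> s a) = tab_content n q \<xi> s a"
proof -
  have q: "qhat powi i \<in> local_carrier q \<and> reduce q (qhat powi i) = q powi i" for i
  proof (cases "0 \<le> i")
    case True
    then show ?thesis using reduce_power[of qhat] reduce_facts(2) by (simp add: power_int_def)
  next
    case False
    let ?x = "qhat ^ nat (- i) :: 'k poly fract"
    have x: "?x \<in> local_carrier q" "reduce q ?x = q ^ nat (- i)" using reduce_power[of qhat] reduce_facts(2) by auto
    then have i: "inverse ?x \<in> local_carrier q" "?x \<noteq> 0"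
      using inverse_mem_local[OF q_nonzero x(1)] q_nonzero by auto
    then have "reduce q (inverse ?x) = inverse (q ^ nat (- i))" using \<rho>.\<phi>_inverse[OF x(1)] x(2) by simp
    then show ?thesis using False i by (simp add: power_int_def power_inverse)
  qed
  have \<xi>: "rconst \<xi> ^ p \<in> local_carrier q \<and> reduce q (rconst \<xi> ^ p) = \<xi> ^ p" for p
    using reduce_facts(1) by (simp flip: rconst_power)
  show "hat_content n \<xi> s a \<in> local_carrier q" "reduce q (hat_content n \<xi> s a) = tab_content n q \<xi> s a"
    unfolding hat_content_def tab_content_seq using q \<xi> by auto
qed

lemma hat_content_separates:
  assumes s: "s \<in> Std d n" "s' \<in> Std d n" "s \<noteq> s'"
  shows "\<exists>a\<in>{1..2 * n}. hat_content n \<xi> s a \<noteq> hat_content n \<xi> s' a"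
proof -
  obtain i where i: "i \<in> {1..n}" "tab_seq s i \<noteq> tab_seq s' i" using tab_seq_inj[OF s(1,2)] s(3) by blast
  show ?thesis
  proof (cases "fst (tab_seq s i) = fst (tab_seq s' i)")
    case False
    then have "hat_content n \<xi> s i \<noteq> hat_content n \<xi> s' i"
      using injD[OF O.M.inj_powi] i unfolding hat_content_def tab_content_seq by auto
    then show ?thesis using i by (intro bexI[of _ i]) auto
  next
    case True
    then have "snd (tab_seq s i) \<noteq> snd (tab_seq s' i)" using i(2) by (simp add: prod_eq_iff)
    then have "rconst \<xi> ^ snd (tab_seq s i) \<noteq> rconst \<xi> ^ snd (tab_seq s' i)"
      using O.M.char_eq_iff component_range[OF s(1) i(1)] component_range[OF s(2) i(1)] by blast
    then have "hat_content n \<xi> s (n + i) \<noteq> hat_content n \<xi> s' (n + i)"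
      using i unfolding hat_content_def tab_content_seq by simp
    then show ?thesis using i by (intro bexI[of _ "n + i"]) auto
  qed
qed

definition residue_classes :: "multitableau set set" where
  "residue_classes = Std d n // content_rel d n q \<xi>"

lemma equiv_content_rel: "equiv (Std d n) (content_rel d n q \<xi>)"
  by (rule equivI) (auto simp: content_rel_def refl_on_def sym_def trans_def)

lemma class_subset: "C \<in> residue_classes \<Longrightarrow> C \<subseteq> Std d n"
  unfolding residue_classes_def using in_quotient_imp_subset[OF equiv_content_rel] .

lemma class_nonempty: "C \<in> residue_classes \<Longrightarrow> C \<noteq> {}"
  unfolding residue_classes_def using in_quotient_imp_non_empty[OF equiv_content_rel] .

lemma finite_class: "C \<in> residue_classes \<Longrightarrow> finite C"
  using class_subset finite_Std by (rule finite_subset)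

lemma finite_classes: "finite residue_classes"
  unfolding residue_classes_def using finite_Std by (intro finite_quotient) (auto simp: content_rel_def)

lemma in_class_iff:
  assumes "C \<in> residue_classes" "s \<in> C" "s' \<in> Std d n"
  shows "s' \<in> C \<longleftrightarrow> (\<forall>a\<in>{1..2 * n}. tab_content n q \<xi> s a = tab_content n q \<xi> s' a)"
proof -
  have "s' \<in> C \<longleftrightarrow> (s, s') \<in> content_rel d n q \<xi>"
    using assms(1) unfolding residue_classes_def
    by (meson assms(2) equiv_content_rel in_quotient_imp_closed in_quotient_imp_in_rel empty_subsetI insert_subset)
  then show ?thesis using assms class_subset by (auto simp: content_rel_def)
qed

text \<open>
  Two products are needed. For each tableau \<open>s\<close> outside \<open>C\<close> there is an \<open>a\<close> at which the contents of \<open>s\<close>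
  and \<open>C\<close> differ modulo the maximal ideal; the product \<open>x\<close> of the corresponding factors
  \<open>L\<^sub>a - c\<close> is zero off \<open>C\<close> and has unit values \<open>\<kappa> s\<close> on \<open>C\<close>. The product of the \<open>1 - x / \<kappa> s\<close> over
  \<open>s \<in> C\<close> is then \<open>0\<close> on \<open>C\<close> and \<open>1\<close> off \<open>C\<close>.
\<close>

lemma class_indicator_exists:
  assumes C: "C \<in> residue_classes"
  shows "\<exists>x. O.diagonal x (\<lambda>s. if s \<in> C then 1 else 0)"
proof -
  obtain s0 where s0: "s0 \<in> C" using class_nonempty[OF C] by blast
  have "\<exists>x \<kappa>. O.diagonal x \<kappa> \<and> (\<forall>s\<in>A. \<kappa> s = 0) \<and> (\<forall>s\<in>Std d n. \<kappa> s \<in> local_carrier q) \<and> (\<forall>s\<in>C. reduce q (\<kappa> s) \<noteq> 0)"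
    if "finite A" "A \<subseteq> Std d n - C" for A
    using that
  proof (induction A rule: finite_induct)
    case empty
    show ?case using O.diagonal_one reduce_1 by (intro exI[of _ "\<one>\<^bsub>O.Y\<^esub>"] exI[of _ "\<lambda>s. 1"]) auto
  next
    case (insert s A)
    then obtain x \<kappa> where x: "O.diagonal x \<kappa>" "\<forall>s\<in>A. \<kappa> s = 0" "\<forall>s\<in>Std d n. \<kappa> s \<in> local_carrier q"
      "\<forall>s\<in>C. reduce q (\<kappa> s) \<noteq> 0" by auto
    obtain a where a: "a \<in> {1..2 * n}" "tab_content n q \<xi> s0 a \<noteq> tab_content n q \<xi> s a"
      using insert.prems in_class_iff[OF C s0, of s] by auto
    let ?L = "yh_L O.R d n qhat a" and ?c = "hat_content n \<xi> s a"
    have "O.diagonal ((?L \<ominus>\<^bsub>O.Y\<^esub> O.sc ?c) \<otimes>\<^bsub>O.Y\<^esub> x) (\<lambda>s'. (hat_content n \<xi> s' a - ?c) * \<kappa> s')"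
      using O.diagonal_mult[OF O.diagonal_minus[OF O.diagonal_L[OF a(1)] O.diagonal_sc[OF reduce_content(1)]] x(1)]
      unfolding hat_content_def .
    moreover have "reduce q ((hat_content n \<xi> s' a - ?c) * \<kappa> s') \<noteq> 0" if "s' \<in> C" for s'
    proof -
      have s': "s' \<in> Std d n" using that class_subset[OF C] by blast
      have "tab_content n q \<xi> s' a \<noteq> tab_content n q \<xi> s a"
        using a that in_class_iff[OF C s0 s'] by auto
      then show ?thesis
        using x(3,4) s' that by (simp add: reduce_facts \<rho>.\<phi>_diff reduce_content O.diff_mem)
    qed
    ultimately show ?case using x(2,3)
      by (intro exI[of _ "(?L \<ominus>\<^bsub>O.Y\<^esub> O.sc ?c) \<otimes>\<^bsub>O.Y\<^esub> x"] exI[of _ "\<lambda>s'. (hat_content n \<xi> s' a - ?c) * \<kappa> s'"])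
        (auto simp: O.mult_mem O.diff_mem reduce_content)
  qed
  from this[of "Std d n - C"] obtain x \<kappa> where x: "O.diagonal x \<kappa>" "\<forall>s\<in>Std d n - C. \<kappa> s = 0"
      "\<forall>s\<in>Std d n. \<kappa> s \<in> local_carrier q" "\<forall>s\<in>C. reduce q (\<kappa> s) \<noteq> 0"
    using finite_Std by auto
  have "\<exists>y \<mu>. O.diagonal y \<mu> \<and> (\<forall>s\<in>Std d n - C. \<mu> s = 1) \<and> (\<forall>s\<in>B. \<mu> s = 0)" if "finite B" "B \<subseteq> C" for B
    using that
  proof (induction B rule: finite_induct)
    case empty
    show ?case using O.diagonal_one by (intro exI[of _ "\<one>\<^bsub>O.Y\<^esub>"] exI[of _ "\<lambda>s. 1"]) auto
  next
    case (insert s B)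
    then obtain y \<mu> where y: "O.diagonal y \<mu>" "\<forall>s\<in>Std d n - C. \<mu> s = 1" "\<forall>s\<in>B. \<mu> s = 0" by auto
    have sC: "s \<in> C" "s \<in> Std d n" using insert.prems class_subset[OF C] by auto
    have i: "inverse (\<kappa> s) \<in> local_carrier q" "\<kappa> s \<noteq> 0"
      using inverse_mem_local[OF q_nonzero, of "\<kappa> s"] x(3,4) sC by auto
    let ?y = "(\<one>\<^bsub>O.Y\<^esub> \<ominus>\<^bsub>O.Y\<^esub> (O.sc (inverse (\<kappa> s)) \<otimes>\<^bsub>O.Y\<^esub> x)) \<otimes>\<^bsub>O.Y\<^esub> y"
    have "O.diagonal ?y (\<lambda>s'. (1 - inverse (\<kappa> s) * \<kappa> s') * \<mu> s')"
      by (rule O.diagonal_mult[OF O.diagonal_minus[OF O.diagonal_one O.diagonal_mult[OF O.diagonal_sc[OF i(1)] x(1)]] y(1)])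
    then show ?case using x(2) y(2,3) i(2)
      by (intro exI[of _ ?y] exI[of _ "\<lambda>s'. (1 - inverse (\<kappa> s) * \<kappa> s') * \<mu> s'"]) auto
  qed
  from this[of C] obtain y \<mu> where y: "O.diagonal y \<mu>" "\<forall>s\<in>Std d n - C. \<mu> s = 1" "\<forall>s\<in>C. \<mu> s = 0"
    using finite_class[OF C] by auto
  have "O.diagonal (\<one>\<^bsub>O.Y\<^esub> \<ominus>\<^bsub>O.Y\<^esub> y) (\<lambda>s. 1 - \<mu> s)" by (rule O.diagonal_minus[OF O.diagonal_one y(1)])
  then have "O.diagonal (\<one>\<^bsub>O.Y\<^esub> \<ominus>\<^bsub>O.Y\<^esub> y) (\<lambda>s. if s \<in> C then 1 else 0)"
    using y(2,3) by (subst (asm) O.diagonal_cong) auto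
  then show ?thesis by blast
qed

definition lifted :: "multitableau set \<Rightarrow> (yh_gen list \<Rightarrow> 'k poly fract) set" where
  "lifted C = (SOME x. O.diagonal x (\<lambda>s. if s \<in> C then 1 else 0))"

lemma diagonal_lifted: "C \<in> residue_classes \<Longrightarrow> O.diagonal (lifted C) (\<lambda>s. if s \<in> C then 1 else 0)"
  unfolding lifted_def using class_indicator_exists by (rule someI_ex)

text \<open>
  The factors are Lagrange interpolation polynomials in the \<open>L\<^sub>a\<close>: at a tableau \<open>s' \<noteq> s\<close> one of the
  factors for an \<open>a\<close> with different contents vanishes.
\<close>

lemma diagonal_tab_idem:
  assumes s: "s \<in> Std d n"
  shows "F.diagonal (tab_idem d n \<xi> s) (\<lambda>s'. if s' = s then 1 else 0)"
proof -
  let ?ct = "hat_content n \<xi>"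
  let ?V = "\<lambda>a. {?ct u a | u. u \<in> Std d n}"
  have finV: "finite (?V a)" for a
  proof -
    have "?V a = (\<lambda>u. ?ct u a) ` Std d n" by blast
    then show ?thesis using finite_imageI[OF finite_Std] by metis
  qed
  have "F.diagonal (tab_idem d n \<xi> s) (\<lambda>s'. \<Prod>a\<in>{1..2 * n}. \<Prod>c\<in>?V a - {?ct s a}. inverse (?ct s a - c) * (?ct s' a - c))"
    unfolding tab_idem_def Let_def rename_fld
  proof (intro F.diagonal_finprod)
    fix a c assume a: "a \<in> {1..2 * n}"
    show "F.diagonal (F.sc (inverse (?ct s a - c)) \<otimes>\<^bsub>F.Y\<^esub> (yh_L F.R d n qhat a \<ominus>\<^bsub>F.Y\<^esub> F.sc c))
       (\<lambda>s'. inverse (?ct s a - c) * (?ct s' a - c))"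
      using F.diagonal_mult[OF F.diagonal_sc[OF UNIV_I] F.diagonal_minus[OF F.diagonal_L[OF a] F.diagonal_sc[OF UNIV_I]]]
      unfolding hat_content_def .
  qed (use finV in auto)
  moreover have "(\<Prod>a\<in>{1..2 * n}. \<Prod>c\<in>?V a - {?ct s a}. inverse (?ct s a - c) * (?ct s' a - c)) = (if s' = s then 1 else 0)"
    if s': "s' \<in> Std d n" for s'
  proof (cases "s' = s")
    case True
    have "(\<Prod>a\<in>{1..2 * n}. \<Prod>c\<in>?V a - {?ct s a}. inverse (?ct s a - c) * (?ct s a - c)) = 1"
      by (intro prod.neutral ballI left_inverse) auto
    then show ?thesis using True by metis
  next
    case False
    then obtain a where a: "a \<in> {1..2 * n}" "?ct s' a \<noteq> ?ct s a" using hat_content_separates[OF s' s] by blast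
    have "(\<Prod>c\<in>?V a - {?ct s a}. inverse (?ct s a - c) * (?ct s' a - c)) = 0"
    proof (rule prod_zero)
      show "finite (?V a - {?ct s a})" using finV by (rule finite_Diff)
      have "?ct s' a \<in> ?V a - {?ct s a}" using a(2) s' by blast
      then show "\<exists>c\<in>?V a - {?ct s a}. inverse (?ct s a - c) * (?ct s' a - c) = 0"
        by (rule bexI[rotated]) simp
    qed
    then have "\<exists>a\<in>{1..2 * n}. (\<Prod>c\<in>?V a - {?ct s a}. inverse (?ct s a - c) * (?ct s' a - c)) = 0"
      using a(1) by blast
    from prod_zero[OF finite_atLeastAtMost this] show ?thesis using False by metis
  qed
  ultimately show ?thesis by (subst (asm) F.diagonal_cong)
qed

lemma class_idem_eq:
  assumes C: "C \<in> residue_classes"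
  shows "class_idem d n q \<xi> C = \<rho>.mapY (lifted C)"
proof -
  have "F.diagonal (class_idem_generic d n \<xi> C) (\<lambda>s'. \<Sum>s\<in>C. if s' = s then 1 else 0)"
    unfolding class_idem_generic_def rename_fld
    using class_subset[OF C] finite_class[OF C] diagonal_tab_idem by (intro F.diagonal_finsum) auto
  moreover have "(\<Sum>s\<in>C. if s' = s then 1 else 0) = (if s' \<in> C then 1 else (0 :: 'k poly fract))" for s'
    using finite_class[OF C] by (simp add: sum.delta')
  ultimately have g: "F.diagonal (class_idem_generic d n \<xi> C) (\<lambda>s. if s \<in> C then 1 else 0)" by simp
  have l: "O.diagonal (lifted C) (\<lambda>s. if s \<in> C then 1 else 0)" by (rule diagonal_lifted[OF C])
  have "(THE x. x \<in> carrier O.Y \<and> \<iota>.mapY x = class_idem_generic d n \<xi> C) = lifted C"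
  proof (rule the_equality)
    show "lifted C \<in> carrier O.Y \<and> \<iota>.mapY (lifted C) = class_idem_generic d n \<xi> C"
      using O.diagonal_closed[OF l] F.diagonal_unique[OF diagonal_map[OF l] g] by blast
    fix x assume x: "x \<in> carrier O.Y \<and> \<iota>.mapY x = class_idem_generic d n \<xi> C"
    have "O.act x m = O.act (lifted C) m" for m
      using act_map[of x m] act_map[OF O.diagonal_closed[OF l], of m] x F.diagonal_unique[OF diagonal_map[OF l] g] by simp
    then show "x = lifted C" using O.act_inj x O.diagonal_closed[OF l] by blast
  qed
  then show ?thesis unfolding class_idem_def rename_fld by simp
qed

end

context specialization
begin

section \<open>The reduced idempotents and generalized eigenspaces\<close>

definition idem :: "multitableau set \<Rightarrow> (yh_gen list \<Rightarrow> 'k) set" where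
  "idem C = \<rho>.mapY (lifted C)"

abbreviation "LK \<equiv> yh_L K.R d n q"
abbreviation "LO \<equiv> yh_L O.R d n qhat"

lemma LK_JM: "a \<in> {1..n} \<Longrightarrow> LK a = K.JM a"
  and LK_t: "a \<in> {1..n} \<Longrightarrow> LK (n + a) = K.t a"
  by (auto simp: yh_L_def)

lemma lifted_closed: "C \<in> residue_classes \<Longrightarrow> lifted C \<in> carrier O.Y"
  using O.diagonal_closed[OF diagonal_lifted] .

lemma idem_closed: "C \<in> residue_classes \<Longrightarrow> idem C \<in> carrier K.Y"
  unfolding idem_def using lifted_closed by (intro \<rho>.m.hom_closed)

lemma class_disjoint: "C \<in> residue_classes \<Longrightarrow> C' \<in> residue_classes \<Longrightarrow> s \<in> C \<Longrightarrow> s \<in> C' \<Longrightarrow> C = C'"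
  using quotient_disj[OF equiv_content_rel] unfolding residue_classes_def by blast

lemma idem_mult:
  assumes C: "C \<in> residue_classes" "C' \<in> residue_classes"
  shows "idem C \<otimes>\<^bsub>K.Y\<^esub> idem C' = (if C = C' then idem C else \<zero>\<^bsub>K.Y\<^esub>)"
proof -
  have p: "O.diagonal (lifted C \<otimes>\<^bsub>O.Y\<^esub> lifted C') (\<lambda>s. (if s \<in> C then 1 else 0) * (if s \<in> C' then 1 else 0))"
    by (rule O.diagonal_mult[OF diagonal_lifted[OF C(1)] diagonal_lifted[OF C(2)]])
  have "lifted C \<otimes>\<^bsub>O.Y\<^esub> lifted C' = (if C = C' then lifted C else \<zero>\<^bsub>O.Y\<^esub>)"
  proof (cases "C = C'")
    case True
    then have "(\<lambda>s. (if s \<in> C then 1 else 0) * (if s \<in> C' then 1 else (0 :: 'k poly fract))) = (\<lambda>s. if s \<in> C then 1 else 0)"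
      by auto
    then show ?thesis using True O.diagonal_unique[OF p] diagonal_lifted[OF C(1)] by simp
  next
    case False
    then have "C \<inter> C' = {}" using class_disjoint[OF C] by blast
    then have "(\<lambda>s. (if s \<in> C then 1 else 0) * (if s \<in> C' then 1 else (0 :: 'k poly fract))) = (\<lambda>s. 0)"
      by (intro ext) auto
    then show ?thesis using False O.diagonal_unique[OF p] O.diagonal_zero by simp
  qed
  then show ?thesis
    unfolding idem_def \<rho>.m.hom_mult[OF lifted_closed[OF C(1)] lifted_closed[OF C(2)], symmetric] by simp
qed

lemma idem_sum: "(\<Oplus>\<^bsub>K.Y\<^esub>C\<in>residue_classes. idem C) = \<one>\<^bsub>K.Y\<^esub>"
proof -
  have c: "lifted \<in> residue_classes \<rightarrow> carrier O.Y" using lifted_closed by auto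
  have "O.diagonal (\<Oplus>\<^bsub>O.Y\<^esub>C\<in>residue_classes. lifted C) (\<lambda>s. \<Sum>C\<in>residue_classes. if s \<in> C then 1 else 0)"
    by (rule O.diagonal_finsum[OF finite_classes diagonal_lifted])
  moreover have "(\<Sum>C\<in>residue_classes. if s \<in> C then 1 else (0 :: 'k poly fract)) = 1" if s: "s \<in> Std d n" for s
  proof -
    have "s \<in> \<Union>residue_classes"
      using s Union_quotient[OF equiv_content_rel] unfolding residue_classes_def by simp
    then obtain C where C: "C \<in> residue_classes" "s \<in> C" by blast
    then have "(\<Sum>C'\<in>residue_classes. if s \<in> C' then 1 else (0 :: 'k poly fract)) = (\<Sum>C'\<in>residue_classes. if C' = C then 1 else 0)"
      using class_disjoint by (intro sum.cong) auto
    then show ?thesis using C(1) finite_classes by simp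
  qed
  ultimately have "O.diagonal (\<Oplus>\<^bsub>O.Y\<^esub>C\<in>residue_classes. lifted C) (\<lambda>s. 1)"
    using O.diagonal_cong[of "\<lambda>s. \<Sum>C\<in>residue_classes. if s \<in> C then 1 else 0" "\<lambda>s. 1"] by blast
  then have "(\<Oplus>\<^bsub>O.Y\<^esub>C\<in>residue_classes. lifted C) = \<one>\<^bsub>O.Y\<^esub>"
    using O.diagonal_unique O.diagonal_one by blast
  then show ?thesis using \<rho>.m.hom_finsum[OF c] \<rho>.m.hom_one by (simp add: idem_def comp_def)
qed

lemma idem_commute:
  assumes "C \<in> residue_classes" "a \<in> {1..2 * n}"
  shows "idem C \<otimes>\<^bsub>K.Y\<^esub> LK a = LK a \<otimes>\<^bsub>K.Y\<^esub> idem C"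
proof -
  have "lifted C \<otimes>\<^bsub>O.Y\<^esub> LO a = LO a \<otimes>\<^bsub>O.Y\<^esub> lifted C"
    by (rule O.diagonal_commute[OF diagonal_lifted[OF assms(1)] O.diagonal_L[OF assms(2)]])
  then show ?thesis
    using \<rho>.m.hom_mult[OF lifted_closed[OF assms(1)] O.L_closed[OF assms(2)]]
      \<rho>.m.hom_mult[OF O.L_closed[OF assms(2)] lifted_closed[OF assms(1)]]
    by (simp add: idem_def \<rho>.map_L[OF assms(2)])
qed

lemma map_L_minus:
  assumes "a \<in> {1..2 * n}" "c \<in> local_carrier q"
  shows "\<rho>.mapY (LO a \<ominus>\<^bsub>O.Y\<^esub> O.sc c) = LK a \<ominus>\<^bsub>K.Y\<^esub> K.sc (reduce q c)"
proof -
  have "\<rho>.mapY (\<ominus>\<^bsub>O.Y\<^esub> O.sc c) = \<ominus>\<^bsub>K.Y\<^esub> K.sc (reduce q c)"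
    using \<rho>.m.hom_a_inv[OF O.sc_closed[OF assms(2)]] \<rho>.map_sc[OF assms(2)] by simp
  then show ?thesis
    using \<rho>.m.hom_add[OF O.L_closed[OF assms(1)] O.Y.a_inv_closed[OF O.sc_closed[OF assms(2)]]]
    by (simp add: a_minus_def \<rho>.map_L[OF assms(1)])
qed

text \<open>
  The product of \<open>L\<^sub>a - c\<close> over the generic contents \<open>c\<close> of the tableaux in \<open>C\<close> vanishes on \<open>C\<close>, so it
  kills the lift; all these contents have the same reduction.
\<close>

lemma nilpotent_on_idem:
  assumes C: "C \<in> residue_classes" and s: "s \<in> C" and a: "a \<in> {1..2 * n}"
  shows "(LK a \<ominus>\<^bsub>K.Y\<^esub> K.sc (tab_content n q \<xi> s a)) [^]\<^bsub>K.Y\<^esub> card C \<otimes>\<^bsub>K.Y\<^esub> idem C = \<zero>\<^bsub>K.Y\<^esub>"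
proof -
  let ?w = "LK a \<ominus>\<^bsub>K.Y\<^esub> K.sc (tab_content n q \<xi> s a)" and ?h = "\<lambda>s. hat_content n \<xi> s a"
  have w: "?w \<in> carrier K.Y" using K.L_closed[OF a] K.sc_closed[OF UNIV_I] by simp
  have "\<exists>y. O.diagonal y (\<lambda>s'. \<Prod>s\<in>B. ?h s' - ?h s) \<and> \<rho>.mapY y = ?w [^]\<^bsub>K.Y\<^esub> card B"
    if "finite B" "B \<subseteq> C" for B
    using that
  proof (induction B rule: finite_induct)
    case empty
    show ?case using O.diagonal_one \<rho>.m.hom_one by (intro exI[of _ "\<one>\<^bsub>O.Y\<^esub>"]) simp
  next
    case (insert r B)
    then obtain y where y: "O.diagonal y (\<lambda>s'. \<Prod>s\<in>B. ?h s' - ?h s)" "\<rho>.mapY y = ?w [^]\<^bsub>K.Y\<^esub> card B" by auto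
    let ?x = "LO a \<ominus>\<^bsub>O.Y\<^esub> O.sc (?h r)"
    have x: "O.diagonal ?x (\<lambda>s'. ?h s' - ?h r)"
      using O.diagonal_minus[OF O.diagonal_L[OF a] O.diagonal_sc[OF reduce_content(1)]] unfolding hat_content_def .
    have "tab_content n q \<xi> r a = tab_content n q \<xi> s a"
      using insert.prems in_class_iff[OF C s, of r] class_subset[OF C] a by auto
    then have "\<rho>.mapY ?x = ?w" using map_L_minus[OF a reduce_content(1)] reduce_content(2) by simp
    then have "\<rho>.mapY (y \<otimes>\<^bsub>O.Y\<^esub> ?x) = ?w [^]\<^bsub>K.Y\<^esub> card (insert r B)"
      using \<rho>.m.hom_mult[OF O.diagonal_closed[OF y(1)] O.diagonal_closed[OF x]] y(2) insert.hyps by simp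
    moreover have "O.diagonal (y \<otimes>\<^bsub>O.Y\<^esub> ?x) (\<lambda>s'. \<Prod>s\<in>insert r B. ?h s' - ?h s)"
    proof -
      have "(\<lambda>s'. \<Prod>s\<in>insert r B. ?h s' - ?h s) = (\<lambda>s'. (\<Prod>s\<in>B. ?h s' - ?h s) * (?h s' - ?h r))"
        using insert.hyps by (simp add: mult.commute)
      then show ?thesis using O.diagonal_mult[OF y(1) x] by simp
    qed
    ultimately show ?case by blast
  qed
  from this[OF finite_class[OF C]] obtain y where
    y: "O.diagonal y (\<lambda>s'. \<Prod>s\<in>C. ?h s' - ?h s)" "\<rho>.mapY y = ?w [^]\<^bsub>K.Y\<^esub> card C" by blast
  have z: "(\<lambda>s'. (\<Prod>s\<in>C. ?h s' - ?h s) * (if s' \<in> C then 1 else 0)) = (\<lambda>s'. 0)"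
    using finite_class[OF C] by (auto simp: fun_eq_iff prod_zero_iff)
  have "y \<otimes>\<^bsub>O.Y\<^esub> lifted C = \<zero>\<^bsub>O.Y\<^esub>"
    using O.diagonal_unique[OF _ O.diagonal_zero] O.diagonal_mult[OF y(1) diagonal_lifted[OF C]] unfolding z by blast
  then show ?thesis
    using \<rho>.m.hom_mult[OF O.diagonal_closed[OF y(1)] lifted_closed[OF C]] y(2) \<rho>.m.hom_zero by (simp add: idem_def)
qed

text \<open>
  The contents at \<open>n + a\<close> do not involve the indeterminate, so they agree on \<open>C\<close> before reduction
  and a single factor suffices.
\<close>

lemma t_on_idem:
  assumes C: "C \<in> residue_classes" and s: "s \<in> C" and a: "a \<in> {1..n}"
  shows "(LK (n + a) \<ominus>\<^bsub>K.Y\<^esub> K.sc (tab_content n q \<xi> s (n + a))) \<otimes>\<^bsub>K.Y\<^esub> idem C = \<zero>\<^bsub>K.Y\<^esub>"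
proof -
  let ?h = "\<lambda>s. hat_content n \<xi> s (n + a)"
  have a': "n + a \<in> {1..2 * n}" using a by auto
  let ?x = "LO (n + a) \<ominus>\<^bsub>O.Y\<^esub> O.sc (?h s)"
  have x: "O.diagonal ?x (\<lambda>s'. ?h s' - ?h s)"
    using O.diagonal_minus[OF O.diagonal_L[OF a'] O.diagonal_sc[OF reduce_content(1)]] unfolding hat_content_def .
  have "?h s' = ?h s" if "s' \<in> C" for s'
  proof -
    have "tab_content n q \<xi> s (n + a) = tab_content n q \<xi> s' (n + a)"
      using that in_class_iff[OF C s, of s'] class_subset[OF C] a' by blast
    then have "\<xi> ^ snd (tab_seq s a) = \<xi> ^ snd (tab_seq s' a)" using a unfolding tab_content_seq by simp
    then show ?thesis using a unfolding hat_content_def tab_content_seq by (simp flip: rconst_power)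
  qed
  then have z: "(\<lambda>s'. (?h s' - ?h s) * (if s' \<in> C then 1 else 0)) = (\<lambda>s'. 0)" by auto
  have "?x \<otimes>\<^bsub>O.Y\<^esub> lifted C = \<zero>\<^bsub>O.Y\<^esub>"
    using O.diagonal_unique[OF _ O.diagonal_zero] O.diagonal_mult[OF x diagonal_lifted[OF C]] unfolding z by blast
  then show ?thesis
    using \<rho>.m.hom_mult[OF O.diagonal_closed[OF x] lifted_closed[OF C]] \<rho>.m.hom_zero
      map_L_minus[OF a' reduce_content(1)] reduce_content(2) by (simp add: idem_def)
qed

abbreviation "res \<equiv> class_res d n q \<xi>"

lemma inj_on_powi_residues: "inj_on (\<lambda>i. q powi i) (zmod (quantum_char q))" "inj_on (\<lambda>i. \<xi> powi i) (zmod d)"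
proof -
  show "inj_on (\<lambda>i. q powi i) (zmod (quantum_char q))"
    by (rule inj_on_powi_zmod[OF q_nonzero quantum_char_order(2)[OF q_neq_1]])
  show "inj_on (\<lambda>i. \<xi> powi i) (zmod d)"
  proof (rule inj_on_powi_zmod)
    show "\<xi> \<noteq> 0" using \<xi>_pow_d K.d_pos by (cases "\<xi> = 0") (auto simp: power_0_left)
    show "d > 0 \<and> d \<le> m" if "0 < m" "\<xi> ^ m = 1" for m
      using \<xi>_primitive[OF that(1)] that(2) K.d_pos by (cases "m < d") auto
  qed
qed

lemma class_res_spec:
  assumes C: "C \<in> residue_classes"
  shows "res C \<in> K_index d n q \<and>
     (\<forall>t\<in>C. \<forall>a\<in>{1..n}. tab_content n q \<xi> t a = q powi fst (res C a) \<and>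
                         tab_content n q \<xi> t (n + a) = \<xi> powi snd (res C a))"
proof -
  obtain s where s: "s \<in> C" using class_nonempty[OF C] by blast
  let ?e = "quantum_char q"
  let ?P = "\<lambda>k. k \<in> K_index d n q \<and>
     (\<forall>t\<in>C. \<forall>a\<in>{1..n}. tab_content n q \<xi> t a = q powi fst (k a) \<and>
                         tab_content n q \<xi> t (n + a) = \<xi> powi snd (k a))"
  define k0 where "k0 = restrict (\<lambda>a. (fst (tab_seq s a) mod int ?e, int (snd (tab_seq s a)) mod int d)) {1..n}"
  have "\<exists>!k. ?P k"
  proof (rule ex1I[of _ k0])
    show "?P k0"
    proof (intro conjI ballI)
      show "k0 \<in> K_index d n q" by (auto simp: k0_def K_index_def zmod_def)
      fix r a assume r: "r \<in> C" and a: "a \<in> {1..n}"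
      have e: "tab_content n q \<xi> r b = tab_content n q \<xi> s b" if "b \<in> {1..2 * n}" for b
        using in_class_iff[OF C s, of r] r class_subset[OF C] that by auto
      show "tab_content n q \<xi> r a = q powi fst (k0 a)"
        using e[of a] a powi_mod_order[OF q_nonzero quantum_char_order(1)[OF q_neq_1]]
        unfolding tab_content_seq by (simp add: k0_def)
      have "\<xi> \<noteq> 0" using \<xi>_pow_d K.d_pos by (cases "\<xi> = 0") (auto simp: power_0_left)
      then show "tab_content n q \<xi> r (n + a) = \<xi> powi snd (k0 a)"
        using e[of "n + a"] a powi_mod_order[of \<xi> d "int (snd (tab_seq s a))"] \<xi>_pow_d
        unfolding tab_content_seq by (simp add: k0_def)
    qed
    fix k assume k: "?P k"
    have k': "?P k0" by fact
    have mem: "k \<in> {1..n} \<rightarrow>\<^sub>E zmod ?e \<times> zmod d" "k0 \<in> {1..n} \<rightarrow>\<^sub>E zmod ?e \<times> zmod d"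
      using conjunct1[OF k] conjunct1[OF k'] unfolding K_index_def .
    show "k = k0"
    proof (rule PiE_ext[OF mem])
      fix a assume a: "a \<in> {1..n}"
      note m = PiE_mem[OF mem(1) a] PiE_mem[OF mem(2) a]
      have "tab_content n q \<xi> s a = q powi fst (k a) \<and> tab_content n q \<xi> s (n + a) = \<xi> powi snd (k a)"
        using k s a by blast
      moreover have "tab_content n q \<xi> s a = q powi fst (k0 a) \<and> tab_content n q \<xi> s (n + a) = \<xi> powi snd (k0 a)"
        using k' s a by blast
      ultimately have "q powi fst (k a) = q powi fst (k0 a)" "\<xi> powi snd (k a) = \<xi> powi snd (k0 a)" by simp_all
      then show "k a = k0 a"
        using inj_onD[OF inj_on_powi_residues(1)] inj_onD[OF inj_on_powi_residues(2)] m
        by (intro prod_eqI) (auto simp: mem_Times_iff)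
    qed
  qed
  from theI'[OF this] show ?thesis unfolding class_res_def .
qed

lemmas res_in = conjunct1[OF class_res_spec]

lemma res_content:
  assumes "C \<in> residue_classes" "s \<in> C" "a \<in> {1..n}"
  shows "tab_content n q \<xi> s a = q powi fst (res C a)" "tab_content n q \<xi> s (n + a) = \<xi> powi snd (res C a)"
  using class_res_spec[OF assms(1)] assms(2,3) by blast+

lemma inj_on_res: "inj_on res residue_classes"
proof (rule inj_onI)
  fix C C' assume C: "C \<in> residue_classes" "C' \<in> residue_classes" "res C = res C'"
  obtain s s' where s: "s \<in> C" "s' \<in> C'" using class_nonempty C by blast
  have "tab_content n q \<xi> s a = tab_content n q \<xi> s' a" if a: "a \<in> {1..2 * n}" for a
  proof (cases "a \<le> n")
    case True
    then have "a \<in> {1..n}" using a by auto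
    then show ?thesis using res_content(1) C s by metis
  next
    case False
    then have "a - n \<in> {1..n}" "a = n + (a - n)" using a by auto
    then show ?thesis using res_content(2) C s by metis
  qed
  then have "s' \<in> C" using in_class_iff[OF C(1) s(1)] class_subset[OF C(2)] s(2) by blast
  then show "C = C'" using class_disjoint[OF C(1,2)] s(2) by blast
qed

lemma eigenspace_iff:
  "x \<in> yh_eigenspace d n q \<xi> k \<longleftrightarrow> x \<in> carrier K.Y \<and> (\<exists>N\<^sub>0. \<forall>N\<ge>N\<^sub>0. \<forall>a\<in>{1..n}.
     (LK a \<ominus>\<^bsub>K.Y\<^esub> K.sc (q powi fst (k a))) [^]\<^bsub>K.Y\<^esub> (N::nat) \<otimes>\<^bsub>K.Y\<^esub> x = \<zero>\<^bsub>K.Y\<^esub> \<and>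
     (LK (n + a) \<ominus>\<^bsub>K.Y\<^esub> K.sc (\<xi> powi snd (k a))) \<otimes>\<^bsub>K.Y\<^esub> x = \<zero>\<^bsub>K.Y\<^esub>)"
  unfolding yh_eigenspace_def Let_def rename_fld mem_Collect_eq by (simp only: LK_JM LK_t cong: ball_cong)

lemma pow_commute_idem:
  assumes C: "C \<in> residue_classes" and a: "a \<in> {1..2 * n}" and x: "x \<in> carrier K.Y"
    and z: "(LK a \<ominus>\<^bsub>K.Y\<^esub> K.sc c) [^]\<^bsub>K.Y\<^esub> (N::nat) \<otimes>\<^bsub>K.Y\<^esub> x = \<zero>\<^bsub>K.Y\<^esub>"
  shows "(LK a \<ominus>\<^bsub>K.Y\<^esub> K.sc c) [^]\<^bsub>K.Y\<^esub> N \<otimes>\<^bsub>K.Y\<^esub> (idem C \<otimes>\<^bsub>K.Y\<^esub> x) = \<zero>\<^bsub>K.Y\<^esub>"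
proof -
  let ?w = "LK a \<ominus>\<^bsub>K.Y\<^esub> K.sc c"
  have c: "LK a \<in> carrier K.Y" "K.sc c \<in> carrier K.Y" "idem C \<in> carrier K.Y"
    using K.L_closed[OF a] K.sc_closed[OF UNIV_I] idem_closed[OF C] by auto
  have w: "?w \<in> carrier K.Y" using c by simp
  have "?w \<otimes>\<^bsub>K.Y\<^esub> idem C = idem C \<otimes>\<^bsub>K.Y\<^esub> ?w"
    using idem_commute[OF C a] K.sc_central[OF UNIV_I c(3)] c
    by (simp add: a_minus_def K.Y.l_distr K.Y.r_distr K.Y.l_minus K.Y.r_minus)
  then have "?w [^]\<^bsub>K.Y\<^esub> N \<otimes>\<^bsub>K.Y\<^esub> idem C = idem C \<otimes>\<^bsub>K.Y\<^esub> ?w [^]\<^bsub>K.Y\<^esub> N"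
    using K.Y.group_commutes_pow w c(3) by blast
  then have "?w [^]\<^bsub>K.Y\<^esub> N \<otimes>\<^bsub>K.Y\<^esub> (idem C \<otimes>\<^bsub>K.Y\<^esub> x) = idem C \<otimes>\<^bsub>K.Y\<^esub> (?w [^]\<^bsub>K.Y\<^esub> N \<otimes>\<^bsub>K.Y\<^esub> x)"
    using w c(3) x by (simp flip: K.Y.m_assoc)
  then show ?thesis using z c(3) by simp
qed

text \<open>
  On the product the eigenvalue of some \<open>L\<^sub>a\<close> would be the one prescribed by \<open>k\<close> and also the one
  prescribed by \<open>C\<close>.
\<close>

lemma idem_kills_other_eigenspaces:
  assumes C: "C \<in> residue_classes" and k: "k \<in> K_index d n q" "k \<noteq> res C"
    and x: "x \<in> yh_eigenspace d n q \<xi> k"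
  shows "idem C \<otimes>\<^bsub>K.Y\<^esub> x = \<zero>\<^bsub>K.Y\<^esub>"
proof -
  obtain s where s: "s \<in> C" using class_nonempty[OF C] by blast
  have xc: "x \<in> carrier K.Y" and ic: "idem C \<in> carrier K.Y" using x idem_closed[OF C] unfolding eigenspace_iff by blast+
  obtain N where N: "\<forall>a\<in>{1..n}. (LK a \<ominus>\<^bsub>K.Y\<^esub> K.sc (q powi fst (k a))) [^]\<^bsub>K.Y\<^esub> (N::nat) \<otimes>\<^bsub>K.Y\<^esub> x = \<zero>\<^bsub>K.Y\<^esub> \<and>
     (LK (n + a) \<ominus>\<^bsub>K.Y\<^esub> K.sc (\<xi> powi snd (k a))) \<otimes>\<^bsub>K.Y\<^esub> x = \<zero>\<^bsub>K.Y\<^esub>"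
    using x unfolding eigenspace_iff by (blast intro: order_refl)
  have mem: "k \<in> {1..n} \<rightarrow>\<^sub>E zmod (quantum_char q) \<times> zmod d" "res C \<in> {1..n} \<rightarrow>\<^sub>E zmod (quantum_char q) \<times> zmod d"
    using k(1) res_in[OF C] unfolding K_index_def by blast+
  then obtain a where a: "a \<in> {1..n}" "k a \<noteq> res C a" using PiE_ext k(2) by metis
  have a': "a \<in> {1..2 * n}" "n + a \<in> {1..2 * n}" using a by auto
  have m: "k a \<in> zmod (quantum_char q) \<times> zmod d" "res C a \<in> zmod (quantum_char q) \<times> zmod d"
    using PiE_mem[OF mem(1) a(1)] PiE_mem[OF mem(2) a(1)] .
  have z: "idem C \<otimes>\<^bsub>K.Y\<^esub> x \<in> carrier K.Y" using xc ic by simp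
  show ?thesis
  proof (cases "fst (k a) = fst (res C a)")
    case False
    then have ne: "q powi fst (k a) \<noteq> q powi fst (res C a)"
      using inj_onD[OF inj_on_powi_residues(1)] m by (auto simp: mem_Times_iff)
    let ?w = "LK a \<ominus>\<^bsub>K.Y\<^esub> K.sc (q powi fst (res C a))"
    have "?w [^]\<^bsub>K.Y\<^esub> card C \<otimes>\<^bsub>K.Y\<^esub> idem C = \<zero>\<^bsub>K.Y\<^esub>"
      using nilpotent_on_idem[OF C s a'(1)] unfolding res_content(1)[OF C s a(1)] .
    moreover have "?w \<in> carrier K.Y" using K.L_closed[OF a'(1)] K.sc_closed[OF UNIV_I] by simp
    ultimately have "?w [^]\<^bsub>K.Y\<^esub> card C \<otimes>\<^bsub>K.Y\<^esub> (idem C \<otimes>\<^bsub>K.Y\<^esub> x) = \<zero>\<^bsub>K.Y\<^esub>"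
      using xc ic by (simp flip: K.Y.m_assoc)
    then show ?thesis
      using K.two_eigenvalues[OF K.L_closed[OF a'(1)] UNIV_I UNIV_I ne UNIV_I z]
        pow_commute_idem[OF C a'(1) xc] N a(1) by blast
  next
    case True
    then have "snd (k a) \<noteq> snd (res C a)" using a(2) by (simp add: prod_eq_iff)
    then have ne: "\<xi> powi snd (k a) \<noteq> \<xi> powi snd (res C a)"
      using inj_onD[OF inj_on_powi_residues(2)] m by (auto simp: mem_Times_iff)
    let ?u = "\<lambda>c. LK (n + a) \<ominus>\<^bsub>K.Y\<^esub> K.sc c"
    have u: "?u c \<in> carrier K.Y" for c using K.L_closed[OF a'(2)] K.sc_closed[OF UNIV_I] by simp
    have "?u (\<xi> powi snd (res C a)) \<otimes>\<^bsub>K.Y\<^esub> idem C = \<zero>\<^bsub>K.Y\<^esub>"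
      using t_on_idem[OF C s a(1)] unfolding res_content(2)[OF C s a(1)] .
    then have 1: "?u (\<xi> powi snd (res C a)) [^]\<^bsub>K.Y\<^esub> (1::nat) \<otimes>\<^bsub>K.Y\<^esub> (idem C \<otimes>\<^bsub>K.Y\<^esub> x) = \<zero>\<^bsub>K.Y\<^esub>"
      using xc ic u by (simp flip: K.Y.m_assoc)
    have "?u (\<xi> powi snd (k a)) [^]\<^bsub>K.Y\<^esub> (1::nat) \<otimes>\<^bsub>K.Y\<^esub> x = \<zero>\<^bsub>K.Y\<^esub>"
      using N a(1) u by simp
    then show ?thesis
      using K.two_eigenvalues[OF K.L_closed[OF a'(2)] UNIV_I UNIV_I ne UNIV_I z _ 1]
        pow_commute_idem[OF C a'(2) xc] by blast
  qed
qed

lemma idem_in_eigenspace: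
  assumes C: "C \<in> residue_classes" and x: "x \<in> carrier K.Y"
  shows "idem C \<otimes>\<^bsub>K.Y\<^esub> x \<in> yh_eigenspace d n q \<xi> (res C)"
  unfolding eigenspace_iff
proof (intro conjI exI[of _ "card C"] allI impI ballI)
  obtain s where s: "s \<in> C" using class_nonempty[OF C] by blast
  have ic: "idem C \<in> carrier K.Y" by (rule idem_closed[OF C])
  then show "idem C \<otimes>\<^bsub>K.Y\<^esub> x \<in> carrier K.Y" using x by simp
  fix N a assume N: "card C \<le> N" and a: "a \<in> {1..n}"
  have a': "a \<in> {1..2 * n}" "n + a \<in> {1..2 * n}" using a by auto
  let ?w = "LK a \<ominus>\<^bsub>K.Y\<^esub> K.sc (q powi fst (res C a))"
  have w: "?w \<in> carrier K.Y" using K.L_closed[OF a'(1)] K.sc_closed[OF UNIV_I] by simp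
  have "?w [^]\<^bsub>K.Y\<^esub> card C \<otimes>\<^bsub>K.Y\<^esub> idem C = \<zero>\<^bsub>K.Y\<^esub>"
    using nilpotent_on_idem[OF C s a'(1)] unfolding res_content(1)[OF C s a] .
  moreover have "?w [^]\<^bsub>K.Y\<^esub> N = ?w [^]\<^bsub>K.Y\<^esub> (N - card C) \<otimes>\<^bsub>K.Y\<^esub> ?w [^]\<^bsub>K.Y\<^esub> card C"
    using K.Y.nat_pow_mult[OF w, of "N - card C" "card C"] N by simp
  ultimately have "?w [^]\<^bsub>K.Y\<^esub> N \<otimes>\<^bsub>K.Y\<^esub> idem C = \<zero>\<^bsub>K.Y\<^esub>" using w ic by (simp add: K.Y.m_assoc)
  then show "?w [^]\<^bsub>K.Y\<^esub> N \<otimes>\<^bsub>K.Y\<^esub> (idem C \<otimes>\<^bsub>K.Y\<^esub> x) = \<zero>\<^bsub>K.Y\<^esub>"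
    using w ic x by (simp flip: K.Y.m_assoc)
  let ?u = "LK (n + a) \<ominus>\<^bsub>K.Y\<^esub> K.sc (\<xi> powi snd (res C a))"
  have u: "?u \<in> carrier K.Y" using K.L_closed[OF a'(2)] K.sc_closed[OF UNIV_I] by simp
  have "?u \<otimes>\<^bsub>K.Y\<^esub> idem C = \<zero>\<^bsub>K.Y\<^esub>"
    using t_on_idem[OF C s a] unfolding res_content(2)[OF C s a] .
  then show "?u \<otimes>\<^bsub>K.Y\<^esub> (idem C \<otimes>\<^bsub>K.Y\<^esub> x) = \<zero>\<^bsub>K.Y\<^esub>" using u ic x by (simp flip: K.Y.m_assoc)
qed

text \<open>
  The family of eigenspace projectors; a sequence that is not the residue sequence of a class
  has eigenspace \<open>0\<close>.
\<close>

definition residue_idem :: "(nat \<Rightarrow> int \<times> int) \<Rightarrow> (yh_gen list \<Rightarrow> 'k) set" where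
  "residue_idem = (\<lambda>k\<in>K_index d n q.
     if k \<in> res ` residue_classes then idem (inv_into residue_classes res k) else \<zero>\<^bsub>K.Y\<^esub>)"

lemma residue_idem_res: "C \<in> residue_classes \<Longrightarrow> residue_idem (res C) = idem C"
  by (simp add: residue_idem_def res_in inv_into_f_f[OF inj_on_res])

lemma residue_idem_cases:
  assumes "k \<in> K_index d n q"
  obtains C where "C \<in> residue_classes" "k = res C" "residue_idem k = idem C"
  | "k \<notin> res ` residue_classes" "residue_idem k = \<zero>\<^bsub>K.Y\<^esub>"
proof (cases "k \<in> res ` residue_classes")
  case True
  then show ?thesis using residue_idem_res that(1) by blast
next
  case False
  then show ?thesis using assms that(2) by (simp add: residue_idem_def)
qed

lemma residue_idem_closed: "k \<in> K_index d n q \<Longrightarrow> residue_idem k \<in> carrier K.Y"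
  by (erule residue_idem_cases) (auto simp: idem_closed)

lemma residue_idem_on_eigenspace:
  assumes k: "k \<in> K_index d n q" and x: "x \<in> yh_eigenspace d n q \<xi> k"
  shows "residue_idem k \<otimes>\<^bsub>K.Y\<^esub> x = x"
proof -
  have xc: "x \<in> carrier K.Y" using x unfolding eigenspace_iff by blast
  have ic: "idem \<in> residue_classes \<rightarrow> carrier K.Y" using idem_closed by blast
  have "x = (\<Oplus>\<^bsub>K.Y\<^esub>C\<in>residue_classes. idem C \<otimes>\<^bsub>K.Y\<^esub> x)"
    using K.Y.finsum_ldistr[OF finite_classes xc ic] idem_sum xc by simp
  also have "\<dots> = residue_idem k \<otimes>\<^bsub>K.Y\<^esub> x"
  proof (rule residue_idem_cases[OF k])
    fix C assume C: "C \<in> residue_classes" "k = res C" "residue_idem k = idem C"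
    have "(\<Oplus>\<^bsub>K.Y\<^esub>C'\<in>residue_classes. idem C' \<otimes>\<^bsub>K.Y\<^esub> x) =
        (\<Oplus>\<^bsub>K.Y\<^esub>C'\<in>residue_classes. if C = C' then idem C' \<otimes>\<^bsub>K.Y\<^esub> x else \<zero>\<^bsub>K.Y\<^esub>)"
    proof (rule K.Y.add.finprod_cong')
      fix C' assume C': "C' \<in> residue_classes"
      show "idem C' \<otimes>\<^bsub>K.Y\<^esub> x = (if C = C' then idem C' \<otimes>\<^bsub>K.Y\<^esub> x else \<zero>\<^bsub>K.Y\<^esub>)"
        using idem_kills_other_eigenspaces[OF C' k _ x] inj_onD[OF inj_on_res _ C(1) C'] C(2) by auto
    qed (use idem_closed xc in auto)
    also have "\<dots> = idem C \<otimes>\<^bsub>K.Y\<^esub> x"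
      using idem_closed xc by (intro K.Y.add.finprod_singleton[OF C(1) finite_classes]) auto
    finally show ?thesis using C(3) by simp
  next
    assume *: "k \<notin> res ` residue_classes" "residue_idem k = \<zero>\<^bsub>K.Y\<^esub>"
    have "(\<Oplus>\<^bsub>K.Y\<^esub>C'\<in>residue_classes. idem C' \<otimes>\<^bsub>K.Y\<^esub> x) = (\<Oplus>\<^bsub>K.Y\<^esub>C'\<in>residue_classes. \<zero>\<^bsub>K.Y\<^esub>)"
      using idem_kills_other_eigenspaces[OF _ k _ x] *(1) by (intro K.Y.add.finprod_cong') auto
    then show ?thesis using xc *(2) by simp
  qed
  finally show ?thesis ..
qed

lemma residue_idem_other_eigenspace:
  assumes l: "l \<in> K_index d n q" and k: "k \<in> K_index d n q" "k \<noteq> l" and x: "x \<in> yh_eigenspace d n q \<xi> k"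
  shows "residue_idem l \<otimes>\<^bsub>K.Y\<^esub> x = \<zero>\<^bsub>K.Y\<^esub>"
proof (rule residue_idem_cases[OF l])
  fix C assume "C \<in> residue_classes" "l = res C" "residue_idem l = idem C"
  then show ?thesis using idem_kills_other_eigenspaces k x by metis
qed (use x in \<open>auto simp: eigenspace_iff\<close>)

lemma residue_idem_range:
  assumes k: "k \<in> K_index d n q"
  shows "{residue_idem k \<otimes>\<^bsub>K.Y\<^esub> x | x. x \<in> carrier K.Y} = yh_eigenspace d n q \<xi> k"
proof
  show "yh_eigenspace d n q \<xi> k \<subseteq> {residue_idem k \<otimes>\<^bsub>K.Y\<^esub> x | x. x \<in> carrier K.Y}"
  proof
    fix x assume x: "x \<in> yh_eigenspace d n q \<xi> k"
    then have "x = residue_idem k \<otimes>\<^bsub>K.Y\<^esub> x" "x \<in> carrier K.Y"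
      using residue_idem_on_eigenspace[OF k] unfolding eigenspace_iff by auto
    then show "x \<in> {residue_idem k \<otimes>\<^bsub>K.Y\<^esub> x | x. x \<in> carrier K.Y}" by blast
  qed
  have "residue_idem k \<otimes>\<^bsub>K.Y\<^esub> x \<in> yh_eigenspace d n q \<xi> k" if x: "x \<in> carrier K.Y" for x
  proof (rule residue_idem_cases[OF k])
    assume "residue_idem k = \<zero>\<^bsub>K.Y\<^esub>"
    moreover have "LK a \<ominus>\<^bsub>K.Y\<^esub> K.sc c \<in> carrier K.Y" if "a \<in> {1..2 * n}" for a c
      using K.L_closed[OF that] K.sc_closed[OF UNIV_I] by simp
    ultimately show ?thesis using x unfolding eigenspace_iff by (auto intro!: exI[of _ 0])
  qed (use idem_in_eigenspace x in metis)
  then show "{residue_idem k \<otimes>\<^bsub>K.Y\<^esub> x | x. x \<in> carrier K.Y} \<subseteq> yh_eigenspace d n q \<xi> k" by blast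
qed

lemma eigen_idempotents_residue_idem: "eigen_idempotents d n q \<xi> residue_idem"
  unfolding eigen_idempotents_def Let_def rename_fld
proof (intro conjI ballI impI)
  let ?K = "K_index d n q" and ?Z = "{k \<in> K_index d n q. residue_idem k \<noteq> \<zero>\<^bsub>K.Y\<^esub>}"
  show "residue_idem \<in> ?K \<rightarrow>\<^sub>E carrier K.Y"
    using residue_idem_closed by (intro PiE_I) (auto simp: residue_idem_def)
  show "residue_idem k \<otimes>\<^bsub>K.Y\<^esub> residue_idem k = residue_idem k" if "k \<in> ?K" for k
    using that by (rule residue_idem_cases) (auto simp: idem_mult)
  show "residue_idem k \<otimes>\<^bsub>K.Y\<^esub> residue_idem l = \<zero>\<^bsub>K.Y\<^esub>" if "k \<in> ?K" "l \<in> ?K" "k \<noteq> l" for k l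
  proof -
    have "residue_idem l \<in> yh_eigenspace d n q \<xi> l"
      using residue_idem_range[OF that(2)] residue_idem_closed[OF that(2)] K.Y.r_one K.Y.one_closed by blast
    then show ?thesis using residue_idem_other_eigenspace[OF that(1,2)] that(3) by metis
  qed
  have sub: "?Z \<subseteq> res ` residue_classes"
  proof
    fix k assume "k \<in> ?Z"
    then have "k \<in> ?K" "residue_idem k \<noteq> \<zero>\<^bsub>K.Y\<^esub>" by auto
    then show "k \<in> res ` residue_classes" by (cases rule: residue_idem_cases) auto
  qed
  have fin: "finite (res ` residue_classes)" using finite_classes by simp
  show "finite ?Z" using sub fin by (rule finite_subset)
  have c: "residue_idem \<in> res ` residue_classes \<rightarrow> carrier K.Y" using residue_idem_closed res_in by auto
  have "(\<Oplus>\<^bsub>K.Y\<^esub>k\<in>?Z. residue_idem k) = (\<Oplus>\<^bsub>K.Y\<^esub>k\<in>res ` residue_classes. residue_idem k)"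
    using sub c fin res_in by (intro K.Y.add.finprod_mono_neutral_cong_left) auto
  also have "\<dots> = (\<Oplus>\<^bsub>K.Y\<^esub>C\<in>residue_classes. residue_idem (res C))"
    by (rule K.Y.finsum_reindex[OF c inj_on_res])
  also have "\<dots> = (\<Oplus>\<^bsub>K.Y\<^esub>C\<in>residue_classes. idem C)"
    using idem_closed residue_idem_res by (intro K.Y.add.finprod_cong') auto
  finally show "(\<Oplus>\<^bsub>K.Y\<^esub>k\<in>?Z. residue_idem k) = \<one>\<^bsub>K.Y\<^esub>" unfolding idem_sum .
qed (rule residue_idem_range)

text \<open>
  Any such family satisfies \<open>e l = residue_idem l e l\<close> and \<open>residue_idem k e l = 0\<close> for \<open>k \<noteq> l\<close>, because
  \<open>e l\<close> lies in the eigenspace of \<open>l\<close>; multiplying \<open>1 = \<Sum> e l\<close> by \<open>residue_idem k\<close> gives \<open>e k\<close>.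
\<close>

lemma eigen_idempotents_unique:
  assumes e: "eigen_idempotents d n q \<xi> e"
  shows "e = residue_idem"
proof (rule PiE_ext)
  let ?K = "K_index d n q" and ?Z = "{k \<in> K_index d n q. e k \<noteq> \<zero>\<^bsub>K.Y\<^esub>}"
  note e' = e[unfolded eigen_idempotents_def Let_def rename_fld]
  show mem: "e \<in> ?K \<rightarrow>\<^sub>E carrier K.Y" using e' by (rule conjunct1)
  show "residue_idem \<in> ?K \<rightarrow>\<^sub>E carrier K.Y"
    using residue_idem_closed by (intro PiE_I) (auto simp: residue_idem_def)
  have ec: "e k \<in> carrier K.Y" if "k \<in> ?K" for k using PiE_mem[OF mem that] .
  have es: "e k \<in> yh_eigenspace d n q \<xi> k" if k: "k \<in> ?K" for k
  proof -
    have "{e k \<otimes>\<^bsub>K.Y\<^esub> x | x. x \<in> carrier K.Y} = yh_eigenspace d n q \<xi> k" using e' k by blast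
    moreover have "e k = e k \<otimes>\<^bsub>K.Y\<^esub> \<one>\<^bsub>K.Y\<^esub>" using ec[OF k] by simp
    ultimately show ?thesis using K.Y.one_closed by blast
  qed
  have fin: "finite ?Z" and sum: "(\<Oplus>\<^bsub>K.Y\<^esub>k\<in>?Z. e k) = \<one>\<^bsub>K.Y\<^esub>" using e' by blast+
  fix k assume k: "k \<in> ?K"
  have rc: "residue_idem k \<in> carrier K.Y" by (rule residue_idem_closed[OF k])
  have "residue_idem k = residue_idem k \<otimes>\<^bsub>K.Y\<^esub> (\<Oplus>\<^bsub>K.Y\<^esub>l\<in>?Z. e l)" unfolding sum using rc by simp
  also have "\<dots> = (\<Oplus>\<^bsub>K.Y\<^esub>l\<in>?Z. residue_idem k \<otimes>\<^bsub>K.Y\<^esub> e l)"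
    using fin rc ec by (intro K.Y.finsum_rdistr) auto
  also have "\<dots> = (\<Oplus>\<^bsub>K.Y\<^esub>l\<in>?Z. if k = l then e l else \<zero>\<^bsub>K.Y\<^esub>)"
  proof (rule K.Y.add.finprod_cong')
    fix l assume l: "l \<in> ?Z"
    then have "l \<in> ?K" by blast
    then show "residue_idem k \<otimes>\<^bsub>K.Y\<^esub> e l = (if k = l then e l else \<zero>\<^bsub>K.Y\<^esub>)"
      using residue_idem_on_eigenspace[OF k] residue_idem_other_eigenspace[OF k] es by (metis (full_types))
  qed (use ec in auto)
  also have "\<dots> = e k"
  proof (cases "k \<in> ?Z")
    case True
    then show ?thesis using ec fin by (intro K.Y.add.finprod_singleton) auto
  next
    case False
    then have "e k = \<zero>\<^bsub>K.Y\<^esub>" using k by blast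
    moreover have "(\<Oplus>\<^bsub>K.Y\<^esub>l\<in>?Z. if k = l then e l else \<zero>\<^bsub>K.Y\<^esub>) = (\<Oplus>\<^bsub>K.Y\<^esub>l\<in>?Z. \<zero>\<^bsub>K.Y\<^esub>)"
      using False by (intro K.Y.add.finprod_cong') auto
    ultimately show ?thesis by simp
  qed
  finally show "e k = residue_idem k" ..
qed

lemma eigen_idem_res:
  assumes "C \<in> residue_classes"
  shows "eigen_idem d n q \<xi> (res C) = idem C"
proof -
  have "(THE e. eigen_idempotents d n q \<xi> e) = residue_idem"
    using eigen_idempotents_residue_idem eigen_idempotents_unique by (rule the_equality)
  then show ?thesis using residue_idem_res[OF assms] by (simp add: eigen_idem_def)
qed

end

theorem theorem20:
  fixes n d :: nat and q \<xi> :: "'k::field" and C :: "multitableau set"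
  assumes "n \<ge> 1" and "d \<ge> 1"
    and "CHAR('k) > 0 \<Longrightarrow> coprime d CHAR('k)"
    and "\<xi> ^ d = 1" and "\<And>m. 0 < m \<Longrightarrow> m < d \<Longrightarrow> \<xi> ^ m \<noteq> 1"
    and "q \<noteq> 0" and "q \<noteq> 1"
    and "C \<in> Std d n // content_rel d n q \<xi>"
  shows "class_idem d n q \<xi> C = eigen_idem d n q \<xi> (class_res d n q \<xi> C)"
proof -
  have "of_nat d \<noteq> (0 :: 'k)"
  proof
    assume "of_nat d = (0 :: 'k)"
    then have dvd: "CHAR('k) dvd d" by (simp add: of_nat_eq_0_iff_char_dvd)
    show False
    proof (cases "CHAR('k) = 0")
      case True
      then show False using dvd assms(2) by simp
    next
      case False
      then have "CHAR('k) = 1" using assms(3) dvd by (metis coprime_common_divisor_nat dvd_refl neq0_conv)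
      then show False using CHAR_not_1 by auto
    qed
  qed
  then interpret specialization n d q \<xi> using assms(4-7) by unfold_locales auto
  have "C \<in> residue_classes" using assms(8) unfolding residue_classes_def .
  then show ?thesis using class_idem_eq eigen_idem_res unfolding idem_def by simp
qed

end
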